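(* Let $m,n\ge 1$ and $1\le m_1<m$ be integers, let $A^0,A^1,\dots,A^n,L$ be real constant $m\times m$ matrices, and let $Q^1,\dots,Q^n,R$ be real constant $m_1\times m$ matrices. Suppose that conditions (A), (C), (S), (S* )$_1$ and (K* ) (all spelled out in the context; (S) and (S* )$_1$ are required for one and the same matrix $S$) hold. Let $s\ge 0$ be an integer, and suppose that $u_0\in H^s(\mathbb{R}^n)\cap L^1(\mathbb{R}^n)$ satisfies the constraint $$\sum_{j=1}^nQ^ju_{x_j}+Ru=0\qquad(\ast)$$ (with $u=u_0$). Then the solution $u=u(t,x)\in\mathbb{R}^m$ of the Cauchy problem $$A^0u_t+\sum_{j=1}^nA^ju_{x_j}+Lu=0\quad(t>0,\ x\in\mathbb{R}^n),\qquad u|_{t=0}=u_0,$$ satisfies $(\ast)$ for all $t>0$. Moreover, there are constants $C,c>0$ (independent of $t,\xi,u_0$) such that the solution satisfies the pointwise estimate $$|\hat u(t,\xi)|\le Ce^{-c\,\eta(\xi)t}|\hat u_0(\xi)|,\qquad \eta(\xi):=\frac{|\xi|^2}{(1+|\xi|^2)^2},$$ for $t\ge 0$, $\xi\in\mathbb{R}^n$, and the decay estimate $$\|\partial_x^ku(t)\|_{L^2}\le C(1+t)^{-n/4-k/2}\|u_0\|_{L^1}+C(1+t)^{-\ell/2}\|\partial_x^{k+\ell}u_0\|_{L^2}$$ for all $t\ge 0$ and all nonnegative integers $k,\ell$ with $k+\ell\le s$.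
   Context: Notation. $\langle\cdot,\cdot\rangle$ is the standard complex inner product. For a matrix $X$ and a subspace $V$, "$X\ge 0$ on $V$" means $\mathrm{Re}\,\langle Xz,z\rangle\ge 0$ for all $z\in V$, and "$X>0$ on $V$" means $\mathrm{Re}\,\langle Xz,z\rangle>0$ for all $0\ne z\in V$. For a real square matrix $X$, $X_1:=(X+X^T)/2$ and $X_2:=(X-X^T)/2$ are its symmetric and skew-symmetric parts. Kernels are taken in $\mathbb{C}^m$. For $\omega\in S^{n-1}$, $A(\omega):=\sum_{j=1}^nA^j\omega_j$ and $Q(\omega):=\sum_{j=1}^nQ^j\omega_j$. $\partial_x^k$ denotes the totality of all $k$-th order $x$-derivatives, and $H^s$ is the $L^2$-based Sobolev space. $\hat u(t,\xi)$ is the Fourier transform in $x$ of $u$; it solves $A^0\hat u_t+i|\xi|A(\omega)\hat u+L\hat u=0$, $\hat u(0,\xi)=\hat u_0(\xi)$, with $\omega=\xi/|\xi|$. In Fourier variables the constraint $(\ast)$ reads $i|\xi|Q(\omega)\hat u+R\hat u=0$. $\mathrm{Image}(R):=\{R\phi:\phi\in\mathbb{C}^m\}\subset\mathbb{C}^{m_1}$; $\Pi_1$ is the orthogonal projection of $\mathbb{C}^{m_1}$ onto $\mathrm{Image}(R)$ and $\Pi_2:=I-\Pi_1$ (both are real symmetric $m_1\times m_1$ matrices). For $\omega\in S^{n-1}$, $X_\omega:=\{\phi\in\mathbb{C}^m:\Pi_2Q(\omega)\phi=0\}$. Condition (A): $A^0,A^1,\dots,A^n$ are real symmetric, $A^0>0$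 on $\mathbb{C}^m$, $L$ is real (not necessarily symmetric) with $L\ge 0$ on $\mathbb{C}^m$, and $\mathrm{Ker}(L)\ne\{0\}$. Condition (C): for each $\omega\in S^{n-1}$, $Q(\omega)(A^0)^{-1}A(\omega)=0$, $R(A^0)^{-1}L=0$, and $Q(\omega)(A^0)^{-1}L+R(A^0)^{-1}A(\omega)=0$. Condition (S): there is a real constant matrix $S$ such that $(SA^0)^T=SA^0$, $(SL)_1+L_1\ge 0$ on $\mathbb{C}^m$, and $\mathrm{Ker}((SL)_1+L_1)=\mathrm{Ker}(L)$. Condition (S* )$_1$: the matrix $S$ in condition (S) satisfies $i(SA(\omega)-T(\omega))_2\ge 0$ on $\mathrm{Ker}(L_1)$ for each $\omega\in S^{n-1}$, where $T(\omega):=(\Pi_1Q(\omega))^T\tilde S R$ with $\tilde S$ a real $m_1\times m_1$ matrix such that $\tilde S_1\ge 0$ on $\mathrm{Image}(R)$. Condition (K* ): there is a real matrix-valued function $K(\omega)\in C^\infty(S^{n-1})$ such that for each $\omega\in S^{n-1}$: $K(-\omega)=-K(\omega)$, $(K(\omega)A^0)^T=-K(\omega)A^0$, and $(K(\omega)A(\omega))_1>0$ on $X_\omega\cap\mathrm{Ker}(L)$. *)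

theory Defs
  imports "HOL-Analysis.Analysis"
begin

section \<open>Real matrices acting on complex vectors\<close>

abbreviation cmat :: "real^'b^'a \<Rightarrow> complex^'b^'a" where
  "cmat \<equiv> map_matrix complex_of_real"

definition cinner :: "complex^'a \<Rightarrow> complex^'a \<Rightarrow> complex" where
  "cinner x y = (\<Sum>i\<in>UNIV. x $ i * cnj (y $ i))"

definition nonneg_on :: "complex^'a^'a \<Rightarrow> (complex^'a) set \<Rightarrow> bool" where
  "nonneg_on X V \<longleftrightarrow> (\<forall>z\<in>V. Re (cinner (X *v z) z) \<ge> 0)"

definition pos_on :: "complex^'a^'a \<Rightarrow> (complex^'a) set \<Rightarrow> bool" where
  "pos_on X V \<longleftrightarrow> (\<forall>z\<in>V. z \<noteq> 0 \<longrightarrow> Re (cinner (X *v z) z) > 0)"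

definition Ker :: "complex^'b^'a \<Rightarrow> (complex^'b) set" where
  "Ker X = {z. X *v z = 0}"

definition Image_C :: "complex^'b^'a \<Rightarrow> (complex^'a) set" where
  "Image_C X = range ((*v) X)"

definition sym_part :: "real^'a^'a \<Rightarrow> real^'a^'a" where
  "sym_part X = (1/2) *\<^sub>R (X + transpose X)"

definition skew_part :: "real^'a^'a \<Rightarrow> real^'a^'a" where
  "skew_part X = (1/2) *\<^sub>R (X - transpose X)"

text \<open>\<open>M(\<omega>) = \<Sum>\<^sub>j M\<^sup>j \<omega>\<^sub>j\<close>, for both families \<open>A\<^sup>j\<close> and \<open>Q\<^sup>j\<close>.\<close>

definition symbol :: "('n::finite \<Rightarrow> real^'b^'a) \<Rightarrow> real^'n \<Rightarrow> real^'b^'a" where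
  "symbol M \<omega> = (\<Sum>j\<in>UNIV. \<omega> $ j *\<^sub>R M j)"

text \<open>The orthogonal projection of the complex space onto the complex image of the real matrix \<open>R\<close>;
  it is a real matrix, namely that of the orthogonal projection of the real space onto the
  real column space of \<open>R\<close>.\<close>

definition proj1 :: "real^'m^'p \<Rightarrow> real^'p^'p" where
  "proj1 R = (THE P. \<forall>z. cmat P *v z \<in> Image_C (cmat R) \<and>
                 (\<forall>w\<in>Image_C (cmat R). cinner (z - cmat P *v z) w = 0))"

definition proj2 :: "real^'m^'p \<Rightarrow> real^'p^'p" where
  "proj2 R = mat 1 - proj1 R"

definition X_space ::
  "('n::finite \<Rightarrow> real^'m^'p) \<Rightarrow> real^'m^'p \<Rightarrow> real^'n \<Rightarrow> (complex^'m) set" where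
  "X_space Q R \<omega> = {\<phi>. cmat (proj2 R ** symbol Q \<omega>) *v \<phi> = 0}"


section \<open>Smooth functions\<close>

text \<open>\<open>C\<^sup>k\<close> regularity; the set \<open>U\<close> is meant to be open.\<close>

fun Ck_on :: "nat \<Rightarrow> 'a::euclidean_space set \<Rightarrow> ('a \<Rightarrow> 'b::real_normed_vector) \<Rightarrow> bool" where
  "Ck_on 0 U f \<longleftrightarrow> continuous_on U f"
| "Ck_on (Suc k) U f \<longleftrightarrow> (\<forall>x\<in>U. f differentiable (at x)) \<and>
     (\<forall>v. Ck_on k U (\<lambda>x. frechet_derivative f (at x) v))"

definition smooth_on_open :: "'a::euclidean_space set \<Rightarrow> ('a \<Rightarrow> 'b::real_normed_vector) \<Rightarrow> bool" where
  "smooth_on_open U f \<longleftrightarrow> (\<forall>k. Ck_on k U f)"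

text \<open>Smoothness on the sphere as an embedded submanifold: \<open>f\<close> is the restriction of
  a smooth function on an open neighbourhood.\<close>

definition smooth_on_sphere :: "('a::euclidean_space \<Rightarrow> 'b::real_normed_vector) \<Rightarrow> bool" where
  "smooth_on_sphere f \<longleftrightarrow>
     (\<exists>U g. open U \<and> sphere 0 1 \<subseteq> U \<and> smooth_on_open U g \<and> (\<forall>\<omega>\<in>sphere 0 1. g \<omega> = f \<omega>))"


section \<open>Structural conditions\<close>

definition cond_A :: "real^'m^'m \<Rightarrow> ('n::finite \<Rightarrow> real^'m^'m) \<Rightarrow> real^'m^'m \<Rightarrow> bool" where
  "cond_A A0 A L \<longleftrightarrow>
     transpose A0 = A0 \<and> (\<forall>j. transpose (A j) = A j) \<and>
     pos_on (cmat A0) UNIV \<and> nonneg_on (cmat L) UNIV \<and> Ker (cmat L) \<noteq> {0}"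

definition cond_C ::
  "real^'m^'m \<Rightarrow> ('n::finite \<Rightarrow> real^'m^'m) \<Rightarrow> real^'m^'m \<Rightarrow> ('n \<Rightarrow> real^'m^'p) \<Rightarrow> real^'m^'p \<Rightarrow> bool" where
  "cond_C A0 A L Q R \<longleftrightarrow> (\<forall>\<omega>\<in>sphere 0 1.
     symbol Q \<omega> ** matrix_inv A0 ** symbol A \<omega> = 0 \<and>
     R ** matrix_inv A0 ** L = 0 \<and>
     symbol Q \<omega> ** matrix_inv A0 ** L + R ** matrix_inv A0 ** symbol A \<omega> = 0)"

text \<open>The matrix \<open>S\<close> is a parameter, since the next condition refers to the same \<open>S\<close>.\<close>

definition cond_S :: "real^'m^'m \<Rightarrow> real^'m^'m \<Rightarrow> real^'m^'m \<Rightarrow> bool" where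
  "cond_S A0 L S \<longleftrightarrow>
     transpose (S ** A0) = S ** A0 \<and>
     nonneg_on (cmat (sym_part (S ** L) + sym_part L)) UNIV \<and>
     Ker (cmat (sym_part (S ** L) + sym_part L)) = Ker (cmat L)"

definition cond_Sstar1 ::
  "('n::finite \<Rightarrow> real^'m^'m) \<Rightarrow> real^'m^'m \<Rightarrow> ('n \<Rightarrow> real^'m^'p) \<Rightarrow> real^'m^'p \<Rightarrow> real^'m^'m \<Rightarrow> bool" where
  "cond_Sstar1 A L Q R S \<longleftrightarrow> (\<exists>St :: real^'p^'p.
     nonneg_on (cmat (sym_part St)) (Image_C (cmat R)) \<and>
     (\<forall>\<omega>\<in>sphere 0 1.
        let T = transpose (proj1 R ** symbol Q \<omega>) ** St ** R
        in nonneg_on (map_matrix (\<lambda>x. \<i> * complex_of_real x) (skew_part (S ** symbol A \<omega> - T)))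
             (Ker (cmat (sym_part L)))))"

definition cond_Kstar ::
  "real^'m^'m \<Rightarrow> ('n::finite \<Rightarrow> real^'m^'m) \<Rightarrow> real^'m^'m \<Rightarrow> ('n \<Rightarrow> real^'m^'p) \<Rightarrow> real^'m^'p \<Rightarrow> bool" where
  "cond_Kstar A0 A L Q R \<longleftrightarrow> (\<exists>K :: real^'n \<Rightarrow> real^'m^'m.
     smooth_on_sphere K \<and>
     (\<forall>\<omega>\<in>sphere 0 1.
        K (-\<omega>) = - K \<omega> \<and>
        transpose (K \<omega> ** A0) = - (K \<omega> ** A0) \<and>
        pos_on (cmat (sym_part (K \<omega> ** symbol A \<omega>))) (X_space Q R \<omega> \<inter> Ker (cmat L))))"


section \<open>Lebesgue and Sobolev spaces\<close>

definition L2 :: "('a::euclidean_space \<Rightarrow> 'b::euclidean_space) \<Rightarrow> bool" where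
  "L2 f \<longleftrightarrow> f \<in> borel_measurable lborel \<and> integrable lborel (\<lambda>x. (norm (f x))\<^sup>2)"

text \<open>As the Bochner integral of a non-integrable function is 0, this is the \<open>L\<^sup>2\<close> norm only
  of functions satisfying \<open>L2\<close>.\<close>

definition L2norm :: "('a::euclidean_space \<Rightarrow> 'b::euclidean_space) \<Rightarrow> real" where
  "L2norm f = sqrt (\<integral>x. (norm (f x))\<^sup>2 \<partial>lborel)"

definition L1norm :: "('a::euclidean_space \<Rightarrow> 'b::euclidean_space) \<Rightarrow> real" where
  "L1norm f = (\<integral>x. norm (f x) \<partial>lborel)"

definition test_function :: "(real^'n::finite \<Rightarrow> real) \<Rightarrow> bool" where
  "test_function \<phi> \<longleftrightarrow> smooth_on_open UNIV \<phi> \<and> compact (closure {x. \<phi> x \<noteq> 0})"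

definition pd :: "'n \<Rightarrow> (real^'n::finite \<Rightarrow> real) \<Rightarrow> real^'n \<Rightarrow> real" where
  "pd j \<phi> x = frechet_derivative \<phi> (at x) (axis j 1)"

text \<open>A list \<open>[j\<^sub>1, \<dots>, j\<^sub>k]\<close> of coordinate directions stands for the derivative
  \<open>\<partial>\<^sub>j\<^sub>1 \<dots> \<partial>\<^sub>j\<^sub>k\<close> of order \<open>k\<close>.\<close>

fun pds :: "'n list \<Rightarrow> (real^'n::finite \<Rightarrow> real) \<Rightarrow> real^'n \<Rightarrow> real" where
  "pds [] \<phi> = \<phi>"
| "pds (j # js) \<phi> = pd j (pds js \<phi>)"

definition has_weak_pds ::
  "'n list \<Rightarrow> (real^'n::finite \<Rightarrow> real^'m) \<Rightarrow> (real^'n \<Rightarrow> real^'m) \<Rightarrow> bool" where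
  "has_weak_pds js f g \<longleftrightarrow> (\<forall>\<phi>. test_function \<phi> \<longrightarrow>
     (\<integral>x. pds js \<phi> x *\<^sub>R f x \<partial>lborel) = (-1) ^ length js *\<^sub>R (\<integral>x. \<phi> x *\<^sub>R g x \<partial>lborel))"

definition Hs :: "nat \<Rightarrow> (real^'n::finite \<Rightarrow> real^'m) \<Rightarrow> bool" where
  "Hs s f \<longleftrightarrow> L2 f \<and> (\<forall>js. length js \<le> s \<longrightarrow> (\<exists>g. L2 g \<and> has_weak_pds js f g))"

text \<open>The weak derivative, unique up to null sets, of a function in \<open>H\<^sup>k\<close> with \<open>k \<ge> length js\<close>.\<close>

definition weak_pds :: "'n list \<Rightarrow> (real^'n::finite \<Rightarrow> real^'m) \<Rightarrow> real^'n \<Rightarrow> real^'m" where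
  "weak_pds js f = (SOME g. L2 g \<and> has_weak_pds js f g)"

text \<open>The norm \<open>\<parallel>\<partial>\<^sub>x\<^sup>k f\<parallel>\<close> in \<open>L\<^sup>2\<close> of the totality of all derivatives of order \<open>k\<close>, for \<open>f\<close> in \<open>H\<^sup>k\<close>.\<close>

definition L2norm_deriv :: "nat \<Rightarrow> (real^'n::finite \<Rightarrow> real^'m) \<Rightarrow> real" where
  "L2norm_deriv k f = sqrt (\<Sum>js | length js = k. (L2norm (weak_pds js f))\<^sup>2)"


section \<open>Fourier transform\<close>

definition fourier :: "(real^'n::finite \<Rightarrow> real^'m) \<Rightarrow> real^'n \<Rightarrow> complex^'m" where
  "fourier f \<xi> = (\<chi> i. \<integral>x. cis (- (x \<bullet> \<xi>)) * complex_of_real (f x $ i) \<partial>lborel)"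

text \<open>The Fourier transform of an \<open>L\<^sup>2\<close> function as the limit in mean of the transforms of its
  truncations to balls; the latter are again in \<open>L\<^sup>2\<close> by Plancherel.\<close>

definition has_L2_fourier ::
  "(real^'n::finite \<Rightarrow> real^'m) \<Rightarrow> (real^'n \<Rightarrow> complex^'m) \<Rightarrow> bool" where
  "has_L2_fourier f g \<longleftrightarrow> L2 f \<and> L2 g \<and>
     ((\<lambda>r. L2norm (\<lambda>\<xi>. fourier (\<lambda>x. indicator (cball 0 r) x *\<^sub>R f x) \<xi> - g \<xi>)) \<longlongrightarrow> 0) at_top"


section \<open>The constraint and the Cauchy problem\<close>

text \<open>\<open>\<Sum>\<^sub>j Q\<^sup>j f\<^sub>x\<^sub>j + R f = 0\<close> in the sense of distributions.\<close>

definition constraint ::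
  "('n::finite \<Rightarrow> real^'m^'p) \<Rightarrow> real^'m^'p \<Rightarrow> (real^'n \<Rightarrow> real^'m) \<Rightarrow> bool" where
  "constraint Q R f \<longleftrightarrow> (\<forall>\<phi>. test_function \<phi> \<longrightarrow>
     (\<integral>x. \<phi> x *\<^sub>R (R *v f x) - (\<Sum>j\<in>UNIV. pd j \<phi> x *\<^sub>R (Q j *v f x)) \<partial>lborel) = 0)"

text \<open>\<open>u\<close> belongs to \<open>C([0,\<infinity>); L\<^sup>2)\<close>, attains the initial value \<open>u0\<close>, and for every \<open>t > 0\<close> satisfies
  \<open>A\<^sup>0 u\<^sub>t + \<Sum>\<^sub>j A\<^sup>j u\<^sub>x\<^sub>j + L u = 0\<close> in the sense of distributions in \<open>x\<close>.\<close>

definition cauchy_solution ::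
  "real^'m^'m \<Rightarrow> ('n::finite \<Rightarrow> real^'m^'m) \<Rightarrow> real^'m^'m \<Rightarrow> (real^'n \<Rightarrow> real^'m) \<Rightarrow>
   (real \<Rightarrow> real^'n \<Rightarrow> real^'m) \<Rightarrow> bool" where
  "cauchy_solution A0 A L u0 u \<longleftrightarrow>
     (\<forall>t\<ge>0. L2 (u t)) \<and>
     (\<forall>t\<ge>0. ((\<lambda>\<tau>. L2norm (\<lambda>x. u \<tau> x - u t x)) \<longlongrightarrow> 0) (at t within {0..})) \<and>
     (AE x in lborel. u 0 x = u0 x) \<and>
     (\<forall>\<phi>. test_function \<phi> \<longrightarrow> (\<forall>t>0.
        ((\<lambda>\<tau>. \<integral>x. \<phi> x *\<^sub>R (A0 *v u \<tau> x) \<partial>lborel) has_vector_derivative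
         (\<integral>x. (\<Sum>j\<in>UNIV. pd j \<phi> x *\<^sub>R (A j *v u t x)) - \<phi> x *\<^sub>R (L *v u t x) \<partial>lborel)) (at t)))"

text \<open>\<open>uh\<close> is the version of the (a priori only almost everywhere defined) Fourier transform in \<open>x\<close>
  of \<open>u\<close> that solves, for every \<open>\<xi>\<close>,
  \<open>A\<^sup>0 uh\<^sub>t + \<i>|\<xi>| A(\<omega>) uh + L uh = 0\<close>, \<open>uh(0,\<xi>) = fourier u0 \<xi>\<close>, where \<open>\<omega> = \<xi>/|\<xi>|\<close>
  is rendered by \<open>sgn \<xi>\<close>; its value at \<open>\<xi> = 0\<close> is irrelevant.\<close>

definition fourier_solution ::
  "real^'m^'m \<Rightarrow> ('n::finite \<Rightarrow> real^'m^'m) \<Rightarrow> real^'m^'m \<Rightarrow> (real^'n \<Rightarrow> real^'m) \<Rightarrow>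
   (real \<Rightarrow> real^'n \<Rightarrow> real^'m) \<Rightarrow> (real \<Rightarrow> real^'n \<Rightarrow> complex^'m) \<Rightarrow> bool" where
  "fourier_solution A0 A L u0 u uh \<longleftrightarrow>
     (\<forall>t\<ge>0. has_L2_fourier (u t) (uh t)) \<and>
     (\<forall>\<xi>. uh 0 \<xi> = fourier u0 \<xi>) \<and>
     (\<forall>\<xi>. \<forall>t\<ge>0. \<exists>w. ((\<lambda>\<tau>. uh \<tau> \<xi>) has_vector_derivative w) (at t within {0..}) \<and>
        cmat A0 *v w + (\<i> * complex_of_real (norm \<xi>)) *s (cmat (symbol A (sgn \<xi>)) *v uh t \<xi>)
          + cmat L *v uh t \<xi> = 0)"

definition eta :: "'a::real_normed_vector \<Rightarrow> real" where
  "eta \<xi> = (norm \<xi>)\<^sup>2 / (1 + (norm \<xi>)\<^sup>2)\<^sup>2"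

end

theory Submission
  imports Defs "HOL-Probability.Characteristic_Functions"
begin

text \<open>
  In Fourier variables the system is, for every \<open>\<xi>\<close>, a linear ordinary differential equation whose flow
  preserves the constraint because of condition (C). With \<open>\<rho> = |\<xi>|\<close>, \<open>\<omega> = \<xi>/|\<xi>|\<close> and small constants
  \<open>a\<^sub>1, a\<^sub>2\<close>, the quadratic form
  \<open>\<langle>A\<^sup>0z,z\<rangle> + a\<^sub>2/(1+\<rho>\<^sup>2) (\<langle>SA\<^sup>0z,z\<rangle> + a\<^sub>1\<rho>/(1+\<rho>\<^sup>2) \<langle>-\<i>K(\<omega>)A\<^sup>0z,z\<rangle>)\<close>
  is equivalent to \<open>|z|\<^sup>2\<close> and decays at the rate \<open>\<eta>(\<xi>)\<close>: \<open>S\<close> controls \<open>Lz\<close>, the constraint makes the bad term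
  of \<open>SA(\<omega>)\<close> nonnegative up to controlled errors, and it forces \<open>z \<in> X\<^sub>\<omega>\<close>, where \<open>K(\<omega>)A(\<omega>)\<close> is coercive
  modulo \<open>Lz\<close>.

  A weak solution \<open>u\<close> is only known to be continuous in \<open>t\<close> with values in \<open>L\<^sup>2\<close>. Testing with
  \<open>cut(x/k) cos (x\<bullet>\<xi> + \<theta>)\<close> shows that the transform of \<open>cut(x/k) u\<close> solves the same equation up to a residual which
  tends to \<open>0\<close> in \<open>L\<^sup>2\<close>; by Gronwall's inequality, \<open>L\<^sup>2\<close> limits of these transforms are given by the flow.
  Plancherel's theorem turns the pointwise estimate into the decay estimate, splitting the frequencies at \<open>|\<xi>| = 1\<close>
  and using that the transform of an \<open>L\<^sup>1\<close> function is bounded.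
\<close>

section \<open>Real matrices on complex vectors\<close>

text \<open>The weights of the quadratic form come from the bookkeeping of errors. Put D = 1 +
  \<rho>^2. The \<open>S\<close> part creates an error of size \<rho>|z| sqrt(<Lz,z>), to be
  absorbed by <Lz,z>, which has weight 1, and by the |z|^2 gained from \<open>K\<close>. With weight
  1/D on the \<open>S\<close> part a gain of (\<rho>/D)^2 |z|^2 suffices. The \<open>K\<close> part
  gains \<rho>|z|^2 at the price of \<rho>|Lz|^2, which the \<open>S\<close> part has to pay out of
  |Lz|^2/D; this yields the further factor \<rho>/D, and the total gain is exactly \<eta>|z|^2. The
  degeneracy of \<eta> at high frequency returns as the l extra derivatives in the decay estimate.
  The other half of the work identifies transforms, since the decay argument is pointwise in \<xi>
  while a solution is only tested with real compactly supported functions. It rests on Bessel's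
  inequality for integrable functions, a pairing identity against test functions, and a bound of
  weak derivatives by frequency moments that loses a factor 2. The first two are obtained by
  inserting a Gaussian factor in \<xi>, which makes every exchange of integrals legitimate, and
  letting its width tend to infinity.\<close>

lemma Re_cinner: "Re (cinner x y) = x \<bullet> y"
  by (simp add: cinner_def inner_vec_def inner_complex_def)

lemma cmat_add: "cmat (X + Y) = cmat X + cmat Y"
  by (simp add: vec_eq_iff)

lemma cmat_diff: "cmat (X - Y) = cmat X - cmat Y"
  by (simp add: vec_eq_iff)

lemma cmat_scaleR: "cmat (c *\<^sub>R X) = c *\<^sub>R cmat X"
  by (simp add: vec_eq_iff) (simp add: scaleR_conv_of_real)

lemma cmat_mult: "cmat (X ** Y) = cmat X ** cmat Y"
  by (simp add: vec_eq_iff matrix_matrix_mult_def)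

lemma cmat_uminus: "cmat (- X) = - cmat X"
  by (simp add: vec_eq_iff)

lemma cmat_zero [simp]: "cmat 0 = 0"
  by (simp add: vec_eq_iff)

lemma cmat_sum: "cmat (sum f I) = (\<Sum>i\<in>I. cmat (f i))"
  by (simp add: vec_eq_iff)

lemma cmat_one [simp]: "cmat (mat 1) = mat 1"
  by (simp add: vec_eq_iff mat_def)

lemma cmat_inject: "cmat X = cmat Y \<Longrightarrow> X = Y"
  by (simp add: vec_eq_iff)

lemma scaleR_matrix_mult_vec: "(c *\<^sub>R (M :: complex^'b^'a)) *v z = c *\<^sub>R (M *v z)"
  by (simp add: vec_eq_iff matrix_vector_mult_def scaleR_sum_right)

lemma matrix_mult_scaleR_vec: "(M :: complex^'b^'a) *v (c *\<^sub>R z) = c *\<^sub>R (M *v z)"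
  by (simp add: vec_eq_iff matrix_vector_mult_def scaleR_sum_right)

lemma matrix_mult_uminus_vec: "(M :: complex^'b^'a) *v (- z) = - (M *v z)"
  using matrix_mult_scaleR_vec[of M "-1" z] by simp

lemma uminus_matrix_mult_vec: "(- (M :: complex^'b^'a)) *v z = - (M *v z)"
  using scaleR_matrix_mult_vec[of "-1" M z] by simp

text \<open>The entries are real, so the adjoint for the real inner product on complex vectors is
  the plain transpose, without conjugation.\<close>

lemma cmat_adjoint: "(cmat X *v x) \<bullet> y = x \<bullet> (cmat (transpose X) *v y)"
proof -
  have "(cmat X *v x) \<bullet> y = (\<Sum>i\<in>UNIV. \<Sum>j\<in>UNIV. (complex_of_real (X$i$j) * x$j) \<bullet> y$i)"
    by (simp add: inner_vec_def matrix_vector_mult_def inner_sum_left)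
  also have "\<dots> = (\<Sum>j\<in>UNIV. \<Sum>i\<in>UNIV. x$j \<bullet> (complex_of_real (X$i$j) * y$i))"
    by (subst sum.swap) (simp add: inner_complex_def algebra_simps)
  also have "\<dots> = x \<bullet> (cmat (transpose X) *v y)"
    by (simp add: inner_vec_def matrix_vector_mult_def inner_sum_right transpose_def)
  finally show ?thesis .
qed

text \<open>All sign conditions concern real parts only, so complex vectors are handled as a real
  Euclidean space. The imaginary unit then becomes a skew isometry which commutes with real
  matrices.\<close>

definition mulI :: "complex^'a \<Rightarrow> complex^'a" where
  "mulI z = \<i> *s z"

lemma mulI_add: "mulI (x + y) = mulI x + mulI y"
  by (simp add: mulI_def vec_eq_iff algebra_simps)

lemma mulI_scaleR: "mulI (c *\<^sub>R x) = c *\<^sub>R mulI x"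
  by (simp add: mulI_def vec_eq_iff)

lemma mulI_uminus: "mulI (- x) = - mulI x"
  by (simp add: mulI_def vec_eq_iff)

lemma mulI_diff: "mulI (x - y) = mulI x - mulI y"
  by (simp add: mulI_def vec_eq_iff algebra_simps)

lemma mulI_mulI [simp]: "mulI (mulI x) = - x"
  by (simp add: mulI_def vec_eq_iff)

lemma mulI_zero [simp]: "mulI 0 = 0"
  by (simp add: mulI_def vec_eq_iff)

lemma mulI_sum: "mulI (sum f I) = (\<Sum>i\<in>I. mulI (f i))"
  by (simp add: mulI_def vec_eq_iff sum_distrib_left)

lemma mulI_cmat: "cmat X *v mulI z = mulI (cmat X *v z)"
  by (simp add: mulI_def vector_scalar_commute)

lemma mulI_inner: "mulI x \<bullet> y = - (x \<bullet> mulI y)"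
  by (simp add: mulI_def inner_vec_def inner_complex_def sum_negf[symmetric] algebra_simps)

lemma norm_mulI [simp]: "norm (mulI x) = norm x"
  by (simp add: norm_eq_sqrt_inner mulI_inner)

lemma bounded_linear_mulI: "bounded_linear (mulI :: complex^'a \<Rightarrow> _)"
  by (rule bounded_linear_intro[where K = 1]) (auto simp: mulI_add mulI_scaleR)

lemma bounded_bilinear_cmat: "bounded_bilinear (\<lambda>(X :: real^'b^'a) z. cmat X *v z)"
  unfolding bilinear_conv_bounded_bilinear[symmetric] bilinear_def
  by (auto intro!: linearI simp: cmat_add cmat_scaleR matrix_vector_right_distrib
      matrix_vector_mult_add_rdistrib scaleR_matrix_mult_vec matrix_mult_scaleR_vec)

lemma cmat_bound:
  obtains C where "C \<ge> 0" "\<And>(X :: real^'b^'a) z. norm (cmat X *v z) \<le> C * norm X * norm z"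
  using bounded_bilinear.nonneg_bounded[OF bounded_bilinear_cmat[where 'a='a and 'b='b]]
  by (metis mult.assoc mult.commute)

lemma cmat_bound1:
  obtains C where "C \<ge> 0" "\<And>z. norm (cmat (X :: real^'b^'a) *v z) \<le> C * norm z"
  by (metis cmat_bound mult_nonneg_nonneg norm_ge_zero)

lemma cmat_bound_on:
  fixes M :: "real^'n \<Rightarrow> real^'b^'a"
  assumes "continuous_on W M" "compact W"
  obtains C where "C \<ge> 0" "\<And>w z. w \<in> W \<Longrightarrow> norm (cmat (M w) *v z) \<le> C * norm z"
proof -
  obtain C where C: "C \<ge> 0" "\<And>(X :: real^'b^'a) z. norm (cmat X *v z) \<le> C * norm X * norm z"
    using cmat_bound by blast
  have "bounded (M ` W)" using assms compact_continuous_image compact_imp_bounded by blast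
  then obtain B where B: "B > 0" "\<And>w. w \<in> W \<Longrightarrow> norm (M w) \<le> B"
    unfolding bounded_pos by auto
  have "norm (cmat (M w) *v z) \<le> (C * B) * norm z" if "w \<in> W" for w z
    using C(2)[of "M w" z] mult_right_mono[OF mult_left_mono[OF B(2)[OF that] C(1)], of "norm z"]
    by (simp add: order_trans)
  moreover have "C * B \<ge> 0" using B(1) C(1) by simp
  ultimately show ?thesis using that by blast
qed

lemma continuous_on_symbol: "continuous_on W (symbol M)"
  unfolding symbol_def by (intro continuous_intros)

text \<open>A real skew matrix contributes only an imaginary number to the form. This lets the
  structural conditions, stated for symmetric parts, be applied to the full matrices that occur in
  the energy identity.\<close>

lemma cmat_sym_part: "(cmat (sym_part X) *v z) \<bullet> z = (cmat X *v z) \<bullet> z"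
proof -
  have "(cmat (transpose X) *v z) \<bullet> z = (cmat X *v z) \<bullet> z"
    using cmat_adjoint[of "transpose X" z z] by (simp add: inner_commute)
  then show ?thesis
    by (simp add: sym_part_def cmat_scaleR cmat_add scaleR_matrix_mult_vec
        matrix_vector_mult_add_rdistrib inner_add_left)
qed

lemma transpose_add: "transpose (X + Y) = transpose X + transpose (Y :: real^'a^'b)"
  by (simp add: transpose_def vec_eq_iff)

lemma transpose_diff: "transpose (X - Y) = transpose X - transpose (Y :: real^'a^'b)"
  by (simp add: transpose_def vec_eq_iff)

lemma transpose_scaleR: "transpose (c *\<^sub>R X) = c *\<^sub>R transpose (X :: real^'a^'b)"
  by (simp add: transpose_def vec_eq_iff)

lemma transpose_sum: "transpose (sum f I) = (\<Sum>i\<in>I. transpose (f i :: real^'a^'b))"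
  by (simp add: transpose_def vec_eq_iff)

lemma transpose_sym_part [simp]: "transpose (sym_part X) = sym_part X"
  by (simp add: sym_part_def transpose_scaleR transpose_add add.commute)

lemma transpose_skew_part [simp]: "transpose (skew_part X) = - skew_part X"
  by (simp add: skew_part_def transpose_scaleR transpose_diff scaleR_diff_right)

text \<open>For symmetric \<open>X\<close> the operator \<i>X is skew-adjoint. This is what removes
  the transport term \<i>A(\<omega>) from the basic energy identity.\<close>

lemma mulI_sym_inner:
  assumes "transpose X = X"
  shows "mulI (cmat X *v z) \<bullet> z = 0"
proof -
  have "mulI (cmat X *v z) \<bullet> z = - (mulI (cmat X *v z) \<bullet> z)"
    by (metis assms cmat_adjoint inner_commute mulI_cmat mulI_inner)
  then show ?thesis by simp
qed

text \<open>The counterpart of \<open>cmat_sym_part\<close> after multiplication by \<i>: now the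
  symmetric part drops out. It turns the assumption on the skew part of SA(\<omega>) - T(\<omega>)
  into one on the matrix itself.\<close>

lemma mulI_skew_part: "mulI (cmat (skew_part X) *v z) \<bullet> z = mulI (cmat X *v z) \<bullet> z"
proof -
  have "X = sym_part X + skew_part X"
    by (simp add: sym_part_def skew_part_def scaleR_right_distrib scaleR_right_diff_distrib
        scaleR_left.add[symmetric] vec_eq_iff field_simps)
  then have "cmat X *v z = cmat (sym_part X) *v z + cmat (skew_part X) *v z"
    by (metis cmat_add matrix_vector_mult_add_rdistrib)
  then show ?thesis
    by (simp add: mulI_add inner_add_left mulI_sym_inner)
qed

lemma map_matrix_imult: "map_matrix (\<lambda>x. \<i> * complex_of_real x) X *v z = mulI (cmat X *v z)"
  by (simp add: vec_eq_iff mulI_def matrix_vector_mult_def sum_distrib_left mult.assoc)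

text \<open>Split x orthogonally along the kernel of \<open>N\<close>. On the unit sphere of the
  orthogonal complement the form attains a minimum, which is positive because a nonnegative
  symmetric form vanishes only on its kernel. It serves to measure the distance from Ker(L), or from
  the kernel of the symmetric part of \<open>L\<close>, by the form itself.\<close>

lemma symmetric_operator_decomposition:
  fixes N :: "'a::euclidean_space \<Rightarrow> 'a"
  assumes lin: "linear N" and sym: "\<And>x y. N x \<bullet> y = x \<bullet> N y" and nonneg: "\<And>x. N x \<bullet> x \<ge> 0"
  obtains c where "c > 0"
    "\<And>x. \<exists>y z. x = y + z \<and> N y = 0 \<and> norm y \<le> norm x \<and> norm z \<le> norm x \<and> c * (norm z)\<^sup>2 \<le> N x \<bullet> x"
proof -
  interpret linear N by fact
  have cont: "continuous_on T N" for T using lin linear_continuous_on linear_linear by blast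
  define K where "K = {x. N x = 0}"
  have subK: "subspace K" unfolding K_def by (rule linear_subspace_kernel[OF lin])
  define P where "P = {x. \<forall>y\<in>K. orthogonal x y}"
  have "closed P" proof -
    have "P = (\<Inter>y\<in>K. {x. x \<bullet> y = 0})" by (auto simp: P_def orthogonal_def)
    then show ?thesis by (auto intro!: closed_INT closed_Collect_eq continuous_intros)
  qed
  have pos0: "N x = 0" if "N x \<bullet> x = 0" for x
  proof (rule ccontr)
    assume ne: "N x \<noteq> 0"
    define a where "a = N x \<bullet> N x" define b where "b = N (N x) \<bullet> N x"
    have a: "a > 0" using ne by (simp add: a_def)
    have b: "b \<ge> 0" using nonneg by (simp add: b_def)
    have q: "N (x - t *\<^sub>R N x) \<bullet> (x - t *\<^sub>R N x) = - 2 * t * a + t^2 * b" for t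
      using that sym[of "N x" x]
      by (simp add: diff scale inner_diff_left inner_diff_right a_def b_def power2_eq_square inner_commute algebra_simps)
    \<comment> \<open>The form along x - t N x is a polynomial in t with slope -2a at 0; t = a/(b+1)
      makes it negative, the summand 1 guarding against b = 0.\<close>
    have "0 \<le> - 2 * (a/(b+1)) * a + (a/(b+1))^2 * b" using nonneg q by metis
    moreover have "(a/(b+1))^2 * b \<le> (a/(b+1)) * a"
    proof -
      have "(a/(b+1))^2 * b = (a/(b+1)) * (a * (b/(b+1)))" by (simp add: power2_eq_square)
      also have "\<dots> \<le> (a/(b+1)) * (a * 1)" using a b by (intro mult_left_mono) auto
      finally show ?thesis by simp
    qed
    moreover have "(a/(b+1)) * a > 0" using a b by simp
    ultimately show False by linarith
  qed
  obtain c where c: "c > 0" "\<And>z. z \<in> P \<Longrightarrow> c * (norm z)\<^sup>2 \<le> N z \<bullet> z"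
  proof (cases "sphere 0 1 \<inter> P = {}")
    case True
    have "z = 0" if "z \<in> P" for z
    proof (rule ccontr)
      assume "z \<noteq> 0"
      then have "(1 / norm z) *\<^sub>R z \<in> sphere 0 1 \<inter> P" using that by (auto simp: P_def orthogonal_def)
      then show False using True by blast
    qed
    then have "1 * (norm z)\<^sup>2 \<le> N z \<bullet> z" if "z \<in> P" for z using that by (metis inner_zero_right mult_zero_right norm_zero order_refl power_zero_numeral)
    with zero_less_one show ?thesis by (rule that)
  next
    case False
    have "compact (sphere 0 1 \<inter> P)" by (intro compact_Int_closed \<open>closed P\<close>) simp
    moreover have "continuous_on (sphere 0 1 \<inter> P) (\<lambda>z. N z \<bullet> z)" by (intro continuous_intros cont)
    ultimately have "\<exists>z0\<in>sphere 0 1 \<inter> P. \<forall>z\<in>sphere 0 1 \<inter> P. N z0 \<bullet> z0 \<le> N z \<bullet> z"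
      by (intro continuous_attains_inf False)
    then obtain z0 where z0: "z0 \<in> sphere 0 1 \<inter> P" "\<And>z. z \<in> sphere 0 1 \<inter> P \<Longrightarrow> N z0 \<bullet> z0 \<le> N z \<bullet> z"
      by blast
    have "N z0 \<bullet> z0 \<noteq> 0"
    proof
      assume "N z0 \<bullet> z0 = 0"
      then have "z0 \<in> K" using pos0 by (simp add: K_def)
      then have "z0 = 0" using z0 by (auto simp: P_def orthogonal_def)
      then show False using z0 by simp
    qed
    then have pos: "N z0 \<bullet> z0 > 0" using nonneg[of z0] by linarith
    have "N z0 \<bullet> z0 * (norm z)\<^sup>2 \<le> N z \<bullet> z" if "z \<in> P" for z
    proof (cases "z = 0")
      case False
      then have "(1 / norm z) *\<^sub>R z \<in> sphere 0 1 \<inter> P" using that by (auto simp: P_def orthogonal_def)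
      from z0(2)[OF this] have "N z0 \<bullet> z0 \<le> (1 / norm z) * ((1 / norm z) * (N z \<bullet> z))" by (simp add: scale)
      then show ?thesis using False by (simp add: field_simps power2_eq_square)
    qed (simp add: zero)
    with pos show ?thesis by (rule that)
  qed
  show ?thesis
  proof (rule that[OF c(1)])
    fix x
    obtain y z where yz: "y \<in> span K" "\<And>w. w \<in> span K \<Longrightarrow> orthogonal z w" "x = y + z"
      using orthogonal_subspace_decomp_exists[of K x] by blast
    have "span K = K" using subK by (simp only: span_eq_iff)
    with yz have yz: "y \<in> K" "z \<in> P" "x = y + z" by (auto simp: P_def)
    have orth: "y \<bullet> z = 0" using yz by (auto simp: P_def orthogonal_def inner_commute)
    have "(norm x)\<^sup>2 = (norm y)\<^sup>2 + (norm z)\<^sup>2"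
      using orth by (simp add: yz(3) norm_add_Pythagorean orthogonal_def)
    then have n: "norm y \<le> norm x" "norm z \<le> norm x"
      by (auto intro: power2_le_imp_le)
    have "N y = 0" using yz by (simp add: K_def)
    then have "N x \<bullet> x = N z \<bullet> z" using sym[of z y] by (simp add: yz(3) add inner_add_right)
    then show "\<exists>y z. x = y + z \<and> N y = 0 \<and> norm y \<le> norm x \<and> norm z \<le> norm x \<and> c * (norm z)\<^sup>2 \<le> N x \<bullet> x"
      using c(2)[OF yz(2)] by (intro exI[of _ y] exI[of _ z] conjI yz(3) n \<open>N y = 0\<close>) simp
  qed
qed

text \<open>By homogeneity only unit vectors matter, and a compactness argument gives constants
  uniform in the parameter. The constraint set \<open>V\<close> is a closed subset of the product
  rather than a family of subspaces with a continuous basis, since the dimension of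
  \<open>X_space Q R \<omega>\<close> may jump with \<omega>.\<close>

lemma coercive_modulo_on_compact_family:
  fixes q p :: "'w::metric_space \<Rightarrow> 'a::euclidean_space \<Rightarrow> real"
  assumes W: "compact W" and V: "closed V"
    and cone: "\<And>w z r. (w, z) \<in> V \<Longrightarrow> (w, r *\<^sub>R z) \<in> V"
    and q: "continuous_on (W \<times> UNIV) (\<lambda>(w, z). q w z)" and p: "continuous_on (W \<times> UNIV) (\<lambda>(w, z). p w z)"
    and qh: "\<And>w z r. q w (r *\<^sub>R z) = r\<^sup>2 * q w z" and ph: "\<And>w z r. p w (r *\<^sub>R z) = r\<^sup>2 * p w z"
    and p0: "\<And>w z. w \<in> W \<Longrightarrow> p w z \<ge> 0"
    and pos: "\<And>w z. w \<in> W \<Longrightarrow> (w, z) \<in> V \<Longrightarrow> z \<noteq> 0 \<Longrightarrow> p w z = 0 \<Longrightarrow> q w z > 0"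
  obtains c C where "c > 0" "C \<ge> 0" "\<And>w z. w \<in> W \<Longrightarrow> (w, z) \<in> V \<Longrightarrow> q w z \<ge> c * (norm z)\<^sup>2 - C * p w z"
proof -
  define K where "K = (W \<times> sphere 0 1) \<inter> V"
  have K: "compact K" unfolding K_def by (intro compact_Int_closed compact_Times W V) simp
  have KW: "K \<subseteq> W \<times> UNIV" by (auto simp: K_def)
  \<comment> \<open>Both constants are tied to one index: if no k works, a limit point of
    counterexamples has p = 0 and q \<le> 0, against \<open>pos\<close>.\<close>
  have "\<exists>k::nat. \<forall>(w, z)\<in>K. q w z \<ge> 1 / (real k + 1) - real k * p w z"
  proof (rule ccontr)
    assume "\<not> ?thesis"
    then have "\<forall>k::nat. \<exists>x. x \<in> K \<and> q (fst x) (snd x) < 1 / (real k + 1) - real k * p (fst x) (snd x)"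
      by (simp add: case_prod_beta Bex_def not_le)
    from choice[OF this] obtain x where x: "\<And>k::nat. x k \<in> K" "\<And>k. q (fst (x k)) (snd (x k)) < 1 / (real k + 1) - real k * p (fst (x k)) (snd (x k))"
      by blast
    obtain y r where y: "y \<in> K" "strict_mono r" "(x \<circ> r) \<longlonglongrightarrow> y"
      using seq_compactE[OF compact_imp_seq_compact[OF K]] x(1) by blast
    have qc: "(\<lambda>k. (\<lambda>(w, z). q w z) (x (r k))) \<longlonglongrightarrow> (\<lambda>(w, z). q w z) y"
      using continuous_on_tendsto_compose[OF continuous_on_subset[OF q KW] y(3)] y(1) x(1) by (simp add: o_def)
    have pc: "(\<lambda>k. (\<lambda>(w, z). p w z) (x (r k))) \<longlonglongrightarrow> (\<lambda>(w, z). p w z) y"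
      using continuous_on_tendsto_compose[OF continuous_on_subset[OF p KW] y(3)] y(1) x(1) by (simp add: o_def)
    obtain B where B: "B > 0" "\<And>k. \<bar>q (fst (x (r k))) (snd (x (r k)))\<bar> \<le> B"
      using convergent_imp_Bseq[OF convergentI[OF qc]] unfolding Bseq_def by (auto simp: case_prod_beta)
    have pk: "p (fst (x k)) (snd (x k)) \<ge> 0" for k using p0 x(1)[of k] by (auto simp: K_def)
    \<comment> \<open>Since \<open>q\<close> is bounded along the subsequence, the failed inequality
      bounds k p, which forces p to 0.\<close>
    have le: "p (fst (x (r k))) (snd (x (r k))) \<le> (1 + B) * inverse (real k)" if "k > 0" for k
    proof -
      have "k \<le> r k" using y(2) by (simp add: seq_suble)
      then have "real k * p (fst (x (r k))) (snd (x (r k))) \<le> real (r k) * p (fst (x (r k))) (snd (x (r k)))"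
        using pk by (simp add: mult_right_mono)
      also have "\<dots> \<le> 1 / (real (r k) + 1) - q (fst (x (r k))) (snd (x (r k)))" using x(2)[of "r k"] by linarith
      also have "1 / (real (r k) + 1) \<le> 1" by simp
      finally have "real k * p (fst (x (r k))) (snd (x (r k))) \<le> 1 + B" using B(2)[of k] by linarith
      then show ?thesis using that by (simp add: field_simps)
    qed
    have "(\<lambda>k. (1 + B) * inverse (real k)) \<longlonglongrightarrow> (1 + B) * 0"
      by (intro tendsto_intros LIMSEQ_inverse_real_of_nat[THEN LIMSEQ_imp_Suc])
    then have "(\<lambda>(w, z). p w z) y \<le> (1 + B) * 0"
      by (rule LIMSEQ_le[OF pc]) (use le in \<open>auto simp: case_prod_beta intro!: exI[of _ 1]\<close>)
    then have py: "p (fst y) (snd y) = 0" using p0[of "fst y" "snd y"] y(1) by (auto simp: K_def case_prod_beta)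
    have "q (fst y) (snd y) > 0"
      by (rule pos[OF _ _ _ py]) (use y(1) in \<open>auto simp: K_def\<close>)
    moreover have "(\<lambda>(w, z). q w z) y \<le> 0"
    proof (rule LIMSEQ_le[OF qc])
      show "(\<lambda>k. inverse (real (Suc k))) \<longlonglongrightarrow> 0" by (rule LIMSEQ_inverse_real_of_nat)
      have "q (fst (x (r k))) (snd (x (r k))) \<le> inverse (real (Suc k))" for k
      proof -
        have "q (fst (x (r k))) (snd (x (r k))) \<le> 1 / (real (r k) + 1)"
          using x(2)[of "r k"] mult_nonneg_nonneg[OF of_nat_0_le_iff pk[of "r k"], of "r k"] by linarith
        also have "\<dots> \<le> inverse (real (Suc k))" using seq_suble[OF y(2), of k]
          by (simp add: field_simps)
        finally show ?thesis .
      qed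
      then show "\<exists>N. \<forall>n\<ge>N. (case x (r n) of (w, z) \<Rightarrow> q w z) \<le> inverse (real (Suc n))"
        by (auto simp: case_prod_beta)
    qed
    ultimately show False by (simp add: case_prod_beta)
  qed
  then obtain k :: nat where k: "\<And>w z. (w, z) \<in> K \<Longrightarrow> q w z \<ge> 1 / (real k + 1) - real k * p w z" by auto
  have "q w z \<ge> (1 / (real k + 1)) * (norm z)\<^sup>2 - real k * p w z" if wz: "w \<in> W" "(w, z) \<in> V" for w z
  proof (cases "z = 0")
    case True
    then show ?thesis using qh[of w 0 0] ph[of w 0 0] by simp
  next
    case False
    have "(w, (1 / norm z) *\<^sub>R z) \<in> K" using wz False cone by (auto simp: K_def)
    from k[OF this] have "1 / (real k + 1) \<le> (1 / norm z)\<^sup>2 * (q w z + real k * p w z)"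
      by (simp add: qh ph algebra_simps)
    then have "1 / (real k + 1) * (norm z)\<^sup>2 \<le> (1 / norm z)\<^sup>2 * (q w z + real k * p w z) * (norm z)\<^sup>2"
      by (rule mult_right_mono) simp
    also have "\<dots> = q w z + real k * p w z" using False by (simp add: power2_eq_square)
    finally show ?thesis by linarith
  qed
  then show ?thesis using that[of "1 / (real k + 1)" "real k"] by simp
qed

section \<open>The projection onto the image\<close>

text \<open>Column j of \<open>G\<close> is a preimage of the projection of the j-th unit vector
  onto the real column space. The two matrix identities encode range and orthogonality and survive
  complexification unchanged.\<close>

lemma orthogonal_projection_matrix_exists:
  fixes R :: "real^'m^'p"
  shows "\<exists>P G. P = R ** G \<and> transpose R ** (mat 1 - P) = 0"
proof -
  define S where "S = range ((*v) R)"
  have S: "subspace S" unfolding S_def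
    by (metis linear_subspace_image matrix_vector_mul_linear subspace_UNIV)
  have "\<exists>g. \<forall>w. (axis j 1 - R *v g) \<bullet> (R *v w) = 0" for j :: 'p
  proof -
    obtain y z where "y \<in> S" "\<And>w. w \<in> S \<Longrightarrow> orthogonal z w" "axis j 1 = y + z"
      using orthogonal_subspace_decomp_exists[of S "axis j 1"] unfolding iffD2[OF span_eq_iff S] by blast
    then have "\<exists>g. y = R *v g" "z = axis j 1 - y" "\<And>w. z \<bullet> (R *v w) = 0"
      unfolding S_def orthogonal_def by auto
    then show ?thesis by auto
  qed
  then obtain g where g: "\<And>j w. (axis j 1 - R *v g j) \<bullet> (R *v w) = 0" by metis
  define G :: "real^'p^'m" where "G = (\<chi> i j. g j $ i)"
  have "(transpose R ** (mat 1 - R ** G)) $ i $ j = 0" for i j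
  proof -
    have c: "(mat 1 - R ** G) $ k $ j = (axis j 1 - R *v g j) $ k" for k
      by (simp add: matrix_matrix_mult_def G_def matrix_vector_mult_def mat_def axis_def)
    have "(transpose R ** (mat 1 - R ** G)) $ i $ j = (axis j 1 - R *v g j) \<bullet> (R *v axis i 1)"
      unfolding matrix_matrix_mult_def[of "transpose R"] vec_lambda_beta c
      by (simp add: transpose_def inner_vec_def column_def matrix_vector_mult_basis mult.commute)
    then show ?thesis using g by simp
  qed
  then have "transpose R ** (mat 1 - R ** G) = 0" by (simp add: vec_eq_iff)
  then show ?thesis by blast
qed

text \<open>Since \<open>proj1\<close> is a definite description among real matrices, existence and
  uniqueness have to be settled first. Existence is the real projection; for uniqueness, the
  difference of two candidates lies in the image and is orthogonal to it, hence to itself.\<close>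

lemma proj1_Image:
  assumes "w \<in> Image_C (cmat (R :: real^'m^'p))"
  shows "cmat (proj1 R) *v w = w"
proof -
  define pr where "pr P \<longleftrightarrow> (\<forall>z. cmat P *v z \<in> Image_C (cmat R) \<and>
                 (\<forall>w\<in>Image_C (cmat R). cinner (z - cmat P *v z) w = 0))" for P
  have diffI: "x - y \<in> Image_C (cmat R)" if xy: "x \<in> Image_C (cmat R)" "y \<in> Image_C (cmat R)" for x y
  proof -
    obtain a b where "x = cmat R *v a" "y = cmat R *v b" using xy by (auto simp: Image_C_def)
    then have "x - y = cmat R *v (a - b)" by (simp only: matrix_vector_mult_diff_distrib)
    then show ?thesis by (simp only: Image_C_def rangeI)
  qed
  have cd: "d = 0" if "cinner d d = 0" for d :: "complex^'p"
    using that Re_cinner[of d d] by simp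
  obtain P G where PG: "P = R ** G" "transpose R ** (mat 1 - P) = 0"
    using orthogonal_projection_matrix_exists by blast
  have "cinner (z - cmat P *v z) (cmat R *v y) = 0" for z y
  proof -
    have "cmat (transpose R) *v (z - cmat P *v z) = cmat (transpose R ** (mat 1 - P)) *v z"
      by (simp add: cmat_mult cmat_diff matrix_vector_mul_assoc[symmetric] matrix_vector_mult_diff_rdistrib)
    then have 0: "cmat (transpose R) *v (z - cmat P *v z) = 0" using PG(2) by simp
    then have 1: "(z - cmat P *v z) \<bullet> (cmat R *v y) = 0" for y
      using cmat_adjoint[of "transpose R" "z - cmat P *v z" y] by simp
    \<comment> \<open>Complex orthogonality follows from the real one by testing with y and with
      \<i>y, both of which \<open>R\<close> maps into the image.\<close>
    have "Im (cinner a b) = a \<bullet> mulI b" for a b :: "complex^'p"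
      by (simp add: cinner_def inner_vec_def mulI_def inner_complex_def sum_negf[symmetric] algebra_simps)
    then show ?thesis using 1[of y] 1[of "mulI y"] by (simp add: complex_eq_iff Re_cinner mulI_cmat)
  qed
  then have prP: "pr P" unfolding pr_def PG(1)
    by (auto simp: Image_C_def cmat_mult matrix_vector_mul_assoc[symmetric])
  have uniq: "P' = P" if "pr P'" for P'
  proof -
    have "cmat P' *v z = cmat P *v z" for z
    proof -
      have I: "cmat P' *v z - cmat P *v z \<in> Image_C (cmat R)" using that prP diffI by (simp add: pr_def)
      have "cinner (z - cmat P *v z) (cmat P' *v z - cmat P *v z) - cinner (z - cmat P' *v z) (cmat P' *v z - cmat P *v z) = 0"
        using that prP I by (simp add: pr_def)
      then have "cinner (cmat P' *v z - cmat P *v z) (cmat P' *v z - cmat P *v z) = 0"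
        by (simp add: cinner_def sum_subtractf[symmetric] algebra_simps)
      from cd[OF this] show ?thesis by (simp only: right_minus_eq)
    qed
    then have "cmat P' = cmat P" by (simp add: matrix_eq)
    then show ?thesis by (rule cmat_inject)
  qed
  have "proj1 R = (THE P. pr P)" unfolding proj1_def pr_def ..
  also have "\<dots> = P" by (rule the_equality[where P = pr, OF prP uniq])
  finally have "proj1 R = P" .
  then have "pr (proj1 R)" using prP by simp
  then have pp: "\<forall>z. cmat (proj1 R) *v z \<in> Image_C (cmat R) \<and>
                 (\<forall>w\<in>Image_C (cmat R). cinner (z - cmat (proj1 R) *v z) w = 0)"
    unfolding pr_def .
  have I: "cmat (proj1 R) *v w \<in> Image_C (cmat R)" using pp by simp
  have O: "cinner (w - cmat (proj1 R) *v w) y = 0" if "y \<in> Image_C (cmat R)" for y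
    using pp that by simp
  from cd[OF O[OF diffI[OF assms I]]] show ?thesis by (simp only: right_minus_eq)
qed

section \<open>The Lyapunov function\<close>

lemma continuous_on_matrix_mult:
  "continuous_on W f \<Longrightarrow> continuous_on W g \<Longrightarrow> continuous_on W (\<lambda>x. (f x :: real^'b^'a) ** g x)"
  unfolding matrix_matrix_mult_def by (intro continuous_on_vec_lambda continuous_intros)

lemma continuous_on_transpose:
  "continuous_on W f \<Longrightarrow> continuous_on W (\<lambda>x. transpose (f x :: real^'b^'a))"
  unfolding transpose_def by (intro continuous_on_vec_lambda continuous_intros)

lemma continuous_on_cmat_mult:
  fixes f :: "'x::topological_space \<Rightarrow> real^'b^'a"
  assumes "continuous_on W f" "continuous_on W g"
  shows "continuous_on W (\<lambda>x. cmat (f x) *v g x)"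
  by (rule bounded_bilinear.continuous_on[OF bounded_bilinear_cmat assms])

text \<open>The compactness lemma with a single parameter value, no constraint on z, and p =
  0.\<close>

lemma coercive_of_pos_on:
  fixes A0 :: "real^'m^'m"
  assumes "pos_on (cmat A0) UNIV"
  obtains c where "c > 0" "\<And>z. c * (norm z)\<^sup>2 \<le> (cmat A0 *v z) \<bullet> z"
proof -
  have pos: "(cmat A0 *v z) \<bullet> z > 0" if "z \<noteq> 0" for z
    using assms that by (simp add: pos_on_def Re_cinner)
  obtain c C where c: "c > 0" "\<And>w z. w \<in> {0::real} \<Longrightarrow> (w, z) \<in> UNIV \<Longrightarrow>
      (cmat A0 *v z) \<bullet> z \<ge> c * (norm z)\<^sup>2 - C * 0"
    by (rule coercive_modulo_on_compact_family[where W = "{0::real}" and V = UNIV and p = "\<lambda>_ _. 0"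
          and q = "\<lambda>_ z. (cmat A0 *v z) \<bullet> z"])
       (auto simp: case_prod_beta matrix_mult_scaleR_vec power2_eq_square pos
         intro!: continuous_intros continuous_on_cmat_mult)
  then show ?thesis using that[of c] by simp
qed

text \<open>The component of z in Ker(L), which is also the kernel of the form, changes neither
  side; on the orthogonal component |Lz| is at most a multiple of the norm, and the form is
  coercive. The denominator M^2 + 1 stays positive even for M = 0.\<close>

lemma structural_S_estimate:
  fixes A0 L S :: "real^'m^'m"
  assumes "cond_S A0 L S"
  obtains c where "c > 0" "\<And>z. c * (norm (cmat L *v z))\<^sup>2 \<le> (cmat S *v (cmat L *v z)) \<bullet> z + (cmat L *v z) \<bullet> z"
proof -
  define X where "X = sym_part (S ** L) + sym_part L"
  have tX: "transpose X = X" by (simp add: X_def transpose_add)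
  have Xz: "(cmat X *v z) \<bullet> z = (cmat S *v (cmat L *v z)) \<bullet> z + (cmat L *v z) \<bullet> z" for z
    by (simp add: X_def cmat_add matrix_vector_mult_add_rdistrib inner_add_left cmat_sym_part
        cmat_mult matrix_vector_mul_assoc[symmetric])
  have nn: "(cmat X *v z) \<bullet> z \<ge> 0" for z
    using assms by (simp add: cond_S_def nonneg_on_def Re_cinner X_def)
  have ker: "cmat L *v z = 0" if "cmat X *v z = 0" for z
    using assms that by (auto simp: cond_S_def Ker_def X_def)
  have "linear ((*v) (cmat X))" by (simp add: bounded_linear.linear)
  moreover have "(cmat X *v x) \<bullet> y = x \<bullet> (cmat X *v y)" for x y using cmat_adjoint[of X] by (simp add: tX)
  ultimately obtain c where c: "c > 0" "\<And>x. \<exists>y z. x = y + z \<and> cmat X *v y = 0 \<and> norm y \<le> norm x \<and> norm z \<le> norm x \<and>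
        c * (norm z)\<^sup>2 \<le> (cmat X *v x) \<bullet> x"
    using symmetric_operator_decomposition[of "(*v) (cmat X)"] nn by blast
  obtain M where M: "M \<ge> 0" "\<And>z. norm (cmat L *v z) \<le> M * norm z" using cmat_bound1[of L] by blast
  show ?thesis
  proof (rule that[of "c / (M\<^sup>2 + 1)"])
    show "c / (M\<^sup>2 + 1) > 0" using c(1) by (simp add: add_nonneg_pos)
    fix x
    obtain y z where yz: "x = y + z" "cmat X *v y = 0" "c * (norm z)\<^sup>2 \<le> (cmat X *v x) \<bullet> x" using c(2)[of x] by blast
    have "cmat L *v x = cmat L *v z" by (simp add: yz(1) matrix_vector_right_distrib ker[OF yz(2)])
    then have "(norm (cmat L *v x))\<^sup>2 \<le> (M * norm z)\<^sup>2" using M(2)[of z] by (simp add: power_mono)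
    also have "\<dots> \<le> (M\<^sup>2 + 1) * (norm z)\<^sup>2" by (simp add: power_mult_distrib algebra_simps)
    finally have "c / (M\<^sup>2 + 1) * (norm (cmat L *v x))\<^sup>2 \<le> c / (M\<^sup>2 + 1) * ((M\<^sup>2 + 1) * (norm z)\<^sup>2)"
      using c(1) by (intro mult_left_mono) (simp_all add: add_nonneg_pos less_imp_le)
    also have "\<dots> = c * (norm z)\<^sup>2" using sum_power2_gt_zero_iff[of M 1] by simp
    finally show "c / (M\<^sup>2 + 1) * (norm (cmat L *v x))\<^sup>2 \<le> (cmat S *v (cmat L *v x)) \<bullet> x + (cmat L *v x) \<bullet> x"
      using yz(3) Xz[of x] by linarith
  qed
qed

text \<open>The operator \<i>(SA(\<omega>) - T(\<omega>)), restricted to its self-adjoint part, is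
  nonnegative on the kernel of the symmetric part of \<open>L\<close>; every remaining term contains
  the component of z orthogonal to that kernel, whose norm is controlled by sqrt(<Lz,z>). The matrix
  T(\<omega>) is designed so that its own contribution becomes a nonnegative form in Rz as soon as
  the constraint holds.\<close>

lemma structural_Sstar_estimate:
  fixes L S :: "real^'m^'m" and A :: "'n::finite \<Rightarrow> real^'m^'m" and Q :: "'n \<Rightarrow> real^'m^'p"
  assumes "cond_Sstar1 A L Q R S" and nnL: "nonneg_on (cmat L) UNIV"
  obtains M where "M \<ge> 0" "\<And>\<omega> \<rho> z. \<omega> \<in> sphere 0 1 \<Longrightarrow> \<rho> \<ge> 0 \<Longrightarrow>
     \<rho> *\<^sub>R mulI (cmat (symbol Q \<omega>) *v z) + cmat R *v z = 0 \<Longrightarrow>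
     \<rho> * (mulI (cmat S *v (cmat (symbol A \<omega>) *v z)) \<bullet> z) \<ge> - (\<rho> * M * norm z * sqrt ((cmat L *v z) \<bullet> z))"
proof -
  obtain St :: "real^'p^'p" where St: "nonneg_on (cmat (sym_part St)) (Image_C (cmat R))"
    "\<And>\<omega>. \<omega> \<in> sphere 0 1 \<Longrightarrow> nonneg_on (map_matrix (\<lambda>x. \<i> * complex_of_real x)
        (skew_part (S ** symbol A \<omega> - transpose (proj1 R ** symbol Q \<omega>) ** St ** R))) (Ker (cmat (sym_part L)))"
    using assms(1) unfolding cond_Sstar1_def Let_def by blast
  define T where "T \<omega> = transpose (proj1 R ** symbol Q \<omega>) ** St ** R" for \<omega>
  define B where "B \<omega> = skew_part (S ** symbol A \<omega> - T \<omega>)" for \<omega>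
  have Bker: "mulI (cmat (B \<omega>) *v z) \<bullet> z \<ge> 0" if "\<omega> \<in> sphere 0 1" "cmat (sym_part L) *v z = 0" for \<omega> z
    using St(2)[OF that(1)] that(2) by (simp add: nonneg_on_def Re_cinner map_matrix_imult Ker_def B_def T_def)
  have "continuous_on (sphere 0 1) B" unfolding B_def T_def skew_part_def
    by (intro continuous_intros continuous_on_transpose continuous_on_matrix_mult continuous_on_symbol)
  then obtain MB where MB: "MB \<ge> 0" "\<And>w z. w \<in> sphere 0 1 \<Longrightarrow> norm (cmat (B w) *v z) \<le> MB * norm z"
    by (rule cmat_bound_on) auto
  have nnN: "(cmat (sym_part L) *v z) \<bullet> z \<ge> 0" for z
    using nnL by (simp add: nonneg_on_def Re_cinner cmat_sym_part)
  have "linear ((*v) (cmat (sym_part L)))" by (simp add: bounded_linear.linear)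
  moreover have "(cmat (sym_part L) *v x) \<bullet> y = x \<bullet> (cmat (sym_part L) *v y)" for x y
    using cmat_adjoint[of "sym_part L"] by simp
  ultimately obtain c where c: "c > 0" "\<And>x. \<exists>y z. x = y + z \<and> cmat (sym_part L) *v y = 0 \<and> norm y \<le> norm x \<and> norm z \<le> norm x \<and>
        c * (norm z)\<^sup>2 \<le> (cmat (sym_part L) *v x) \<bullet> x"
    using symmetric_operator_decomposition[of "(*v) (cmat (sym_part L))"] nnN by blast
  show ?thesis
  proof (rule that[of "3 * MB / sqrt c"])
    show "0 \<le> 3 * MB / sqrt c" using MB(1) c(1) by simp
    fix \<omega> :: "real^'n" and \<rho> :: real and x :: "complex^'m"
    assume \<omega>: "\<omega> \<in> sphere 0 1" and \<rho>: "\<rho> \<ge> 0" and con: "\<rho> *\<^sub>R mulI (cmat (symbol Q \<omega>) *v x) + cmat R *v x = 0"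
    define H where "H z = mulI (cmat (B \<omega>) *v z)" for z
    have H_add: "H (y + z) = H y + H z" for y z by (simp add: H_def matrix_vector_right_distrib mulI_add)
    have H_sym: "H y \<bullet> z = y \<bullet> H z" for y z
    proof -
      have "H y \<bullet> z = (cmat (B \<omega>) *v mulI y) \<bullet> z" by (simp add: H_def mulI_cmat)
      also have "\<dots> = - (mulI y \<bullet> (cmat (B \<omega>) *v z))"
        by (simp add: cmat_adjoint B_def cmat_uminus uminus_matrix_mult_vec)
      also have "\<dots> = y \<bullet> H z" by (simp add: mulI_inner H_def)
      finally show ?thesis .
    qed
    have H_norm: "norm (H z) \<le> MB * norm z" for z using MB(2)[OF \<omega>] by (simp add: H_def)
    obtain y z where yz: "x = y + z" "cmat (sym_part L) *v y = 0" "norm y \<le> norm x" "norm z \<le> norm x"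
        "c * (norm z)\<^sup>2 \<le> (cmat (sym_part L) *v x) \<bullet> x" using c(2)[of x] by blast
    have inner_le: "u \<bullet> v \<ge> - (norm u * norm v)" for u v :: "complex^'m"
      using Cauchy_Schwarz_ineq2[of u v] by linarith
    have "H y \<bullet> z \<ge> - (MB * norm x * norm z)"
    proof -
      have "norm (H y) * norm z \<le> (MB * norm x) * norm z"
        using H_norm[of y] mult_left_mono[OF yz(3) MB(1)] by (intro mult_right_mono) auto
      then show ?thesis using inner_le[of "H y" z] by linarith
    qed
    moreover have "H z \<bullet> z \<ge> - (MB * norm x * norm z)"
    proof -
      have "norm (H z) * norm z \<le> (MB * norm x) * norm z"
        using H_norm[of z] mult_left_mono[OF yz(4) MB(1)] by (intro mult_right_mono) auto
      then show ?thesis using inner_le[of "H z" z] by linarith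
    qed
    moreover have "H y \<bullet> y \<ge> 0" using Bker[OF \<omega> yz(2)] by (simp add: H_def)
    \<comment> \<open>The factor 3 below counts the mixed term twice and the pure term in z once,
      each bounded by MB |x| |z|.\<close>
    moreover have "H x \<bullet> x = H y \<bullet> y + 2 * (H y \<bullet> z) + H z \<bullet> z"
      using H_sym[of z y] by (simp add: yz(1) H_add inner_add_left inner_add_right inner_commute)
    ultimately have 1: "H x \<bullet> x \<ge> - (3 * MB * norm x * norm z)" by linarith
    have "sqrt c * norm z \<le> sqrt ((cmat L *v x) \<bullet> x)"
    proof -
      have "sqrt c * norm z = sqrt (c * (norm z)\<^sup>2)" by (simp add: real_sqrt_mult)
      also have "\<dots> \<le> sqrt ((cmat L *v x) \<bullet> x)" using yz(5) by (simp add: cmat_sym_part)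
      finally show ?thesis .
    qed
    then have "norm z \<le> sqrt ((cmat L *v x) \<bullet> x) / sqrt c" using c(1) by (simp add: field_simps)
    then have "3 * MB * norm x * norm z \<le> 3 * MB * norm x * (sqrt ((cmat L *v x) \<bullet> x) / sqrt c)"
      using MB(1) by (intro mult_left_mono) auto
    with 1 have 2: "H x \<bullet> x \<ge> - (3 * MB / sqrt c * norm x * sqrt ((cmat L *v x) \<bullet> x))" by simp
    have Hx: "H x \<bullet> x = mulI (cmat S *v (cmat (symbol A \<omega>) *v x)) \<bullet> x - mulI (cmat (T \<omega>) *v x) \<bullet> x"
      by (simp add: H_def B_def mulI_skew_part cmat_diff cmat_mult matrix_vector_mult_diff_rdistrib
          mulI_diff inner_diff_left matrix_vector_mul_assoc[symmetric])
    \<comment> \<open>By the constraint -\<rho>\<i>Q(\<omega>)x equals Rx, on which the projection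
      acts as the identity; what is left is <St r, r> with r = Rx in the image of R.\<close>
    have "\<rho> * (mulI (cmat (T \<omega>) *v x) \<bullet> x) \<ge> 0"
    proof -
      define r where "r = cmat R *v x"
      have rI: "r \<in> Image_C (cmat R)" by (simp add: r_def Image_C_def)
      have r: "- (\<rho> *\<^sub>R mulI (cmat (symbol Q \<omega>) *v x)) = r" using con by (simp add: r_def eq_neg_iff_add_eq_0 minus_equation_iff[of _ "cmat R *v x"] add.commute neg_eq_iff_add_eq_0)
      have "mulI (cmat (T \<omega>) *v x) = cmat (transpose (proj1 R ** symbol Q \<omega>)) *v mulI (cmat St *v r)"
        by (simp add: T_def r_def cmat_mult mulI_cmat matrix_vector_mul_assoc[symmetric])
      then have "mulI (cmat (T \<omega>) *v x) \<bullet> x = mulI (cmat St *v r) \<bullet> (cmat (proj1 R) *v (cmat (symbol Q \<omega>) *v x))"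
        by (simp add: cmat_adjoint cmat_mult matrix_vector_mul_assoc[symmetric])
      then have "\<rho> * (mulI (cmat (T \<omega>) *v x) \<bullet> x) = (cmat St *v r) \<bullet> (cmat (proj1 R) *v (- (\<rho> *\<^sub>R mulI (cmat (symbol Q \<omega>) *v x))))"
        by (simp add: mulI_inner matrix_mult_uminus_vec matrix_mult_scaleR_vec mulI_cmat)
      also have "\<dots> = (cmat St *v r) \<bullet> r" unfolding r proj1_Image[OF rI] ..
      also have "\<dots> \<ge> 0" using St(1) rI by (simp add: nonneg_on_def Re_cinner cmat_sym_part)
      finally show ?thesis .
    qed
    moreover have "\<rho> * (H x \<bullet> x) \<ge> \<rho> * (- (3 * MB / sqrt c * norm x * sqrt ((cmat L *v x) \<bullet> x)))"
      by (rule mult_left_mono[OF 2 \<rho>])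
    ultimately show "\<rho> * (mulI (cmat S *v (cmat (symbol A \<omega>) *v x)) \<bullet> x) \<ge> - (\<rho> * (3 * MB / sqrt c) * norm x * sqrt ((cmat L *v x) \<bullet> x))"
      unfolding Hx by (simp add: algebra_simps)
  qed
qed

lemma smooth_on_sphere_imp_continuous_on:
  assumes "smooth_on_sphere f"
  shows "continuous_on (sphere 0 1) f"
proof -
  obtain U g where U: "sphere 0 1 \<subseteq> U" "smooth_on_open U g" "\<forall>\<omega>\<in>sphere 0 1. g \<omega> = f \<omega>"
    using assms unfolding smooth_on_sphere_def by blast
  then have "continuous_on U g" unfolding smooth_on_open_def by (metis Ck_on.simps(1))
  then have "continuous_on (sphere 0 1) g" using U(1) by (rule continuous_on_subset)
  then show ?thesis using U(3) by (metis continuous_on_cong)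
qed

text \<open>Positivity is assumed only on the intersection of X_\<omega> with Ker(L). Taking p =
  |Lz|^2, which vanishes exactly on Ker(L), the compactness lemma extends it to all of X_\<omega>,
  uniformly in \<omega>, at the cost of a multiple of |Lz|^2.\<close>

lemma structural_K_estimate:
  fixes L :: "real^'m^'m" and A :: "'n::finite \<Rightarrow> real^'m^'m" and Q :: "'n \<Rightarrow> real^'m^'p"
  assumes K: "continuous_on (sphere 0 1) K"
    and pos: "\<And>\<omega>. \<omega> \<in> sphere 0 1 \<Longrightarrow> pos_on (cmat (sym_part (K \<omega> ** symbol A \<omega>))) (X_space Q R \<omega> \<inter> Ker (cmat L))"
  obtains c C where "c > 0" "C \<ge> 0" "\<And>\<omega> z. \<omega> \<in> sphere 0 1 \<Longrightarrow> z \<in> X_space Q R \<omega> \<Longrightarrow>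
     (cmat (K \<omega>) *v (cmat (symbol A \<omega>) *v z)) \<bullet> z \<ge> c * (norm z)\<^sup>2 - C * (norm (cmat L *v z))\<^sup>2"
proof -
  define V where "V = {x :: (real^'n) \<times> (complex^'m). cmat (proj2 R ** symbol Q (fst x)) *v snd x = 0}"
  have "closed V" unfolding V_def
    by (intro closed_Collect_eq continuous_on_cmat_mult continuous_on_matrix_mult
        continuous_on_compose2[OF continuous_on_symbol] continuous_intros) auto
  have K': "continuous_on (sphere 0 1 \<times> UNIV) (\<lambda>x. K (fst x))"
    by (rule continuous_on_compose2[OF K]) (auto intro!: continuous_intros)
  have A': "continuous_on (sphere 0 1 \<times> UNIV) (\<lambda>x. symbol A (fst x))"
    by (rule continuous_on_compose2[OF continuous_on_symbol]) (auto intro!: continuous_intros)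
  obtain c C where c: "c > 0" "C \<ge> 0" "\<And>w z. w \<in> sphere 0 1 \<Longrightarrow> (w, z) \<in> V \<Longrightarrow>
      (cmat (K w) *v (cmat (symbol A w) *v z)) \<bullet> z \<ge> c * (norm z)\<^sup>2 - C * (norm (cmat L *v z))\<^sup>2"
  proof (rule coercive_modulo_on_compact_family[where W = "sphere (0::real^'n) 1" and V = V
        and p = "\<lambda>_ z. (norm (cmat L *v z))\<^sup>2"
        and q = "\<lambda>w z. (cmat (K w) *v (cmat (symbol A w) *v z)) \<bullet> z"])
    show "closed V" by fact
    show "continuous_on (sphere 0 1 \<times> UNIV) (\<lambda>(w, z). (cmat (K w) *v (cmat (symbol A w) *v z)) \<bullet> z)"
      unfolding case_prod_beta by (intro continuous_on_inner continuous_on_cmat_mult K' A' continuous_intros)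
    show "continuous_on (sphere 0 1 \<times> UNIV) (\<lambda>(w, z). (norm (cmat L *v z))\<^sup>2)"
      unfolding case_prod_beta by (intro continuous_intros continuous_on_cmat_mult)
    show "(w, r *\<^sub>R z) \<in> V" if "(w, z) \<in> V" for w z r
      using that by (simp add: V_def matrix_mult_scaleR_vec)
    show "0 < (cmat (K w) *v (cmat (symbol A w) *v z)) \<bullet> z"
      if "w \<in> sphere 0 1" "(w, z) \<in> V" "z \<noteq> 0" "(norm (cmat L *v z))\<^sup>2 = 0" for w z
    proof -
      have "z \<in> X_space Q R w \<inter> Ker (cmat L)" using that by (simp add: V_def X_space_def Ker_def)
      then have "(cmat (sym_part (K w ** symbol A w)) *v z) \<bullet> z > 0"
        using pos[OF that(1)] that(3) by (simp add: pos_on_def Re_cinner)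
      then show ?thesis by (simp add: cmat_sym_part cmat_mult matrix_vector_mul_assoc)
    qed
  qed (simp_all add: matrix_mult_scaleR_vec power2_eq_square)
  show ?thesis
    by (rule that[OF c(1,2)]) (use c(3) in \<open>simp add: V_def X_space_def\<close>)
qed

text \<open>The energy balance reduced to real numbers: w = |z|, y = |Lz|, x = sqrt(<Lz,z>). The
  gains are x^2, then c3 y^2 with weight a2/D, and c2 w^2 with weight a1 a2 \<rho>^2/D^2. Each of
  the two mixed terms consumes a quarter of the last gain by Young's inequality, so half of it
  survives.\<close>

lemma dissipation_inequality:
  fixes \<rho> w x y :: real
  assumes nn: "\<rho> \<ge> 0" "w \<ge> 0" "x \<ge> 0" "y \<ge> 0" "M \<ge> 0" and pos: "c2 > 0" "c3 > 0" "a1 > 0" "a2 > 0"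
    and a1: "a1 * (M + M\<^sup>2 / c2) \<le> c3" and a2: "a2 * (1 + M\<^sup>2 / (a1 * c2)) \<le> 1"
    and D: "D = 1 + \<rho>\<^sup>2"
  shows "- x\<^sup>2 + a2 / D * (x\<^sup>2 - c3 * y\<^sup>2 + \<rho> * M * w * x + a1 * (\<rho> / D) * (- \<rho> * (c2 * w\<^sup>2 - M * y\<^sup>2) + M * w * y))
    \<le> - (a1 * a2 * c2 / 2) * (\<rho>\<^sup>2 / D\<^sup>2) * w\<^sup>2"
proof -
  have Dp: "D \<ge> 1" "D > 0" by (simp_all add: D add_pos_nonneg)
  \<comment> \<open>Completed squares in place of Young's inequality. In this one the weight 1/D
    stays with w, so the cost in x^2 is free of D.\<close>
  have e1: "0 \<le> a1 * a2 * c2 / 4 * (\<rho> * w / D - 2 * M * x / (a1 * c2))\<^sup>2" using pos by simp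
  also have "\<dots> = a1 * a2 * c2 / 4 * (\<rho>\<^sup>2 / D\<^sup>2) * w\<^sup>2 - a2 / D * (\<rho> * M * w * x) + a2 * (M\<^sup>2 / (a1 * c2)) * x\<^sup>2"
    using pos Dp by (simp add: field_simps power2_eq_square)
  finally have 1: "a2 / D * (\<rho> * M * w * x) \<le> a1 * a2 * c2 / 4 * (\<rho>\<^sup>2 / D\<^sup>2) * w\<^sup>2 + a2 * (M\<^sup>2 / (a1 * c2)) * x\<^sup>2" by linarith
  have e2: "0 \<le> a1 * a2 / D\<^sup>2 * c2 / 4 * (\<rho> * w - 2 * M * y / c2)\<^sup>2" using pos by simp
  also have "\<dots> = a1 * a2 * c2 / 4 * (\<rho>\<^sup>2 / D\<^sup>2) * w\<^sup>2 - a1 * a2 / D\<^sup>2 * \<rho> * M * w * y + a1 * a2 / D\<^sup>2 * (M\<^sup>2 / c2) * y\<^sup>2"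
    using pos Dp by (simp add: field_simps power2_eq_square)
  finally have 2: "a1 * a2 / D\<^sup>2 * \<rho> * M * w * y \<le> a1 * a2 * c2 / 4 * (\<rho>\<^sup>2 / D\<^sup>2) * w\<^sup>2 + a1 * a2 / D\<^sup>2 * (M\<^sup>2 / c2) * y\<^sup>2" by linarith
  \<comment> \<open>The bracket grows at most like D, which cancels one of the two factors 1/D; the
    condition on \<open>a1\<close> then makes the gain with \<open>c3\<close> pay for all terms in
    y^2.\<close>
  have 3: "a1 * a2 / D\<^sup>2 * (M * \<rho>\<^sup>2 + M\<^sup>2 / c2) * y\<^sup>2 \<le> a2 / D * c3 * y\<^sup>2"
  proof (rule mult_right_mono)
    define g where "g = M\<^sup>2 / c2"
    have "g \<ge> 0" using pos by (simp add: g_def)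
    then have "M * \<rho>\<^sup>2 + g \<le> D * (M + g)" using nn by (simp add: D algebra_simps)
    then have "a1 * a2 / D\<^sup>2 * (M * \<rho>\<^sup>2 + M\<^sup>2 / c2) \<le> a1 * a2 / D\<^sup>2 * (D * (M + M\<^sup>2 / c2))"
      using pos unfolding g_def by (intro mult_left_mono) auto
    also have "\<dots> = a2 / D * (a1 * (M + M\<^sup>2 / c2))" using Dp by (simp add: power2_eq_square)
    also have "\<dots> \<le> a2 / D * c3" using a1 pos Dp by (intro mult_left_mono) auto
    finally show "a1 * a2 / D\<^sup>2 * (M * \<rho>\<^sup>2 + M\<^sup>2 / c2) \<le> a2 / D * c3" .
  qed simp
  have 4: "a2 / D * x\<^sup>2 \<le> a2 * x\<^sup>2" using pos Dp by (intro mult_right_mono) (auto simp: field_simps)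
  have 5: "a2 * x\<^sup>2 + a2 * (M\<^sup>2 / (a1 * c2)) * x\<^sup>2 \<le> x\<^sup>2"
    using mult_right_mono[OF a2, of "x\<^sup>2"] by (simp add: algebra_simps)
  \<comment> \<open>With the products named, the five inequalities combine linearly.\<close>
  define t1 where "t1 = a2 / D * x\<^sup>2"
  define t2 where "t2 = a2 / D * c3 * y\<^sup>2"
  define t3 where "t3 = a2 / D * (\<rho> * M * w * x)"
  define g where "g = a1 * a2 * c2 * (\<rho>\<^sup>2 / D\<^sup>2) * w\<^sup>2"
  define h1 where "h1 = a1 * a2 / D\<^sup>2 * (M * \<rho>\<^sup>2) * y\<^sup>2"
  define h2 where "h2 = a1 * a2 / D\<^sup>2 * (M\<^sup>2 / c2) * y\<^sup>2"
  define k where "k = a1 * a2 / D\<^sup>2 * \<rho> * M * w * y"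
  define x1 where "x1 = a2 * x\<^sup>2"
  define x2 where "x2 = a2 * (M\<^sup>2 / (a1 * c2)) * x\<^sup>2"
  have g4: "a1 * a2 * c2 / 4 * (\<rho>\<^sup>2 / D\<^sup>2) * w\<^sup>2 = g / 4"
    and g2: "- (a1 * a2 * c2 / 2) * (\<rho>\<^sup>2 / D\<^sup>2) * w\<^sup>2 = - g / 2" by (simp_all add: g_def)
  have s1: "t3 \<le> g / 4 + x2" using 1 unfolding g4 t3_def x2_def .
  have s2: "k \<le> g / 4 + h2" using 2 unfolding g4 k_def h2_def .
  have s3: "h1 + h2 \<le> t2" using 3 unfolding h1_def h2_def t2_def by (simp add: algebra_simps)
  have s4: "t1 \<le> x1" using 4 unfolding t1_def x1_def .
  have s5: "x1 + x2 \<le> x\<^sup>2" using 5 unfolding x1_def x2_def .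
  have "a2 / D * (x\<^sup>2 - c3 * y\<^sup>2 + \<rho> * M * w * x + a1 * (\<rho> / D) * (- \<rho> * (c2 * w\<^sup>2 - M * y\<^sup>2) + M * w * y))
     = t1 - t2 + t3 - g + h1 + k"
    unfolding t1_def t2_def t3_def g_def h1_def k_def using Dp by (simp add: field_simps power2_eq_square)
  then show ?thesis unfolding g2 using s1 s2 s3 s4 s5 by linarith
qed

section \<open>Differentiating the Lyapunov function along solutions\<close>

lemma exp_decay_of_derivative:
  fixes E :: "real \<Rightarrow> real"
  assumes E: "\<And>t. t \<ge> 0 \<Longrightarrow> (E has_real_derivative E' t) (at t within {0..})"
    and le: "\<And>t. t \<ge> 0 \<Longrightarrow> E' t \<le> - b * E t" and t: "t \<ge> 0"
  shows "E t \<le> exp (- b * t) * E 0"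
proof -
  have "E t * exp (b * t) \<le> E 0 * exp (b * 0)"
  proof (rule DERIV_nonpos_imp_decreasing_open[OF t])
    fix x :: real assume x: "0 < x" "x < t"
    have "at x within {0..} = at x" using x by (intro at_within_interior) (simp add: interior_real_atLeast)
    then have "(E has_real_derivative E' x) (at x)" using E[of x] x by simp
    then have "((\<lambda>t. E t * exp (b * t)) has_real_derivative (E' x + b * E x) * exp (b * x)) (at x)"
      by (auto intro!: derivative_eq_intros simp: algebra_simps)
    moreover have "(E' x + b * E x) * exp (b * x) \<le> 0"
      using le[of x] x by (intro mult_nonpos_nonneg) auto
    ultimately show "\<exists>y. ((\<lambda>t. E t * exp (b * t)) has_real_derivative y) (at x) \<and> y \<le> 0" by blast
  next
    have "continuous_on {0..} E"
      unfolding continuous_on_eq_continuous_within using E DERIV_continuous by (metis atLeast_iff)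
    then have "continuous_on {0..t} E" by (rule continuous_on_subset) auto
    then show "continuous_on {0..t} (\<lambda>t. E t * exp (b * t))" by (intro continuous_intros)
  qed
  then show ?thesis by (simp add: exp_minus field_simps)
qed

lemma quadratic_form_has_derivative:
  fixes H :: "'a::euclidean_space \<Rightarrow> 'a"
  assumes H: "bounded_linear H" and sym: "\<And>x y. H x \<bullet> y = x \<bullet> H y"
    and z: "(z has_vector_derivative z') (at t within T)"
  shows "((\<lambda>t. H (z t) \<bullet> z t) has_real_derivative 2 * (z t \<bullet> H z')) (at t within T)"
proof -
  have 1: "((\<lambda>t. H (z t)) has_vector_derivative H z') (at t within T)"
    by (rule bounded_linear.has_vector_derivative[OF H z])
  have "((\<lambda>t. H (z t) \<bullet> z t) has_vector_derivative (H (z t) \<bullet> z' + H z' \<bullet> z t)) (at t within T)"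
    using bounded_bilinear.has_vector_derivative[OF bounded_bilinear_inner 1 z] .
  moreover have "H (z t) \<bullet> z' + H z' \<bullet> z t = 2 * (z t \<bullet> H z')" by (simp add: sym inner_commute)
  ultimately show ?thesis by (simp add: has_real_derivative_iff_has_vector_derivative)
qed

text \<open>The curve \<open>z\<close> is arbitrary apart from the equation and the constraint, so
  the constants depend on the matrices alone. The squared estimate \<open>core\<close> treats
  \<omega> and \<rho> as independent, which also covers \<xi> = 0, where \<open>sgn \<xi>\<close> is
  not a unit vector.\<close>

proposition pointwise_decay:
  fixes A0 L S :: "real^'m^'m" and A :: "'n::finite \<Rightarrow> real^'m^'m"
    and Q :: "'n \<Rightarrow> real^'m^'p" and R :: "real^'m^'p"
  assumes cA: "cond_A A0 A L" and cS: "cond_S A0 L S"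
    and cS1: "cond_Sstar1 A L Q R S" and cK: "cond_Kstar A0 A L Q R"
  obtains C c where "C > 0" "c > 0"
    "\<And>\<xi> z z' t. (\<And>t. t \<ge> 0 \<Longrightarrow> (z has_vector_derivative z' t) (at t within {0..})) \<Longrightarrow>
      (\<And>t. t \<ge> 0 \<Longrightarrow> cmat A0 *v z' t + norm \<xi> *\<^sub>R mulI (cmat (symbol A (sgn \<xi>)) *v z t) + cmat L *v z t = 0) \<Longrightarrow>
      (\<And>t. t \<ge> 0 \<Longrightarrow> norm \<xi> *\<^sub>R mulI (cmat (symbol Q (sgn \<xi>)) *v z t) + cmat R *v z t = 0) \<Longrightarrow>
      t \<ge> 0 \<Longrightarrow> norm (z t) \<le> C * exp (- c * eta \<xi> * t) * norm (z 0)"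
proof -
  have tA0: "transpose A0 = A0" and tA: "\<And>j. transpose (A j) = A j" and pA0: "pos_on (cmat A0) UNIV"
    and nnL: "nonneg_on (cmat L) UNIV" using cA by (auto simp: cond_A_def)
  have tSA0: "transpose (S ** A0) = S ** A0" using cS by (simp add: cond_S_def)
  obtain K :: "real^'n \<Rightarrow> real^'m^'m" where K: "smooth_on_sphere K"
      "\<And>\<omega>. \<omega> \<in> sphere 0 1 \<Longrightarrow> transpose (K \<omega> ** A0) = - (K \<omega> ** A0)"
      "\<And>\<omega>. \<omega> \<in> sphere 0 1 \<Longrightarrow> pos_on (cmat (sym_part (K \<omega> ** symbol A \<omega>))) (X_space Q R \<omega> \<inter> Ker (cmat L))"
    using cK unfolding cond_Kstar_def by blast
  have Kc: "continuous_on (sphere 0 1) K" using K(1) by (rule smooth_on_sphere_imp_continuous_on)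
  have symA: "transpose (symbol A \<omega>) = symbol A \<omega>" for \<omega>
    by (simp add: symbol_def transpose_sum transpose_scaleR tA)
  obtain c0 where c0: "c0 > 0" "\<And>z. c0 * (norm z)\<^sup>2 \<le> (cmat A0 *v z) \<bullet> z"
    by (rule coercive_of_pos_on[OF pA0], rule that)
  obtain c3 where c3: "c3 > 0" "\<And>z. c3 * (norm (cmat L *v z))\<^sup>2 \<le> (cmat S *v (cmat L *v z)) \<bullet> z + (cmat L *v z) \<bullet> z"
    by (rule structural_S_estimate[OF cS], rule that)
  obtain M1 where M1: "M1 \<ge> 0" "\<And>\<omega> \<rho> z. \<omega> \<in> sphere 0 1 \<Longrightarrow> \<rho> \<ge> 0 \<Longrightarrow>
     \<rho> *\<^sub>R mulI (cmat (symbol Q \<omega>) *v z) + cmat R *v z = 0 \<Longrightarrow>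
     \<rho> * (mulI (cmat S *v (cmat (symbol A \<omega>) *v z)) \<bullet> z) \<ge> - (\<rho> * M1 * norm z * sqrt ((cmat L *v z) \<bullet> z))"
    by (rule structural_Sstar_estimate[OF cS1 nnL], rule that)
  obtain c2 M2 where M2: "c2 > 0" "M2 \<ge> 0" "\<And>\<omega> z. \<omega> \<in> sphere 0 1 \<Longrightarrow> z \<in> X_space Q R \<omega> \<Longrightarrow>
     (cmat (K \<omega>) *v (cmat (symbol A \<omega>) *v z)) \<bullet> z \<ge> c2 * (norm z)\<^sup>2 - M2 * (norm (cmat L *v z))\<^sup>2"
    by (rule structural_K_estimate[where K = K and A = A and Q = Q and R = R and L = L, OF Kc K(3)], assumption, rule that)
  obtain M3 where M3: "M3 \<ge> 0" "\<And>z. norm (cmat A0 *v z) \<le> M3 * norm z" using cmat_bound1[of A0] by blast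
  obtain M4 where M4: "M4 \<ge> 0" "\<And>z. norm (cmat (S ** A0) *v z) \<le> M4 * norm z" using cmat_bound1[of "S ** A0"] by blast
  obtain M5 where M5: "M5 \<ge> 0" "\<And>w z. w \<in> sphere 0 1 \<Longrightarrow> norm (cmat (K w) *v z) \<le> M5 * norm z"
    by (rule cmat_bound_on[OF Kc]) (auto intro: that)
  define M where "M = M1 + M2 + M5 + 1"
  have M: "M \<ge> 1" "M1 \<le> M" "M2 \<le> M" "M5 \<le> M" using M1(1) M2(2) M5(1) by (auto simp: M_def)
  \<comment> \<open>Chosen first: the errors in |Lz|^2 caused by the \<open>K\<close> part must not
    exceed the gain \<open>c3\<close> of the \<open>S\<close> part.\<close>
  define a1 where "a1 = c3 / (M + M\<^sup>2 / c2)"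
  have MM: "M + M\<^sup>2 / c2 > 0" using M(1) M2(1) by (intro add_pos_nonneg) auto
  have a1: "a1 > 0" "a1 * (M + M\<^sup>2 / c2) \<le> c3" using MM c3(1) by (auto simp: a1_def)
  define N where "N = M4 + a1 * (M5 * M3)"
  have N: "N \<ge> 0" using M3(1) M4(1) M5(1) a1(1) by (simp add: N_def)
  \<comment> \<open>Chosen second, because its smallness depends on \<open>a1\<close>. The first
    bound lets <Lz,z> absorb its errors; the second keeps the perturbation below c0/4 |z|^2, half of
    what the form of \<open>A0\<close> supplies.\<close>
  define a2 where "a2 = min (1 / (1 + M\<^sup>2 / (a1 * c2))) (c0 / (4 * (N + 1)))"
  have MM2: "1 + M\<^sup>2 / (a1 * c2) > 0" using a1(1) M2(1) by (intro add_pos_nonneg) auto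
  have a2: "a2 > 0" "a2 * (1 + M\<^sup>2 / (a1 * c2)) \<le> 1" "a2 * N \<le> c0 / 4"
  proof -
    show "a2 > 0" using MM2 c0(1) N by (simp add: a2_def)
    have "a2 \<le> 1 / (1 + M\<^sup>2 / (a1 * c2))" by (simp add: a2_def)
    then show "a2 * (1 + M\<^sup>2 / (a1 * c2)) \<le> 1" using MM2 by (simp only: pos_le_divide_eq)
    have "a2 \<le> c0 / (4 * (N + 1))" by (simp add: a2_def)
    then have "a2 * (4 * (N + 1)) \<le> c0" using N by (subst (asm) pos_le_divide_eq) auto
    then show "a2 * N \<le> c0 / 4" using \<open>a2 > 0\<close> by (simp add: algebra_simps)
  qed
  define M' where "M' = M3 + c0"
  have M': "M' > 0" using M3(1) c0(1) by (simp add: M'_def)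
  \<comment> \<open>The dissipation rate divided by the upper bound \<open>M'\<close> of the
    Lyapunov function, which converts |z|^2 back into that function.\<close>
  define \<kappa> where "\<kappa> = a1 * a2 * c2 / (2 * M')"
  have \<kappa>: "\<kappa> > 0" using a1 a2 M2(1) M' by (simp add: \<kappa>_def)
  have core: "(norm (z t))\<^sup>2 \<le> (4 * M' / c0) * exp (- \<kappa> * (\<rho>\<^sup>2 / (1 + \<rho>\<^sup>2)\<^sup>2) * t) * (norm (z 0))\<^sup>2"
    if \<omega>: "\<omega> \<in> sphere 0 1" and \<rho>: "\<rho> \<ge> 0"
      and dz: "\<And>t. t \<ge> 0 \<Longrightarrow> (z has_vector_derivative z' t) (at t within {0..})"
      and ode: "\<And>t. t \<ge> 0 \<Longrightarrow> cmat A0 *v z' t + \<rho> *\<^sub>R mulI (cmat (symbol A \<omega>) *v z t) + cmat L *v z t = 0"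
      and con: "\<And>t. t \<ge> 0 \<Longrightarrow> \<rho> *\<^sub>R mulI (cmat (symbol Q \<omega>) *v z t) + cmat R *v z t = 0"
      and t0: "t \<ge> 0"
    for \<omega> \<rho> z z' t
  proof -
    define D where "D = 1 + \<rho>\<^sup>2"
    have D: "D \<ge> 1" "D > 0" by (simp_all add: D_def add_pos_nonneg)
    have rD: "0 \<le> \<rho> / D" "\<rho> / D \<le> 1"
    proof -
      show "0 \<le> \<rho> / D" using \<rho> D by simp
      have "0 \<le> (\<rho> - 1)\<^sup>2" by simp
      then have "2 * \<rho> \<le> 1 + \<rho>\<^sup>2" by (simp add: power2_eq_square algebra_simps)
      then have "\<rho> \<le> D" using \<rho> unfolding D_def by linarith
      then show "\<rho> / D \<le> 1" using D by simp
    qed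
    \<comment> \<open>\<open>K \<omega> ** A0\<close> is skew, so the factor -\<i> makes it
      self-adjoint; only then is the derivative of the quadratic form twice a single pairing with
      z'.\<close>
    define H where "H x = - mulI (cmat (K \<omega> ** A0) *v x)" for x
    have H_bl: "bounded_linear H" unfolding H_def
      by (intro bounded_linear_minus bounded_linear_compose[OF bounded_linear_mulI] matrix_vector_mul_bounded_linear)
    have H_sym: "H x \<bullet> y = x \<bullet> H y" for x y
    proof -
      have "H x \<bullet> y = - ((cmat (K \<omega> ** A0) *v mulI x) \<bullet> y)" by (simp add: H_def mulI_cmat)
      also have "\<dots> = mulI x \<bullet> (cmat (K \<omega> ** A0) *v y)"
        by (simp add: cmat_adjoint K(2)[OF \<omega>] cmat_uminus uminus_matrix_mult_vec)
      also have "\<dots> = x \<bullet> H y" by (simp add: mulI_inner H_def)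
      finally show ?thesis .
    qed
    define E where "E t = 1/2 * ((cmat A0 *v z t) \<bullet> z t) + a2 / D * (1/2 * ((cmat (S ** A0) *v z t) \<bullet> z t)
       + a1 * (\<rho> / D) * (1/2 * (H (z t) \<bullet> z t)))" for t
    define E' where "E' t = z t \<bullet> (cmat A0 *v z' t) + a2 / D * (z t \<bullet> (cmat (S ** A0) *v z' t)
       + a1 * (\<rho> / D) * (z t \<bullet> H (z' t)))" for t
    have dE: "(E has_real_derivative E' t) (at t within {0..})" if t: "t \<ge> 0" for t
    proof -
      have 1: "((\<lambda>t. (cmat A0 *v z t) \<bullet> z t) has_real_derivative 2 * (z t \<bullet> (cmat A0 *v z' t))) (at t within {0..})"
        by (rule quadratic_form_has_derivative[OF _ _ dz[OF t]]) (simp_all add: cmat_adjoint tA0)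
      have 2: "((\<lambda>t. (cmat (S ** A0) *v z t) \<bullet> z t) has_real_derivative 2 * (z t \<bullet> (cmat (S ** A0) *v z' t))) (at t within {0..})"
        by (rule quadratic_form_has_derivative[OF _ _ dz[OF t]]) (simp_all add: cmat_adjoint tSA0)
      have 3: "((\<lambda>t. H (z t) \<bullet> z t) has_real_derivative 2 * (z t \<bullet> H (z' t))) (at t within {0..})"
        by (rule quadratic_form_has_derivative[OF H_bl H_sym dz[OF t]])
      show ?thesis unfolding E_def E'_def
        by (rule DERIV_cong, (rule DERIV_add DERIV_cmult 1 2 3)+) simp
    qed
    have E'_le: "E' t \<le> - (a1 * a2 * c2 / 2) * (\<rho>\<^sup>2 / D\<^sup>2) * (norm (z t))\<^sup>2" if t: "t \<ge> 0" for t
    proof -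
      define x where "x = sqrt ((cmat L *v z t) \<bullet> z t)"
      define y where "y = norm (cmat L *v z t)"
      define w where "w = norm (z t)"
      have Lnn: "(cmat L *v z t) \<bullet> z t \<ge> 0" using nnL by (simp add: nonneg_on_def Re_cinner)
      have x2: "x\<^sup>2 = (cmat L *v z t) \<bullet> z t" using Lnn by (simp add: x_def)
      have nn: "w \<ge> 0" "x \<ge> 0" "y \<ge> 0" using Lnn by (auto simp: w_def x_def y_def)
      have A0z': "cmat A0 *v z' t = - (\<rho> *\<^sub>R mulI (cmat (symbol A \<omega>) *v z t)) - cmat L *v z t"
      proof -
        have "a = - b - c" if "a + b + c = 0" for a b c :: "complex^'m"
        proof -
          have "a = a + b + c - b - c" by simp
          then show ?thesis unfolding that by simp
        qed
        from this[OF ode[OF t]] show ?thesis .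
      qed
      have t1: "z t \<bullet> (cmat A0 *v z' t) = - x\<^sup>2"
        using mulI_sym_inner[OF symA, of \<omega> "z t"] by (simp add: A0z' x2 inner_diff_right inner_commute)
      have t2: "z t \<bullet> (cmat (S ** A0) *v z' t) \<le> x\<^sup>2 - c3 * y\<^sup>2 + \<rho> * M * w * x"
      proof -
        have "z t \<bullet> (cmat (S ** A0) *v z' t) = z t \<bullet> (cmat S *v (cmat A0 *v z' t))"
          by (simp add: cmat_mult matrix_vector_mul_assoc)
        also have "\<dots> = - (\<rho> * (mulI (cmat S *v (cmat (symbol A \<omega>) *v z t)) \<bullet> z t)) - (cmat S *v (cmat L *v z t)) \<bullet> z t"
          by (simp add: A0z' matrix_vector_mult_diff_distrib matrix_mult_uminus_vec matrix_mult_scaleR_vec mulI_cmat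
              inner_diff_right inner_commute)
        also have "\<dots> \<le> \<rho> * M1 * w * x + (x\<^sup>2 - c3 * y\<^sup>2)"
          using M1(2)[OF \<omega> \<rho> con[OF t]] c3(2)[of "z t"] unfolding x2 unfolding w_def x_def y_def by linarith
        also have "\<rho> * M1 * w * x \<le> \<rho> * M * w * x" using M \<rho> nn by (intro mult_right_mono mult_left_mono) auto
        finally show ?thesis by simp
      qed
      \<comment> \<open>For \<rho> = 0 both sides vanish. That case is split off because the
        constraint then only says Rz = 0 and does not place z in X_\<omega>.\<close>
      have t3: "\<rho> / D * (z t \<bullet> H (z' t)) \<le> \<rho> / D * (- \<rho> * (c2 * w\<^sup>2 - M * y\<^sup>2) + M * w * y)"
      proof (cases "\<rho> = 0")
        case False
        have Rz: "cmat R *v z t = - (\<rho> *\<^sub>R mulI (cmat (symbol Q \<omega>) *v z t))"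
          using con[OF t] by (simp add: add_eq_0_iff2 add_eq_0_iff)
        \<comment> \<open>Projecting the constraint off the image of R removes its zeroth order
          term; dividing by \<rho> leaves membership in X_\<omega>.\<close>
        have "cmat (proj2 R) *v (cmat R *v z t) = 0"
          using proj1_Image[of "cmat R *v z t" R]
          by (simp add: proj2_def cmat_diff matrix_vector_mult_diff_rdistrib Image_C_def)
        then have "mulI (\<rho> *\<^sub>R (cmat (proj2 R) *v (cmat (symbol Q \<omega>) *v z t))) = 0"
          by (simp add: Rz matrix_mult_uminus_vec matrix_mult_scaleR_vec mulI_cmat mulI_scaleR)
        then have "norm (\<rho> *\<^sub>R (cmat (proj2 R) *v (cmat (symbol Q \<omega>) *v z t))) = 0" by (metis norm_mulI norm_zero)
        then have "cmat (proj2 R) *v (cmat (symbol Q \<omega>) *v z t) = 0" using False by simp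
        then have X: "z t \<in> X_space Q R \<omega>" by (simp add: X_space_def cmat_mult matrix_vector_mul_assoc[symmetric])
        have "z t \<bullet> H (z' t) = - (z t \<bullet> mulI (cmat (K \<omega>) *v (cmat A0 *v z' t)))"
          by (simp add: H_def cmat_mult matrix_vector_mul_assoc)
        also have "\<dots> = - (\<rho> * ((cmat (K \<omega>) *v (cmat (symbol A \<omega>) *v z t)) \<bullet> z t)) + z t \<bullet> mulI (cmat (K \<omega>) *v (cmat L *v z t))"
          by (simp add: A0z' matrix_vector_mult_diff_distrib matrix_mult_uminus_vec matrix_mult_scaleR_vec mulI_cmat
              inner_diff_right mulI_diff mulI_scaleR mulI_uminus inner_commute)
        also have "\<dots> \<le> - (\<rho> * (c2 * w\<^sup>2 - M * y\<^sup>2)) + M * w * y"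
        proof (rule add_mono)
          have "M2 * y\<^sup>2 \<le> M * y\<^sup>2" using M by (intro mult_right_mono) auto
          then have "c2 * w\<^sup>2 - M * y\<^sup>2 \<le> (cmat (K \<omega>) *v (cmat (symbol A \<omega>) *v z t)) \<bullet> z t"
            using M2(3)[OF \<omega> X] unfolding w_def y_def by linarith
          then show "- (\<rho> * ((cmat (K \<omega>) *v (cmat (symbol A \<omega>) *v z t)) \<bullet> z t)) \<le> - (\<rho> * (c2 * w\<^sup>2 - M * y\<^sup>2))"
            using \<rho> by (simp add: mult_left_mono)
          have "z t \<bullet> mulI (cmat (K \<omega>) *v (cmat L *v z t)) \<le> w * norm (cmat (K \<omega>) *v (cmat L *v z t))"
            using norm_cauchy_schwarz[of "z t" "mulI (cmat (K \<omega>) *v (cmat L *v z t))"] by (simp add: w_def)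
          also have "\<dots> \<le> w * (M * y)"
          proof (rule mult_left_mono[OF _ nn(1)])
            have "M5 * y \<le> M * y" using M nn by (intro mult_right_mono) auto
            then show "norm (cmat (K \<omega>) *v (cmat L *v z t)) \<le> M * y"
              using M5(2)[OF \<omega>, of "cmat L *v z t"] unfolding y_def by linarith
          qed
          finally show "z t \<bullet> mulI (cmat (K \<omega>) *v (cmat L *v z t)) \<le> M * w * y" by (simp add: algebra_simps)
        qed
        finally have "z t \<bullet> H (z' t) \<le> - \<rho> * (c2 * w\<^sup>2 - M * y\<^sup>2) + M * w * y" by simp
        then show ?thesis using rD(1) by (rule mult_left_mono)
      qed simp
      have "a1 * (\<rho> / D) * (z t \<bullet> H (z' t)) \<le> a1 * (\<rho> / D) * (- \<rho> * (c2 * w\<^sup>2 - M * y\<^sup>2) + M * w * y)"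
        using mult_left_mono[OF t3, of a1] a1(1) by (simp only: mult.assoc less_imp_le)
      with t2 have "z t \<bullet> (cmat (S ** A0) *v z' t) + a1 * (\<rho> / D) * (z t \<bullet> H (z' t))
         \<le> x\<^sup>2 - c3 * y\<^sup>2 + \<rho> * M * w * x + a1 * (\<rho> / D) * (- \<rho> * (c2 * w\<^sup>2 - M * y\<^sup>2) + M * w * y)" by linarith
      then have "E' t \<le> - x\<^sup>2 + a2 / D * (x\<^sup>2 - c3 * y\<^sup>2 + \<rho> * M * w * x + a1 * (\<rho> / D) * (- \<rho> * (c2 * w\<^sup>2 - M * y\<^sup>2) + M * w * y))"
        unfolding E'_def t1 using a2(1) D(2) by (intro add_left_mono mult_left_mono) auto
      also have "\<dots> \<le> - (a1 * a2 * c2 / 2) * (\<rho>\<^sup>2 / D\<^sup>2) * w\<^sup>2"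
        by (rule dissipation_inequality) (use nn \<rho> M M2(1) c3(1) a1 a2 D_def in auto)
      finally show ?thesis by (simp add: w_def)
    qed
    have E_bd: "\<bar>E t - 1/2 * ((cmat A0 *v z t) \<bullet> z t)\<bar> \<le> c0 / 4 * (norm (z t))\<^sup>2" for t
    proof -
      have b2: "\<bar>(cmat (S ** A0) *v z t) \<bullet> z t\<bar> \<le> M4 * (norm (z t))\<^sup>2"
      proof -
        have "\<bar>(cmat (S ** A0) *v z t) \<bullet> z t\<bar> \<le> norm (cmat (S ** A0) *v z t) * norm (z t)" by (rule Cauchy_Schwarz_ineq2)
        also have "\<dots> \<le> M4 * norm (z t) * norm (z t)" using M4(2) by (rule mult_right_mono) simp
        finally show ?thesis by (simp add: power2_eq_square mult.assoc)
      qed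
      have b3: "\<bar>H (z t) \<bullet> z t\<bar> \<le> (M5 * M3) * (norm (z t))\<^sup>2"
      proof -
        have "norm (H (z t)) = norm (cmat (K \<omega>) *v (cmat A0 *v z t))" by (simp add: H_def cmat_mult matrix_vector_mul_assoc)
        also have "\<dots> \<le> M5 * norm (cmat A0 *v z t)" by (rule M5(2)[OF \<omega>])
        also have "\<dots> \<le> M5 * (M3 * norm (z t))" by (rule mult_left_mono[OF M3(2) M5(1)])
        finally have "norm (H (z t)) * norm (z t) \<le> M5 * (M3 * norm (z t)) * norm (z t)" by (rule mult_right_mono) simp
        then show ?thesis using Cauchy_Schwarz_ineq2[of "H (z t)" "z t"] by (simp add: power2_eq_square mult.assoc)
      qed
      define p where "p = \<bar>(cmat (S ** A0) *v z t) \<bullet> z t\<bar>"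
      define q where "q = \<bar>H (z t) \<bullet> z t\<bar>"
      have pq: "p \<ge> 0" "q \<ge> 0" by (auto simp: p_def q_def)
      have "\<bar>E t - 1/2 * ((cmat A0 *v z t) \<bullet> z t)\<bar> = a2 / D * \<bar>1/2 * ((cmat (S ** A0) *v z t) \<bullet> z t)
          + a1 * (\<rho> / D) * (1/2 * (H (z t) \<bullet> z t))\<bar>"
        unfolding E_def using a2(1) D(2) by (simp add: abs_mult)
      also have "\<dots> \<le> a2 / D * (p + a1 * q)"
      proof (rule mult_left_mono)
        have "\<bar>a1 * (\<rho> / D) * (1/2 * (H (z t) \<bullet> z t))\<bar> = a1 * (\<rho> / D * (1/2 * q))"
          unfolding q_def using a1(1) \<rho> D(2) by (simp add: abs_mult)
        also have "\<dots> \<le> a1 * (1 * q)" using a1(1) rD pq by (intro mult_left_mono mult_mono) auto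
        finally have "\<bar>a1 * (\<rho> / D) * (1/2 * (H (z t) \<bullet> z t))\<bar> \<le> a1 * q" by simp
        moreover have "\<bar>1/2 * ((cmat (S ** A0) *v z t) \<bullet> z t)\<bar> \<le> p" by (simp add: p_def)
        ultimately show "\<bar>1/2 * ((cmat (S ** A0) *v z t) \<bullet> z t) + a1 * (\<rho> / D) * (1/2 * (H (z t) \<bullet> z t))\<bar> \<le> p + a1 * q"
          by linarith
      qed (use a2(1) D(2) in simp)
      also have "\<dots> \<le> a2 * (p + a1 * q)"
        using a2(1) D(1) pq a1(1) by (intro mult_right_mono) (auto simp: field_simps)
      also have "\<dots> \<le> a2 * (M4 * (norm (z t))\<^sup>2 + a1 * ((M5 * M3) * (norm (z t))\<^sup>2))"
        using b2 b3 a1(1) a2(1) unfolding p_def q_def by (intro mult_left_mono add_mono) auto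
      also have "\<dots> = a2 * N * (norm (z t))\<^sup>2" by (simp add: N_def algebra_simps)
      also have "\<dots> \<le> c0 / 4 * (norm (z t))\<^sup>2" using a2(3) by (rule mult_right_mono) simp
      finally show ?thesis .
    qed
    have lo: "c0 / 4 * (norm (z t))\<^sup>2 \<le> E t" for t using E_bd[of t] c0(2)[of "z t"] by linarith
    have hi: "E t \<le> M' * (norm (z t))\<^sup>2" for t
    proof -
      have "(cmat A0 *v z t) \<bullet> z t \<le> norm (cmat A0 *v z t) * norm (z t)" by (rule norm_cauchy_schwarz)
      also have "\<dots> \<le> M3 * norm (z t) * norm (z t)" using M3(2) by (rule mult_right_mono) simp
      finally have "(cmat A0 *v z t) \<bullet> z t \<le> M3 * (norm (z t))\<^sup>2" by (simp add: power2_eq_square mult.assoc)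
      moreover have "M3 * (norm (z t))\<^sup>2 \<ge> 0" "c0 * (norm (z t))\<^sup>2 \<ge> 0" using M3(1) c0(1) by auto
      ultimately show ?thesis using E_bd[of t] unfolding M'_def distrib_right by linarith
    qed
    have "E t \<le> exp (- (\<kappa> * (\<rho>\<^sup>2 / D\<^sup>2)) * t) * E 0"
    proof (rule exp_decay_of_derivative[OF dE _ t0])
      fix t :: real assume t: "t \<ge> 0"
      have "\<kappa> * (\<rho>\<^sup>2 / D\<^sup>2) * E t \<le> \<kappa> * (\<rho>\<^sup>2 / D\<^sup>2) * (M' * (norm (z t))\<^sup>2)"
        using \<kappa> by (intro mult_left_mono hi) auto
      also have "\<dots> = (a1 * a2 * c2 / 2) * (\<rho>\<^sup>2 / D\<^sup>2) * (norm (z t))\<^sup>2" using M' by (simp add: \<kappa>_def)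
      finally show "E' t \<le> - (\<kappa> * (\<rho>\<^sup>2 / D\<^sup>2)) * E t" using E'_le[OF t] unfolding mult_minus_left by linarith
    qed
    also have "\<dots> \<le> exp (- (\<kappa> * (\<rho>\<^sup>2 / D\<^sup>2)) * t) * (M' * (norm (z 0))\<^sup>2)" by (intro mult_left_mono hi) simp
    finally have "c0 / 4 * (norm (z t))\<^sup>2 \<le> exp (- (\<kappa> * (\<rho>\<^sup>2 / D\<^sup>2)) * t) * (M' * (norm (z 0))\<^sup>2)"
      using lo[of t] by linarith
    then show ?thesis using c0(1) unfolding D_def[symmetric] by (simp add: field_simps)
  qed
  show ?thesis
  \<comment> \<open>Passing from the squared norm to the norm takes the root of the constant and
    halves the rate.\<close>
  proof (rule that[of "sqrt (4 * M' / c0)" "\<kappa> / 2"])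
    show "sqrt (4 * M' / c0) > 0" using M' c0(1) by simp
    show "\<kappa> / 2 > 0" using \<kappa> by simp
    fix \<xi> :: "real^'n" and z z' and t :: real
    assume dz: "\<And>t. t \<ge> 0 \<Longrightarrow> (z has_vector_derivative z' t) (at t within {0..})"
      and ode: "\<And>t. t \<ge> 0 \<Longrightarrow> cmat A0 *v z' t + norm \<xi> *\<^sub>R mulI (cmat (symbol A (sgn \<xi>)) *v z t) + cmat L *v z t = 0"
      and con: "\<And>t. t \<ge> 0 \<Longrightarrow> norm \<xi> *\<^sub>R mulI (cmat (symbol Q (sgn \<xi>)) *v z t) + cmat R *v z t = 0"
      and t: "t \<ge> 0"
    \<comment> \<open>Any unit vector serves at \<xi> = 0, since there the factor
      \<open>norm \<xi>\<close> erases the direction.\<close>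
    define \<omega> :: "real^'n" where "\<omega> = (if \<xi> = 0 then axis undefined 1 else sgn \<xi>)"
    have \<omega>: "\<omega> \<in> sphere 0 1" by (simp add: \<omega>_def norm_sgn)
    have ode': "cmat A0 *v z' t + norm \<xi> *\<^sub>R mulI (cmat (symbol A \<omega>) *v z t) + cmat L *v z t = 0" if "t \<ge> 0" for t
      using ode[OF that] by (cases "\<xi> = 0") (simp_all add: \<omega>_def)
    have con': "norm \<xi> *\<^sub>R mulI (cmat (symbol Q \<omega>) *v z t) + cmat R *v z t = 0" if "t \<ge> 0" for t
      using con[OF that] by (cases "\<xi> = 0") (simp_all add: \<omega>_def)
    have "(norm (z t))\<^sup>2 \<le> (4 * M' / c0) * exp (- \<kappa> * eta \<xi> * t) * (norm (z 0))\<^sup>2"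
      using core[OF \<omega> norm_ge_zero dz ode' con' t] by (simp add: eta_def)
    then have "sqrt ((norm (z t))\<^sup>2) \<le> sqrt ((4 * M' / c0) * exp (- \<kappa> * eta \<xi> * t) * (norm (z 0))\<^sup>2)"
      by (rule real_sqrt_le_mono)
    moreover have "sqrt (exp (- \<kappa> * eta \<xi> * t)) = exp (- (\<kappa> / 2) * eta \<xi> * t)"
      by (rule real_sqrt_unique) (simp_all add: power2_eq_square mult_exp_exp)
    ultimately show "norm (z t) \<le> sqrt (4 * M' / c0) * exp (- (\<kappa> / 2) * eta \<xi> * t) * norm (z 0)"
      unfolding real_sqrt_mult[of "4 * M' / c0 * exp (- \<kappa> * eta \<xi> * t)"]
        real_sqrt_mult[of "4 * M' / c0"] real_sqrt_abs abs_norm_cancel by simp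
  qed
qed

section \<open>The flow in Fourier variables\<close>

text \<open>The exponential series of t G applied to z, kept at the level of vectors: measurability
  in a parameter of \<open>G\<close> can then be read off the partial sums.\<close>

definition flow :: "('a::euclidean_space \<Rightarrow> 'a) \<Rightarrow> real \<Rightarrow> 'a \<Rightarrow> 'a" where
  "flow G t z = (\<Sum>k. (t ^ k / fact k) *\<^sub>R (G ^^ k) z)"

lemma flow_summable:
  fixes G :: "'a::euclidean_space \<Rightarrow> 'a"
  assumes G: "bounded_linear G"
  shows "summable (\<lambda>k. (t ^ k / fact k) *\<^sub>R (G ^^ k) z)"
proof -
  obtain B where B: "B > 0" "\<And>x. norm (G x) \<le> norm x * B"
    using bounded_linear.pos_bounded[OF G] by blast
  have it: "norm ((G ^^ k) z) \<le> B ^ k * norm z" for k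
  proof (induction k)
    case (Suc k)
    have "norm ((G ^^ Suc k) z) \<le> norm ((G ^^ k) z) * B" using B(2)[of "(G ^^ k) z"] by simp
    also have "\<dots> \<le> (B ^ k * norm z) * B" using Suc B(1) by (intro mult_right_mono) auto
    finally show ?case by (simp add: mult_ac)
  qed simp
  have "summable (\<lambda>k. norm z * ((\<bar>t\<bar> * B) ^ k / fact k))"
    using summable_exp_generic[of "\<bar>t\<bar> * B"] by (intro summable_mult) (simp add: divide_inverse mult.commute)
  then show ?thesis
  proof (rule summable_comparison_test[rotated], intro exI[of _ 0] allI impI)
    fix k
    have "norm ((t ^ k / fact k) *\<^sub>R (G ^^ k) z) = \<bar>t\<bar> ^ k / fact k * norm ((G ^^ k) z)" by (simp add: power_abs)
    also have "\<dots> \<le> \<bar>t\<bar> ^ k / fact k * (B ^ k * norm z)" by (rule mult_left_mono[OF it]) simp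
    finally show "norm ((t ^ k / fact k) *\<^sub>R (G ^^ k) z) \<le> norm z * ((\<bar>t\<bar> * B) ^ k / fact k)"
      by (simp add: power_mult_distrib mult_ac)
  qed
qed

lemma flow_0 [simp]: "flow G 0 z = z"
proof -
  have "flow G 0 z = (\<Sum>k\<in>{0}. (0 ^ k / fact k) *\<^sub>R (G ^^ k) z)"
    unfolding flow_def by (rule suminf_finite) auto
  then show ?thesis by simp
qed

lemma flow_inner:
  assumes G: "bounded_linear G"
  shows "flow G t z \<bullet> b = (\<Sum>k. ((G ^^ k) z \<bullet> b) / fact k * t ^ k)"
proof -
  have "flow G t z \<bullet> b = (\<Sum>k. ((t ^ k / fact k) *\<^sub>R (G ^^ k) z) \<bullet> b)"
    unfolding flow_def by (rule bounded_linear.suminf[OF bounded_linear_inner_left flow_summable[OF G]])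
  then show ?thesis by (simp add: mult.commute)
qed

text \<open>Every coordinate is an everywhere convergent power series in t; termwise differentiation
  shifts the coefficients, which replaces z by G z, and G commutes with the series by
  continuity.\<close>

lemma flow_has_vector_derivative:
  assumes G: "bounded_linear G"
  shows "((\<lambda>t. flow G t z) has_vector_derivative G (flow G t z)) (at t within T)"
proof -
  have comm: "flow G t (G z) = G (flow G t z)"
  proof -
    have "G (flow G t z) = (\<Sum>k. G ((t ^ k / fact k) *\<^sub>R (G ^^ k) z))"
      unfolding flow_def by (rule bounded_linear.suminf[OF G flow_summable[OF G]])
    also have "\<dots> = flow G t (G z)"
      unfolding flow_def by (simp add: linear_simps(5)[OF G] funpow_swap1)
    finally show ?thesis ..
  qed
  have "((\<lambda>t. flow G t z \<bullet> b) has_real_derivative flow G t (G z) \<bullet> b) (at t)" for b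
  proof -
    define c where "c k = ((G ^^ k) z \<bullet> b) / fact k" for k
    have "summable (\<lambda>k. c k * y ^ k)" for y
      using bounded_linear.summable[OF bounded_linear_inner_left[of b] flow_summable[OF G, of y z]]
      by (simp add: c_def mult.commute)
    then have "((\<lambda>t. \<Sum>k. c k * t ^ k) has_real_derivative (\<Sum>k. diffs c k * t ^ k)) (at t)"
      by (rule termdiffs_strong_converges_everywhere)
    moreover have "diffs c k = ((G ^^ k) (G z) \<bullet> b) / fact k" for k
      by (simp add: diffs_def c_def funpow_swap1 field_simps del: of_nat_Suc)
    ultimately show ?thesis by (simp add: flow_inner[OF G] c_def)
  qed
  then have "((\<lambda>t. flow G t z \<bullet> b) has_derivative (\<lambda>h. h *\<^sub>R (flow G t (G z) \<bullet> b))) (at t within T)" for b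
    unfolding has_real_derivative_iff_has_vector_derivative has_vector_derivative_def
    by (rule has_derivative_at_withinI)
  then have "((\<lambda>t. flow G t z) has_vector_derivative flow G t (G z)) (at t within T)"
    unfolding has_vector_derivative_def
    by (subst has_derivative_componentwise_within) simp
  then show ?thesis by (simp add: comm)
qed

text \<open>Joint continuity of the generator makes all iterates measurable in the parameter. This
  is how the solution becomes a measurable function of \<xi>.\<close>

lemma flow_measurable:
  assumes G: "\<And>x. bounded_linear (G x)" and cont: "continuous_on UNIV (\<lambda>x. G (fst x) (snd x))"
    and f: "f \<in> borel_measurable borel"
  shows "(\<lambda>x :: 'b::euclidean_space. flow (G x) t (f x :: 'a::euclidean_space)) \<in> borel_measurable borel"
proof -
  have it: "(\<lambda>x. (G x ^^ k) (f x)) \<in> borel_measurable borel" for k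
  proof (induction k)
    case (Suc k)
    have "(\<lambda>x. G x ((G x ^^ k) (f x))) \<in> borel_measurable borel"
      by (rule borel_measurable_continuous_Pair[OF measurable_ident_sets[OF refl] Suc cont])
    then show ?case by simp
  qed (use f in simp)
  show ?thesis
  proof (rule borel_measurable_LIMSEQ_metric)
    show "(\<lambda>n. \<Sum>k<n. (t ^ k / fact k) *\<^sub>R (G x ^^ k) (f x)) \<longlonglongrightarrow> flow (G x) t (f x)" for x
      unfolding flow_def by (rule summable_LIMSEQ[OF flow_summable[OF G]])
    show "(\<lambda>x. \<Sum>k<n. (t ^ k / fact k) *\<^sub>R (G x ^^ k) (f x)) \<in> borel_measurable borel" for n
      by (intro borel_measurable_sum borel_measurable_scaleR borel_measurable_const it)
  qed
qed

section \<open>The generator of the transformed system and the propagation of the constraint\<close>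

lemma matrix_inv_of_pos_on:
  assumes "pos_on (cmat A0) UNIV"
  shows "A0 ** matrix_inv A0 = mat 1" "matrix_inv A0 ** A0 = mat 1"
proof -
  have "x = 0" if "A0 *v x = 0" for x
  proof (rule ccontr)
    assume "x \<noteq> 0"
    define z where "z = (\<chi> i. complex_of_real (x $ i))"
    have "cmat A0 *v z = 0"
      using that by (simp add: z_def vec_eq_iff matrix_vector_mult_def flip: of_real_mult of_real_sum)
    moreover have "z \<noteq> 0" using \<open>x \<noteq> 0\<close> by (simp add: z_def vec_eq_iff)
    ultimately show False using assms by (auto simp: pos_on_def Re_cinner)
  qed
  then have "\<exists>B. B ** A0 = mat 1" by (subst matrix_left_invertible_ker) blast
  then have "invertible A0" by (simp only: invertible_left_inverse)
  then have "A0 ** matrix_inv A0 = mat 1 \<and> matrix_inv A0 ** A0 = mat 1"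
    unfolding invertible_def matrix_inv_def by (rule someI_ex)
  then show "A0 ** matrix_inv A0 = mat 1" "matrix_inv A0 ** A0 = mat 1" by blast+
qed

text \<open>The transformed equation solved for the time derivative. The symbol is taken at \<xi>
  itself, not at the direction: being linear it absorbs the factor |\<xi>|, and the generator stays
  continuous at \<xi> = 0.\<close>

definition generator :: "real^'m^'m \<Rightarrow> ('n::finite \<Rightarrow> real^'m^'m) \<Rightarrow> real^'m^'m \<Rightarrow> real^'n \<Rightarrow> complex^'m \<Rightarrow> complex^'m" where
  "generator A0 A L \<xi> z = - (cmat (matrix_inv A0) *v (mulI (cmat (symbol A \<xi>) *v z) + cmat L *v z))"

lemma bounded_linear_generator: "bounded_linear (generator A0 A L \<xi>)"
  unfolding generator_def
  by (intro bounded_linear_minus bounded_linear_compose[OF matrix_vector_mul_bounded_linear]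
      bounded_linear_add bounded_linear_compose[OF bounded_linear_mulI] matrix_vector_mul_bounded_linear)

lemma continuous_on_mulI: "continuous_on W f \<Longrightarrow> continuous_on W (\<lambda>x. mulI (f x))"
  by (rule bounded_linear.continuous_on[OF bounded_linear_mulI])

lemma continuous_generator: "continuous_on UNIV (\<lambda>x. generator A0 A L (fst x) (snd x))"
  unfolding generator_def
  by (intro continuous_intros continuous_on_cmat_mult continuous_on_mulI
      continuous_on_compose2[OF continuous_on_symbol[of UNIV]]) auto

lemma symbol_norm_sgn: "norm \<xi> *\<^sub>R symbol M (sgn \<xi>) = symbol M \<xi>"
proof (cases "\<xi> = 0")
  case False
  then have "norm \<xi> * (sgn \<xi> $ j) = \<xi> $ j" for j by (simp add: sgn_div_norm)
  then show ?thesis by (simp add: symbol_def scaleR_sum_right)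
qed (simp add: symbol_def)

lemma scaleR_mulI_symbol: "norm \<xi> *\<^sub>R mulI (cmat (symbol M (sgn \<xi>)) *v z) = mulI (cmat (symbol M \<xi>) *v z)"
  by (simp flip: symbol_norm_sgn[of \<xi>] add: cmat_scaleR scaleR_matrix_mult_vec mulI_scaleR)

lemma A0_generator:
  assumes "pos_on (cmat A0) UNIV"
  shows "cmat A0 *v generator A0 A L \<xi> z = - (mulI (cmat (symbol A \<xi>) *v z) + cmat L *v z)"
proof -
  have "cmat A0 *v (cmat (matrix_inv A0) *v w) = w" for w
    by (simp add: matrix_vector_mul_assoc cmat_mult[symmetric] matrix_inv_of_pos_on[OF assms])
  then show ?thesis by (simp add: generator_def matrix_mult_uminus_vec)
qed

text \<open>The three identities of condition (C) say that the coefficients of \<rho>^2, \<rho> and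
  1 in the product of \<i>\<rho>Q(\<omega>) + R, the inverse of \<open>A0\<close>, and
  \<i>\<rho>A(\<omega>) + L all vanish.\<close>

lemma constraint_generator:
  fixes A :: "'n::finite \<Rightarrow> real^'m^'m" and Q :: "'n \<Rightarrow> real^'m^'p"
  assumes "cond_C A0 A L Q R"
  shows "mulI (cmat (symbol Q \<xi>) *v generator A0 A L \<xi> z) + cmat R *v generator A0 A L \<xi> z = 0"
proof -
  define B where "B = matrix_inv A0"
  \<comment> \<open>Condition (C) is stated for unit vectors, so some direction has to be supplied
    at \<xi> = 0 as well.\<close>
  define \<omega> :: "real^'n" where "\<omega> = (if \<xi> = 0 then axis undefined 1 else sgn \<xi>)"
  have \<omega>: "\<omega> \<in> sphere 0 1" by (simp add: \<omega>_def norm_sgn)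
  have sym: "symbol M \<xi> = norm \<xi> *\<^sub>R symbol M \<omega>" for M :: "'n \<Rightarrow> real^'e^'d"
    by (cases "\<xi> = 0") (simp_all add: \<omega>_def symbol_norm_sgn, simp add: symbol_def)
  have C: "symbol Q \<omega> ** B ** symbol A \<omega> = 0" "R ** B ** L = 0" "symbol Q \<omega> ** B ** L + R ** B ** symbol A \<omega> = 0"
    using assms \<omega> by (auto simp: cond_C_def B_def)
  have z: "cmat M *v z = 0" if "M = 0" for M :: "real^'m^'p" using that by simp
  have s: "cmat (symbol Q \<omega>) *v (cmat B *v (cmat L *v z)) + cmat R *v (cmat B *v (cmat (symbol A \<omega>) *v z)) = 0"
    using z[OF C(3)] by (simp add: cmat_add cmat_mult matrix_vector_mult_add_rdistrib matrix_vector_mul_assoc matrix_mul_assoc)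
  have q: "cmat (symbol Q \<omega>) *v (cmat B *v (cmat (symbol A \<omega>) *v z)) = 0"
    using z[OF C(1)] by (simp add: cmat_mult matrix_vector_mul_assoc matrix_mul_assoc)
  have r: "cmat R *v (cmat B *v (cmat L *v z)) = 0"
    using z[OF C(2)] by (simp add: cmat_mult matrix_vector_mul_assoc matrix_mul_assoc)
  have "mulI (cmat (symbol Q \<xi>) *v generator A0 A L \<xi> z) + cmat R *v generator A0 A L \<xi> z
    = - (mulI (norm \<xi> *\<^sub>R (cmat (symbol Q \<omega>) *v (cmat B *v (cmat L *v z)) + cmat R *v (cmat B *v (cmat (symbol A \<omega>) *v z)))))
      + (norm \<xi> * norm \<xi>) *\<^sub>R (cmat (symbol Q \<omega>) *v (cmat B *v (cmat (symbol A \<omega>) *v z))) - cmat R *v (cmat B *v (cmat L *v z))"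
    unfolding generator_def B_def[symmetric] sym
    by (simp add: cmat_scaleR scaleR_matrix_mult_vec matrix_mult_scaleR_vec matrix_mult_uminus_vec mulI_scaleR mulI_cmat
        mulI_add mulI_uminus mulI_diff matrix_vector_right_distrib scaleR_add_right algebra_simps)
  then show ?thesis by (simp add: s q r)
qed

text \<open>The constraint functional annihilates the whole range of the generator, so its value is
  constant along the flow, and this constant is 0 at the start.\<close>

lemma flow_constraint:
  assumes "cond_C A0 A L Q R" and 0: "mulI (cmat (symbol Q \<xi>) *v z) + cmat R *v z = 0"
  shows "mulI (cmat (symbol Q \<xi>) *v flow (generator A0 A L \<xi>) t z) + cmat R *v flow (generator A0 A L \<xi>) t z = 0"
proof -
  define f where "f w = mulI (cmat (symbol Q \<xi>) *v w) + cmat R *v w" for w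
  have f: "bounded_linear f" unfolding f_def
    by (intro bounded_linear_add bounded_linear_compose[OF bounded_linear_mulI] matrix_vector_mul_bounded_linear)
  have "((\<lambda>t. f (flow (generator A0 A L \<xi>) t z)) has_vector_derivative f (generator A0 A L \<xi> (flow (generator A0 A L \<xi>) t z))) (at t within UNIV)" for t
    by (rule bounded_linear.has_vector_derivative[OF f flow_has_vector_derivative[OF bounded_linear_generator]])
  then have "((\<lambda>t. f (flow (generator A0 A L \<xi>) t z)) has_vector_derivative 0) (at t within UNIV)" for t
    using constraint_generator[OF assms(1)] by (simp add: f_def)
  from has_vector_derivative_zero_constant[OF convex_UNIV this]
  obtain c where c: "\<And>t. f (flow (generator A0 A L \<xi>) t z) = c" by (metis UNIV_I)
  then have "f (flow (generator A0 A L \<xi>) t z) = f (flow (generator A0 A L \<xi>) 0 z)" by (simp only: c)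
  then show ?thesis using 0 by (simp add: f_def)
qed

text \<open>Energy estimate for an inhomogeneous equation, comparing a transformed cutoff of the
  solution with the flow. Differentiability is asked for only inside (0,T) because the weak
  formulation speaks of t > 0; the initial time enters through continuity.\<close>

lemma gronwall_residual:
  fixes A0 L :: "real^'m^'m"
  assumes A: "cond_A A0 A L" and c0: "c0 > 0" "\<And>z. c0 * (norm z)\<^sup>2 \<le> (cmat A0 *v z) \<bullet> z"
    and T: "T \<ge> 0" and dc: "continuous_on {0..T} d" and rc: "continuous_on {0..T} r"
    and dd: "\<And>t. 0 < t \<Longrightarrow> t < T \<Longrightarrow> (d has_vector_derivative d' t) (at t)"
    and ode: "\<And>t. 0 < t \<Longrightarrow> t < T \<Longrightarrow> cmat A0 *v d' t + mulI (cmat (symbol A \<xi>) *v d t) + cmat L *v d t = r t"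
  shows "c0 * (norm (d T))\<^sup>2 \<le> exp (T / c0) * ((cmat A0 *v d 0) \<bullet> d 0 + integral {0..T} (\<lambda>t. (norm (r t))\<^sup>2))"
proof -
  define e where "e t = (cmat A0 *v d t) \<bullet> d t" for t
  define I where "I t = integral {0..t} (\<lambda>t. (norm (r t))\<^sup>2)" for t
  have rc2: "continuous_on {0..T} (\<lambda>t. (norm (r t))\<^sup>2)" by (intro continuous_intros rc)
  have tA0: "transpose A0 = A0" and tA: "\<And>j. transpose (A j) = A j"
    and nnL: "nonneg_on (cmat L) UNIV" using A by (auto simp: cond_A_def)
  have symA: "transpose (symbol A \<xi>) = symbol A \<xi>"
    by (simp add: symbol_def transpose_sum transpose_scaleR tA)
  \<comment> \<open>By 2 d.r \<le> |d|^2 + |r|^2 and |d|^2 \<le> e/c0, the integrating factor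
    exp(-t/c0) makes this difference nonincreasing.\<close>
  have "e T * exp (- T / c0) - I T \<le> e 0 * exp (- 0 / c0) - I 0"
  proof (rule DERIV_nonpos_imp_decreasing_open[OF T])
    fix t assume t: "0 < t" "t < T"
    have de: "(e has_real_derivative 2 * (d t \<bullet> (cmat A0 *v d' t))) (at t)"
      unfolding e_def by (rule quadratic_form_has_derivative[OF _ _ dd[OF t]]) (simp_all add: cmat_adjoint tA0)
    have "(I has_vector_derivative (norm (r t))\<^sup>2) (at t within {0..T})"
      unfolding I_def using integral_has_vector_derivative[OF rc2, of t] t by simp
    then have dI: "(I has_real_derivative (norm (r t))\<^sup>2) (at t)"
      using t by (simp add: has_real_derivative_iff_has_vector_derivative at_within_Icc_at)
    define g where "g = 2 * (d t \<bullet> (cmat A0 *v d' t)) * exp (- t / c0) - e t * exp (- t / c0) / c0 - (norm (r t))\<^sup>2"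
    have 1: "((\<lambda>t. e t * exp (- t / c0) - I t) has_real_derivative g) (at t)"
      unfolding g_def using c0(1) by (auto intro!: derivative_eq_intros de dI)
    have "cmat A0 *v d' t = r t - mulI (cmat (symbol A \<xi>) *v d t) - cmat L *v d t"
    proof -
      have "a = (a + b + c) - b - c" for a b c :: "complex^'m" by simp
      from this[of "cmat A0 *v d' t" "mulI (cmat (symbol A \<xi>) *v d t)" "cmat L *v d t"] show ?thesis
        unfolding ode[OF t] .
    qed
    then have "2 * (d t \<bullet> (cmat A0 *v d' t)) = 2 * (d t \<bullet> r t) - 2 * ((cmat L *v d t) \<bullet> d t)"
      using mulI_sym_inner[OF symA, of "d t"] by (simp add: inner_diff_right inner_commute)
    also have "\<dots> \<le> 2 * (d t \<bullet> r t)" using nnL by (simp add: nonneg_on_def Re_cinner)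
    also have "\<dots> \<le> 2 * (norm (d t) * norm (r t))" using norm_cauchy_schwarz[of "d t" "r t"] by simp
    also have "\<dots> \<le> (norm (d t))\<^sup>2 + (norm (r t))\<^sup>2" using sum_squares_bound[of "norm (d t)" "norm (r t)"] by simp
    also have "(norm (d t))\<^sup>2 \<le> e t / c0" using c0(2)[of "d t"] c0(1) by (simp add: e_def field_simps)
    finally have "2 * (d t \<bullet> (cmat A0 *v d' t)) - e t / c0 \<le> (norm (r t))\<^sup>2" by simp
    then have "(2 * (d t \<bullet> (cmat A0 *v d' t)) - e t / c0) * exp (- t / c0) \<le> (norm (r t))\<^sup>2 * exp (- t / c0)"
      by (rule mult_right_mono) simp
    also have "\<dots> \<le> (norm (r t))\<^sup>2 * 1" using t c0(1) by (intro mult_left_mono) auto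
    finally have "g \<le> 0" by (simp add: g_def algebra_simps)
    with 1 show "\<exists>y. ((\<lambda>t. e t * exp (- t / c0) - I t) has_real_derivative y) (at t) \<and> y \<le> 0" by blast
  next
    have "continuous_on {0..T} I" unfolding I_def
      by (rule indefinite_integral_continuous_1) (rule integrable_continuous_real[OF rc2])
    then show "continuous_on {0..T} (\<lambda>t. e t * exp (- t / c0) - I t)"
      unfolding e_def by (intro continuous_intros continuous_on_cmat_mult dc) (use c0(1) in auto)
  qed
  then have "e T * exp (- T / c0) \<le> e 0 + I T" by (simp add: I_def)
  then have "exp (T / c0) * (e T * exp (- T / c0)) \<le> exp (T / c0) * (e 0 + I T)" by (rule mult_left_mono) simp
  moreover have "exp (T / c0) * (e T * exp (- T / c0)) = e T" by (simp add: exp_minus)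
  ultimately show ?thesis using c0(2)[of "d T"] unfolding e_def I_def by linarith
qed

section \<open>Smooth functions and test functions\<close>

abbreviation smooth :: "('a::euclidean_space \<Rightarrow> real) \<Rightarrow> bool" where
  "smooth f \<equiv> smooth_on_open UNIV f"

lemma Ck_on_has_derivativeI:
  assumes "\<And>x. (f has_derivative f' x) (at x)" "\<And>v. Ck_on k UNIV (\<lambda>x. f' x v)"
  shows "Ck_on (Suc k) UNIV f"
proof -
  have "frechet_derivative f (at x) = f' x" for x by (rule frechet_derivative_at[OF assms(1), symmetric])
  then show ?thesis using assms by (auto simp: differentiable_def)
qed

lemma Ck_on_has_derivative:
  "Ck_on (Suc k) UNIV f \<Longrightarrow> (f has_derivative frechet_derivative f (at x)) (at x)"
  by (simp add: frechet_derivative_works)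

lemma Ck_on_Suc: "Ck_on (Suc k) UNIV f \<Longrightarrow> Ck_on k UNIV f"
proof (induction k arbitrary: f)
  case 0
  then have "f differentiable (at x)" for x by simp
  then show ?case by (simp add: continuous_at_imp_continuous_on differentiable_imp_continuous_within)
next
  case (Suc k)
  have "Ck_on (Suc k) UNIV (\<lambda>x. frechet_derivative f (at x) v)" for v
    using Suc.prems by (subst (asm) Ck_on.simps(2)) blast
  from Suc.IH[OF this] show ?case using Suc.prems by simp
qed

lemma Ck_on_const: "Ck_on k UNIV (\<lambda>x. c)"
proof (induction k arbitrary: c)
  case (Suc k)
  show ?case by (rule Ck_on_has_derivativeI[OF has_derivative_const Suc])
qed simp

lemma Ck_on_add:
  fixes f g :: "'a::euclidean_space \<Rightarrow> real"
  shows "Ck_on k UNIV f \<Longrightarrow> Ck_on k UNIV g \<Longrightarrow> Ck_on k UNIV (\<lambda>x. f x + g x)"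
proof (induction k arbitrary: f g)
  case 0
  then show ?case by (simp add: continuous_on_add)
next
  case (Suc k)
  show ?case
  proof (rule Ck_on_has_derivativeI)
    show "((\<lambda>x. f x + g x) has_derivative (\<lambda>v. frechet_derivative f (at x) v + frechet_derivative g (at x) v)) (at x)" for x
      by (intro has_derivative_add Ck_on_has_derivative[OF Suc.prems(1)] Ck_on_has_derivative[OF Suc.prems(2)])
  qed (use Suc in auto)
qed

lemma Ck_on_mult:
  fixes f g :: "'a::euclidean_space \<Rightarrow> real"
  shows "Ck_on k UNIV f \<Longrightarrow> Ck_on k UNIV g \<Longrightarrow> Ck_on k UNIV (\<lambda>x. f x * g x)"
proof (induction k arbitrary: f g)
  case 0
  then show ?case by (simp add: continuous_on_mult)
next
  case (Suc k)
  show ?case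
  proof (rule Ck_on_has_derivativeI)
    show "((\<lambda>x. f x * g x) has_derivative (\<lambda>v. f x * frechet_derivative g (at x) v + frechet_derivative f (at x) v * g x)) (at x)" for x
      by (intro has_derivative_mult Ck_on_has_derivative[OF Suc.prems(1)] Ck_on_has_derivative[OF Suc.prems(2)])
    show "Ck_on k UNIV (\<lambda>x. f x * frechet_derivative g (at x) v + frechet_derivative f (at x) v * g x)" for v
      using Suc.prems by (intro Ck_on_add Suc.IH Ck_on_Suc[OF Suc.prems(1)] Ck_on_Suc[OF Suc.prems(2)]) auto
  qed
qed

lemma Ck_on_inner: "Ck_on k UNIV (\<lambda>x :: 'a::euclidean_space. x \<bullet> a)"
proof (cases k)
  case (Suc l)
  have "((\<lambda>x. x \<bullet> a) has_derivative (\<lambda>v. v \<bullet> a)) (at x)" for x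
    by (rule bounded_linear.has_derivative[OF bounded_linear_inner_left has_derivative_ident])
  then show ?thesis unfolding Suc by (rule Ck_on_has_derivativeI) (rule Ck_on_const)
qed (simp add: continuous_intros)

lemma Ck_on_scaleR:
  fixes f :: "'a::euclidean_space \<Rightarrow> real"
  shows "Ck_on k UNIV f \<Longrightarrow> Ck_on k UNIV (\<lambda>x. f (e *\<^sub>R x))"
proof (induction k arbitrary: f)
  case 0
  have "continuous_on UNIV (\<lambda>x. f (e *\<^sub>R x))"
    by (rule continuous_on_compose2[of UNIV f]) (use 0 in \<open>auto intro!: continuous_intros\<close>)
  then show ?case by simp
next
  case (Suc k)
  show ?case
  proof (rule Ck_on_has_derivativeI)
    fix x
    have "((\<lambda>x. f (e *\<^sub>R x)) has_derivative (\<lambda>v. frechet_derivative f (at (e *\<^sub>R x)) (e *\<^sub>R v))) (at x)"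
      by (rule has_derivative_compose[OF _ Ck_on_has_derivative[OF Suc.prems]])
         (rule has_derivative_scaleR_right[OF has_derivative_ident])
    moreover have "frechet_derivative f (at (e *\<^sub>R x)) (e *\<^sub>R v) = e * frechet_derivative f (at (e *\<^sub>R x)) v" for v
      using linear_scale[OF has_derivative_linear[OF Ck_on_has_derivative[OF Suc.prems]]] by simp
    ultimately show "((\<lambda>x. f (e *\<^sub>R x)) has_derivative (\<lambda>v. e * frechet_derivative f (at (e *\<^sub>R x)) v)) (at x)" by simp
  next
    fix v
    have "Ck_on k UNIV (\<lambda>x. frechet_derivative f (at x) v)" using Suc.prems by simp
    from Suc.IH[OF this] show "Ck_on k UNIV (\<lambda>x. e * frechet_derivative f (at (e *\<^sub>R x)) v)"
      by (intro Ck_on_mult Ck_on_const)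
  qed
qed

text \<open>Differentiation only advances the phase by pi/2. Carrying an arbitrary phase closes the
  induction and treats sine and cosine at once, here and in all later computations.\<close>

lemma Ck_on_cos: "Ck_on k UNIV (\<lambda>x :: 'a::euclidean_space. cos (x \<bullet> \<xi> + \<theta>))"
proof (induction k arbitrary: \<theta>)
  case 0
  show ?case by (simp add: continuous_intros)
next
  case (Suc k)
  show ?case
  proof (rule Ck_on_has_derivativeI)
    show "((\<lambda>x. cos (x \<bullet> \<xi> + \<theta>)) has_derivative (\<lambda>v. (v \<bullet> \<xi>) * cos (x \<bullet> \<xi> + (\<theta> + pi/2)))) (at x)" for x
      by (auto intro!: derivative_eq_intros simp: cos_add sin_add algebra_simps)
    show "Ck_on k UNIV (\<lambda>x. (v \<bullet> \<xi>) * cos (x \<bullet> \<xi> + (\<theta> + pi/2)))" for v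
      by (intro Ck_on_mult Ck_on_const Suc)
  qed
qed

text \<open>The derivatives of \<open>exp (-1/t)\<close> are linear combinations of the functions \<open>exp (-1/t) / t^j\<close>,
  which are dominated by \<open>t\<^sup>2\<close> at the origin; hence all of them are smooth.\<close>

definition flat_exp :: "nat \<Rightarrow> real \<Rightarrow> real" where
  "flat_exp j t = (if t > 0 then exp (- 1 / t) / t ^ j else 0)"

lemma flat_exp_le: "\<bar>flat_exp j t\<bar> \<le> fact (j + 2) * t\<^sup>2"
proof (cases "t > 0")
  case True
  define s where "s = 1 / t"
  have s: "s > 0" using True by (simp add: s_def)
  \<comment> \<open>The single term of order j + 2 of the exponential series at s = 1/t: j powers
    cancel the denominator and two are left over as t^2.\<close>
  have "(\<Sum>k\<in>{j+2}. s ^ k /\<^sub>R fact k) \<le> (\<Sum>k. s ^ k /\<^sub>R fact k)"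
    using s by (intro sum_le_suminf summable_exp_generic) auto
  then have "s ^ (j + 2) \<le> fact (j + 2) * exp s" by (simp add: exp_def field_simps del: fact_Suc add_2_eq_Suc' power_Suc)
  then have "s ^ j * exp (- s) \<le> fact (j + 2) / s ^ 2"
    using s by (simp add: exp_minus field_simps power_add del: fact_Suc add_2_eq_Suc')
  then show ?thesis using True by (simp add: flat_exp_def s_def power_divide field_simps del: fact_Suc add_2_eq_Suc')
qed (simp add: flat_exp_def)

lemma flat_exp_0_bounds: "0 \<le> flat_exp 0 t" "flat_exp 0 t \<le> 1"
  by (simp_all add: flat_exp_def)

lemma flat_exp_has_derivative:
  "(flat_exp j has_real_derivative (- real j * flat_exp (j + 1) t + flat_exp (j + 2) t)) (at t)"
proof -
  consider "t > 0" | "t < 0" | "t = 0" by linarith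
  then show ?thesis
  proof cases
    case 1
    have "((\<lambda>t. exp (- 1 / t) / t ^ j) has_real_derivative (- real j * flat_exp (j + 1) t + flat_exp (j + 2) t)) (at t)"
    proof (cases j)
      case 0
      then show ?thesis using 1 by (auto intro!: derivative_eq_intros simp: flat_exp_def field_simps power2_eq_square)
    next
      case (Suc i)
      have e: "((\<lambda>t. exp (- 1 / t)) has_real_derivative exp (- 1 / t) / t\<^sup>2) (at t)"
        using 1 by (auto intro!: derivative_eq_intros simp: power2_eq_square)
      have d: "((\<lambda>t. t ^ Suc i) has_real_derivative real (Suc i) * t ^ i) (at t)"
        using DERIV_pow[of "Suc i" t] by simp
      show ?thesis unfolding Suc
        by (rule DERIV_cong[OF DERIV_divide[OF e d]])
           (use 1 in \<open>simp_all add: flat_exp_def field_simps power2_eq_square del: of_nat_Suc\<close>)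
    qed
    then show ?thesis
    proof (rule has_field_derivative_transform_within[OF _ 1])
      fix s assume "dist s t < t"
      then have "s > 0" by (simp add: dist_real_def)
      then show "exp (- 1 / s) / s ^ j = flat_exp j s" by (simp add: flat_exp_def)
    qed simp
  next
    case 2
    have "((\<lambda>t. 0) has_real_derivative 0) (at t)" by simp
    then have "(flat_exp j has_real_derivative 0) (at t)"
    proof (rule has_field_derivative_transform_within[where d = "- t"])
      show "0 < - t" using 2 by simp
      fix s assume "dist s t < - t"
      then have "s < 0" by (simp add: dist_real_def)
      then show "0 = flat_exp j s" by (simp add: flat_exp_def)
    qed simp
    then show ?thesis using 2 by (simp add: flat_exp_def)
  next
    case 3
    have "((\<lambda>h. flat_exp j h / h) \<longlongrightarrow> 0) (at 0)"
    proof (rule Lim_null_comparison)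
      show "\<forall>\<^sub>F h in at 0. norm (flat_exp j h / h) \<le> fact (j + 2) * \<bar>h\<bar>"
      proof (rule eventuallyI)
        fix h :: real
        show "norm (flat_exp j h / h) \<le> fact (j + 2) * \<bar>h\<bar>"
        proof (cases "h = 0")
          case False
          have "\<bar>flat_exp j h\<bar> \<le> (fact (j + 2) * \<bar>h\<bar>) * \<bar>h\<bar>"
            using flat_exp_le[of j h] by (simp add: power2_eq_square abs_mult_self_eq mult.assoc del: fact_Suc add_2_eq_Suc')
          then have "\<bar>flat_exp j h\<bar> / \<bar>h\<bar> \<le> fact (j + 2) * \<bar>h\<bar>" using False by (subst pos_divide_le_eq) auto
          then show ?thesis by simp
        qed simp
      qed
      have "((\<lambda>h :: real. fact (j + 2) * \<bar>h\<bar>) \<longlongrightarrow> fact (j + 2) * \<bar>0\<bar>) (at 0)" by (intro tendsto_intros)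
      then show "((\<lambda>h :: real. fact (j + 2) * \<bar>h\<bar>) \<longlongrightarrow> 0) (at 0)" by simp
    qed
    then show ?thesis using 3 by (simp add: DERIV_def flat_exp_def)
  qed
qed

lemma Ck_on_flat_exp:
  fixes p :: "'a::euclidean_space \<Rightarrow> real"
  assumes p: "smooth p"
  shows "Ck_on k UNIV (\<lambda>x. flat_exp j (p x))"
proof (induction k arbitrary: j)
  case 0
  have "continuous_on UNIV (flat_exp j)"
    using flat_exp_has_derivative by (meson DERIV_isCont continuous_at_imp_continuous_on)
  moreover have "continuous_on UNIV p" using p unfolding smooth_on_open_def by (metis Ck_on.simps(1))
  ultimately have "continuous_on UNIV (\<lambda>x. flat_exp j (p x))" by (metis continuous_on_compose2 subset_UNIV)
  then show ?case by simp
next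
  case (Suc k)
  have p1: "Ck_on (Suc k) UNIV p" using p by (simp only: smooth_on_open_def)
  show ?case
  proof (rule Ck_on_has_derivativeI)
    show "((\<lambda>x. flat_exp j (p x)) has_derivative
       (\<lambda>v. (- real j * flat_exp (j + 1) (p x) + flat_exp (j + 2) (p x)) * frechet_derivative p (at x) v)) (at x)" for x
      by (rule has_derivative_compose[OF Ck_on_has_derivative[OF p1] flat_exp_has_derivative[unfolded has_field_derivative_def]])
    show "Ck_on k UNIV (\<lambda>x. (- real j * flat_exp (j + 1) (p x) + flat_exp (j + 2) (p x)) * frechet_derivative p (at x) v)" for v
      using p1 by (intro Ck_on_mult Ck_on_add Ck_on_const Suc) auto
  qed
qed

section \<open>Calculus rules for smooth functions and iterated partial derivatives\<close>

lemma smooth_const: "smooth (\<lambda>x. c)" and smooth_inner: "smooth (\<lambda>x :: 'a::euclidean_space. x \<bullet> a)"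
  and smooth_cos: "smooth (\<lambda>x :: 'a. cos (x \<bullet> \<xi> + \<theta>))"
  by (simp_all add: smooth_on_open_def Ck_on_const Ck_on_inner Ck_on_cos)

lemma smooth_add: "smooth f \<Longrightarrow> smooth g \<Longrightarrow> smooth (\<lambda>x. f x + g x)"
  by (simp add: smooth_on_open_def Ck_on_add)

lemma smooth_mult: "smooth f \<Longrightarrow> smooth g \<Longrightarrow> smooth (\<lambda>x. f x * g x)"
  by (simp add: smooth_on_open_def Ck_on_mult)

lemma smooth_scaleR: "smooth f \<Longrightarrow> smooth (\<lambda>x. f (e *\<^sub>R x))"
  by (simp add: smooth_on_open_def Ck_on_scaleR)

lemma smooth_flat_exp: "smooth p \<Longrightarrow> smooth (\<lambda>x. flat_exp j (p x))"
  by (simp add: smooth_on_open_def Ck_on_flat_exp)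

lemma smooth_prod: "finite I \<Longrightarrow> (\<And>i. i \<in> I \<Longrightarrow> smooth (f i)) \<Longrightarrow> smooth (\<lambda>x. \<Prod>i\<in>I. f i x)"
  by (induction I rule: finite_induct) (auto intro: smooth_const smooth_mult)

lemma smooth_sum: "finite I \<Longrightarrow> (\<And>i. i \<in> I \<Longrightarrow> smooth (f i)) \<Longrightarrow> smooth (\<lambda>x. \<Sum>i\<in>I. f i x)"
  by (induction I rule: finite_induct) (auto intro: smooth_const smooth_add)

lemma smooth_has_derivative: "smooth f \<Longrightarrow> (f has_derivative frechet_derivative f (at x)) (at x)"
  unfolding smooth_on_open_def by (rule Ck_on_has_derivative[of 0]) blast

lemma smooth_continuous: "smooth f \<Longrightarrow> continuous_on UNIV f"
  unfolding smooth_on_open_def by (metis Ck_on.simps(1))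

lemma smooth_measurable: "smooth f \<Longrightarrow> f \<in> borel_measurable lborel"
  using borel_measurable_continuous_onI[OF smooth_continuous] by simp

lemma smooth_pd: "smooth f \<Longrightarrow> smooth (pd j f)"
proof -
  assume "smooth f"
  then have "Ck_on (Suc k) UNIV f" for k by (simp only: smooth_on_open_def)
  then have "Ck_on k UNIV (\<lambda>x. frechet_derivative f (at x) (axis j 1))" for k by simp
  then show ?thesis unfolding smooth_on_open_def pd_def[abs_def] by blast
qed

lemma smooth_pds: "smooth f \<Longrightarrow> smooth (pds js f)"
  by (induction js) (simp_all add: smooth_pd)

lemma pd_eqI: "(f has_derivative f') (at x) \<Longrightarrow> pd j f x = f' (axis j 1)"
  unfolding pd_def by (simp add: frechet_derivative_at[symmetric])

lemma pd_add: "smooth f \<Longrightarrow> smooth g \<Longrightarrow> pd j (\<lambda>x. f x + g x) = (\<lambda>x. pd j f x + pd j g x)"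
  by (rule ext, rule trans[OF pd_eqI[OF has_derivative_add]]) (auto intro: smooth_has_derivative simp: pd_def)

lemma pd_mult: "smooth f \<Longrightarrow> smooth g \<Longrightarrow> pd j (\<lambda>x. f x * g x) = (\<lambda>x. f x * pd j g x + pd j f x * g x)"
  by (rule ext, rule trans[OF pd_eqI[OF has_derivative_mult]]) (auto intro: smooth_has_derivative simp: pd_def)

lemma pd_cmult: "smooth f \<Longrightarrow> pd j (\<lambda>x. c * f x) = (\<lambda>x. c * pd j f x)"
  by (rule ext, rule trans[OF pd_eqI[OF has_derivative_mult_right]]) (auto intro: smooth_has_derivative simp: pd_def)

lemma pd_scaleR: "smooth f \<Longrightarrow> pd j (\<lambda>x. f (e *\<^sub>R x)) = (\<lambda>x. e * pd j f (e *\<^sub>R x))"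
proof
  fix x assume f: "smooth f"
  have "((\<lambda>x. f (e *\<^sub>R x)) has_derivative (\<lambda>v. frechet_derivative f (at (e *\<^sub>R x)) (e *\<^sub>R v))) (at x)"
    by (rule has_derivative_compose[OF _ smooth_has_derivative[OF f]])
       (rule has_derivative_scaleR_right[OF has_derivative_ident])
  from pd_eqI[OF this] show "pd j (\<lambda>x. f (e *\<^sub>R x)) x = e * pd j f (e *\<^sub>R x)"
    using linear_scale[OF has_derivative_linear[OF smooth_has_derivative[OF f]]]
    by (simp add: pd_def)
qed

lemma pd_cos: "pd j (\<lambda>x. cos (x \<bullet> \<xi> + \<theta>)) = (\<lambda>x. \<xi> $ j * cos (x \<bullet> \<xi> + (\<theta> + pi/2)))"
proof
  fix x :: "real^'a"
  have "((\<lambda>x. cos (x \<bullet> \<xi> + \<theta>)) has_derivative (\<lambda>v. (v \<bullet> \<xi>) * cos (x \<bullet> \<xi> + (\<theta> + pi/2)))) (at x)"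
    by (auto intro!: derivative_eq_intros simp: cos_add sin_add algebra_simps)
  then show "pd j (\<lambda>x. cos (x \<bullet> \<xi> + \<theta>)) x = \<xi> $ j * cos (x \<bullet> \<xi> + (\<theta> + pi/2))"
    by (simp add: pd_eqI inner_axis' )
qed

lemma pds_snoc: "pds (js @ [j]) f = pds js (pd j f)"
  by (induction js) simp_all

lemma pds_add: "smooth f \<Longrightarrow> smooth g \<Longrightarrow> pds js (\<lambda>x. f x + g x) = (\<lambda>x. pds js f x + pds js g x)"
  by (induction js) (simp_all add: pd_add smooth_pds)

lemma pds_cmult: "smooth f \<Longrightarrow> pds js (\<lambda>x. c * f x) = (\<lambda>x. c * pds js f x)"
  by (induction js) (simp_all add: pd_cmult smooth_pds)

lemma pds_cos: "pds js (\<lambda>x. cos (x \<bullet> \<xi> + \<theta>)) = (\<lambda>x. (\<Prod>j\<leftarrow>js. \<xi> $ j) * cos (x \<bullet> \<xi> + (\<theta> + real (length js) * (pi/2))))"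
proof (induction js)
  case (Cons j js)
  show ?case unfolding pds.simps(2) Cons.IH pd_cmult[OF smooth_cos] pd_cos by (simp add: field_simps)
qed simp

section \<open>Test functions, the smooth cutoff and its dilations\<close>

lemma test_functionD:
  assumes "test_function \<phi>"
  obtains r where "r > 0" "\<And>x. x \<notin> cball 0 r \<Longrightarrow> \<phi> x = 0"
proof -
  have "bounded (closure {x. \<phi> x \<noteq> 0})" using assms by (simp add: test_function_def compact_imp_bounded)
  then have "bounded {x. \<phi> x \<noteq> 0}" by (rule bounded_subset[OF _ closure_subset])
  then obtain r where "r > 0" "\<forall>x\<in>{x. \<phi> x \<noteq> 0}. norm x \<le> r" unfolding bounded_pos by blast
  moreover from this have "\<phi> x = 0" if "x \<notin> cball 0 r" for x
  proof (rule_tac ccontr)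
    assume "\<phi> x \<noteq> 0"
    then have "norm x \<le> r" using \<open>\<forall>x\<in>{x. \<phi> x \<noteq> 0}. norm x \<le> r\<close> by blast
    then show False using that by simp
  qed
  ultimately show ?thesis using that by blast
qed

lemma test_functionI:
  assumes "smooth \<phi>" "\<And>x. x \<notin> cball 0 r \<Longrightarrow> \<phi> x = 0"
  shows "test_function \<phi>"
proof -
  have "{x. \<phi> x \<noteq> 0} \<subseteq> cball 0 r" using assms(2) by blast
  then have "closure {x. \<phi> x \<noteq> 0} \<subseteq> cball 0 r" by (rule closure_minimal) simp
  then show ?thesis unfolding test_function_def using assms(1)
    by (metis bounded_cball bounded_subset closed_closure compact_eq_bounded_closed)
qed

lemma test_function_smooth: "test_function \<phi> \<Longrightarrow> smooth \<phi>"
  by (simp add: test_function_def)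

lemma test_function_bounded:
  assumes "test_function \<phi>"
  obtains B where "B > 0" "\<And>x. \<bar>\<phi> x\<bar> \<le> B"
proof -
  obtain r where r: "r > 0" "\<And>x. x \<notin> cball 0 r \<Longrightarrow> \<phi> x = 0" using test_functionD[OF assms] by blast
  have "continuous_on (cball 0 r) \<phi>" using smooth_continuous[OF test_function_smooth[OF assms]] by (rule continuous_on_subset) simp
  then have "bounded (\<phi> ` cball 0 r)" using compact_continuous_image compact_imp_bounded compact_cball by blast
  then obtain B where B: "B > 0" "\<And>x. x \<in> cball 0 r \<Longrightarrow> \<bar>\<phi> x\<bar> \<le> B" unfolding bounded_pos by auto
  have "\<bar>\<phi> x\<bar> \<le> B" for x using B r(2)[of x] by (cases "x \<in> cball 0 r") auto
  then show ?thesis using that B(1) by blast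
qed

lemma test_function_mult: "test_function \<phi> \<Longrightarrow> smooth f \<Longrightarrow> test_function (\<lambda>x. \<phi> x * f x)"
proof -
  assume \<phi>: "test_function \<phi>" and f: "smooth f"
  obtain r where r: "r > 0" "\<And>x. x \<notin> cball 0 r \<Longrightarrow> \<phi> x = 0" using test_functionD[OF \<phi>] by blast
  show ?thesis
    by (rule test_functionI[where r = r]) (use smooth_mult[OF test_function_smooth[OF \<phi>] f] r(2) in auto)
qed

lemma test_function_scaleR:
  assumes "test_function \<phi>" "e \<noteq> 0" shows "test_function (\<lambda>x. \<phi> (e *\<^sub>R x))"
proof -
  obtain r where r: "r > 0" "\<And>x. x \<notin> cball 0 r \<Longrightarrow> \<phi> x = 0" using test_functionD[OF assms(1)] by blast
  show ?thesis
  proof (rule test_functionI[where r = "r / \<bar>e\<bar>"])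
    show "smooth (\<lambda>x. \<phi> (e *\<^sub>R x))" using assms(1) by (intro smooth_scaleR test_function_smooth)
    fix x :: "real^'a" assume "x \<notin> cball 0 (r / \<bar>e\<bar>)"
    then have "e *\<^sub>R x \<notin> cball 0 r" using assms(2) by (simp add: field_simps)
    then show "\<phi> (e *\<^sub>R x) = 0" by (rule r(2))
  qed
qed

lemma test_function_pd:
  assumes "test_function \<phi>" shows "test_function (pd j \<phi>)"
proof -
  obtain r where r: "r > 0" "\<And>x. x \<notin> cball 0 r \<Longrightarrow> \<phi> x = 0" using test_functionD[OF assms] by blast
  show ?thesis
  proof (rule test_functionI)
    show "smooth (pd j \<phi>)" using assms by (intro smooth_pd test_function_smooth)
    fix x :: "real^'a" assume x: "x \<notin> cball 0 r"
    have "((\<lambda>x. 0) has_derivative (\<lambda>v. 0)) (at x)" by simp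
    then have "(\<phi> has_derivative (\<lambda>v. 0)) (at x)"
      by (rule has_derivative_transform_within_open[of _ _ _ UNIV "- cball 0 r"]) (use x r(2) in auto)
    then show "pd j \<phi> x = 0" by (simp add: pd_eqI)
  qed
qed

lemma test_function_pds: "test_function \<phi> \<Longrightarrow> test_function (pds js \<phi>)"
  by (induction js) (simp_all add: test_function_pd)

text \<open>The bump exp(1 - 1/(1 - |x|^2)) on the unit ball, normalised to 1 at the origin. The
  argument is spelled as a polynomial in inner products so that the closure rules for smoothness
  apply directly.\<close>

definition cutoff :: "real^'n::finite \<Rightarrow> real" where
  "cutoff x = exp 1 * flat_exp 0 (1 + (- 1) * (\<Sum>i\<in>UNIV. (x \<bullet> axis i 1) * (x \<bullet> axis i 1)))"

lemma cutoff_eq: "cutoff x = exp 1 * flat_exp 0 (1 - (norm x)\<^sup>2)"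
proof -
  have "(norm x)\<^sup>2 = (\<Sum>i\<in>UNIV. x $ i * x $ i)" by (simp add: power2_norm_eq_inner inner_vec_def)
  then show ?thesis by (simp add: cutoff_def inner_axis)
qed

lemma test_function_cutoff: "test_function cutoff"
proof (rule test_functionI)
  show "smooth cutoff" unfolding cutoff_def[abs_def]
    by (intro smooth_mult smooth_add smooth_flat_exp smooth_const smooth_sum smooth_inner) simp
  fix x :: "real^'a" assume "x \<notin> cball 0 1"
  then have "1 \<le> (norm x)\<^sup>2" by (simp add: one_le_power)
  then show "cutoff x = 0" by (simp add: cutoff_eq flat_exp_def)
qed

lemma cutoff_0 [simp]: "cutoff 0 = 1"
  by (simp add: cutoff_eq flat_exp_def exp_minus)

lemma cutoff_bounds: "0 \<le> cutoff x" "cutoff x \<le> 1"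
proof -
  show "0 \<le> cutoff x" by (simp add: cutoff_eq flat_exp_def)
  show "cutoff x \<le> 1"
  proof (cases "1 - (norm x)\<^sup>2 > 0")
    case True
    have "1 \<le> 1 / (1 - (norm x)\<^sup>2)" using True by (simp add: field_simps)
    then show ?thesis using True by (simp add: cutoff_eq flat_exp_def mult_exp_exp)
  qed (simp add: cutoff_eq flat_exp_def)
qed

text \<open>By the Leibniz rule every derivative falling on the dilated cutoff gains a factor \<open>e\<close>.\<close>

lemma pds_dilation_limit:
  fixes g h :: "real^'n::finite \<Rightarrow> real"
  assumes "test_function g" "smooth h" "\<And>js. \<exists>B. \<forall>x. \<bar>pds js h x\<bar> \<le> B"
    and e: "e \<longlonglongrightarrow> 0" "\<And>k. \<bar>e k\<bar> \<le> 1"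
  shows "(\<exists>B. \<forall>k x. \<bar>pds js (\<lambda>x. g (e k *\<^sub>R x) * h x) x\<bar> \<le> B) \<and>
         (\<forall>x. (\<lambda>k. pds js (\<lambda>x. g (e k *\<^sub>R x) * h x) x) \<longlonglongrightarrow> g 0 * pds js h x)"
  using assms(1-3)
\<comment> \<open>The innermost derivative is the one that meets the product, so lists are taken
  apart from the end. The hypothesis is used for the pair of \<open>pd j g\<close> and
  \<open>h\<close> as well as for \<open>g\<close> and \<open>pd j h\<close>, hence the
  generalisation over both functions.\<close>
proof (induction js arbitrary: g h rule: rev_induct)
  case Nil
  obtain B where B: "B > 0" "\<And>x. \<bar>g x\<bar> \<le> B" using test_function_bounded[OF Nil(1)] by blast
  obtain B' where B': "\<And>x. \<bar>h x\<bar> \<le> B'" using Nil(3)[of "[]"] by auto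
  have "\<bar>g (e k *\<^sub>R x) * h x\<bar> \<le> B * B'" for k x
    unfolding abs_mult by (rule mult_mono) (use B B' in auto)
  moreover have "(\<lambda>k. g (e k *\<^sub>R x) * h x) \<longlonglongrightarrow> g (0 *\<^sub>R x) * h x" for x
  proof -
    have "isCont g (0 *\<^sub>R x)" using smooth_continuous[OF test_function_smooth[OF Nil(1)]]
      by (simp add: continuous_on_eq_continuous_at)
    then have "(\<lambda>k. g (e k *\<^sub>R x)) \<longlonglongrightarrow> g (0 *\<^sub>R x)"
      by (rule isCont_tendsto_compose) (intro tendsto_intros e)
    then show ?thesis by (intro tendsto_intros)
  qed
  ultimately show ?case by auto
next
  case (snoc j js)
  have sg: "smooth g" using snoc.prems(1) by (rule test_function_smooth)
  have bh: "\<exists>B. \<forall>x. \<bar>pds ks (pd j h) x\<bar> \<le> B" for ks using snoc.prems(3)[of "ks @ [j]"] by (simp add: pds_snoc)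
  note 1 = snoc.IH[OF test_function_pd[OF snoc.prems(1), of j] snoc.prems(2,3)]
  note 2 = snoc.IH[OF snoc.prems(1) smooth_pd[OF snoc.prems(2), of j] bh]
  have eq: "pds (js @ [j]) (\<lambda>x. g (e k *\<^sub>R x) * h x) x
     = pds js (\<lambda>x. g (e k *\<^sub>R x) * pd j h x) x + e k * pds js (\<lambda>x. pd j g (e k *\<^sub>R x) * h x) x" for k x
  proof -
    have "pd j (\<lambda>x. g (e k *\<^sub>R x) * h x) = (\<lambda>x. g (e k *\<^sub>R x) * pd j h x + e k * (pd j g (e k *\<^sub>R x) * h x))"
      by (simp add: pd_mult smooth_scaleR sg snoc.prems(2) pd_scaleR mult.assoc)
    then show ?thesis
      by (simp add: pds_snoc pds_add pds_cmult smooth_mult smooth_scaleR smooth_pd sg snoc.prems(2) smooth_const)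
  qed
  obtain B1 where B1: "\<And>k x. \<bar>pds js (\<lambda>x. pd j g (e k *\<^sub>R x) * h x) x\<bar> \<le> B1" using 1 by blast
  obtain B2 where B2: "\<And>k x. \<bar>pds js (\<lambda>x. g (e k *\<^sub>R x) * pd j h x) x\<bar> \<le> B2" using 2 by blast
  have "\<bar>pds (js @ [j]) (\<lambda>x. g (e k *\<^sub>R x) * h x) x\<bar> \<le> B2 + 1 * B1" for k x
    unfolding eq by (rule order_trans[OF abs_triangle_ineq], rule add_mono[OF B2], unfold abs_mult,
        rule mult_mono) (use e(2) B1 in auto)
  moreover have "(\<lambda>k. pds (js @ [j]) (\<lambda>x. g (e k *\<^sub>R x) * h x) x) \<longlonglongrightarrow> g 0 * pds js (pd j h) x + 0 * (pd j g 0 * pds js h x)" for x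
    unfolding eq using 1 2 by (intro tendsto_intros e) auto
  ultimately show ?case by (auto simp: pds_snoc)
qed

text \<open>A product over the coordinates of the factors exp(-1/(k d)), where d is the distance to
  a face: each vanishes outside and tends to 1 inside as k grows.\<close>

lemma box_approximation:
  fixes a b :: "real^'n::finite"
  obtains \<phi> where "\<And>k::nat. test_function (\<phi> k)" "\<And>k x. 0 \<le> \<phi> k x" "\<And>k x. \<phi> k x \<le> indicator (box a b) x"
    "\<And>x. (\<lambda>k. \<phi> k x) \<longlonglongrightarrow> indicator (box a b) x"
proof -
  define \<phi> where "\<phi> k x = (\<Prod>i\<in>UNIV. flat_exp 0 (real k * (x \<bullet> axis i 1) + (- real k * a $ i)) * flat_exp 0 ((- real k) * (x \<bullet> axis i 1) + real k * b $ i))"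
    for k :: nat and x :: "real^'n"
  have sm: "smooth (\<phi> k)" for k unfolding \<phi>_def[abs_def]
    by (intro smooth_prod smooth_mult smooth_flat_exp smooth_add smooth_const smooth_inner) simp
  have mem: "x \<in> box a b \<longleftrightarrow> (\<forall>i. a $ i < x $ i \<and> x $ i < b $ i)" for x by (simp add: mem_box_cart)
  have eq: "\<phi> k x = (\<Prod>i\<in>UNIV. flat_exp 0 (real k * (x $ i - a $ i)) * flat_exp 0 (real k * (b $ i - x $ i)))" for k x
    by (simp add: \<phi>_def inner_axis algebra_simps)
  have zero: "\<phi> k x = 0" if "x \<notin> box a b" for k x
  proof -
    obtain i where "x $ i \<le> a $ i \<or> b $ i \<le> x $ i" using \<open>x \<notin> box a b\<close> unfolding mem not_all not_less[symmetric] by blast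
    then have "flat_exp 0 (real k * (x $ i - a $ i)) * flat_exp 0 (real k * (b $ i - x $ i)) = 0"
      by (auto simp: flat_exp_def zero_less_mult_iff)
    then show ?thesis unfolding eq by (intro prod_zero) auto
  qed
  show ?thesis
  proof (rule that[of \<phi>])
    fix k :: nat and x :: "real^'n"
    obtain r where "\<forall>x\<in>box a b. norm x \<le> r" using bounded_box[of a b] unfolding bounded_iff by blast
    then have "box a b \<subseteq> cball 0 r" by auto
    then have "\<phi> k x = 0" if "x \<notin> cball 0 r" for x using that zero[of x k] by blast
    then show "test_function (\<phi> k)" by (rule test_functionI[OF sm])
    show "0 \<le> \<phi> k x" unfolding eq by (intro prod_nonneg mult_nonneg_nonneg flat_exp_0_bounds)
    show "\<phi> k x \<le> indicator (box a b) x"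
    proof (cases "x \<in> box a b")
      case True
      have "\<phi> k x \<le> 1" unfolding eq
        by (intro prod_le_1) (auto intro!: mult_le_one mult_nonneg_nonneg flat_exp_0_bounds)
      then show ?thesis using True by simp
    qed (simp add: zero)
    show "(\<lambda>k. \<phi> k x) \<longlonglongrightarrow> indicator (box a b) x"
    proof (cases "x \<in> box a b")
      case True
      have lim: "(\<lambda>k. flat_exp 0 (real k * c)) \<longlonglongrightarrow> 1" if c: "c > 0" for c :: real
      proof -
        have "(\<lambda>k. exp (- (1 / c) * inverse (real k))) \<longlonglongrightarrow> exp (- (1 / c) * 0)"
          by (intro tendsto_intros LIMSEQ_inverse_real_of_nat[THEN LIMSEQ_imp_Suc])
        then have "(\<lambda>k. exp (- (1 / c) * inverse (real k))) \<longlonglongrightarrow> 1" by simp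
        then show ?thesis
          by (rule Lim_transform_eventually)
             (use c in \<open>auto intro!: eventually_sequentiallyI[of 1] simp: flat_exp_def field_simps\<close>)
      qed
      have "(\<lambda>k. \<phi> k x) \<longlonglongrightarrow> (\<Prod>i\<in>(UNIV :: 'n set). 1 * 1)"
        unfolding eq using True by (intro tendsto_prod tendsto_mult lim) (auto simp: mem)
      then show ?thesis using True by simp
    qed (simp add: zero)
  qed
qed

section \<open>Integration by parts for test functions\<close>

lemma lborel_integral_translation:
  fixes f :: "'a::euclidean_space \<Rightarrow> 'b::euclidean_space"
  assumes "f \<in> borel_measurable borel"
  shows "(\<integral>x. f (c + x) \<partial>lborel) = (\<integral>x. f x \<partial>lborel)"
proof -
  have "(\<integral>x. f x \<partial>lborel) = (\<integral>x. f x \<partial>(distr lborel borel ((+) c)))" by (simp add: lborel_distr_plus)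
  also have "\<dots> = (\<integral>x. f (c + x) \<partial>lborel)" by (rule integral_distr) (use assms in auto)
  finally show ?thesis ..
qed

lemma integrable_indicator_cball: "integrable lborel (\<lambda>x :: 'a::euclidean_space. B * indicator (cball 0 r) x :: real)"
  using emeasure_bounded_finite[OF bounded_cball, of "0 :: 'a" r]
  by (intro integrable_mult_right integrable_real_indicator) auto

lemma test_function_integrable:
  assumes "test_function \<phi>" shows "integrable lborel \<phi>"
proof -
  obtain r where r: "r > 0" "\<And>x. x \<notin> cball 0 r \<Longrightarrow> \<phi> x = 0" using test_functionD[OF assms] by blast
  obtain B where B: "B > 0" "\<And>x. \<bar>\<phi> x\<bar> \<le> B" using test_function_bounded[OF assms] by blast
  show ?thesis
  proof (rule Bochner_Integration.integrable_bound[OF integrable_indicator_cball[of B r]])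
    show "\<phi> \<in> borel_measurable lborel" using assms by (intro smooth_measurable test_function_smooth)
    show "AE x in lborel. norm (\<phi> x) \<le> norm (B * indicator (cball 0 r) x)"
    proof (rule AE_I2)
      fix x show "norm (\<phi> x) \<le> norm (B * indicator (cball 0 r) x)"
        using B r(2)[of x] by (cases "x \<in> cball 0 r") auto
    qed
  qed
qed

text \<open>Difference quotients have integral 0 by translation invariance and converge to the
  derivative under a common integrable bound.\<close>

lemma integral_pd:
  fixes \<phi> :: "real^'n::finite \<Rightarrow> real"
  assumes \<phi>: "test_function \<phi>"
  shows "(\<integral>x. pd j \<phi> x \<partial>lborel) = 0"
proof -
  have sm: "smooth \<phi>" using \<phi> by (rule test_function_smooth)
  obtain r where r: "r > 0" "\<And>x. x \<notin> cball 0 r \<Longrightarrow> \<phi> x = 0" using test_functionD[OF \<phi>] by blast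
  obtain B where B: "B > 0" "\<And>x. \<bar>pd j \<phi> x\<bar> \<le> B" using test_function_bounded[OF test_function_pd[OF \<phi>]] by blast
  have m: "\<phi> \<in> borel_measurable borel" using smooth_measurable[OF sm] by simp
  define q where "q k x = real (Suc k) * (\<phi> (inverse (real (Suc k)) *\<^sub>R axis j 1 + x) - \<phi> x)" for k x
  have line: "((\<lambda>t. \<phi> (t *\<^sub>R axis j 1 + x)) has_real_derivative pd j \<phi> (t *\<^sub>R axis j 1 + x)) (at t)" for t x
  proof -
    let ?D = "frechet_derivative \<phi> (at (t *\<^sub>R axis j 1 + x))"
    have "((\<lambda>t. \<phi> (t *\<^sub>R axis j 1 + x)) has_derivative (\<lambda>s. ?D (s *\<^sub>R axis j 1))) (at t)"
      by (rule has_derivative_compose[OF _ smooth_has_derivative[OF sm]]) (auto intro!: derivative_eq_intros)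
    moreover have "?D (s *\<^sub>R axis j 1) = ?D (axis j 1) * s" for s
      using linear_scale[OF has_derivative_linear[OF smooth_has_derivative[OF sm]]] by (simp add: mult.commute)
    ultimately show ?thesis by (simp add: has_field_derivative_def pd_def)
  qed
  have "(\<lambda>k. \<integral>x. q k x \<partial>lborel) \<longlonglongrightarrow> (\<integral>x. pd j \<phi> x \<partial>lborel)"
  \<comment> \<open>The mean value theorem supplies \<open>B\<close>; the radius grows by 1 because
    the steps 1/(k+1) are at most 1.\<close>
  proof (rule integral_dominated_convergence[where w = "\<lambda>x. B * indicator (cball 0 (r + 1)) x"])
    show "pd j \<phi> \<in> borel_measurable lborel" using sm by (intro smooth_measurable smooth_pd)
    show "q k \<in> borel_measurable lborel" for k unfolding q_def[abs_def] using m by measurable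
    show "integrable lborel (\<lambda>x :: real^'n. B * indicator (cball 0 (r + 1)) x)" by (rule integrable_indicator_cball)
    show "AE x in lborel. (\<lambda>k. q k x) \<longlonglongrightarrow> pd j \<phi> x"
    proof (rule AE_I2)
      fix x
      have "((\<lambda>h. (\<phi> ((0 + h) *\<^sub>R axis j 1 + x) - \<phi> (0 *\<^sub>R axis j 1 + x)) / h) \<longlongrightarrow> pd j \<phi> (0 *\<^sub>R axis j 1 + x)) (at 0)"
        using line[of x 0] unfolding DERIV_def .
      moreover have "filterlim (\<lambda>k. inverse (real (Suc k))) (at 0) sequentially"
        using LIMSEQ_inverse_real_of_nat by (simp add: filterlim_at)
      ultimately have "(\<lambda>k. (\<phi> ((0 + inverse (real (Suc k))) *\<^sub>R axis j 1 + x) - \<phi> (0 *\<^sub>R axis j 1 + x)) / inverse (real (Suc k))) \<longlonglongrightarrow> pd j \<phi> (0 *\<^sub>R axis j 1 + x)"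
        by (rule filterlim_compose)
      then show "(\<lambda>k. q k x) \<longlonglongrightarrow> pd j \<phi> x" by (simp add: q_def field_simps)
    qed
    fix k
    show "AE x in lborel. norm (q k x) \<le> B * indicator (cball 0 (r + 1)) x"
    proof (rule AE_I2)
      fix x :: "real^'n"
      define h where "h = inverse (real (Suc k))"
      have h: "0 < h" "h \<le> 1" by (simp_all add: h_def field_simps)
      show "norm (q k x) \<le> B * indicator (cball 0 (r + 1)) x"
      proof (cases "x \<in> cball 0 (r + 1)")
        case True
        obtain z where "\<phi> (h *\<^sub>R axis j 1 + x) - \<phi> (0 *\<^sub>R axis j 1 + x) = (h - 0) * pd j \<phi> (z *\<^sub>R axis j 1 + x)"
          using MVT2[OF h(1) line] by blast
        then have "\<bar>\<phi> (h *\<^sub>R axis j 1 + x) - \<phi> x\<bar> \<le> h * B" using h B(2) by (simp add: abs_mult)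
        then have "inverse h * \<bar>\<phi> (h *\<^sub>R axis j 1 + x) - \<phi> x\<bar> \<le> inverse h * (h * B)" using h by (intro mult_left_mono) auto
        moreover have "norm (q k x) = inverse h * \<bar>\<phi> (h *\<^sub>R axis j 1 + x) - \<phi> x\<bar>" by (simp add: q_def h_def abs_mult)
        moreover have "inverse h * (h * B) = B" using h by simp
        ultimately show ?thesis using True by simp
      next
        case False
        then have "norm x > r + 1" by simp
        moreover have "norm x \<le> norm (h *\<^sub>R axis j 1 + x) + norm (h *\<^sub>R (axis j 1 :: real^'n))"
          using norm_triangle_ineq4[of "h *\<^sub>R axis j 1 + x" "h *\<^sub>R axis j 1"] by simp
        ultimately have "norm (h *\<^sub>R axis j 1 + x) > r" using h by simp
        then have "\<phi> (h *\<^sub>R axis j 1 + x) = 0" "\<phi> x = 0" using False r(1) by (auto intro!: r(2))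
        then show ?thesis using False by (simp add: q_def h_def)
      qed
    qed
  qed
  moreover have "(\<integral>x. q k x \<partial>lborel) = 0" for k
  proof -
    have 1: "integrable lborel (\<lambda>x. \<phi> (c + x))" for c
    proof -
      have "integrable (distr lborel borel ((+) c)) \<phi>" using test_function_integrable[OF \<phi>] by (simp add: lborel_distr_plus)
      then show ?thesis by (subst (asm) integrable_distr_eq) (use m in auto)
    qed
    show ?thesis unfolding q_def
      using 1 test_function_integrable[OF \<phi>] lborel_integral_translation[OF m] by simp
  qed
  ultimately show ?thesis by (simp add: LIMSEQ_const_iff)
qed

section \<open>Square integrable functions\<close>

text \<open>The squared norm with values in the extended nonnegative reals. Unlike
  \<open>L2norm\<close>, which is 0 for functions of infinite norm, it lets estimates prove
  membership in L2.\<close>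

definition nsq :: "('a::euclidean_space \<Rightarrow> 'b::real_normed_vector) \<Rightarrow> ennreal" where
  "nsq f = (\<integral>\<^sup>+x. ennreal ((norm (f x))\<^sup>2) \<partial>lborel)"

lemma L2_iff_nsq: "L2 f \<longleftrightarrow> f \<in> borel_measurable lborel \<and> nsq f < \<infinity>"
  unfolding L2_def nsq_def integrable_iff_bounded by auto

lemma L2_measurable: "L2 f \<Longrightarrow> f \<in> borel_measurable lborel"
  by (simp add: L2_def)

lemma L2norm_sq: "f \<in> borel_measurable lborel \<Longrightarrow> (L2norm f)\<^sup>2 = enn2real (nsq f)"
  unfolding L2norm_def nsq_def by (simp add: integral_eq_nn_integral)

lemma L2norm_nonneg [simp]: "L2norm f \<ge> 0"
  by (simp add: L2norm_def)

lemma nsq_eq_L2norm: "L2 f \<Longrightarrow> nsq f = ennreal ((L2norm f)\<^sup>2)"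
  by (simp add: L2_iff_nsq L2norm_sq less_top)

lemma L2norm_sq_le:
  assumes "f \<in> borel_measurable lborel" "nsq f \<le> ennreal c" "c \<ge> 0"
  shows "(L2norm f)\<^sup>2 \<le> c"
  using enn2real_mono[OF assms(2)] assms by (simp add: L2norm_sq)

lemma nsq_mono: "(\<And>x. norm (f x) \<le> norm (g x)) \<Longrightarrow> nsq f \<le> nsq g"
  unfolding nsq_def by (intro nn_integral_mono ennreal_leI power_mono) auto

lemma nsq_cong_AE: "AE x in lborel. f x = g x \<Longrightarrow> nsq f = nsq g"
  unfolding nsq_def by (rule nn_integral_cong_AE) auto

lemma nsq_scale:
  assumes "f \<in> borel_measurable lborel"
  shows "nsq (\<lambda>x. c *\<^sub>R f x) = ennreal (c\<^sup>2) * nsq f"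
  unfolding nsq_def using assms
  by (simp add: power_mult_distrib ennreal_mult nn_integral_cmult)

lemma norm_add_sq_le: "(norm (a + b))\<^sup>2 \<le> 2 * (norm a)\<^sup>2 + 2 * (norm b)\<^sup>2"
proof -
  have "(norm (a + b))\<^sup>2 \<le> (norm a + norm b)\<^sup>2" by (intro power_mono norm_triangle_ineq) simp
  also have "\<dots> \<le> 2 * (norm a)\<^sup>2 + 2 * (norm b)\<^sup>2"
    using sum_squares_bound[of "norm a" "norm b"] by (simp add: power2_sum)
  finally show ?thesis .
qed

lemma nsq_add_le:
  fixes f g :: "'a::euclidean_space \<Rightarrow> 'b::euclidean_space"
  assumes [measurable]: "f \<in> borel_measurable lborel" "g \<in> borel_measurable lborel"
  shows "nsq (\<lambda>x. f x + g x) \<le> 2 * nsq f + 2 * nsq g"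
proof -
  have "nsq (\<lambda>x. f x + g x) \<le> (\<integral>\<^sup>+x. ennreal 2 * ennreal ((norm (f x))\<^sup>2) + ennreal 2 * ennreal ((norm (g x))\<^sup>2) \<partial>lborel)"
    unfolding nsq_def
  proof (rule nn_integral_mono)
    fix x
    have "ennreal ((norm (f x + g x))\<^sup>2) \<le> ennreal (2 * (norm (f x))\<^sup>2 + 2 * (norm (g x))\<^sup>2)"
      by (rule ennreal_leI[OF norm_add_sq_le])
    also have "\<dots> = ennreal 2 * ennreal ((norm (f x))\<^sup>2) + ennreal 2 * ennreal ((norm (g x))\<^sup>2)"
      by (subst ennreal_plus) (simp_all add: ennreal_mult)
    finally show "ennreal ((norm (f x + g x))\<^sup>2) \<le> ennreal 2 * ennreal ((norm (f x))\<^sup>2) + ennreal 2 * ennreal ((norm (g x))\<^sup>2)" .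
  qed
  also have "\<dots> = 2 * nsq f + 2 * nsq g"
    unfolding nsq_def by (simp add: nn_integral_add nn_integral_cmult)
  finally show ?thesis .
qed

lemma nsq_minus_commute: "nsq (\<lambda>x. f x - g x) = nsq (\<lambda>x. g x - f x)"
  unfolding nsq_def by (simp add: norm_minus_commute)

lemma L2_add:
  fixes f g :: "'a::euclidean_space \<Rightarrow> 'b::euclidean_space"
  assumes "L2 f" "L2 g" shows "L2 (\<lambda>x. f x + g x)"
proof -
  have [measurable]: "f \<in> borel_measurable lborel" "g \<in> borel_measurable lborel" using assms by (auto simp: L2_iff_nsq)
  have "nsq (\<lambda>x. f x + g x) \<le> 2 * nsq f + 2 * nsq g" by (rule nsq_add_le) fact+
  also have "\<dots> < \<infinity>" using assms by (simp add: L2_iff_nsq ennreal_mult_less_top)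
  finally show ?thesis by (simp add: L2_iff_nsq)
qed

lemma L2_diff:
  fixes f g :: "'a::euclidean_space \<Rightarrow> 'b::euclidean_space"
  assumes "L2 f" "L2 g" shows "L2 (\<lambda>x. f x - g x)"
proof -
  have "L2 (\<lambda>x. - g x)" using assms(2) by (simp add: L2_iff_nsq nsq_def)
  from L2_add[OF assms(1) this] show ?thesis by simp
qed

lemma L2_bound:
  fixes f :: "'a::euclidean_space \<Rightarrow> 'b::euclidean_space" and g :: "'a \<Rightarrow> 'c::euclidean_space"
  assumes "L2 g" "f \<in> borel_measurable lborel" "\<And>x. norm (f x) \<le> norm (g x)"
  shows "L2 f"
  using assms nsq_mono[of f g] by (auto simp: L2_iff_nsq intro: le_less_trans)

lemma L2_scaleR:
  fixes f :: "'a::euclidean_space \<Rightarrow> 'b::euclidean_space"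
  assumes f: "L2 f" and [measurable]: "m \<in> borel_measurable lborel" and B: "\<And>x. \<bar>m x\<bar> \<le> B"
  shows "L2 (\<lambda>x. m x *\<^sub>R f x)" "nsq (\<lambda>x. m x *\<^sub>R f x) \<le> ennreal (B\<^sup>2) * nsq f"
proof -
  have [measurable]: "f \<in> borel_measurable lborel" using f by (rule L2_measurable)
  have B0: "B \<ge> 0" using B[of undefined] by linarith
  have "nsq (\<lambda>x. m x *\<^sub>R f x) \<le> nsq (\<lambda>x. B *\<^sub>R f x)"
    using B B0 by (intro nsq_mono) (auto intro!: mult_right_mono)
  then show 1: "nsq (\<lambda>x. m x *\<^sub>R f x) \<le> ennreal (B\<^sup>2) * nsq f" by (simp add: nsq_scale)
  then show "L2 (\<lambda>x. m x *\<^sub>R f x)"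
    using f by (auto simp: L2_iff_nsq ennreal_mult_less_top intro!: le_less_trans[OF 1])
qed

lemma Cauchy_Schwarz_L2:
  fixes f :: "'a::euclidean_space \<Rightarrow> 'b::euclidean_space" and g :: "'a \<Rightarrow> 'c::euclidean_space"
  assumes "L2 f" "L2 g"
  shows "integrable lborel (\<lambda>x. norm (f x) * norm (g x))"
    "(\<integral>x. norm (f x) * norm (g x) \<partial>lborel) \<le> L2norm f * L2norm g"
proof -
  have [measurable]: "f \<in> borel_measurable lborel" "g \<in> borel_measurable lborel" using assms by (auto simp: L2_iff_nsq)
  define I where "I = (\<integral>\<^sup>+x. ennreal (norm (f x)) * ennreal (norm (g x)) \<partial>lborel)"
  have "I\<^sup>2 \<le> (\<integral>\<^sup>+x. (ennreal (norm (f x)))\<^sup>2 \<partial>lborel) * (\<integral>\<^sup>+x. (ennreal (norm (g x)))\<^sup>2 \<partial>lborel)"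
    unfolding I_def by (rule Cauchy_Schwarz_nn_integral) simp_all
  also have "\<dots> = nsq f * nsq g" by (simp add: nsq_def ennreal_power)
  also have "\<dots> = ennreal ((L2norm f * L2norm g)\<^sup>2)" using assms by (simp add: nsq_eq_L2norm ennreal_mult' power_mult_distrib)
  finally have I2: "I\<^sup>2 \<le> (ennreal (L2norm f * L2norm g))\<^sup>2" by (simp add: ennreal_power)
  then have I: "I \<le> ennreal (L2norm f * L2norm g)"
  proof (cases I rule: ennreal_cases)
    case (real a)
    then have "a\<^sup>2 \<le> (L2norm f * L2norm g)\<^sup>2" using I2 by (simp add: ennreal_power)
    then have "a \<le> L2norm f * L2norm g" by (rule power2_le_imp_le) simp
    then show ?thesis using real by (simp add: ennreal_leI)
  qed (simp add: ennreal_power top_unique)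
  have eq: "(\<integral>\<^sup>+x. ennreal (norm (norm (f x) * norm (g x))) \<partial>lborel) = I"
    unfolding I_def by (simp add: ennreal_mult)
  show int: "integrable lborel (\<lambda>x. norm (f x) * norm (g x))"
    unfolding integrable_iff_bounded eq using I by (auto intro: le_less_trans)
  have "ennreal (\<integral>x. norm (f x) * norm (g x) \<partial>lborel) = I"
    using nn_integral_eq_integral[OF int] eq by simp
  then have "ennreal (\<integral>x. norm (f x) * norm (g x) \<partial>lborel) \<le> ennreal (L2norm f * L2norm g)" using I by simp
  then show "(\<integral>x. norm (f x) * norm (g x) \<partial>lborel) \<le> L2norm f * L2norm g"
    by (subst (asm) ennreal_le_iff) auto
qed

lemma integrable_mult_L2:
  fixes f g :: "'a::euclidean_space \<Rightarrow> complex"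
  assumes "L2 f" "L2 g"
  shows "integrable lborel (\<lambda>x. f x * g x)" "norm (\<integral>x. f x * g x \<partial>lborel) \<le> L2norm f * L2norm g"
proof -
  have [measurable]: "f \<in> borel_measurable lborel" "g \<in> borel_measurable lborel" using assms by (auto simp: L2_iff_nsq)
  show "integrable lborel (\<lambda>x. f x * g x)"
    by (rule Bochner_Integration.integrable_bound[OF Cauchy_Schwarz_L2(1)[OF assms]]) (auto simp: norm_mult)
  have "norm (\<integral>x. f x * g x \<partial>lborel) \<le> (\<integral>x. norm (f x * g x) \<partial>lborel)" by simp
  then show "norm (\<integral>x. f x * g x \<partial>lborel) \<le> L2norm f * L2norm g"
    using Cauchy_Schwarz_L2(2)[OF assms] by (simp add: norm_mult)
qed

lemma integrable_scaleR_L2: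
  fixes f :: "'a::euclidean_space \<Rightarrow> real" and g :: "'a::euclidean_space \<Rightarrow> 'b::euclidean_space"
  assumes "L2 f" "L2 g"
  shows "integrable lborel (\<lambda>x. f x *\<^sub>R g x)"
    "norm (\<integral>x. f x *\<^sub>R g x \<partial>lborel) \<le> L2norm f * L2norm g"
proof -
  have [measurable]: "f \<in> borel_measurable lborel" "g \<in> borel_measurable lborel" using assms by (auto simp: L2_iff_nsq)
  show "integrable lborel (\<lambda>x. f x *\<^sub>R g x)"
    by (rule Bochner_Integration.integrable_bound[OF Cauchy_Schwarz_L2(1)[OF assms]]) auto
  have "norm (\<integral>x. f x *\<^sub>R g x \<partial>lborel) \<le> (\<integral>x. norm (f x *\<^sub>R g x) \<partial>lborel)" by (rule integral_norm_bound)
  then show "norm (\<integral>x. f x *\<^sub>R g x \<partial>lborel) \<le> L2norm f * L2norm g"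
    using Cauchy_Schwarz_L2(2)[OF assms] by simp
qed

lemma L2_bounded_support:
  fixes f :: "'a::euclidean_space \<Rightarrow> real"
  assumes [measurable]: "f \<in> borel_measurable lborel" and B: "\<And>x. \<bar>f x\<bar> \<le> B" and r: "\<And>x. x \<notin> cball 0 r \<Longrightarrow> f x = 0"
  shows "L2 f"
proof -
  have "integrable lborel (\<lambda>x. (norm (f x))\<^sup>2)"
  proof (rule Bochner_Integration.integrable_bound[OF integrable_indicator_cball[of "B\<^sup>2" r]])
    show "AE x in lborel. norm ((norm (f x))\<^sup>2) \<le> norm (B\<^sup>2 * indicator (cball 0 r) x)"
    proof (rule AE_I2)
      fix x :: 'a
      have "\<bar>f x\<bar>\<^sup>2 \<le> B\<^sup>2" using B[of x] by (intro power_mono) auto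
      then show "norm ((norm (f x))\<^sup>2) \<le> norm (B\<^sup>2 * indicator (cball 0 r) x)"
        using r[of x] by (cases "x \<in> cball 0 r") auto
    qed
  qed simp
  then show ?thesis by (simp add: L2_def)
qed

lemma test_function_L2:
  assumes "test_function \<phi>" shows "L2 \<phi>"
proof -
  obtain r where r: "\<And>x. x \<notin> cball 0 r \<Longrightarrow> \<phi> x = 0" using test_functionD[OF assms] by blast
  obtain B where B: "\<And>x. \<bar>\<phi> x\<bar> \<le> B" using test_function_bounded[OF assms] by blast
  show ?thesis by (rule L2_bounded_support[OF smooth_measurable[OF test_function_smooth[OF assms]] B r])
qed

lemma test_function_scaleR_integrable:
  fixes f :: "real^'n \<Rightarrow> 'b::euclidean_space"
  shows "test_function \<phi> \<Longrightarrow> L2 f \<Longrightarrow> integrable lborel (\<lambda>x. \<phi> x *\<^sub>R f x)"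
  by (rule integrable_scaleR_L2[OF test_function_L2])

lemma L2_linear:
  fixes T :: "'b::euclidean_space \<Rightarrow> 'c::euclidean_space"
  assumes T: "bounded_linear T" and f: "L2 f"
  shows "L2 (\<lambda>x. T (f x))"
proof -
  obtain B where B: "B > 0" "\<And>x. norm (T x) \<le> norm x * B" using bounded_linear.pos_bounded[OF T] by blast
  have m: "f \<in> borel_measurable lborel" using f by (rule L2_measurable)
  have "L2 (\<lambda>x. B *\<^sub>R f x)" by (rule L2_scaleR(1)[OF f, of _ B]) (use B in auto)
  moreover have "(\<lambda>x. T (f x)) \<in> borel_measurable lborel"
    by (rule borel_measurable_continuous_on[OF linear_continuous_on[OF T] m])
  ultimately show ?thesis by (rule L2_bound) (use B in \<open>auto simp: mult.commute\<close>)
qed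

lemma nsq_vec:
  fixes f :: "'a::euclidean_space \<Rightarrow> 'b::euclidean_space^'m"
  assumes [measurable]: "f \<in> borel_measurable lborel"
  shows "nsq f = (\<Sum>i\<in>UNIV. nsq (\<lambda>x. f x $ i))"
proof -
  have [measurable]: "(\<lambda>x. f x $ i) \<in> borel_measurable lborel" for i
    by (rule borel_measurable_continuous_on[OF _ assms]) (intro continuous_intros)
  have "(norm (f x))\<^sup>2 = (\<Sum>i\<in>UNIV. (norm (f x $ i))\<^sup>2)" for x
    by (simp add: power2_norm_eq_inner inner_vec_def)
  then have "nsq f = (\<integral>\<^sup>+x. (\<Sum>i\<in>UNIV. ennreal ((norm (f x $ i))\<^sup>2)) \<partial>lborel)"
    by (simp add: nsq_def sum_ennreal)
  also have "\<dots> = (\<Sum>i\<in>UNIV. nsq (\<lambda>x. f x $ i))"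
    unfolding nsq_def by (rule nn_integral_sum) simp
  finally show ?thesis .
qed

lemma borel_measurable_vec_iff:
  fixes f :: "'a::euclidean_space \<Rightarrow> 'b::euclidean_space^'m"
  shows "f \<in> borel_measurable lborel \<longleftrightarrow> (\<forall>i. (\<lambda>x. f x $ i) \<in> borel_measurable lborel)"
proof
  assume f: "f \<in> borel_measurable lborel"
  show "\<forall>i. (\<lambda>x. f x $ i) \<in> borel_measurable lborel"
    by (rule allI, rule borel_measurable_continuous_on[OF _ f]) (intro continuous_intros)
next
  assume i: "\<forall>i. (\<lambda>x. f x $ i) \<in> borel_measurable lborel"
  have "f = (\<lambda>x. \<Sum>i\<in>UNIV. axis i (f x $ i))"
  proof (intro ext, subst vec_eq_iff, rule allI)
    fix x k
    have "(\<Sum>i\<in>UNIV. axis i (f x $ i)) $ k = (\<Sum>i\<in>UNIV. if i = k then f x $ i else 0)"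
      unfolding sum_component by (rule sum.cong) (auto simp: axis_def)
    then show "f x $ k = (\<Sum>i\<in>UNIV. axis i (f x $ i)) $ k" by simp
  qed
  moreover
  have "(\<lambda>x. axis i (f x $ i) :: 'b^'m) \<in> borel_measurable lborel" for i
  proof (rule borel_measurable_continuous_on[of "axis i"])
    show "continuous_on UNIV (axis i :: 'b \<Rightarrow> 'b^'m)"
      unfolding axis_def
    proof (intro continuous_on_vec_lambda)
      show "continuous_on UNIV (\<lambda>x :: 'b. if k = i then x else 0)" for k by (cases "k = i") simp_all
    qed
    show "(\<lambda>x. f x $ i) \<in> borel_measurable lborel" using i by blast
  qed
  then have "(\<lambda>x. \<Sum>i\<in>UNIV. axis i (f x $ i)) \<in> borel_measurable lborel" by (intro borel_measurable_sum)
  ultimately show "f \<in> borel_measurable lborel" by (simp only:)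
qed

lemma L2_vec_iff:
  fixes f :: "'a::euclidean_space \<Rightarrow> 'b::euclidean_space^'m"
  shows "L2 f \<longleftrightarrow> (\<forall>i. L2 (\<lambda>x. f x $ i))"
proof
  assume "L2 f" then show "\<forall>i. L2 (\<lambda>x. f x $ i)"
    by (intro allI L2_linear[of "\<lambda>x. x $ _"]) (auto simp: bounded_linear_vec_nth)
next
  assume i: "\<forall>i. L2 (\<lambda>x. f x $ i)"
  then have m: "f \<in> borel_measurable lborel" unfolding borel_measurable_vec_iff using L2_measurable by blast
  have "nsq f < \<infinity>" unfolding nsq_vec[OF m] using i by (auto simp: L2_iff_nsq)
  with m show "L2 f" by (simp add: L2_iff_nsq)
qed

section \<open>Uniqueness of weak derivatives\<close>

text \<open>The positive and negative parts define measures that agree on boxes. Boxes are stable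
  under intersection, generate the Borel sets, and exhaust the space with finite mass, so the
  measures and hence the densities coincide. Only local integrability enters, as \<open>h\<close>
  will merely be in L2.\<close>

lemma AE_zero_of_box_integrals:
  fixes h :: "'a::euclidean_space \<Rightarrow> real"
  assumes [measurable]: "h \<in> borel_measurable lborel"
    and int: "\<And>a b. integrable lborel (\<lambda>x. indicator (box a b) x * h x)"
    and zero: "\<And>a b. (\<integral>x. indicator (box a b) x * h x \<partial>lborel) = 0"
  shows "AE x in lborel. h x = 0"
proof -
  define p where "p x = max 0 (h x)" for x
  define n where "n x = max 0 (- h x)" for x
  have [measurable]: "p \<in> borel_measurable lborel" "n \<in> borel_measurable lborel" by (auto simp: p_def[abs_def] n_def[abs_def])
  have ip: "integrable lborel (\<lambda>x. indicator (box a b) x * p x)" for a b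
    by (rule Bochner_Integration.integrable_bound[OF int[of a b]]) (auto simp: p_def indicator_def)
  have im: "integrable lborel (\<lambda>x. indicator (box a b) x * n x)" for a b
    by (rule Bochner_Integration.integrable_bound[OF int[of a b]]) (auto simp: n_def indicator_def)
  have ep: "emeasure (density lborel (\<lambda>x. ennreal (p x))) (box a b) = ennreal (\<integral>x. indicator (box a b) x * p x \<partial>lborel)" for a b
  proof -
    have "emeasure (density lborel (\<lambda>x. ennreal (p x))) (box a b) = (\<integral>\<^sup>+x. ennreal (indicator (box a b) x * p x) \<partial>lborel)"
      by (subst emeasure_density) (auto intro!: nn_integral_cong simp: indicator_def)
    also have "\<dots> = ennreal (\<integral>x. indicator (box a b) x * p x \<partial>lborel)"
      by (rule nn_integral_eq_integral[OF ip]) (simp add: p_def)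
    finally show ?thesis .
  qed
  have em: "emeasure (density lborel (\<lambda>x. ennreal (n x))) (box a b) = ennreal (\<integral>x. indicator (box a b) x * n x \<partial>lborel)" for a b
  proof -
    have "emeasure (density lborel (\<lambda>x. ennreal (n x))) (box a b) = (\<integral>\<^sup>+x. ennreal (indicator (box a b) x * n x) \<partial>lborel)"
      by (subst emeasure_density) (auto intro!: nn_integral_cong simp: indicator_def)
    also have "\<dots> = ennreal (\<integral>x. indicator (box a b) x * n x \<partial>lborel)"
      by (rule nn_integral_eq_integral[OF im]) (simp add: n_def)
    finally show ?thesis .
  qed
  have eq: "(\<integral>x. indicator (box a b) x * p x \<partial>lborel) = (\<integral>x. indicator (box a b) x * n x \<partial>lborel)" for a b
  proof -
    have "(\<integral>x. indicator (box a b) x * p x \<partial>lborel) - (\<integral>x. indicator (box a b) x * n x \<partial>lborel)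
       = (\<integral>x. indicator (box a b) x * p x - indicator (box a b) x * n x \<partial>lborel)" by (simp add: ip im)
    also have "\<dots> = (\<integral>x. indicator (box a b) x * h x \<partial>lborel)"
      by (rule Bochner_Integration.integral_cong) (auto simp: p_def n_def max_def indicator_def)
    finally show ?thesis using zero by simp
  qed
  have "density lborel (\<lambda>x. ennreal (p x)) = density lborel (\<lambda>x. ennreal (n x))"
  proof (rule measure_eqI_generator_eq)
    let ?E = "range (\<lambda>(a, b). box a b :: 'a set)"
    let ?A = "\<lambda>n::nat. box (- (real n *\<^sub>R One)) (real n *\<^sub>R One) :: 'a set"
    show "Int_stable ?E" by (auto simp: Int_stable_def box_Int_box)
    show "?E \<subseteq> Pow UNIV" by simp
    show "sets (density lborel (\<lambda>x. ennreal (p x))) = sigma_sets UNIV ?E"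
      "sets (density lborel (\<lambda>x. ennreal (n x))) = sigma_sets UNIV ?E" by (simp_all add: borel_eq_box)
    show "range ?A \<subseteq> ?E" "(\<Union>i. ?A i) = UNIV" unfolding UN_box_eq_UNIV by auto
    show "emeasure (density lborel (\<lambda>x. ennreal (p x))) (?A i) \<noteq> \<infinity>" for i by (simp add: ep)
    show "emeasure (density lborel (\<lambda>x. ennreal (p x))) X = emeasure (density lborel (\<lambda>x. ennreal (n x))) X"
      if "X \<in> ?E" for X using that by (auto simp: ep em eq)
  qed
  then have "AE x in lborel. ennreal (p x) = ennreal (n x)"
    by (intro sigma_finite_measure.density_unique[OF sigma_finite_lborel]) auto
  then show ?thesis
  proof eventually_elim
    case (elim x)
    then have "p x = n x" by (subst (asm) ennreal_inj) (auto simp: p_def n_def)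
    then show ?case by (auto simp: p_def n_def max_def split: if_splits)
  qed
qed

text \<open>The fundamental lemma of the calculus of variations: indicators of boxes are dominated
  limits of test functions.\<close>

lemma AE_zero_of_test_functions:
  fixes g :: "real^'n::finite \<Rightarrow> real^'m"
  assumes g: "L2 g" and zero: "\<And>\<phi>. test_function \<phi> \<Longrightarrow> (\<integral>x. \<phi> x *\<^sub>R g x \<partial>lborel) = 0"
  shows "AE x in lborel. g x = 0"
proof -
  have gm: "g \<in> borel_measurable lborel" using g by (rule L2_measurable)
  have "AE x in lborel. g x $ i = 0" for i
  proof (rule AE_zero_of_box_integrals)
    have gi: "L2 (\<lambda>x. g x $ i)" using g by (simp add: L2_vec_iff)
    then show gim: "(\<lambda>x. g x $ i) \<in> borel_measurable lborel" by (rule L2_measurable)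
    fix a b :: "real^'n"
    obtain r where "\<forall>x\<in>box a b. norm x \<le> r" using bounded_box[of a b] unfolding bounded_iff by blast
    then have r: "indicator (box a b) x = (0::real)" if "x \<notin> cball 0 r" for x using that by (auto simp: indicator_def)
    have L: "L2 (\<lambda>x. indicator (box a b) x :: real)"
      by (rule L2_bounded_support[of _ 1 r]) (use r in \<open>auto simp: indicator_def\<close>)
    show int: "integrable lborel (\<lambda>x. indicator (box a b) x * g x $ i)"
      using integrable_scaleR_L2(1)[OF L gi] by simp
    obtain \<phi> where \<phi>: "\<And>k::nat. test_function (\<phi> k)" "\<And>k x. 0 \<le> \<phi> k x" "\<And>k x. \<phi> k x \<le> indicator (box a b) x"
        "\<And>x. (\<lambda>k. \<phi> k x) \<longlonglongrightarrow> indicator (box a b) x" using box_approximation[of a b] by blast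
    have "(\<lambda>k. \<integral>x. \<phi> k x * g x $ i \<partial>lborel) \<longlonglongrightarrow> (\<integral>x. indicator (box a b) x * g x $ i \<partial>lborel)"
    proof (rule integral_dominated_convergence[where w = "\<lambda>x. norm (indicator (box a b) x * g x $ i)"])
      show "(\<lambda>x. \<phi> k x * g x $ i) \<in> borel_measurable lborel" for k
        using smooth_measurable[OF test_function_smooth[OF \<phi>(1)]] gim by simp
      show "AE x in lborel. (\<lambda>k. \<phi> k x * g x $ i) \<longlonglongrightarrow> indicator (box a b) x * g x $ i"
        by (intro AE_I2 tendsto_intros \<phi>(4))
      show "AE x in lborel. norm (\<phi> k x * g x $ i) \<le> norm (indicator (box a b) x * g x $ i)" for k
        using \<phi>(2,3)[of k] by (intro AE_I2) (auto simp: abs_mult intro!: mult_right_mono)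
    qed (use int gim in auto)
    moreover have "(\<integral>x. \<phi> k x * g x $ i \<partial>lborel) = 0" for k
    proof -
      have "(\<integral>x. \<phi> k x *\<^sub>R g x \<partial>lborel) $ i = (\<integral>x. (\<phi> k x *\<^sub>R g x) $ i \<partial>lborel)"
        by (rule integral_bounded_linear[OF bounded_linear_vec_nth test_function_scaleR_integrable[OF \<phi>(1) g], symmetric])
      then show ?thesis using zero[OF \<phi>(1)] by simp
    qed
    ultimately show "(\<integral>x. indicator (box a b) x * g x $ i \<partial>lborel) = 0" by (simp add: LIMSEQ_const_iff)
  qed
  then have "AE x in lborel. \<forall>i\<in>UNIV. g x $ i = 0" by (intro AE_finite_allI) auto
  then show ?thesis by eventually_elim (simp add: vec_eq_iff)
qed

lemma weak_pds_unique:
  fixes f g g' :: "real^'n::finite \<Rightarrow> real^'m"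
  assumes "L2 g" "L2 g'" "has_weak_pds js f g" "has_weak_pds js f g'"
  shows "AE x in lborel. g x = g' x"
proof -
  have "AE x in lborel. g x - g' x = 0"
  proof (rule AE_zero_of_test_functions[OF L2_diff[OF assms(1,2)]])
    fix \<phi> :: "real^'n \<Rightarrow> real" assume \<phi>: "test_function \<phi>"
    have "(-1) ^ length js *\<^sub>R (\<integral>x. \<phi> x *\<^sub>R g x \<partial>lborel) = (-1) ^ length js *\<^sub>R (\<integral>x. \<phi> x *\<^sub>R g' x \<partial>lborel)"
      using assms(3)[unfolded has_weak_pds_def, rule_format, OF \<phi>]
        assms(4)[unfolded has_weak_pds_def, rule_format, OF \<phi>] by (rule trans[OF sym])
    then have "(\<integral>x. \<phi> x *\<^sub>R g x \<partial>lborel) = (\<integral>x. \<phi> x *\<^sub>R g' x \<partial>lborel)" by simp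
    then show "(\<integral>x. \<phi> x *\<^sub>R (g x - g' x) \<partial>lborel) = 0"
      by (simp add: scaleR_diff_right test_function_scaleR_integrable[OF \<phi> assms(1)]
          test_function_scaleR_integrable[OF \<phi> assms(2)])
  qed
  then show ?thesis by simp
qed

text \<open>\<open>weak_pds\<close> is an arbitrary choice among weak derivatives; by uniqueness
  almost everywhere its norm can be computed from any of them.\<close>

lemma nsq_weak_pds:
  fixes f g :: "real^'n::finite \<Rightarrow> real^'m"
  assumes "L2 g" "has_weak_pds js f g"
  shows "L2 (weak_pds js f)" "has_weak_pds js f (weak_pds js f)" "nsq (weak_pds js f) = nsq g"
proof -
  have "L2 (weak_pds js f) \<and> has_weak_pds js f (weak_pds js f)"
    unfolding weak_pds_def by (rule someI[of _ g]) (use assms in simp)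
  then show 1: "L2 (weak_pds js f)" "has_weak_pds js f (weak_pds js f)" by blast+
  show "nsq (weak_pds js f) = nsq g" by (rule nsq_cong_AE[OF weak_pds_unique[OF 1(1) assms(1) 1(2) assms(2)]])
qed

section \<open>The Fourier transform of scalar functions\<close>

text \<open>The sign s = -1 gives the transform used in \<open>fourier\<close>, s = 1 the inverse
  transform without its factor (2 pi)^-n; Bessel's inequality and the pairing identity are thus
  proved once for both.\<close>

definition ft :: "real \<Rightarrow> ('a::euclidean_space \<Rightarrow> complex) \<Rightarrow> 'a \<Rightarrow> complex" where
  "ft s f \<xi> = (\<integral>x. cis (s * (x \<bullet> \<xi>)) * f x \<partial>lborel)"

lemma measurable_cis [measurable (raw)]:
  "\<theta> \<in> borel_measurable M \<Longrightarrow> (\<lambda>x. cis (\<theta> x)) \<in> borel_measurable M"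
  by (rule borel_measurable_continuous_on[of cis]) (auto intro!: continuous_intros)

lemma cis_mult_integrable:
  assumes "integrable lborel f" and [measurable]: "\<theta> \<in> borel_measurable lborel"
  shows "integrable lborel (\<lambda>x. cis (\<theta> x) * f x)"
proof -
  have [measurable]: "f \<in> borel_measurable lborel" using assms(1) by simp
  show ?thesis by (rule Bochner_Integration.integrable_bound[OF assms(1)]) (auto simp: norm_mult)
qed

lemma ft_bound: "norm (ft s f \<xi>) \<le> (\<integral>x. norm (f x) \<partial>lborel)"
proof -
  have "norm (ft s f \<xi>) \<le> (\<integral>x. norm (cis (s * (x \<bullet> \<xi>)) * f x) \<partial>lborel)"
    unfolding ft_def by (rule integral_norm_bound)
  then show ?thesis by (simp add: norm_mult)
qed

lemma ft_continuous:
  assumes f: "integrable lborel f"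
  shows "continuous_on UNIV (ft s f)"
  unfolding continuous_on_sequentially
proof (intro ballI allI impI)
  fix X :: "nat \<Rightarrow> 'a" and a :: 'a
  assume X: "(\<forall>n. X n \<in> UNIV) \<and> X \<longlonglongrightarrow> a"
  have [measurable]: "f \<in> borel_measurable lborel" using f by simp
  have "(\<lambda>n. \<integral>x. cis (s * (x \<bullet> X n)) * f x \<partial>lborel) \<longlonglongrightarrow> (\<integral>x. cis (s * (x \<bullet> a)) * f x \<partial>lborel)"
  proof (rule integral_dominated_convergence[where w = "\<lambda>x. norm (f x)"])
    show "AE x in lborel. (\<lambda>n. cis (s * (x \<bullet> X n)) * f x) \<longlonglongrightarrow> cis (s * (x \<bullet> a)) * f x"
    proof (rule AE_I2)
      fix x
      show "(\<lambda>n. cis (s * (x \<bullet> X n)) * f x) \<longlonglongrightarrow> cis (s * (x \<bullet> a)) * f x"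
        using X by (intro tendsto_intros) auto
    qed
  qed (use f in \<open>auto simp: norm_mult\<close>)
  then show "(ft s f \<circ> X) \<longlonglongrightarrow> ft s f a" by (simp add: o_def ft_def)
qed

lemma ft_measurable: "integrable lborel f \<Longrightarrow> ft s f \<in> borel_measurable lborel"
  using borel_measurable_continuous_onI[OF ft_continuous] by simp

lemma ft_cnj: "ft (- s) (\<lambda>x. cnj (f x)) \<xi> = cnj (ft s f \<xi>)"
proof -
  have "cnj (ft s f \<xi>) = (\<integral>x. cnj (cis (s * (x \<bullet> \<xi>)) * f x) \<partial>lborel)"
    unfolding ft_def by (rule Bochner_Integration.integral_cnj[symmetric])
  then show ?thesis unfolding ft_def by (simp add: cis_cnj)
qed

lemma ft_diff:
  assumes "integrable lborel f" "integrable lborel g"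
  shows "ft s (\<lambda>x. f x - g x) \<xi> = ft s f \<xi> - ft s g \<xi>"
  unfolding ft_def by (simp add: right_diff_distrib cis_mult_integrable assms)

text \<open>A phase has modulus 1, so the double integrand is dominated by the product of two
  integrable functions. The general phase \<open>\<theta>\<close> covers both signs of the kernel
  and both orders of its arguments.\<close>

lemma fubini_phase:
  fixes F :: "'b::euclidean_space \<Rightarrow> complex" and w :: "'a::euclidean_space \<Rightarrow> complex"
  assumes F: "integrable lborel F" and w: "integrable lborel w"
    and \<theta>: "(\<lambda>p. \<theta> (fst p) (snd p)) \<in> borel_measurable (lborel \<Otimes>\<^sub>M lborel)"
  shows "(\<integral>\<xi>. w \<xi> * (\<integral>x. cis (\<theta> x \<xi>) * F x \<partial>lborel) \<partial>lborel) = (\<integral>x. F x * (\<integral>\<xi>. cis (\<theta> x \<xi>) * w \<xi> \<partial>lborel) \<partial>lborel)"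
proof -
  have [measurable]: "F \<in> borel_measurable lborel" "w \<in> borel_measurable lborel" using F w by simp_all
  note \<theta>[measurable]
  have \<theta>2: "\<theta> x \<in> borel_measurable lborel" for x
    using measurable_compose_Pair1[OF _ \<theta>, of x] by simp
  define G where "G = (\<lambda>(x, \<xi>). w \<xi> * (cis (\<theta> x \<xi>) * F x))"
  have Gm: "G \<in> borel_measurable (lborel \<Otimes>\<^sub>M lborel)" unfolding G_def case_prod_beta by measurable
  have "integrable (lborel \<Otimes>\<^sub>M lborel) G"
  proof (rule lborel_pair.Fubini_integrable[OF Gm])
    have "(\<lambda>x. \<integral>\<xi>. norm (G (x, \<xi>)) \<partial>lborel) = (\<lambda>x. (\<integral>\<xi>. norm (w \<xi>) \<partial>lborel) * norm (F x))"
      by (simp add: G_def norm_mult)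
    then show "integrable lborel (\<lambda>x. \<integral>\<xi>. norm (G (x, \<xi>)) \<partial>lborel)" using F by simp
    show "AE x in lborel. integrable lborel (\<lambda>\<xi>. G (x, \<xi>))"
    proof (rule AE_I2)
      fix x
      have "integrable lborel (\<lambda>\<xi>. (cis (\<theta> x \<xi>) * w \<xi>) * F x)"
        by (rule integrable_mult_left[OF cis_mult_integrable[OF w \<theta>2]])
      then show "integrable lborel (\<lambda>\<xi>. G (x, \<xi>))" by (simp add: G_def mult_ac)
    qed
  qed
  then have "(\<integral>\<xi>. (\<integral>x. w \<xi> * (cis (\<theta> x \<xi>) * F x) \<partial>lborel) \<partial>lborel) = (\<integral>x. (\<integral>\<xi>. w \<xi> * (cis (\<theta> x \<xi>) * F x) \<partial>lborel) \<partial>lborel)"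
    unfolding G_def by (rule lborel_pair.Fubini_integral)
  moreover have "(\<integral>\<xi>. w \<xi> * (cis (\<theta> x \<xi>) * F x) \<partial>lborel) = F x * (\<integral>\<xi>. cis (\<theta> x \<xi>) * w \<xi> \<partial>lborel)" for x
    by (subst integral_mult_right_zero[symmetric]) (simp add: mult_ac)
  ultimately show ?thesis by simp
qed

lemma integral_affine:
  fixes f :: "'a::euclidean_space \<Rightarrow> 'b::euclidean_space"
  assumes c: "c \<noteq> 0" and [measurable]: "f \<in> borel_measurable borel"
  shows "(\<integral>x. f x \<partial>lborel) = \<bar>c\<bar> ^ DIM('a) *\<^sub>R (\<integral>x. f (t + c *\<^sub>R x) \<partial>lborel)"
proof -
  have "(\<integral>x. f x \<partial>lborel) = (\<integral>x. f x \<partial>(density (distr lborel borel (\<lambda>x. t + c *\<^sub>R x)) (\<lambda>_. ennreal (\<bar>c\<bar> ^ DIM('a)))))"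
    by (subst lborel_affine[OF c, of t]) (simp add: ennreal_power)
  also have "\<dots> = (\<integral>x. \<bar>c\<bar> ^ DIM('a) *\<^sub>R f x \<partial>(distr lborel borel (\<lambda>x. t + c *\<^sub>R x)))"
    by (rule integral_density) auto
  also have "\<dots> = (\<integral>x. \<bar>c\<bar> ^ DIM('a) *\<^sub>R f (t + c *\<^sub>R x) \<partial>lborel)"
    by (rule integral_distr) auto
  finally show ?thesis by simp
qed

lemma nn_integral_affine:
  fixes f :: "'a::euclidean_space \<Rightarrow> ennreal"
  assumes c: "c \<noteq> 0" and [measurable]: "f \<in> borel_measurable borel"
  shows "(\<integral>\<^sup>+x. f x \<partial>lborel) = ennreal (\<bar>c\<bar> ^ DIM('a)) * (\<integral>\<^sup>+x. f (t + c *\<^sub>R x) \<partial>lborel)"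
proof -
  have "(\<integral>\<^sup>+x. f x \<partial>lborel) = (\<integral>\<^sup>+x. f x \<partial>(density (distr lborel borel (\<lambda>x. t + c *\<^sub>R x)) (\<lambda>_. ennreal (\<bar>c\<bar> ^ DIM('a)))))"
    by (subst lborel_affine[OF c, of t]) (simp add: ennreal_power)
  also have "\<dots> = (\<integral>\<^sup>+x. ennreal (\<bar>c\<bar> ^ DIM('a)) * f x \<partial>(distr lborel borel (\<lambda>x. t + c *\<^sub>R x)))"
    by (rule nn_integral_density) auto
  also have "\<dots> = (\<integral>\<^sup>+x. ennreal (\<bar>c\<bar> ^ DIM('a)) * f (t + c *\<^sub>R x) \<partial>lborel)"
    by (rule nn_integral_distr) auto
  also have "\<dots> = ennreal (\<bar>c\<bar> ^ DIM('a)) * (\<integral>\<^sup>+x. f (t + c *\<^sub>R x) \<partial>lborel)"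
    by (rule nn_integral_cmult) auto
  finally show ?thesis .
qed

section \<open>Gaussians, their transforms and the associated approximate identity\<close>

definition gaussian :: "'a::euclidean_space \<Rightarrow> real" where
  "gaussian x = exp (- (norm x)\<^sup>2 / 2)"

lemma gaussian_bounds [simp]: "0 < gaussian x" "0 \<le> gaussian x" "gaussian x \<le> 1"
  by (simp_all add: gaussian_def)

lemma gaussian_measurable [measurable]: "gaussian \<in> borel_measurable borel"
  unfolding gaussian_def[abs_def] by measurable

lemma gaussian_product: "complex_of_real (gaussian x) * cis (z \<bullet> x) =
    (\<Prod>b\<in>Basis. cis ((z \<bullet> b) * (x \<bullet> b)) * complex_of_real (exp (- (x \<bullet> b)\<^sup>2 / 2)))"
proof -
  have "gaussian x = (\<Prod>b\<in>Basis. exp (- (x \<bullet> b)\<^sup>2 / 2))"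
    unfolding gaussian_def power2_norm_eq_inner
    by (subst euclidean_inner) (simp add: exp_sum[symmetric] sum_negf sum_divide_distrib power2_eq_square)
  moreover have "cis (z \<bullet> x) = (\<Prod>b\<in>Basis. cis ((z \<bullet> b) * (x \<bullet> b)))"
    unfolding cis_conv_exp by (subst euclidean_inner) (simp add: exp_sum[symmetric] sum_distrib_left)
  ultimately show ?thesis by (simp add: prod.distrib mult.commute)
qed

text \<open>Both facts are read off the characteristic function of the standard normal distribution,
  rescaled by sqrt(2 pi).\<close>

lemma gaussian_1d:
  "integrable lborel (\<lambda>x. cis (t * x) * complex_of_real (exp (- x\<^sup>2 / 2)))"
  "(\<integral>x. cis (t * x) * complex_of_real (exp (- x\<^sup>2 / 2)) \<partial>lborel) = complex_of_real (sqrt (2 * pi) * exp (- t\<^sup>2 / 2))"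
proof -
  have d: "exp (- x\<^sup>2 / 2) = sqrt (2 * pi) * std_normal_density x" for x :: real
    by (simp add: std_normal_density_def)
  have "integrable lborel (\<lambda>x. complex_of_real (exp (- x\<^sup>2 / 2)))"
    unfolding d complex_of_real_integrable_eq by (intro integrable_mult_right integrable_normal_density) simp
  then show "integrable lborel (\<lambda>x. cis (t * x) * complex_of_real (exp (- x\<^sup>2 / 2)))"
    by (rule cis_mult_integrable) simp
  have "complex_of_real (exp (- t\<^sup>2 / 2)) = char std_normal_distribution t"
    by (simp add: char_std_normal_distribution)
  also have "\<dots> = (\<integral>x. std_normal_density x *\<^sub>R exp (\<i> * complex_of_real (t * x)) \<partial>lborel)"
    unfolding char_def by (subst integral_density) auto
  finally have "complex_of_real (sqrt (2 * pi)) * complex_of_real (exp (- t\<^sup>2 / 2))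
      = complex_of_real (sqrt (2 * pi)) * (\<integral>x. std_normal_density x *\<^sub>R exp (\<i> * complex_of_real (t * x)) \<partial>lborel)" by (rule arg_cong)
  also have "\<dots> = (\<integral>x. complex_of_real (sqrt (2 * pi)) * (std_normal_density x *\<^sub>R exp (\<i> * complex_of_real (t * x))) \<partial>lborel)"
    by (rule integral_mult_right_zero[symmetric])
  also have "\<dots> = (\<integral>x. cis (t * x) * complex_of_real (exp (- x\<^sup>2 / 2)) \<partial>lborel)"
    unfolding d by (rule Bochner_Integration.integral_cong) (simp_all add: cis_conv_exp scaleR_conv_of_real mult_ac)
  finally show "(\<integral>x. cis (t * x) * complex_of_real (exp (- x\<^sup>2 / 2)) \<partial>lborel) = complex_of_real (sqrt (2 * pi) * exp (- t\<^sup>2 / 2))"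
    by simp
qed

lemma lborel_integral_product:
  fixes f :: "'a::euclidean_space \<Rightarrow> real \<Rightarrow> complex"
  assumes "\<And>b. b \<in> Basis \<Longrightarrow> integrable lborel (f b)"
  shows "integrable lborel (\<lambda>x. \<Prod>b\<in>Basis. f b (x \<bullet> b))"
    "(\<integral>x. (\<Prod>b\<in>Basis. f b (x \<bullet> b)) \<partial>lborel) = (\<Prod>b\<in>Basis. \<integral>x. f b x \<partial>lborel)"
proof -
  interpret product_sigma_finite "\<lambda>_::'a. lborel :: real measure" by standard
  have fm[measurable]: "b \<in> Basis \<Longrightarrow> f b \<in> borel_measurable borel" for b using assms[of b] by (auto dest: borel_measurable_integrable)
  have T: "(\<lambda>f. \<Sum>b\<in>Basis. f b *\<^sub>R b) \<in> (\<Pi>\<^sub>M b\<in>(Basis::'a set). lborel) \<rightarrow>\<^sub>M borel" by measurable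
  have m: "(\<lambda>x. \<Prod>b\<in>Basis. f b (x \<bullet> b)) \<in> borel_measurable borel" by measurable
  have s: "(\<Prod>b\<in>Basis. f b ((\<Sum>c\<in>Basis. g c *\<^sub>R c) \<bullet> b)) = (\<Prod>b\<in>Basis. f b (g b))" for g :: "'a \<Rightarrow> real"
    by (rule prod.cong) (auto simp: inner_sum_left_Basis)
  show "integrable lborel (\<lambda>x. \<Prod>b\<in>Basis. f b (x \<bullet> b))"
    by (subst lborel_eq, subst integrable_distr_eq[OF T m], unfold s)
       (rule product_integrable_prod[OF finite_Basis assms])
  show "(\<integral>x. (\<Prod>b\<in>Basis. f b (x \<bullet> b)) \<partial>lborel) = (\<Prod>b\<in>Basis. \<integral>x. f b x \<partial>lborel)"
    by (subst lborel_eq, subst integral_distr[OF T m], unfold s)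
       (rule product_integral_prod[OF finite_Basis assms])
qed

lemma gaussian_fourier:
  "integrable lborel (\<lambda>x :: 'a::euclidean_space. complex_of_real (gaussian x) * cis (z \<bullet> x))"
  "(\<integral>x. complex_of_real (gaussian x) * cis (z \<bullet> x) \<partial>lborel) = complex_of_real (sqrt (2 * pi) ^ DIM('a) * gaussian (z :: 'a))"
proof -
  show "integrable lborel (\<lambda>x :: 'a. complex_of_real (gaussian x) * cis (z \<bullet> x))"
    unfolding gaussian_product by (intro lborel_integral_product gaussian_1d)
  have "(\<integral>x. complex_of_real (gaussian x) * cis (z \<bullet> x) \<partial>lborel)
     = (\<Prod>b\<in>Basis. \<integral>x. cis ((z \<bullet> b) * x) * complex_of_real (exp (- x\<^sup>2 / 2)) \<partial>lborel)"
    unfolding gaussian_product by (intro lborel_integral_product gaussian_1d)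
  also have "\<dots> = complex_of_real (\<Prod>b\<in>Basis. sqrt (2 * pi) * exp (- (z \<bullet> b)\<^sup>2 / 2))"
    by (simp only: gaussian_1d(2) of_real_prod)
  also have "(\<Prod>b\<in>Basis. sqrt (2 * pi) * exp (- (z \<bullet> b)\<^sup>2 / 2)) = sqrt (2 * pi) ^ DIM('a) * gaussian z"
  proof -
    have "gaussian z = (\<Prod>b\<in>Basis. exp (- (z \<bullet> b)\<^sup>2 / 2))"
      unfolding gaussian_def power2_norm_eq_inner
      by (subst euclidean_inner) (simp add: exp_sum[symmetric] sum_negf sum_divide_distrib power2_eq_square)
    then show ?thesis by (simp add: prod.distrib)
  qed
  finally show "(\<integral>x. complex_of_real (gaussian x) * cis (z \<bullet> x) \<partial>lborel) = complex_of_real (sqrt (2 * pi) ^ DIM('a) * gaussian z)" .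
qed

lemma gaussian_integral:
  "integrable lborel (gaussian :: 'a::euclidean_space \<Rightarrow> real)"
  "(\<integral>x. gaussian (x :: 'a) \<partial>lborel) = sqrt (2 * pi) ^ DIM('a)"
  "(\<integral>\<^sup>+x. ennreal (gaussian (x :: 'a)) \<partial>lborel) = ennreal (sqrt (2 * pi) ^ DIM('a))"
proof -
  have "integrable lborel (\<lambda>x :: 'a. complex_of_real (gaussian x))" using gaussian_fourier(1)[of 0] by simp
  then show i: "integrable lborel (gaussian :: 'a \<Rightarrow> real)" by (simp only: complex_of_real_integrable_eq)
  have "complex_of_real (\<integral>x. gaussian (x :: 'a) \<partial>lborel) = complex_of_real (sqrt (2 * pi) ^ DIM('a))"
    using gaussian_fourier(2)[of "0 :: 'a"] by (simp add: gaussian_def)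
  then show e: "(\<integral>x. gaussian (x :: 'a) \<partial>lborel) = sqrt (2 * pi) ^ DIM('a)" by (simp only: of_real_eq_iff)
  show "(\<integral>\<^sup>+x. ennreal (gaussian (x :: 'a)) \<partial>lborel) = ennreal (sqrt (2 * pi) ^ DIM('a))"
    using nn_integral_eq_integral[OF i] e by simp
qed

lemma gaussian_scale_integrable:
  assumes "e \<noteq> 0" shows "integrable lborel (\<lambda>x :: 'a::euclidean_space. gaussian (e *\<^sub>R x))"
proof (rule integrableI_bounded)
  have "ennreal (sqrt (2 * pi) ^ DIM('a)) = ennreal (\<bar>e\<bar> ^ DIM('a)) * (\<integral>\<^sup>+x. ennreal (gaussian (0 + e *\<^sub>R x :: 'a)) \<partial>lborel)"
    unfolding gaussian_integral(3)[symmetric] by (rule nn_integral_affine[OF assms]) simp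
  then have "ennreal (\<bar>e\<bar> ^ DIM('a)) * (\<integral>\<^sup>+x. ennreal (gaussian (e *\<^sub>R x :: 'a)) \<partial>lborel) = ennreal (sqrt (2 * pi) ^ DIM('a))"
    by simp
  then have "ennreal (\<bar>e\<bar> ^ DIM('a)) * (\<integral>\<^sup>+x. ennreal (gaussian (e *\<^sub>R x :: 'a)) \<partial>lborel) < \<infinity>"
    by (simp only: ennreal_less_top infinity_ennreal_def)
  then show "(\<integral>\<^sup>+x. ennreal (norm (gaussian (e *\<^sub>R x :: 'a))) \<partial>lborel) < \<infinity>"
    using assms by (auto simp: ennreal_mult_less_top)
qed simp

text \<open>The transform of the regularising factor \<open>gaussian (e *\<^sub>R \<xi>)\<close>: a
  heat kernel concentrating at the origin as e tends to 0. Its mass is (2 pi)^d rather than 1, and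
  this is the source of that constant in Bessel's inequality and in the pairing identity.\<close>

definition heat :: "real \<Rightarrow> 'a::euclidean_space \<Rightarrow> real" where
  "heat e z = (sqrt (2 * pi) / e) ^ DIM('a) * gaussian ((1 / e) *\<^sub>R z)"

lemma heat_nonneg: "e > 0 \<Longrightarrow> heat e z \<ge> 0"
  by (simp add: heat_def)

lemma heat_fourier:
  assumes e: "e > 0" and s: "s = 1 \<or> s = -1"
  shows "(\<integral>\<xi>. cis (s * (z \<bullet> \<xi>)) * complex_of_real (gaussian (e *\<^sub>R \<xi>)) \<partial>lborel) = complex_of_real (heat e (z :: 'a::euclidean_space))"
proof -
  define g where "g x = complex_of_real (gaussian x) * cis (((s / e) *\<^sub>R z) \<bullet> x)" for x
  have [measurable]: "g \<in> borel_measurable borel" unfolding g_def[abs_def] by measurable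
  have "complex_of_real (sqrt (2 * pi) ^ DIM('a) * gaussian ((s / e) *\<^sub>R z)) = (\<integral>x. g x \<partial>lborel)"
    unfolding g_def by (rule gaussian_fourier(2)[symmetric])
  also have "\<dots> = \<bar>e\<bar> ^ DIM('a) *\<^sub>R (\<integral>x. g (0 + e *\<^sub>R x) \<partial>lborel)"
    by (rule integral_affine) (use e in auto)
  also have "(\<lambda>x. g (0 + e *\<^sub>R x)) = (\<lambda>\<xi>. cis (s * (z \<bullet> \<xi>)) * complex_of_real (gaussian (e *\<^sub>R \<xi>)))"
    using e by (simp add: g_def mult.commute)
  finally have "complex_of_real (sqrt (2 * pi) ^ DIM('a) * gaussian ((s / e) *\<^sub>R z)) =
      complex_of_real (e ^ DIM('a)) * (\<integral>\<xi>. cis (s * (z \<bullet> \<xi>)) * complex_of_real (gaussian (e *\<^sub>R \<xi>)) \<partial>lborel)"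
    using e by (simp add: scaleR_conv_of_real)
  moreover have "gaussian ((s / e) *\<^sub>R z) = gaussian ((1 / e) *\<^sub>R z)" using s by (auto simp: gaussian_def)
  ultimately show ?thesis using e by (simp add: heat_def power_divide field_simps)
qed

lemma heat_mass:
  fixes x :: "'a::euclidean_space"
  assumes e: "e > 0"
  shows "(\<integral>\<^sup>+y. ennreal (heat e (x - y)) \<partial>lborel) = ennreal ((2 * pi) ^ DIM('a))"
    "(\<integral>\<^sup>+y. ennreal (heat e (y - x)) \<partial>lborel) = ennreal ((2 * pi) ^ DIM('a))"
proof -
  have [measurable]: "heat e \<in> borel_measurable (borel :: 'a measure)" unfolding heat_def[abs_def] by measurable
  have "(\<integral>\<^sup>+y. ennreal (heat e (y - x)) \<partial>lborel) = ennreal (\<bar>e\<bar> ^ DIM('a)) * (\<integral>\<^sup>+z. ennreal (heat e ((x + e *\<^sub>R z) - x)) \<partial>lborel)"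
    by (rule nn_integral_affine) (use e in auto)
  also have "\<dots> = ennreal (e ^ DIM('a)) * (\<integral>\<^sup>+z. ennreal ((sqrt (2 * pi) / e) ^ DIM('a)) * ennreal (gaussian (z :: 'a)) \<partial>lborel)"
    using e by (simp add: heat_def ennreal_mult)
  also have "\<dots> = ennreal (e ^ DIM('a)) * (ennreal ((sqrt (2 * pi) / e) ^ DIM('a)) * ennreal (sqrt (2 * pi) ^ DIM('a)))"
    by (simp add: nn_integral_cmult gaussian_integral(3))
  also have "\<dots> = ennreal (e ^ DIM('a) * ((sqrt (2 * pi) / e) ^ DIM('a) * sqrt (2 * pi) ^ DIM('a)))"
    using e by (simp add: ennreal_mult)
  also have "e ^ DIM('a) * ((sqrt (2 * pi) / e) ^ DIM('a) * sqrt (2 * pi) ^ DIM('a)) = (2 * pi) ^ DIM('a)"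
  proof -
    have "e * ((sqrt (2 * pi) / e) * sqrt (2 * pi)) = 2 * pi" using e by simp
    then show ?thesis by (simp only: power_mult_distrib[symmetric])
  qed
  finally show 1: "(\<integral>\<^sup>+y. ennreal (heat e (y - x)) \<partial>lborel) = ennreal ((2 * pi) ^ DIM('a))" .
  have "heat e (x - y) = heat e (y - x)" for y :: 'a
    by (simp add: heat_def gaussian_def norm_minus_commute)
  with 1 show "(\<integral>\<^sup>+y. ennreal (heat e (x - y)) \<partial>lborel) = ennreal ((2 * pi) ^ DIM('a))" by simp
qed

text \<open>The Gaussian factor makes the frequency integrand integrable, so Fubini's theorem
  applies twice. The remaining integral over \<xi>, with the difference x - y in the phase, is the
  heat kernel.\<close>

lemma ft_product_gaussian:
  fixes f g :: "'a::euclidean_space \<Rightarrow> complex"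
  assumes f: "integrable lborel f" and g: "integrable lborel g" and e: "e > 0" and s: "s = 1 \<or> s = -1"
  shows "(\<integral>\<xi>. complex_of_real (gaussian (e *\<^sub>R \<xi>)) * (ft s f \<xi> * ft (- s) g \<xi>) \<partial>lborel)
    = (\<integral>x. f x * (\<integral>y. g y * complex_of_real (heat e (x - y)) \<partial>lborel) \<partial>lborel)"
proof -
  have gi: "integrable lborel (\<lambda>\<xi> :: 'a. complex_of_real (gaussian (e *\<^sub>R \<xi>)))"
    unfolding complex_of_real_integrable_eq using gaussian_scale_integrable[of e] e by simp
  have [measurable]: "ft (- s) g \<in> borel_measurable lborel" by (rule ft_measurable[OF g])
  have wi: "integrable lborel (\<lambda>\<xi>. complex_of_real (gaussian (e *\<^sub>R \<xi>)) * ft (- s) g \<xi>)"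
  proof (rule Bochner_Integration.integrable_bound[OF integrable_mult_right[OF gi, of "complex_of_real (\<integral>x. norm (g x) \<partial>lborel)"]])
    show "AE \<xi> in lborel. norm (complex_of_real (gaussian (e *\<^sub>R \<xi>)) * ft (- s) g \<xi>)
       \<le> norm (complex_of_real (\<integral>x. norm (g x) \<partial>lborel) * complex_of_real (gaussian (e *\<^sub>R \<xi>)))"
      using ft_bound[of "- s" g] by (intro AE_I2) (auto simp: norm_mult mult.commute[of "gaussian _"] intro!: mult_right_mono)
  qed measurable
  have "(\<integral>\<xi>. complex_of_real (gaussian (e *\<^sub>R \<xi>)) * (ft s f \<xi> * ft (- s) g \<xi>) \<partial>lborel)
     = (\<integral>\<xi>. (complex_of_real (gaussian (e *\<^sub>R \<xi>)) * ft (- s) g \<xi>) * (\<integral>x. cis (s * (x \<bullet> \<xi>)) * f x \<partial>lborel) \<partial>lborel)"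
    by (simp add: ft_def[of s] mult_ac)
  also have "\<dots> = (\<integral>x. f x * (\<integral>\<xi>. cis (s * (x \<bullet> \<xi>)) * (complex_of_real (gaussian (e *\<^sub>R \<xi>)) * ft (- s) g \<xi>) \<partial>lborel) \<partial>lborel)"
    by (rule fubini_phase[OF f wi]) measurable
  also have "(\<lambda>x. \<integral>\<xi>. cis (s * (x \<bullet> \<xi>)) * (complex_of_real (gaussian (e *\<^sub>R \<xi>)) * ft (- s) g \<xi>) \<partial>lborel)
     = (\<lambda>x. \<integral>y. g y * complex_of_real (heat e (x - y)) \<partial>lborel)"
  proof (rule ext)
    fix x :: 'a
    have wi2: "integrable lborel (\<lambda>\<xi>. cis (s * (x \<bullet> \<xi>)) * complex_of_real (gaussian (e *\<^sub>R \<xi>)))"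
      by (rule cis_mult_integrable[OF gi]) simp
    have "(\<integral>\<xi>. cis (s * (x \<bullet> \<xi>)) * (complex_of_real (gaussian (e *\<^sub>R \<xi>)) * ft (- s) g \<xi>) \<partial>lborel)
       = (\<integral>\<xi>. (cis (s * (x \<bullet> \<xi>)) * complex_of_real (gaussian (e *\<^sub>R \<xi>))) * (\<integral>y. cis (- s * (y \<bullet> \<xi>)) * g y \<partial>lborel) \<partial>lborel)"
      by (simp add: ft_def mult.assoc)
    also have "\<dots> = (\<integral>y. g y * (\<integral>\<xi>. cis (- s * (y \<bullet> \<xi>)) * (cis (s * (x \<bullet> \<xi>)) * complex_of_real (gaussian (e *\<^sub>R \<xi>))) \<partial>lborel) \<partial>lborel)"
      by (rule fubini_phase[OF g wi2]) measurable
    also have "(\<lambda>y. \<integral>\<xi>. cis (- s * (y \<bullet> \<xi>)) * (cis (s * (x \<bullet> \<xi>)) * complex_of_real (gaussian (e *\<^sub>R \<xi>))) \<partial>lborel)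
       = (\<lambda>y. complex_of_real (heat e (x - y)))"
    proof -
      have "cis (- s * (y \<bullet> \<xi>)) * (cis (s * (x \<bullet> \<xi>)) * G) = cis (s * ((x - y) \<bullet> \<xi>)) * G" for y \<xi> :: 'a and G
      proof -
        have "cis (- s * (y \<bullet> \<xi>)) * cis (s * (x \<bullet> \<xi>)) = cis (s * ((x - y) \<bullet> \<xi>))"
          by (simp add: cis_mult inner_diff_left algebra_simps)
        then show ?thesis by (simp only: mult.assoc[symmetric])
      qed
      then show ?thesis by (simp only: heat_fourier[OF e s])
    qed
    finally show "(\<integral>\<xi>. cis (s * (x \<bullet> \<xi>)) * (complex_of_real (gaussian (e *\<^sub>R \<xi>)) * ft (- s) g \<xi>) \<partial>lborel)
      = (\<integral>y. g y * complex_of_real (heat e (x - y)) \<partial>lborel)" .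
  qed
  finally show ?thesis .
qed

section \<open>Bessel's inequality and Parseval's pairing identity\<close>

lemma ennreal_norm_integral_le: "ennreal (norm (\<integral>x. f x \<partial>M)) \<le> (\<integral>\<^sup>+x. ennreal (norm (f x)) \<partial>M)"
  by (cases "integrable M f") (simp_all add: integral_norm_bound_ennreal not_integrable_integral_eq)

text \<open>With the conjugate of f as second function, the regularised integral of |ft s f|^2
  becomes a double integral of f(x), the conjugate of f(y) and the heat kernel. The
  arithmetic-geometric mean separates x from y, the kernel integrates to (2 pi)^d in either
  variable, and the bound is uniform in the width e.\<close>

lemma ft_bessel:
  fixes f :: "'a::euclidean_space \<Rightarrow> complex"
  assumes f: "integrable lborel f" and s: "s = 1 \<or> s = -1"
  shows "nsq (ft s f) \<le> ennreal ((2 * pi) ^ DIM('a)) * nsq f"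
proof -
  have fm[measurable]: "f \<in> borel_measurable lborel" using f by simp
  have [measurable]: "ft s f \<in> borel_measurable lborel" by (rule ft_measurable[OF f])
  have cf: "integrable lborel (\<lambda>x. cnj (f x))" using f by simp
  define c where "c = ennreal ((2 * pi) ^ DIM('a))"
  have bd: "(\<integral>\<^sup>+\<xi>. ennreal (gaussian (e *\<^sub>R \<xi>) * (norm (ft s f \<xi>))\<^sup>2) \<partial>lborel) \<le> c * nsq f" if e: "e > 0" for e
  proof -
    \<comment> \<open>Half the square, so that |f(x)||f(y)| \<le> h(x) + h(y) and the two halves add
      up to \<open>nsq f\<close> again.\<close>
    define h where "h x = ennreal ((norm (f x))\<^sup>2 / 2)" for x
    have [measurable]: "h \<in> borel_measurable lborel" unfolding h_def[abs_def] by measurable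
    have [measurable]: "heat e \<in> borel_measurable (borel :: 'a measure)" unfolding heat_def[abs_def] by measurable
    have h2: "(\<integral>\<^sup>+x. h x \<partial>lborel) + (\<integral>\<^sup>+x. h x \<partial>lborel) = nsq f"
      unfolding nsq_def h_def
      by (subst nn_integral_add[symmetric]) (auto intro!: nn_integral_cong simp flip: ennreal_plus)
    have gsi: "integrable lborel (\<lambda>\<xi> :: 'a. (\<integral>x. norm (f x) \<partial>lborel)\<^sup>2 * gaussian (e *\<^sub>R \<xi>))"
      using gaussian_scale_integrable[of e] e by (intro integrable_mult_right) simp
    have wi: "integrable lborel (\<lambda>\<xi>. gaussian (e *\<^sub>R \<xi>) * (norm (ft s f \<xi>))\<^sup>2)"
    proof (rule Bochner_Integration.integrable_bound[OF gsi])
      show "AE \<xi> in lborel. norm (gaussian (e *\<^sub>R \<xi>) * (norm (ft s f \<xi>))\<^sup>2) \<le> norm ((\<integral>x. norm (f x) \<partial>lborel)\<^sup>2 * gaussian (e *\<^sub>R \<xi>))"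
        using ft_bound[of s f] by (intro AE_I2) (auto simp: abs_mult mult.commute[of "gaussian _"] intro!: mult_right_mono power_mono)
    qed measurable
    have "(\<integral>\<^sup>+\<xi>. ennreal (gaussian (e *\<^sub>R \<xi>) * (norm (ft s f \<xi>))\<^sup>2) \<partial>lborel) = ennreal (\<integral>\<xi>. gaussian (e *\<^sub>R \<xi>) * (norm (ft s f \<xi>))\<^sup>2 \<partial>lborel)"
      by (rule nn_integral_eq_integral[OF wi]) simp
    also have "\<dots> = ennreal (norm (complex_of_real (\<integral>\<xi>. gaussian (e *\<^sub>R \<xi>) * (norm (ft s f \<xi>))\<^sup>2 \<partial>lborel)))"
      by (simp add: integral_nonneg_AE)
    also have "complex_of_real (\<integral>\<xi>. gaussian (e *\<^sub>R \<xi>) * (norm (ft s f \<xi>))\<^sup>2 \<partial>lborel)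
       = (\<integral>\<xi>. complex_of_real (gaussian (e *\<^sub>R \<xi>)) * (ft s f \<xi> * ft (- s) (\<lambda>x. cnj (f x)) \<xi>) \<partial>lborel)"
      unfolding ft_cnj complex_norm_square[symmetric] by (simp flip: integral_complex_of_real)
    also have "\<dots> = (\<integral>x. f x * (\<integral>y. cnj (f y) * complex_of_real (heat e (x - y)) \<partial>lborel) \<partial>lborel)"
      by (rule ft_product_gaussian[OF f cf e s])
    also have "ennreal (norm \<dots>) \<le> (\<integral>\<^sup>+x. ennreal (norm (f x * (\<integral>y. cnj (f y) * complex_of_real (heat e (x - y)) \<partial>lborel))) \<partial>lborel)"
      by (rule ennreal_norm_integral_le)
    also have "\<dots> \<le> (\<integral>\<^sup>+x. (\<integral>\<^sup>+y. h x * ennreal (heat e (x - y)) + h y * ennreal (heat e (x - y)) \<partial>lborel) \<partial>lborel)"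
    proof (rule nn_integral_mono)
      fix x
      have "ennreal (norm (f x * (\<integral>y. cnj (f y) * complex_of_real (heat e (x - y)) \<partial>lborel)))
         \<le> (\<integral>\<^sup>+y. ennreal (norm (f x * (cnj (f y) * complex_of_real (heat e (x - y))))) \<partial>lborel)"
        by (subst integral_mult_right_zero[symmetric]) (rule ennreal_norm_integral_le)
      also have "\<dots> \<le> (\<integral>\<^sup>+y. h x * ennreal (heat e (x - y)) + h y * ennreal (heat e (x - y)) \<partial>lborel)"
      proof (rule nn_integral_mono)
        fix y
        have "norm (f x * (cnj (f y) * complex_of_real (heat e (x - y)))) = (norm (f x) * norm (f y)) * heat e (x - y)"
          using heat_nonneg[OF e, of "x - y"] by (simp add: norm_mult)
        also have "\<dots> \<le> ((norm (f x))\<^sup>2 / 2 + (norm (f y))\<^sup>2 / 2) * heat e (x - y)"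
          using sum_squares_bound[of "norm (f x)" "norm (f y)"] heat_nonneg[OF e, of "x - y"] by (intro mult_right_mono) auto
        finally have "ennreal (norm (f x * (cnj (f y) * complex_of_real (heat e (x - y))))) \<le> ennreal (((norm (f x))\<^sup>2 / 2 + (norm (f y))\<^sup>2 / 2) * heat e (x - y))"
          by (rule ennreal_leI)
        also have "\<dots> = h x * ennreal (heat e (x - y)) + h y * ennreal (heat e (x - y))"
        proof -
          have "ennreal (((norm (f x))\<^sup>2 / 2 + (norm (f y))\<^sup>2 / 2) * heat e (x - y))
            = ennreal ((norm (f x))\<^sup>2 / 2 + (norm (f y))\<^sup>2 / 2) * ennreal (heat e (x - y))"
            using heat_nonneg[OF e, of "x - y"] by (intro ennreal_mult) auto
          also have "ennreal ((norm (f x))\<^sup>2 / 2 + (norm (f y))\<^sup>2 / 2) = h x + h y"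
            unfolding h_def by (rule ennreal_plus) auto
          finally show ?thesis by (simp only: distrib_right)
        qed
        finally show "ennreal (norm (f x * (cnj (f y) * complex_of_real (heat e (x - y))))) \<le> h x * ennreal (heat e (x - y)) + h y * ennreal (heat e (x - y))" .
      qed
      finally show "ennreal (norm (f x * (\<integral>y. cnj (f y) * complex_of_real (heat e (x - y)) \<partial>lborel)))
        \<le> (\<integral>\<^sup>+y. h x * ennreal (heat e (x - y)) + h y * ennreal (heat e (x - y)) \<partial>lborel)" .
    qed
    also have "\<dots> = (\<integral>\<^sup>+x. h x * c + (\<integral>\<^sup>+y. h y * ennreal (heat e (x - y)) \<partial>lborel) \<partial>lborel)"
      by (intro nn_integral_cong, subst nn_integral_add) (auto simp: nn_integral_cmult heat_mass[OF e] c_def)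
    also have "\<dots> = (\<integral>\<^sup>+x. h x \<partial>lborel) * c + (\<integral>\<^sup>+x. (\<integral>\<^sup>+y. h y * ennreal (heat e (x - y)) \<partial>lborel) \<partial>lborel)"
      by (subst nn_integral_add) (auto simp: nn_integral_multc)
    also have "(\<integral>\<^sup>+x. (\<integral>\<^sup>+y. h y * ennreal (heat e (x - y)) \<partial>lborel) \<partial>lborel) = (\<integral>\<^sup>+y. (\<integral>\<^sup>+x. h y * ennreal (heat e (x - y)) \<partial>lborel) \<partial>lborel)"
      by (rule lborel_pair.Fubini'[symmetric]) measurable
    also have "\<dots> = (\<integral>\<^sup>+x. h x \<partial>lborel) * c"
      by (simp add: nn_integral_cmult heat_mass[OF e] nn_integral_multc c_def)
    also have "(\<integral>\<^sup>+x. h x \<partial>lborel) * c + (\<integral>\<^sup>+x. h x \<partial>lborel) * c = c * nsq f"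
      unfolding h2[symmetric] by (simp add: distrib_left mult.commute)
    finally show ?thesis .
  qed
  \<comment> \<open>The Gaussian factor is removed by Fatou's lemma, since the integrability of the
    limit is still unknown.\<close>
  have "nsq (ft s f) = (\<integral>\<^sup>+\<xi>. liminf (\<lambda>k. ennreal (gaussian (inverse (real (Suc k)) *\<^sub>R \<xi>) * (norm (ft s f \<xi>))\<^sup>2)) \<partial>lborel)"
    unfolding nsq_def
  proof (rule nn_integral_cong)
    fix \<xi> :: 'a
    have "(\<lambda>k. gaussian (inverse (real (Suc k)) *\<^sub>R \<xi>) * (norm (ft s f \<xi>))\<^sup>2) \<longlonglongrightarrow> exp (- (norm (0 *\<^sub>R \<xi>))\<^sup>2 / 2) * (norm (ft s f \<xi>))\<^sup>2"
      unfolding gaussian_def by (intro tendsto_intros LIMSEQ_inverse_real_of_nat) simp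
    then have "(\<lambda>k. ennreal (gaussian (inverse (real (Suc k)) *\<^sub>R \<xi>) * (norm (ft s f \<xi>))\<^sup>2)) \<longlonglongrightarrow> ennreal ((norm (ft s f \<xi>))\<^sup>2)"
      by (intro tendsto_ennrealI) simp
    then show "ennreal ((norm (ft s f \<xi>))\<^sup>2) = liminf (\<lambda>k. ennreal (gaussian (inverse (real (Suc k)) *\<^sub>R \<xi>) * (norm (ft s f \<xi>))\<^sup>2))"
      by (rule lim_imp_Liminf[OF trivial_limit_sequentially, symmetric])
  qed
  also have "\<dots> \<le> liminf (\<lambda>k. \<integral>\<^sup>+\<xi>. ennreal (gaussian (inverse (real (Suc k)) *\<^sub>R \<xi>) * (norm (ft s f \<xi>))\<^sup>2) \<partial>lborel)"
    by (rule nn_integral_liminf) measurable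
  also have "\<dots> \<le> liminf (\<lambda>k. c * nsq f)" by (intro Liminf_mono eventuallyI bd) simp
  also have "\<dots> = c * nsq f" by (simp add: Liminf_const)
  finally show ?thesis by (simp add: c_def)
qed

lemma ft_L2:
  assumes "integrable lborel f" "L2 f" "s = 1 \<or> s = -1"
  shows "L2 (ft s f)"
proof -
  have "nsq (ft s f) \<le> ennreal ((2 * pi) ^ DIM('a)) * nsq f" by (rule ft_bessel[OF assms(1,3)])
  also have "\<dots> < \<infinity>" using assms(2) by (simp add: L2_iff_nsq ennreal_mult_less_top)
  finally show ?thesis using ft_measurable[OF assms(1)] by (simp add: L2_iff_nsq)
qed

text \<open>The same regularisation with e tending to 0, now with dominated convergence on both
  sides. Continuity and boundedness of \<psi> make its convolution with the heat kernel converge at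
  every point to (2 pi)^d \<psi>.\<close>

lemma ft_parseval:
  fixes f \<psi> :: "'a::euclidean_space \<Rightarrow> complex"
  assumes f: "integrable lborel f" "L2 f" and \<psi>: "integrable lborel \<psi>" "L2 \<psi>"
    and c: "continuous_on UNIV \<psi>" and B: "\<And>x. norm (\<psi> x) \<le> B" and s: "s = 1 \<or> s = -1"
  shows "(\<integral>\<xi>. ft s f \<xi> * ft (- s) \<psi> \<xi> \<partial>lborel) = complex_of_real ((2 * pi) ^ DIM('a)) * (\<integral>x. f x * \<psi> x \<partial>lborel)"
proof -
  have s': "- s = 1 \<or> - s = -1" using s by auto
  have [measurable]: "f \<in> borel_measurable lborel" "ft s f \<in> borel_measurable lborel" "ft (- s) \<psi> \<in> borel_measurable lborel"
    using f(1) ft_measurable[OF f(1)] ft_measurable[OF \<psi>(1)] by simp_all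
  have \<psi>m[measurable]: "\<psi> \<in> borel_measurable borel" by (rule borel_measurable_continuous_onI[OF c])
  define e where "e k = inverse (real (Suc k))" for k
  have e: "e k > 0" for k by (simp add: e_def)
  have e0: "e \<longlonglongrightarrow> 0" unfolding e_def[abs_def] by (rule LIMSEQ_inverse_real_of_nat)
  define N where "N = (2 * pi) ^ DIM('a)"
  \<comment> \<open>The substitution y = x - e z moves the width of the kernel into the argument of
    \<psi>, leaving a fixed Gaussian as dominating function.\<close>
  have conv: "(\<integral>y. \<psi> y * complex_of_real (heat (e k) (x - y)) \<partial>lborel)
     = complex_of_real (sqrt (2 * pi) ^ DIM('a)) * (\<integral>z. \<psi> (x - e k *\<^sub>R z) * complex_of_real (gaussian z) \<partial>lborel)" for k x
  proof -
    have [measurable]: "heat (e k) \<in> borel_measurable (borel :: 'a measure)" unfolding heat_def[abs_def] by measurable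
    have "(\<integral>y. \<psi> y * complex_of_real (heat (e k) (x - y)) \<partial>lborel)
       = \<bar>- e k\<bar> ^ DIM('a) *\<^sub>R (\<integral>z. \<psi> (x + (- e k) *\<^sub>R z) * complex_of_real (heat (e k) (x - (x + (- e k) *\<^sub>R z))) \<partial>lborel)"
      by (rule integral_affine) (use e[of k] in auto)
    also have "(\<lambda>z. \<psi> (x + (- e k) *\<^sub>R z) * complex_of_real (heat (e k) (x - (x + (- e k) *\<^sub>R z))))
       = (\<lambda>z. complex_of_real ((sqrt (2 * pi) / e k) ^ DIM('a)) * (\<psi> (x - e k *\<^sub>R z) * complex_of_real (gaussian z)))"
      using e[of k] by (simp add: heat_def mult_ac)
    also have "\<bar>- e k\<bar> ^ DIM('a) *\<^sub>R (\<integral>z. complex_of_real ((sqrt (2 * pi) / e k) ^ DIM('a)) * (\<psi> (x - e k *\<^sub>R z) * complex_of_real (gaussian z)) \<partial>lborel)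
       = complex_of_real (\<bar>- e k\<bar> ^ DIM('a) * (sqrt (2 * pi) / e k) ^ DIM('a)) * (\<integral>z. \<psi> (x - e k *\<^sub>R z) * complex_of_real (gaussian z) \<partial>lborel)"
      by (simp add: scaleR_conv_of_real)
    also have "\<bar>- e k\<bar> ^ DIM('a) * (sqrt (2 * pi) / e k) ^ DIM('a) = sqrt (2 * pi) ^ DIM('a)"
    proof -
      have "\<bar>- e k\<bar> * (sqrt (2 * pi) / e k) = sqrt (2 * pi)" using e[of k] by simp
      then show ?thesis by (simp only: power_mult_distrib[symmetric])
    qed
    finally show ?thesis .
  qed
  have gi: "integrable lborel (\<lambda>z :: 'a. complex_of_real (gaussian z))"
    unfolding complex_of_real_integrable_eq by (rule gaussian_integral(1))
  have inner_bd: "norm (\<integral>z. \<psi> (x - e k *\<^sub>R z) * complex_of_real (gaussian z) \<partial>lborel) \<le> B * sqrt (2 * pi) ^ DIM('a)" for k x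
  proof -
    have "norm (\<integral>z. \<psi> (x - e k *\<^sub>R z) * complex_of_real (gaussian z) \<partial>lborel) \<le> (\<integral>z. B * gaussian (z :: 'a) \<partial>lborel)"
    proof (rule order_trans[OF Bochner_Integration.integral_norm_bound], rule Bochner_Integration.integral_mono)
      show i: "integrable lborel (\<lambda>z :: 'a. B * gaussian z)" by (intro integrable_mult_right gaussian_integral(1))
      show "norm (\<psi> (x - e k *\<^sub>R z) * complex_of_real (gaussian z)) \<le> B * gaussian z" for z
        using B by (auto simp: norm_mult intro!: mult_right_mono)
      have [measurable]: "(\<lambda>z. \<psi> (x - e k *\<^sub>R z)) \<in> borel_measurable borel" by measurable
      show "integrable lborel (\<lambda>z. norm (\<psi> (x - e k *\<^sub>R z) * complex_of_real (gaussian z)))"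
      proof (rule Bochner_Integration.integrable_bound[OF i])
        show "AE z in lborel. norm (norm (\<psi> (x - e k *\<^sub>R z) * complex_of_real (gaussian z))) \<le> norm (B * gaussian z)"
          using B order_trans[OF norm_ge_zero B] by (intro AE_I2) (auto simp: norm_mult abs_mult intro!: mult_right_mono)
      qed measurable
    qed
    then show ?thesis by (simp add: gaussian_integral(2))
  qed
  have inner_lim: "(\<lambda>k. \<integral>z. \<psi> (x - e k *\<^sub>R z) * complex_of_real (gaussian z) \<partial>lborel) \<longlonglongrightarrow> (\<integral>z. \<psi> x * complex_of_real (gaussian (z :: 'a)) \<partial>lborel)" for x
  proof (rule integral_dominated_convergence[where w = "\<lambda>z :: 'a. B * gaussian z"])
    show "AE z in lborel. (\<lambda>k. \<psi> (x - e k *\<^sub>R z) * complex_of_real (gaussian z)) \<longlonglongrightarrow> \<psi> x * complex_of_real (gaussian z)"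
    proof (rule AE_I2)
      fix z
      have "(\<lambda>k. x - e k *\<^sub>R z) \<longlonglongrightarrow> x - 0 *\<^sub>R z" by (intro tendsto_intros e0)
      then have xl: "(\<lambda>k. x - e k *\<^sub>R z) \<longlonglongrightarrow> x" by simp
      have "isCont \<psi> x" using c by (simp add: continuous_on_eq_continuous_at)
      from isCont_tendsto_compose[OF this xl] have "(\<lambda>k. \<psi> (x - e k *\<^sub>R z)) \<longlonglongrightarrow> \<psi> x" .
      then show "(\<lambda>k. \<psi> (x - e k *\<^sub>R z) * complex_of_real (gaussian z)) \<longlonglongrightarrow> \<psi> x * complex_of_real (gaussian z)" by (intro tendsto_intros)
    qed
    show "integrable lborel (\<lambda>z :: 'a. B * gaussian z)" by (intro integrable_mult_right gaussian_integral(1))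
    show "AE z in lborel. norm (\<psi> (x - e k *\<^sub>R z) * complex_of_real (gaussian z)) \<le> B * gaussian z" for k
      using B by (intro AE_I2) (auto simp: norm_mult intro!: mult_right_mono)
  qed measurable
  have inner_val: "complex_of_real (sqrt (2 * pi) ^ DIM('a)) * (\<integral>z. \<psi> x * complex_of_real (gaussian (z :: 'a)) \<partial>lborel) = complex_of_real N * \<psi> x" for x
  proof -
    have "sqrt (2 * pi) ^ DIM('a) * sqrt (2 * pi) ^ DIM('a) = N"
      unfolding N_def power_mult_distrib[symmetric] by simp
    then have "complex_of_real N = complex_of_real (sqrt (2 * pi) ^ DIM('a)) * complex_of_real (sqrt (2 * pi) ^ DIM('a))"
      unfolding of_real_mult[symmetric] by (rule arg_cong[OF sym])
    moreover have "(\<integral>z. \<psi> x * complex_of_real (gaussian (z :: 'a)) \<partial>lborel) = \<psi> x * complex_of_real (sqrt (2 * pi) ^ DIM('a))"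
      unfolding gaussian_integral(2)[symmetric] by simp
    ultimately show ?thesis by (simp only: mult_ac)
  qed
  have ip: "integrable lborel (\<lambda>\<xi>. ft s f \<xi> * ft (- s) \<psi> \<xi>)"
    by (rule integrable_mult_L2(1)[OF ft_L2[OF f s] ft_L2[OF \<psi> s']])
  have "(\<lambda>k. \<integral>\<xi>. complex_of_real (gaussian (e k *\<^sub>R \<xi>)) * (ft s f \<xi> * ft (- s) \<psi> \<xi>) \<partial>lborel) \<longlonglongrightarrow> (\<integral>\<xi>. ft s f \<xi> * ft (- s) \<psi> \<xi> \<partial>lborel)"
  proof (rule integral_dominated_convergence[where w = "\<lambda>\<xi>. norm (ft s f \<xi> * ft (- s) \<psi> \<xi>)"])
    show "AE \<xi> in lborel. (\<lambda>k. complex_of_real (gaussian (e k *\<^sub>R \<xi>)) * (ft s f \<xi> * ft (- s) \<psi> \<xi>)) \<longlonglongrightarrow> ft s f \<xi> * ft (- s) \<psi> \<xi>"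
    proof (rule AE_I2)
      fix \<xi> :: 'a
      have "(\<lambda>k. complex_of_real (gaussian (e k *\<^sub>R \<xi>)) * (ft s f \<xi> * ft (- s) \<psi> \<xi>)) \<longlonglongrightarrow> complex_of_real (exp (- (norm (0 *\<^sub>R \<xi>))\<^sup>2 / 2)) * (ft s f \<xi> * ft (- s) \<psi> \<xi>)"
        unfolding gaussian_def by (intro tendsto_intros e0) simp
      then show "(\<lambda>k. complex_of_real (gaussian (e k *\<^sub>R \<xi>)) * (ft s f \<xi> * ft (- s) \<psi> \<xi>)) \<longlonglongrightarrow> ft s f \<xi> * ft (- s) \<psi> \<xi>" by simp
    qed
    show "AE \<xi> in lborel. norm (complex_of_real (gaussian (e k *\<^sub>R \<xi>)) * (ft s f \<xi> * ft (- s) \<psi> \<xi>)) \<le> norm (ft s f \<xi> * ft (- s) \<psi> \<xi>)" for k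
      by (intro AE_I2) (simp add: norm_mult mult_left_le_one_le)
  qed (use ip in auto)
  moreover have "(\<integral>\<xi>. complex_of_real (gaussian (e k *\<^sub>R \<xi>)) * (ft s f \<xi> * ft (- s) \<psi> \<xi>) \<partial>lborel)
      = (\<integral>x. f x * (\<integral>y. \<psi> y * complex_of_real (heat (e k) (x - y)) \<partial>lborel) \<partial>lborel)" for k
    by (rule ft_product_gaussian[OF f(1) \<psi>(1) e s])
  moreover have "(\<lambda>k. \<integral>x. f x * (\<integral>y. \<psi> y * complex_of_real (heat (e k) (x - y)) \<partial>lborel) \<partial>lborel) \<longlonglongrightarrow> (\<integral>x. f x * (complex_of_real N * \<psi> x) \<partial>lborel)"
    unfolding conv
  proof (rule integral_dominated_convergence[where w = "\<lambda>x. norm (f x) * (sqrt (2 * pi) ^ DIM('a) * (B * sqrt (2 * pi) ^ DIM('a)))"])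
    show "AE x in lborel. (\<lambda>k. f x * (complex_of_real (sqrt (2 * pi) ^ DIM('a)) * (\<integral>z. \<psi> (x - e k *\<^sub>R z) * complex_of_real (gaussian z) \<partial>lborel)))
        \<longlonglongrightarrow> f x * (complex_of_real N * \<psi> x)"
      unfolding inner_val[symmetric] by (intro AE_I2 tendsto_intros inner_lim)
    show "AE x in lborel. norm (f x * (complex_of_real (sqrt (2 * pi) ^ DIM('a)) * (\<integral>z. \<psi> (x - e k *\<^sub>R z) * complex_of_real (gaussian z) \<partial>lborel)))
        \<le> norm (f x) * (sqrt (2 * pi) ^ DIM('a) * (B * sqrt (2 * pi) ^ DIM('a)))" for k
      unfolding norm_mult by (intro AE_I2 mult_left_mono order_trans[OF mult_left_mono[OF inner_bd]]) (auto simp: norm_power)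
    show "(\<lambda>x. f x * (complex_of_real (sqrt (2 * pi) ^ DIM('a)) * (\<integral>z. \<psi> (x - e k *\<^sub>R z) * complex_of_real (gaussian z) \<partial>lborel))) \<in> borel_measurable lborel" for k
      by measurable
  qed (use f(1) in \<open>auto intro: integrable_norm\<close>)
  ultimately have "(\<integral>\<xi>. ft s f \<xi> * ft (- s) \<psi> \<xi> \<partial>lborel) = (\<integral>x. f x * (complex_of_real N * \<psi> x) \<partial>lborel)"
    by (simp only: LIMSEQ_unique)
  also have "\<dots> = complex_of_real N * (\<integral>x. f x * \<psi> x \<partial>lborel)"
    by (subst integral_mult_right_zero[symmetric]) (simp add: mult_ac)
  finally show ?thesis by (simp add: N_def)
qed

section \<open>The Fourier transform of vector functions\<close>

lemma fourier_nth: "fourier f \<xi> $ i = ft (-1) (\<lambda>x. complex_of_real (f x $ i)) \<xi>"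
  by (simp add: fourier_def ft_def)

lemma integrable_vec_nth:
  fixes f :: "'a::euclidean_space \<Rightarrow> real^'m"
  assumes "integrable lborel f"
  shows "integrable lborel (\<lambda>x. f x $ i)" "integrable lborel (\<lambda>x. complex_of_real (f x $ i))"
proof -
  show 1: "integrable lborel (\<lambda>x. f x $ i)" by (rule integrable_bounded_linear[OF bounded_linear_vec_nth assms])
  then show "integrable lborel (\<lambda>x. complex_of_real (f x $ i))" by (simp only: complex_of_real_integrable_eq)
qed

lemma fourier_measurable:
  assumes "integrable lborel f" shows "fourier f \<in> borel_measurable lborel"
  unfolding borel_measurable_vec_iff fourier_nth
  by (rule allI, rule ft_measurable, rule integrable_vec_nth(2)[OF assms])

lemma nsq_of_real: "nsq (\<lambda>x. complex_of_real (f x)) = nsq f"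
  by (simp add: nsq_def)

lemma fourier_bessel:
  fixes f :: "real^'n::finite \<Rightarrow> real^'m"
  assumes f: "integrable lborel f"
  shows "nsq (fourier f) \<le> ennreal ((2 * pi) ^ CARD('n)) * nsq f"
proof -
  have fm: "f \<in> borel_measurable lborel" using f by simp
  have "nsq (fourier f) = (\<Sum>i\<in>UNIV. nsq (ft (-1) (\<lambda>x. complex_of_real (f x $ i))))"
    unfolding nsq_vec[OF fourier_measurable[OF f]] fourier_nth ..
  also have "\<dots> \<le> (\<Sum>i\<in>UNIV. ennreal ((2 * pi) ^ CARD('n)) * nsq (\<lambda>x. f x $ i))"
  proof (rule sum_mono)
    fix i
    show "nsq (ft (-1) (\<lambda>x. complex_of_real (f x $ i))) \<le> ennreal ((2 * pi) ^ CARD('n)) * nsq (\<lambda>x. f x $ i)"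
      using ft_bessel[OF integrable_vec_nth(2)[OF f], of "-1" i] by (simp add: nsq_of_real)
  qed
  also have "\<dots> = ennreal ((2 * pi) ^ CARD('n)) * nsq f"
    unfolding nsq_vec[OF fm] sum_distrib_left ..
  finally show ?thesis .
qed

lemma fourier_diff:
  fixes f g :: "real^'n::finite \<Rightarrow> real^'m"
  assumes "integrable lborel f" "integrable lborel g"
  shows "fourier (\<lambda>x. f x - g x) \<xi> = fourier f \<xi> - fourier g \<xi>"
  by (simp add: vec_eq_iff fourier_nth ft_diff integrable_vec_nth(2)[OF assms(1)] integrable_vec_nth(2)[OF assms(2)])

lemma fourier_continuous:
  fixes f :: "real^'n::finite \<Rightarrow> real^'m"
  assumes "integrable lborel f" shows "continuous_on UNIV (fourier f)"
proof -
  have "continuous_on UNIV (\<lambda>\<xi>. \<chi> i. ft (-1) (\<lambda>x. complex_of_real (f x $ i)) \<xi>)"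
    by (intro continuous_on_vec_lambda ft_continuous integrable_vec_nth(2)[OF assms])
  moreover have "fourier f = (\<lambda>\<xi>. \<chi> i. ft (-1) (\<lambda>x. complex_of_real (f x $ i)) \<xi>)"
    by (simp add: fun_eq_iff vec_eq_iff fourier_nth)
  ultimately show ?thesis by simp
qed

section \<open>Transforms expressed through integrals against real test functions\<close>

definition cvec :: "real^'m \<Rightarrow> complex^'m" where
  "cvec v = (\<chi> i. complex_of_real (v $ i))"

lemma cvec_nth [simp]: "cvec v $ i = complex_of_real (v $ i)"
  by (simp add: cvec_def)

lemma norm_cvec [simp]: "norm (cvec v) = norm v"
  by (simp add: norm_vec_def)

lemma cvec_linear: "cvec (a + b) = cvec a + cvec b" "cvec (a - b) = cvec a - cvec b" "cvec (- a) = - cvec a"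
  "cvec (c *\<^sub>R a) = c *\<^sub>R cvec a" "cvec 0 = 0" "cvec (sum f I) = (\<Sum>i\<in>I. cvec (f i))"
  by (simp_all add: vec_eq_iff) (simp_all add: scaleR_conv_of_real)

lemma bounded_linear_cvec: "bounded_linear cvec"
  by (rule bounded_linear_intro[where K = 1]) (auto simp: cvec_linear)

lemma cvec_matrix: "cvec (M *v a) = cmat M *v cvec a"
  by (simp add: vec_eq_iff matrix_vector_mult_def)

text \<open>The test functions \<open>m cos (x \<bullet> \<xi>)\<close> and \<open>m cos (x \<bullet> \<xi> + pi/2) = - m sin (x \<bullet> \<xi>)\<close> give the real and
  imaginary parts of the transform of \<open>m f\<close>.\<close>

lemma cos_mult_integrable:
  fixes f :: "real^'n::finite \<Rightarrow> real^'m"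
  assumes i: "integrable lborel (\<lambda>x. m x *\<^sub>R f x)"
  shows "integrable lborel (\<lambda>x. (m x * cos (x \<bullet> \<xi> + \<theta>)) *\<^sub>R f x)"
proof -
  have [measurable]: "(\<lambda>x. m x *\<^sub>R f x) \<in> borel_measurable lborel" using i by simp
  have "integrable lborel (\<lambda>x. cos (x \<bullet> \<xi> + \<theta>) *\<^sub>R (m x *\<^sub>R f x))"
  proof (rule Bochner_Integration.integrable_bound[OF i])
    show "AE x in lborel. norm (cos (x \<bullet> \<xi> + \<theta>) *\<^sub>R (m x *\<^sub>R f x)) \<le> norm (m x *\<^sub>R f x)"
      by (intro AE_I2) (simp only: norm_scaleR[of "cos _"], simp add: mult_left_le_one_le)
  qed measurable
  then show ?thesis by (simp add: mult.commute)
qed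

lemma fourier_cos_decomposition:
  fixes f :: "real^'n::finite \<Rightarrow> real^'m"
  assumes i: "integrable lborel (\<lambda>x. m x *\<^sub>R f x)"
  shows "fourier (\<lambda>x. m x *\<^sub>R f x) \<xi> = cvec (\<integral>x. (m x * cos (x \<bullet> \<xi> + 0)) *\<^sub>R f x \<partial>lborel)
     + mulI (cvec (\<integral>x. (m x * cos (x \<bullet> \<xi> + pi / 2)) *\<^sub>R f x \<partial>lborel))"
  unfolding vec_eq_iff
proof
  fix k
  have ik: "integrable lborel (\<lambda>x. m x * cos (x \<bullet> \<xi> + \<theta>) * f x $ k)" for \<theta>
    using integrable_vec_nth(1)[OF cos_mult_integrable[OF i, of \<xi> \<theta>], of k] by simp
  have nth: "(\<integral>x. (m x * cos (x \<bullet> \<xi> + \<theta>)) *\<^sub>R f x \<partial>lborel) $ k = (\<integral>x. m x * cos (x \<bullet> \<xi> + \<theta>) * f x $ k \<partial>lborel)" for \<theta>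
    using integral_bounded_linear[OF bounded_linear_vec_nth cos_mult_integrable[OF i, of \<xi> \<theta>], of k] by simp
  have ic: "integrable lborel (\<lambda>x. complex_of_real (m x * cos (x \<bullet> \<xi> + \<theta>) * f x $ k))" for \<theta>
    using ik by (simp only: complex_of_real_integrable_eq)
  have "fourier (\<lambda>x. m x *\<^sub>R f x) \<xi> $ k = (\<integral>x. complex_of_real (m x * cos (x \<bullet> \<xi> + 0) * f x $ k)
      + \<i> * complex_of_real (m x * cos (x \<bullet> \<xi> + pi / 2) * f x $ k) \<partial>lborel)"
    unfolding fourier_def vec_lambda_beta
    by (rule Bochner_Integration.integral_cong) (auto simp: complex_eq_iff cos_add)
  also have "\<dots> = (\<integral>x. complex_of_real (m x * cos (x \<bullet> \<xi> + 0) * f x $ k) \<partial>lborel)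
      + \<i> * (\<integral>x. complex_of_real (m x * cos (x \<bullet> \<xi> + pi / 2) * f x $ k) \<partial>lborel)"
    by (subst Bochner_Integration.integral_add[OF ic integrable_mult_right[OF ic]]) (simp only: integral_mult_right_zero)
  also have "\<dots> = (cvec (\<integral>x. (m x * cos (x \<bullet> \<xi> + 0)) *\<^sub>R f x \<partial>lborel)
     + mulI (cvec (\<integral>x. (m x * cos (x \<bullet> \<xi> + pi / 2)) *\<^sub>R f x \<partial>lborel))) $ k"
    by (simp only: nth vector_add_component cvec_nth mulI_def vector_smult_component integral_complex_of_real)
  finally show "fourier (\<lambda>x. m x *\<^sub>R f x) \<xi> $ k = (cvec (\<integral>x. (m x * cos (x \<bullet> \<xi> + 0)) *\<^sub>R f x \<partial>lborel)
     + mulI (cvec (\<integral>x. (m x * cos (x \<bullet> \<xi> + pi / 2)) *\<^sub>R f x \<partial>lborel))) $ k" .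
qed

text \<open>The bound is uniform in \<xi>, so continuity in L2 becomes uniform continuity of
  transformed cutoffs. The factor 2 comes from estimating real and imaginary parts
  separately.\<close>

lemma fourier_norm_le:
  fixes f :: "real^'n::finite \<Rightarrow> real^'m"
  assumes m: "L2 m" and f: "L2 f"
  shows "norm (fourier (\<lambda>x. m x *\<^sub>R f x) \<xi>) \<le> 2 * (L2norm m * L2norm f)"
proof -
  have i: "integrable lborel (\<lambda>x. m x *\<^sub>R f x)" by (rule integrable_scaleR_L2(1)[OF m f])
  have "norm (\<integral>x. (m x * cos (x \<bullet> \<xi> + \<theta>)) *\<^sub>R f x \<partial>lborel) \<le> L2norm m * L2norm f" for \<theta>
  proof -
    have "norm (\<integral>x. (m x * cos (x \<bullet> \<xi> + \<theta>)) *\<^sub>R f x \<partial>lborel) \<le> (\<integral>x. norm ((m x * cos (x \<bullet> \<xi> + \<theta>)) *\<^sub>R f x) \<partial>lborel)"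
      by (rule Bochner_Integration.integral_norm_bound)
    also have "\<dots> \<le> (\<integral>x. norm (m x) * norm (f x) \<partial>lborel)"
    proof (rule Bochner_Integration.integral_mono)
      show "integrable lborel (\<lambda>x. norm ((m x * cos (x \<bullet> \<xi> + \<theta>)) *\<^sub>R f x))"
        by (rule integrable_norm[OF cos_mult_integrable[OF i]])
      show "integrable lborel (\<lambda>x. norm (m x) * norm (f x))" by (rule Cauchy_Schwarz_L2(1)[OF m f])
      show "norm ((m x * cos (x \<bullet> \<xi> + \<theta>)) *\<^sub>R f x) \<le> norm (m x) * norm (f x)" for x
        by (auto simp: abs_mult intro!: mult_right_mono mult_left_le)
    qed
    also have "\<dots> \<le> L2norm m * L2norm f" by (rule Cauchy_Schwarz_L2(2)[OF m f])
    finally show ?thesis .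
  qed
  note b = this
  define P where "P \<theta> = cvec (\<integral>x. (m x * cos (x \<bullet> \<xi> + \<theta>)) *\<^sub>R f x \<partial>lborel)" for \<theta>
  have "norm (P 0 + mulI (P (pi / 2))) \<le> norm (P 0) + norm (mulI (P (pi / 2)))" by (rule norm_triangle_ineq)
  moreover have "norm (P \<theta>) \<le> L2norm m * L2norm f" for \<theta> unfolding P_def norm_cvec by (rule b)
  ultimately have "norm (P 0 + mulI (P (pi / 2))) \<le> L2norm m * L2norm f + L2norm m * L2norm f"
    unfolding norm_mulI by (meson add_mono order_trans)
  then show ?thesis unfolding fourier_cos_decomposition[OF i] P_def by simp
qed

lemma integral_matrix_vector:
  fixes f :: "'a::euclidean_space \<Rightarrow> real^'m"
  assumes "integrable lborel (\<lambda>x. m x *\<^sub>R f x)"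
  shows "integrable lborel (\<lambda>x. m x *\<^sub>R (M *v f x))"
    "(\<integral>x. m x *\<^sub>R (M *v f x) \<partial>lborel) = M *v (\<integral>x. m x *\<^sub>R f x \<partial>lborel)"
proof -
  have bl: "bounded_linear ((*v) M)" by simp
  show "integrable lborel (\<lambda>x. m x *\<^sub>R (M *v f x))"
    using integrable_bounded_linear[OF bl assms] by (simp add: matrix_vector_mult_scaleR)
  show "(\<integral>x. m x *\<^sub>R (M *v f x) \<partial>lborel) = M *v (\<integral>x. m x *\<^sub>R f x \<partial>lborel)"
    using integral_bounded_linear[OF bl assms] by (simp add: matrix_vector_mult_scaleR)
qed

text \<open>By the Leibniz rule a derivative of \<open>m\<close> times a cosine falls either on the
  cosine, where the phase shift by pi/2 reassembles to multiplication by -\<i>\<xi>, or on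
  \<open>m\<close>, which produces the residual.\<close>

lemma fourier_first_order_term:
  fixes f :: "real^'n::finite \<Rightarrow> real^'m" and M :: "'n \<Rightarrow> real^'m^'p"
  assumes m: "test_function m" and f: "L2 f"
  shows "cvec (\<integral>x. (\<Sum>j\<in>UNIV. pd j (\<lambda>x. m x * cos (x \<bullet> \<xi> + 0)) x *\<^sub>R (M j *v f x)) \<partial>lborel)
     + mulI (cvec (\<integral>x. (\<Sum>j\<in>UNIV. pd j (\<lambda>x. m x * cos (x \<bullet> \<xi> + pi / 2)) x *\<^sub>R (M j *v f x)) \<partial>lborel))
   = (\<Sum>j\<in>UNIV. cmat (M j) *v fourier (\<lambda>x. pd j m x *\<^sub>R f x) \<xi>) - mulI (cmat (symbol M \<xi>) *v fourier (\<lambda>x. m x *\<^sub>R f x) \<xi>)"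
proof -
  define a where "a \<theta> = (\<integral>x. (m x * cos (x \<bullet> \<xi> + \<theta>)) *\<^sub>R f x \<partial>lborel)" for \<theta>
  define b where "b j \<theta> = (\<integral>x. (pd j m x * cos (x \<bullet> \<xi> + \<theta>)) *\<^sub>R f x \<partial>lborel)" for j \<theta>
  have sm: "smooth m" by (rule test_function_smooth[OF m])
  have i: "integrable lborel (\<lambda>x. m x *\<^sub>R f x)" by (rule test_function_scaleR_integrable[OF m f])
  have ij: "integrable lborel (\<lambda>x. pd j m x *\<^sub>R f x)" for j by (rule test_function_scaleR_integrable[OF test_function_pd[OF m] f])
  have I: "(\<integral>x. (\<Sum>j\<in>UNIV. pd j (\<lambda>x. m x * cos (x \<bullet> \<xi> + \<theta>)) x *\<^sub>R (M j *v f x)) \<partial>lborel)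
      = (\<Sum>j\<in>UNIV. M j *v (\<xi> $ j *\<^sub>R a (\<theta> + pi / 2) + b j \<theta>))" for \<theta>
  proof -
    have tf: "test_function (\<lambda>x. m x * cos (x \<bullet> \<xi> + \<theta>))" by (rule test_function_mult[OF m smooth_cos])
    have int: "integrable lborel (\<lambda>x. pd j (\<lambda>x. m x * cos (x \<bullet> \<xi> + \<theta>)) x *\<^sub>R f x)" for j
      by (rule test_function_scaleR_integrable[OF test_function_pd[OF tf] f])
    have "(\<integral>x. pd j (\<lambda>x. m x * cos (x \<bullet> \<xi> + \<theta>)) x *\<^sub>R f x \<partial>lborel) = \<xi> $ j *\<^sub>R a (\<theta> + pi / 2) + b j \<theta>" for j
    proof -
      have "pd j (\<lambda>x. m x * cos (x \<bullet> \<xi> + \<theta>)) x *\<^sub>R f x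
         = \<xi> $ j *\<^sub>R ((m x * cos (x \<bullet> \<xi> + (\<theta> + pi / 2))) *\<^sub>R f x) + (pd j m x * cos (x \<bullet> \<xi> + \<theta>)) *\<^sub>R f x" for x
        unfolding pd_mult[OF sm smooth_cos] pd_cos by (simp add: scaleR_add_left mult_ac)
      then show ?thesis unfolding a_def b_def
        by (simp only: Bochner_Integration.integral_add[OF integrable_scaleR_right[OF cos_mult_integrable[OF i]] cos_mult_integrable[OF ij]]
            integral_scaleR_right)
    qed
    then show ?thesis
      by (simp only: Bochner_Integration.integral_sum[OF integral_matrix_vector(1)[OF int]] integral_matrix_vector(2)[OF int])
  qed
  \<comment> \<open>Two phase shifts change the sign, matching the square of \<i>; this is what lets
    the two real identities recombine into a complex one.\<close>
  have api: "a (pi / 2 + pi / 2) = - a 0" unfolding a_def by (simp add: cos_add)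
  have F: "fourier (\<lambda>x. m x *\<^sub>R f x) \<xi> = cvec (a 0) + mulI (cvec (a (pi / 2)))"
    unfolding a_def by (rule fourier_cos_decomposition[OF i])
  have Fj: "fourier (\<lambda>x. pd j m x *\<^sub>R f x) \<xi> = cvec (b j 0) + mulI (cvec (b j (pi / 2)))" for j
    unfolding b_def by (rule fourier_cos_decomposition[OF ij])
  have sym: "cmat (symbol M \<xi>) *v z = (\<Sum>j\<in>UNIV. \<xi> $ j *\<^sub>R (cmat (M j) *v z))" for z
    by (simp add: scaleR_sum_right symbol_def cmat_sum cmat_scaleR scaleR_matrix_mult_vec[symmetric] vec_eq_iff matrix_vector_mult_def
        sum_distrib_right sum.swap[of _ UNIV "UNIV :: 'm set"])
  show ?thesis
    unfolding I api F Fj sym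
    by (simp add: cvec_linear cvec_matrix mulI_sum mulI_add mulI_diff mulI_scaleR mulI_uminus mulI_cmat matrix_vector_right_distrib
        matrix_mult_scaleR_vec matrix_mult_uminus_vec sum.distrib sum_subtractf scaleR_add_right sum_negf algebra_simps)
qed

section \<open>Cutoffs and the Fourier transform in mean\<close>

definition dil :: "nat \<Rightarrow> real" where
  "dil k = inverse (real (Suc k))"

lemma dil: "dil k > 0" "\<bar>dil k\<bar> \<le> 1" "dil \<longlonglongrightarrow> 0"
proof -
  show "dil k > 0" "\<bar>dil k\<bar> \<le> 1" by (simp_all add: dil_def field_simps)
  show "dil \<longlonglongrightarrow> 0" unfolding dil_def[abs_def] by (rule LIMSEQ_inverse_real_of_nat)
qed

definition cut_at :: "nat \<Rightarrow> real^'n::finite \<Rightarrow> real" where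
  "cut_at k x = cutoff (dil k *\<^sub>R x)"

lemma test_function_cut: "test_function (cut_at k)"
  unfolding cut_at_def[abs_def] using dil(1)[of k] by (intro test_function_scaleR test_function_cutoff) simp

lemma cut_measurable [measurable]: "cut_at k \<in> borel_measurable borel"
  using smooth_measurable[OF test_function_smooth[OF test_function_cut]] by simp

lemma cut_bounds: "0 \<le> cut_at k x" "cut_at k x \<le> 1"
  by (simp_all add: cut_at_def cutoff_bounds)

lemma cut_abs: "\<bar>cut_at k x\<bar> \<le> 1"
  using cut_bounds[of k x] by linarith

lemma cut_tendsto: "(\<lambda>k. cut_at k x) \<longlonglongrightarrow> 1"
proof -
  have "(\<lambda>k. dil k *\<^sub>R x) \<longlonglongrightarrow> 0 *\<^sub>R x" by (intro tendsto_intros dil)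
  moreover have "continuous_on UNIV (cutoff :: real^'a \<Rightarrow> real)"
    by (rule smooth_continuous[OF test_function_smooth[OF test_function_cutoff]])
  then have "isCont (cutoff :: real^'a \<Rightarrow> real) (0 *\<^sub>R x)" by (simp add: continuous_on_eq_continuous_at)
  ultimately have "(\<lambda>k. cutoff (dil k *\<^sub>R x)) \<longlonglongrightarrow> cutoff (0 *\<^sub>R x)" by (rule isCont_tendsto_compose[rotated])
  then show ?thesis by (simp add: cut_at_def)
qed

text \<open>The chain rule yields the factor \<open>dil k\<close>, the sole reason why the residual
  of a cutoff solution disappears in the limit.\<close>

lemma pd_cut_bound:
  obtains B where "B > 0" "\<And>k j (x :: real^'n::finite). \<bar>pd j (cut_at k) x\<bar> \<le> dil k * B"
proof -
  have "\<exists>B>0. \<forall>x. \<bar>pd j (cutoff :: real^'n \<Rightarrow> real) x\<bar> \<le> B" for j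
    using test_function_bounded[OF test_function_pd[OF test_function_cutoff]] by metis
  then obtain B where B: "\<And>j. B j > 0" "\<And>j x. \<bar>pd j (cutoff :: real^'n \<Rightarrow> real) x\<bar> \<le> B j" by metis
  have eq: "pd j (cut_at k) x = dil k * pd j cutoff (dil k *\<^sub>R x)" for j k and x :: "real^'n"
    unfolding cut_at_def[abs_def] pd_scaleR[OF test_function_smooth[OF test_function_cutoff]] ..
  have "B j \<le> (\<Sum>j\<in>UNIV. B j)" for j by (rule member_le_sum) (use B(1) in \<open>auto intro: less_imp_le\<close>)
  then have "\<bar>pd j (cut_at k) x\<bar> \<le> dil k * (\<Sum>j\<in>UNIV. B j)" for j k and x :: "real^'n"
    unfolding eq abs_mult using dil(1)[of k] order_trans[OF B(2)] by (simp add: mult_left_mono)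
  moreover have "(\<Sum>j\<in>UNIV. B j) > 0" by (rule sum_pos) (use B(1) in auto)
  ultimately show ?thesis using that by blast
qed

lemma nsq_vanishing:
  fixes f :: "'a::euclidean_space \<Rightarrow> 'b::euclidean_space"
  assumes f: "L2 f" and [measurable]: "\<And>k. m k \<in> borel_measurable lborel" and b: "\<And>k x. \<bar>m k x\<bar> \<le> 1"
    and lim: "\<And>x. (\<lambda>k. m k x) \<longlonglongrightarrow> 0"
  shows "(\<lambda>k. nsq (\<lambda>x. m k x *\<^sub>R f x)) \<longlonglongrightarrow> 0"
proof -
  have [measurable]: "f \<in> borel_measurable lborel" using f by (rule L2_measurable)
  have "(\<lambda>k. \<integral>\<^sup>+x. ennreal ((norm (m k x *\<^sub>R f x))\<^sup>2) \<partial>lborel) \<longlonglongrightarrow> (\<integral>\<^sup>+x. ennreal 0 \<partial>(lborel :: 'a measure))"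
  proof (rule nn_integral_dominated_convergence[where w = "\<lambda>x. ennreal ((norm (f x))\<^sup>2)"])
    show "(\<integral>\<^sup>+x. ennreal ((norm (f x))\<^sup>2) \<partial>lborel) < \<infinity>" using f by (simp add: L2_iff_nsq nsq_def)
    show "AE x in lborel. ennreal ((norm (m k x *\<^sub>R f x))\<^sup>2) \<le> ennreal ((norm (f x))\<^sup>2)" for k
      using b by (intro AE_I2 ennreal_leI power_mono) (auto simp: mult_left_le_one_le)
    show "AE x in lborel. (\<lambda>k. ennreal ((norm (m k x *\<^sub>R f x))\<^sup>2)) \<longlonglongrightarrow> ennreal 0"
    proof (rule AE_I2)
      fix x
      have "(\<lambda>k. (norm (m k x *\<^sub>R f x))\<^sup>2) \<longlonglongrightarrow> (norm (0 *\<^sub>R f x))\<^sup>2" by (intro tendsto_intros lim)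
      then show "(\<lambda>k. ennreal ((norm (m k x *\<^sub>R f x))\<^sup>2)) \<longlonglongrightarrow> ennreal 0" by (intro tendsto_ennrealI) simp
    qed
  qed measurable
  then show ?thesis by (simp add: nsq_def)
qed

text \<open>\<open>has_L2_fourier\<close> truncates sharply to balls, whereas the weak formulation
  only admits smooth cutoffs. Bessel's inequality shows that both ways of truncating lead to the
  same limit.\<close>

lemma has_L2_fourier_cutI:
  fixes f :: "real^'n::finite \<Rightarrow> real^'m"
  assumes f: "L2 f" and g: "g \<in> borel_measurable lborel"
    and lim: "(\<lambda>k. nsq (\<lambda>\<xi>. fourier (\<lambda>x. cut_at k x *\<^sub>R f x) \<xi> - g \<xi>)) \<longlonglongrightarrow> 0"
  shows "has_L2_fourier f g"
proof -
  have fm[measurable]: "f \<in> borel_measurable lborel" using f by (rule L2_measurable)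
  note g[measurable]
  define c where "c = ennreal ((2 * pi) ^ CARD('n))"
  have ci: "integrable lborel (\<lambda>x. cut_at k x *\<^sub>R f x)" for k by (rule test_function_scaleR_integrable[OF test_function_cut f])
  have cL: "L2 (\<lambda>x. cut_at k x *\<^sub>R f x)" for k
    by (rule L2_scaleR(1)[OF f, of _ 1]) (simp_all add: cut_abs)
  define I where "I r = (indicator (cball 0 r) :: real^'n \<Rightarrow> real)" for r
  have IL: "L2 (I r)" for r
  proof (rule L2_bounded_support[of _ 1 r])
    show "I r \<in> borel_measurable lborel" unfolding I_def
      by (rule borel_measurable_indicator) (simp add: borel_closed)
  qed (auto simp: I_def indicator_def)
  have Im[measurable]: "I r \<in> borel_measurable lborel" for r using IL by (rule L2_measurable)
  have ri: "integrable lborel (\<lambda>x. I r x *\<^sub>R f x)" for r by (rule integrable_scaleR_L2(1)[OF IL f])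
  have "L2 (fourier (\<lambda>x. cut_at k x *\<^sub>R f x))" for k
  proof -
    have "nsq (fourier (\<lambda>x. cut_at k x *\<^sub>R f x)) \<le> c * nsq (\<lambda>x. cut_at k x *\<^sub>R f x)" unfolding c_def by (rule fourier_bessel[OF ci])
    also have "\<dots> < \<infinity>" using cL[of k] by (simp add: L2_iff_nsq c_def ennreal_mult_less_top)
    finally show ?thesis using fourier_measurable[OF ci] by (simp add: L2_iff_nsq)
  qed
  note FL = this
  have gL: "L2 g"
  proof -
    have "eventually (\<lambda>k. nsq (\<lambda>\<xi>. fourier (\<lambda>x. cut_at k x *\<^sub>R f x) \<xi> - g \<xi>) < 1) sequentially"
      using order_tendstoD(2)[OF lim, of 1] by simp
    then obtain k where k: "nsq (\<lambda>\<xi>. fourier (\<lambda>x. cut_at k x *\<^sub>R f x) \<xi> - g \<xi>) < 1"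
      using eventually_happens trivial_limit_sequentially by blast
    have "L2 (\<lambda>\<xi>. fourier (\<lambda>x. cut_at k x *\<^sub>R f x) \<xi> - g \<xi>)"
      using less_trans[OF k ennreal_one_less_top] fourier_measurable[OF ci[of k]] by (simp add: L2_iff_nsq)
    from L2_diff[OF FL[of k] this] show ?thesis by simp
  qed
  \<comment> \<open>For fixed r the smooth cutoff is inserted as an intermediate function and k
    tends to infinity; only the tail of f outside the ball is left, with two factors 2 from two uses
    of \<open>nsq_add_le\<close>.\<close>
  have bd: "nsq (\<lambda>\<xi>. fourier (\<lambda>x. I r x *\<^sub>R f x) \<xi> - g \<xi>) \<le> 4 * c * nsq (\<lambda>x. (1 - I r x) *\<^sub>R f x)" for r
  proof -
    define a where "a = nsq (\<lambda>x. (1 - I r x) *\<^sub>R f x)"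
    define b where "b k = nsq (\<lambda>x. (1 - cut_at k x) *\<^sub>R f x)" for k
    define d where "d k = nsq (\<lambda>\<xi>. fourier (\<lambda>x. cut_at k x *\<^sub>R f x) \<xi> - g \<xi>)" for k
    have b0: "b \<longlonglongrightarrow> 0" unfolding b_def[abs_def]
    proof (rule nsq_vanishing[OF f])
      show "\<bar>1 - cut_at k x\<bar> \<le> 1" for k x using cut_bounds[of k x] by simp
      show "(\<lambda>k. 1 - cut_at k x) \<longlonglongrightarrow> 0" for x using tendsto_diff[OF tendsto_const[of 1] cut_tendsto[of x]] by simp
    qed measurable
    have "nsq (\<lambda>\<xi>. fourier (\<lambda>x. I r x *\<^sub>R f x) \<xi> - g \<xi>) \<le> 2 * (c * (2 * b k + 2 * a)) + 2 * d k" for k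
    proof -
      have "nsq (\<lambda>\<xi>. fourier (\<lambda>x. I r x *\<^sub>R f x) \<xi> - g \<xi>)
         = nsq (\<lambda>\<xi>. fourier (\<lambda>x. I r x *\<^sub>R f x - cut_at k x *\<^sub>R f x) \<xi> + (fourier (\<lambda>x. cut_at k x *\<^sub>R f x) \<xi> - g \<xi>))"
        by (simp add: fourier_diff[OF ri ci])
      also have "\<dots> \<le> 2 * nsq (fourier (\<lambda>x. I r x *\<^sub>R f x - cut_at k x *\<^sub>R f x)) + 2 * d k"
        unfolding d_def using fourier_measurable[OF ci[of k]] fourier_measurable[OF Bochner_Integration.integrable_diff[OF ri ci[of k]]]
        by (intro nsq_add_le) auto
      also have "nsq (fourier (\<lambda>x. I r x *\<^sub>R f x - cut_at k x *\<^sub>R f x)) \<le> c * nsq (\<lambda>x. I r x *\<^sub>R f x - cut_at k x *\<^sub>R f x)"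
        unfolding c_def by (rule fourier_bessel[OF Bochner_Integration.integrable_diff[OF ri ci]])
      also have "nsq (\<lambda>x. I r x *\<^sub>R f x - cut_at k x *\<^sub>R f x) = nsq (\<lambda>x. (1 - cut_at k x) *\<^sub>R f x + (I r x - 1) *\<^sub>R f x)"
        by (simp add: algebra_simps)
      also have "\<dots> \<le> 2 * b k + 2 * nsq (\<lambda>x. (I r x - 1) *\<^sub>R f x)"
        unfolding b_def by (intro nsq_add_le) measurable
      also have "nsq (\<lambda>x. (I r x - 1) *\<^sub>R f x) = a"
        unfolding a_def nsq_def by (simp add: abs_minus_commute)
      finally show ?thesis by (simp add: add_mono mult_left_mono)
    qed
    moreover have "(\<lambda>k. 2 * (c * (2 * b k + 2 * a)) + 2 * d k) \<longlonglongrightarrow> 2 * (c * (2 * 0 + 2 * a)) + 2 * 0"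
      using lim unfolding d_def[symmetric]
      by (intro tendsto_add ennreal_tendsto_cmult tendsto_const b0) (auto simp: c_def ennreal_mult_less_top)
    ultimately have "nsq (\<lambda>\<xi>. fourier (\<lambda>x. I r x *\<^sub>R f x) \<xi> - g \<xi>) \<le> 2 * (c * (2 * 0 + 2 * a)) + 2 * 0"
      by (intro LIMSEQ_le_const) auto
    also have "\<dots> = 4 * c * a" by (simp add: mult_ac flip: mult.assoc)
    finally show ?thesis by (simp add: a_def)
  qed
  have "((\<lambda>r. L2norm (\<lambda>\<xi>. fourier (\<lambda>x. I r x *\<^sub>R f x) \<xi> - g \<xi>)) \<longlongrightarrow> 0) at_top"
  proof (rule tendsto_at_topI_sequentially)
    fix X :: "nat \<Rightarrow> real" assume X: "filterlim X at_top sequentially"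
    have "(\<lambda>k. nsq (\<lambda>x. (1 - I (X k) x) *\<^sub>R f x)) \<longlonglongrightarrow> 0"
    proof (rule nsq_vanishing[OF f])
      show "\<bar>1 - I (X k) x\<bar> \<le> 1" for k x by (simp add: I_def indicator_def)
      fix x :: "real^'n"
      have "eventually (\<lambda>k. norm x \<le> X k) sequentially" using X by (simp add: filterlim_at_top)
      then have "eventually (\<lambda>k. 1 - I (X k) x = 0) sequentially" by eventually_elim (simp add: I_def)
      then show "(\<lambda>k. 1 - I (X k) x) \<longlonglongrightarrow> 0" by (rule tendsto_eventually)
    qed measurable
    then have "(\<lambda>k. 4 * c * nsq (\<lambda>x. (1 - I (X k) x) *\<^sub>R f x)) \<longlonglongrightarrow> 4 * c * 0"
      by (intro ennreal_tendsto_cmult) (simp_all add: c_def ennreal_mult_less_top)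
    then have u: "(\<lambda>k. 4 * c * nsq (\<lambda>x. (1 - I (X k) x) *\<^sub>R f x)) \<longlonglongrightarrow> 0" by simp
    have "(\<lambda>k. nsq (\<lambda>\<xi>. fourier (\<lambda>x. I (X k) x *\<^sub>R f x) \<xi> - g \<xi>)) \<longlonglongrightarrow> 0"
      by (rule tendsto_sandwich[OF _ _ tendsto_const[of 0] u]) (rule eventuallyI, simp, rule eventuallyI, rule bd)
    then have "(\<lambda>k. sqrt (enn2real (nsq (\<lambda>\<xi>. fourier (\<lambda>x. I (X k) x *\<^sub>R f x) \<xi> - g \<xi>)))) \<longlonglongrightarrow> sqrt (enn2real 0)"
      by (intro tendsto_real_sqrt tendsto_enn2real) simp_all
    moreover have "sqrt (enn2real (nsq (\<lambda>\<xi>. fourier (\<lambda>x. I r x *\<^sub>R f x) \<xi> - g \<xi>))) = L2norm (\<lambda>\<xi>. fourier (\<lambda>x. I r x *\<^sub>R f x) \<xi> - g \<xi>)" for r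
    proof -
      have "(\<lambda>\<xi>. fourier (\<lambda>x. I r x *\<^sub>R f x) \<xi> - g \<xi>) \<in> borel_measurable lborel" using fourier_measurable[OF ri[of r]] by simp
      from L2norm_sq[OF this] show ?thesis by (simp flip: \<open>_ = enn2real _\<close>)
    qed
    ultimately show "(\<lambda>k. L2norm (\<lambda>\<xi>. fourier (\<lambda>x. I (X k) x *\<^sub>R f x) \<xi> - g \<xi>)) \<longlonglongrightarrow> 0" by simp
  qed
  then show ?thesis unfolding has_L2_fourier_def using f gL by (simp add: I_def)
qed

section \<open>The Fourier transform of the solution\<close>

lemma L2norm_add_sq_le:
  fixes f g :: "'a::euclidean_space \<Rightarrow> 'b::euclidean_space"
  assumes "L2 f" "L2 g"
  shows "(L2norm (\<lambda>x. f x + g x))\<^sup>2 \<le> 2 * (L2norm f)\<^sup>2 + 2 * (L2norm g)\<^sup>2"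
proof (rule L2norm_sq_le)
  show "(\<lambda>x. f x + g x) \<in> borel_measurable lborel" by (rule L2_measurable[OF L2_add[OF assms]])
  have "nsq (\<lambda>x. f x + g x) \<le> 2 * nsq f + 2 * nsq g" using assms by (intro nsq_add_le L2_measurable)
  also have "\<dots> = ennreal (2 * (L2norm f)\<^sup>2 + 2 * (L2norm g)\<^sup>2)"
    by (simp add: nsq_eq_L2norm[OF assms(1)] nsq_eq_L2norm[OF assms(2)] ennreal_mult)
  finally show "nsq (\<lambda>x. f x + g x) \<le> ennreal (2 * (L2norm f)\<^sup>2 + 2 * (L2norm g)\<^sup>2)" .
qed simp

section \<open>Weak solutions as continuous curves in L2, and the equation for their transformed
  cutoffs\<close>

lemma cauchy_solution_L2: "cauchy_solution A0 A L u0 u \<Longrightarrow> t \<ge> 0 \<Longrightarrow> L2 (u t)"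
  by (simp add: cauchy_solution_def)

lemma cauchy_solution_tendsto:
  assumes cs: "cauchy_solution A0 A L u0 u" and X: "\<And>n. X n \<ge> 0" "X \<longlonglongrightarrow> t" and t: "t \<ge> 0"
  shows "(\<lambda>n. L2norm (\<lambda>x. u (X n) x - u t x)) \<longlonglongrightarrow> 0"
proof -
  define h where "h \<tau> = L2norm (\<lambda>x. u \<tau> x - u t x)" for \<tau>
  have h0: "h t = 0" by (simp add: h_def L2norm_def)
  have "(h \<longlongrightarrow> h t) (at t within {0..})" unfolding h0 unfolding h_def using cs t by (simp add: cauchy_solution_def)
  then have "continuous (at t within {0..}) h" by (simp add: continuous_within)
  then have "(\<lambda>n. h (X n)) \<longlonglongrightarrow> h t"
    by (rule continuous_within_tendsto_compose) (use X in auto)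
  then show ?thesis by (simp only: h0) (simp only: h_def)
qed

text \<open>Sequential compactness of [0,T]: times with unbounded norms would accumulate at a time
  where the curve is continuous.\<close>

lemma cauchy_solution_bounded:
  assumes cs: "cauchy_solution A0 A L u0 u"
  obtains N where "N \<ge> 0" "\<And>t. 0 \<le> t \<Longrightarrow> t \<le> T \<Longrightarrow> (L2norm (u t))\<^sup>2 \<le> N"
proof (rule ccontr)
  assume no: "\<not> thesis"
  have "\<exists>t. 0 \<le> t \<and> t \<le> T \<and> real k < (L2norm (u t))\<^sup>2" for k :: nat
  proof (rule ccontr)
    assume "\<not> ?thesis"
    then have "(L2norm (u t))\<^sup>2 \<le> real k" if "0 \<le> t" "t \<le> T" for t using that by (meson not_le)
    then show False using no that[of "real k"] by simp
  qed
  then obtain \<tau> where \<tau>: "\<And>k. 0 \<le> \<tau> k" "\<And>k. \<tau> k \<le> T" "\<And>k::nat. real k < (L2norm (u (\<tau> k)))\<^sup>2" by metis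
  have "seq_compact {0..T}" by (rule compact_imp_seq_compact) simp
  then obtain t r where t: "t \<in> {0..T}" "strict_mono r" "(\<tau> \<circ> r) \<longlonglongrightarrow> t"
    using seq_compactE[of "{0..T}" \<tau>] \<tau>(1,2) by (metis atLeastAtMost_iff)
  have "(\<lambda>n. L2norm (\<lambda>x. u ((\<tau> \<circ> r) n) x - u t x)) \<longlonglongrightarrow> 0"
    by (rule cauchy_solution_tendsto[OF cs _ t(3)]) (use \<tau>(1) t(1) in simp_all)
  then have "(\<lambda>n. 2 * (L2norm (\<lambda>x. u ((\<tau> \<circ> r) n) x - u t x))\<^sup>2 + 2 * (L2norm (u t))\<^sup>2) \<longlonglongrightarrow> 2 * 0\<^sup>2 + 2 * (L2norm (u t))\<^sup>2"
    by (intro tendsto_intros)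
  then have "Bseq (\<lambda>n. 2 * (L2norm (\<lambda>x. u ((\<tau> \<circ> r) n) x - u t x))\<^sup>2 + 2 * (L2norm (u t))\<^sup>2)"
    by (intro convergent_imp_Bseq) (auto simp: convergent_def)
  then obtain K where K: "\<And>n. \<bar>2 * (L2norm (\<lambda>x. u ((\<tau> \<circ> r) n) x - u t x))\<^sup>2 + 2 * (L2norm (u t))\<^sup>2\<bar> \<le> K"
    unfolding Bseq_def by auto
  obtain n :: nat where n: "K < real n" using reals_Archimedean2 by blast
  have "(L2norm (u ((\<tau> \<circ> r) n)))\<^sup>2 \<le> 2 * (L2norm (\<lambda>x. u ((\<tau> \<circ> r) n) x - u t x))\<^sup>2 + 2 * (L2norm (u t))\<^sup>2"
  proof -
    have 1: "L2 (u ((\<tau> \<circ> r) n))" "L2 (u t)" using cauchy_solution_L2[OF cs] \<tau>(1) t(1) by auto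
    show ?thesis using L2norm_add_sq_le[OF L2_diff[OF 1] 1(2)] by simp
  qed
  moreover have "real n \<le> real (r n)" using seq_suble[OF t(2), of n] by simp
  moreover have "real (r n) < (L2norm (u ((\<tau> \<circ> r) n)))\<^sup>2" using \<tau>(3)[of "r n"] by simp
  ultimately show False using K[of n] n by linarith
qed

text \<open>Joint continuity yields measurability on the product space, needed to exchange the
  integrals over time and frequency. The curve is frozen for negative times by \<open>max 0\<close>
  so that the function is continuous everywhere.\<close>

lemma fourier_solution_jointly_continuous:
  fixes u :: "real \<Rightarrow> real^'n::finite \<Rightarrow> real^'m"
  assumes cs: "cauchy_solution A0 A L u0 u" and m: "L2 m"
  shows "continuous_on UNIV (\<lambda>p. fourier (\<lambda>x. m x *\<^sub>R u (max 0 (fst p)) x) (snd p))"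
  unfolding continuous_on_sequentially
proof (intro ballI allI impI)
  fix Z :: "nat \<Rightarrow> real \<times> (real^'n)" and a :: "real \<times> (real^'n)"
  assume "(\<forall>n. Z n \<in> UNIV) \<and> Z \<longlonglongrightarrow> a"
  then have Z: "Z \<longlonglongrightarrow> a" by simp
  define X where "X n = max 0 (fst (Z n))" for n
  define t where "t = max 0 (fst a)"
  have Xt: "X \<longlonglongrightarrow> t" unfolding X_def[abs_def] t_def by (intro tendsto_max tendsto_const tendsto_fst Z)
  have Zs: "(\<lambda>n. snd (Z n)) \<longlonglongrightarrow> snd a" by (intro tendsto_snd Z)
  have X0: "X n \<ge> 0" and t0: "t \<ge> 0" for n by (auto simp: X_def t_def)
  have L: "L2 (u (X n))" "L2 (u t)" for n using cauchy_solution_L2[OF cs] X0 t0 by auto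
  have i: "integrable lborel (\<lambda>x. m x *\<^sub>R u (X n) x)" "integrable lborel (\<lambda>x. m x *\<^sub>R u t x)" for n
    using integrable_scaleR_L2(1)[OF m L(1)] integrable_scaleR_L2(1)[OF m L(2)] by auto
  have lim0: "(\<lambda>n. 2 * (L2norm m * L2norm (\<lambda>x. u (X n) x - u t x))) \<longlonglongrightarrow> 2 * (L2norm m * 0)"
    by (intro tendsto_intros cauchy_solution_tendsto[OF cs X0 Xt t0])
  have 1: "(\<lambda>n. fourier (\<lambda>x. m x *\<^sub>R (u (X n) x - u t x)) (snd (Z n))) \<longlonglongrightarrow> 0"
  proof (rule Lim_null_comparison)
    show "\<forall>\<^sub>F n in sequentially. norm (fourier (\<lambda>x. m x *\<^sub>R (u (X n) x - u t x)) (snd (Z n)))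
        \<le> 2 * (L2norm m * L2norm (\<lambda>x. u (X n) x - u t x))"
      by (intro eventuallyI fourier_norm_le m L2_diff L)
    show "(\<lambda>n. 2 * (L2norm m * L2norm (\<lambda>x. u (X n) x - u t x))) \<longlonglongrightarrow> 0" using lim0 by simp
  qed
  have "isCont (fourier (\<lambda>x. m x *\<^sub>R u t x)) (snd a)"
    using fourier_continuous[OF i(2)] by (simp add: continuous_on_eq_continuous_at)
  from isCont_tendsto_compose[OF this Zs]
  have 2: "(\<lambda>n. fourier (\<lambda>x. m x *\<^sub>R u t x) (snd (Z n))) \<longlonglongrightarrow> fourier (\<lambda>x. m x *\<^sub>R u t x) (snd a)" .
  have eq: "fourier (\<lambda>x. m x *\<^sub>R (u (X n) x - u t x)) \<xi> + fourier (\<lambda>x. m x *\<^sub>R u t x) \<xi> = fourier (\<lambda>x. m x *\<^sub>R u (X n) x) \<xi>" for n \<xi>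
    unfolding scaleR_diff_right fourier_diff[OF i] by simp
  have "(\<lambda>n. fourier (\<lambda>x. m x *\<^sub>R u (X n) x) (snd (Z n))) \<longlonglongrightarrow> fourier (\<lambda>x. m x *\<^sub>R u t x) (snd a)"
    using tendsto_add[OF 1 2] unfolding eq by simp
  then show "((\<lambda>p. fourier (\<lambda>x. m x *\<^sub>R u (max 0 (fst p)) x) (snd p)) \<circ> Z) \<longlonglongrightarrow> fourier (\<lambda>x. m x *\<^sub>R u (max 0 (fst a)) x) (snd a)"
    by (simp add: o_def X_def t_def)
qed

text \<open>The weak equation is tested with m cos(x.\<xi>) and m cos(x.\<xi> + pi/2), and the two
  real equations are combined into one complex equation. All errors are collected in the derivatives
  of \<open>m\<close> on the right.\<close>

lemma fourier_cut_solution_ode: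
  fixes u :: "real \<Rightarrow> real^'n::finite \<Rightarrow> real^'m"
  assumes cs: "cauchy_solution A0 A L u0 u" and pos: "pos_on (cmat A0) UNIV" and m: "test_function m" and t: "t > 0"
  obtains w where "((\<lambda>\<tau>. fourier (\<lambda>x. m x *\<^sub>R u \<tau> x) \<xi>) has_vector_derivative w) (at t)"
    "cmat A0 *v w + mulI (cmat (symbol A \<xi>) *v fourier (\<lambda>x. m x *\<^sub>R u t x) \<xi>) + cmat L *v fourier (\<lambda>x. m x *\<^sub>R u t x) \<xi>
      = (\<Sum>j\<in>UNIV. cmat (A j) *v fourier (\<lambda>x. pd j m x *\<^sub>R u t x) \<xi>)"
proof -
  define \<phi> where "\<phi> \<theta> x = m x * cos (x \<bullet> \<xi> + \<theta>)" for \<theta> x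
  have tf: "test_function (\<phi> \<theta>)" for \<theta> unfolding \<phi>_def[abs_def] by (rule test_function_mult[OF m smooth_cos])
  define Y where "Y \<theta> \<tau> = (\<integral>x. \<phi> \<theta> x *\<^sub>R u \<tau> x \<partial>lborel)" for \<theta> \<tau>
  define E where "E \<theta> = (\<integral>x. (\<Sum>j\<in>UNIV. pd j (\<phi> \<theta>) x *\<^sub>R (A j *v u t x)) \<partial>lborel)" for \<theta>
  have L: "L2 (u \<tau>)" if "\<tau> \<ge> 0" for \<tau> using cauchy_solution_L2[OF cs that] .
  have Lt: "L2 (u t)" using L t by simp
  have dY: "((\<lambda>\<tau>. A0 *v Y \<theta> \<tau>) has_vector_derivative (E \<theta> - L *v Y \<theta> t)) (at t)" for \<theta>
  proof -
    have "((\<lambda>\<tau>. \<integral>x. \<phi> \<theta> x *\<^sub>R (A0 *v u \<tau> x) \<partial>lborel) has_vector_derivative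
         (\<integral>x. (\<Sum>j\<in>UNIV. pd j (\<phi> \<theta>) x *\<^sub>R (A j *v u t x)) - \<phi> \<theta> x *\<^sub>R (L *v u t x) \<partial>lborel)) (at t)"
      using cs tf t unfolding cauchy_solution_def by blast
    moreover have "(\<integral>x. (\<Sum>j\<in>UNIV. pd j (\<phi> \<theta>) x *\<^sub>R (A j *v u t x)) - \<phi> \<theta> x *\<^sub>R (L *v u t x) \<partial>lborel) = E \<theta> - L *v Y \<theta> t"
    proof -
      have "integrable lborel (\<lambda>x. \<Sum>j\<in>UNIV. pd j (\<phi> \<theta>) x *\<^sub>R (A j *v u t x))"
        by (intro Bochner_Integration.integrable_sum integral_matrix_vector(1) test_function_scaleR_integrable[OF test_function_pd[OF tf] Lt])
      then show ?thesis unfolding E_def Y_def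
        by (simp only: Bochner_Integration.integral_diff[OF _ integral_matrix_vector(1)[OF test_function_scaleR_integrable[OF tf Lt]]]
            integral_matrix_vector(2)[OF test_function_scaleR_integrable[OF tf Lt]])
    qed
    ultimately have d: "((\<lambda>\<tau>. \<integral>x. \<phi> \<theta> x *\<^sub>R (A0 *v u \<tau> x) \<partial>lborel) has_vector_derivative (E \<theta> - L *v Y \<theta> t)) (at t)" by simp
    show ?thesis
      by (rule has_vector_derivative_transform_within_open[OF d, of "{0<..}"])
         (use t in \<open>auto simp: Y_def integral_matrix_vector(2)[OF test_function_scaleR_integrable[OF tf L]]\<close>)
  qed
  \<comment> \<open>The weak formulation differentiates only moments of A0 u; applying the inverse
    of \<open>A0\<close> transfers differentiability to the transform itself.\<close>
  define B where "B = cmat (matrix_inv A0)"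
  define F where "F \<tau> = fourier (\<lambda>x. m x *\<^sub>R u \<tau> x) \<xi>" for \<tau>
  have FY: "F \<tau> = cvec (Y 0 \<tau>) + mulI (cvec (Y (pi / 2) \<tau>))" if "\<tau> \<ge> 0" for \<tau>
    unfolding F_def Y_def \<phi>_def by (rule fourier_cos_decomposition[OF test_function_scaleR_integrable[OF m L[OF that]]])
  define W' where "W' = cvec (E 0 - L *v Y 0 t) + mulI (cvec (E (pi / 2) - L *v Y (pi / 2) t))"
  have blB: "bounded_linear (\<lambda>z. B *v z)" unfolding B_def by simp
  have "((\<lambda>\<tau>. B *v (cvec (A0 *v Y 0 \<tau>) + mulI (cvec (A0 *v Y (pi / 2) \<tau>)))) has_vector_derivative B *v W') (at t)"
    unfolding W'_def
    by (intro bounded_linear.has_vector_derivative[OF blB] has_vector_derivative_add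
        bounded_linear.has_vector_derivative[OF bounded_linear_cvec] bounded_linear.has_vector_derivative[OF bounded_linear_mulI] dY)
  moreover have BA: "B *v (cmat A0 *v z) = z" "cmat A0 *v (B *v z) = z" for z
    by (simp_all add: B_def matrix_vector_mul_assoc cmat_mult[symmetric] matrix_inv_of_pos_on[OF pos])
  have "B *v (cvec (A0 *v Y 0 \<tau>) + mulI (cvec (A0 *v Y (pi / 2) \<tau>))) = F \<tau>" if "\<tau> \<ge> 0" for \<tau>
    unfolding FY[OF that] cvec_matrix mulI_cmat[symmetric] matrix_vector_right_distrib[symmetric] BA ..
  ultimately have dF: "(F has_vector_derivative B *v W') (at t)"
    by (elim has_vector_derivative_transform_within_open[of _ _ _ "{0<..}"]) (use t in auto)
  have "W' = cvec (E 0) + mulI (cvec (E (pi / 2))) - cmat L *v F t"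
    using t by (simp add: W'_def FY cvec_linear cvec_matrix mulI_diff mulI_cmat matrix_vector_right_distrib)
  also have "cvec (E 0) + mulI (cvec (E (pi / 2))) = (\<Sum>j\<in>UNIV. cmat (A j) *v fourier (\<lambda>x. pd j m x *\<^sub>R u t x) \<xi>) - mulI (cmat (symbol A \<xi>) *v F t)"
    unfolding E_def \<phi>_def[abs_def] F_def by (rule fourier_first_order_term[OF m Lt])
  finally have "cmat A0 *v (B *v W') + mulI (cmat (symbol A \<xi>) *v F t) + cmat L *v F t = (\<Sum>j\<in>UNIV. cmat (A j) *v fourier (\<lambda>x. pd j m x *\<^sub>R u t x) \<xi>)"
    by (simp add: BA)
  then show ?thesis using dF unfolding F_def[abs_def] by (rule that[rotated])
qed

lemma nn_integral_Icc:
  fixes f :: "real \<Rightarrow> real"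
  assumes f: "continuous_on {0..T} f" and nn: "\<And>t. f t \<ge> 0"
  shows "ennreal (integral {0..T} f) = (\<integral>\<^sup>+t. ennreal (indicator {0..T} t * f t) \<partial>lborel)"
proof -
  have si: "set_integrable lborel {0..T} f" by (rule borel_integrable_atLeastAtMost'[OF f])
  have "integral {0..T} f = (\<integral>t. indicator {0..T} t *\<^sub>R f t \<partial>lborel)"
    using set_borel_integral_eq_integral(2)[OF si] by (simp add: set_lebesgue_integral_def)
  moreover have "(\<integral>\<^sup>+t. ennreal (indicator {0..T} t *\<^sub>R f t) \<partial>lborel) = ennreal (\<integral>t. indicator {0..T} t *\<^sub>R f t \<partial>lborel)"
    by (rule nn_integral_eq_integral) (use si nn in \<open>auto simp: set_integrable_def\<close>)
  ultimately show ?thesis by simp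
qed

text \<open>The distinguished version of the transform of a solution: for integrable initial data it
  is meaningful at every single \<xi>.\<close>

definition fsol :: "real^'m^'m \<Rightarrow> ('n::finite \<Rightarrow> real^'m^'m) \<Rightarrow> real^'m^'m \<Rightarrow> (real^'n \<Rightarrow> real^'m) \<Rightarrow> real \<Rightarrow> real^'n \<Rightarrow> complex^'m" where
  "fsol A0 A L u0 t \<xi> = flow (generator A0 A L \<xi>) t (fourier u0 \<xi>)"

lemma fsol_measurable:
  assumes "integrable lborel u0" shows "fsol A0 A L u0 t \<in> borel_measurable lborel"
proof -
  have "fourier u0 \<in> borel_measurable borel" using fourier_measurable[OF assms] by simp
  from flow_measurable[OF bounded_linear_generator continuous_generator this]
  show ?thesis unfolding fsol_def[abs_def] by simp
qed

lemma fsol_has_vector_derivative: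
  "((\<lambda>t. fsol A0 A L u0 t \<xi>) has_vector_derivative generator A0 A L \<xi> (fsol A0 A L u0 t \<xi>)) (at t within T)"
  unfolding fsol_def by (rule flow_has_vector_derivative[OF bounded_linear_generator])

lemma fourier_cong_AE:
  assumes "AE x in lborel. f x = g x" "f \<in> borel_measurable lborel" "g \<in> borel_measurable lborel"
  shows "fourier f \<xi> = fourier g \<xi>"
proof -
  have "(\<lambda>x. f x $ i) \<in> borel_measurable lborel" "(\<lambda>x. g x $ i) \<in> borel_measurable lborel" for i
    using assms(2,3) unfolding borel_measurable_vec_iff by blast+
  then show ?thesis unfolding vec_eq_iff fourier_nth ft_def
    by (intro allI integral_cong_AE) (use assms(1) in \<open>auto elim: eventually_mono\<close>)
qed

text \<open>One factor \<open>CARD('n)\<close> comes from the Cauchy-Schwarz inequality for the sum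
  over j, the other from adding up equal bounds.\<close>

lemma nsq_fourier_residual_le:
  fixes v :: "real^'n::finite \<Rightarrow> real^'m" and A :: "'n \<Rightarrow> real^'m^'m"
  assumes C: "C \<ge> 0" "\<And>j z. norm (cmat (A j) *v z) \<le> C * norm z"
    and v: "L2 v" and m: "\<And>j. test_function (m j)" "\<And>j x. \<bar>m j x\<bar> \<le> b"
  shows "nsq (\<lambda>\<xi>. \<Sum>j\<in>UNIV. cmat (A j) *v fourier (\<lambda>x. m j x *\<^sub>R v x) \<xi>)
    \<le> ennreal (C\<^sup>2 * real CARD('n) * real CARD('n) * (2 * pi) ^ CARD('n) * b\<^sup>2 * (L2norm v)\<^sup>2)"
proof -
  have i: "integrable lborel (\<lambda>x. m j x *\<^sub>R v x)" for j by (rule test_function_scaleR_integrable[OF m(1) v])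
  have fm[measurable]: "fourier (\<lambda>x. m j x *\<^sub>R v x) \<in> borel_measurable lborel" for j by (rule fourier_measurable[OF i])
  have "nsq (\<lambda>\<xi>. \<Sum>j\<in>UNIV. cmat (A j) *v fourier (\<lambda>x. m j x *\<^sub>R v x) \<xi>)
     \<le> (\<integral>\<^sup>+\<xi>. (\<Sum>j\<in>UNIV. ennreal (C\<^sup>2 * real CARD('n)) * ennreal ((norm (fourier (\<lambda>x. m j x *\<^sub>R v x) \<xi>))\<^sup>2)) \<partial>lborel)"
    unfolding nsq_def
  proof (rule nn_integral_mono)
    fix \<xi> :: "real^'n"
    define a where "a j = norm (fourier (\<lambda>x. m j x *\<^sub>R v x) \<xi>)" for j
    have "norm (\<Sum>j\<in>UNIV. cmat (A j) *v fourier (\<lambda>x. m j x *\<^sub>R v x) \<xi>) \<le> (\<Sum>j\<in>UNIV. C * a j)"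
      by (rule order_trans[OF norm_sum sum_mono]) (simp add: a_def C(2))
    then have "(norm (\<Sum>j\<in>UNIV. cmat (A j) *v fourier (\<lambda>x. m j x *\<^sub>R v x) \<xi>))\<^sup>2 \<le> (\<Sum>j\<in>UNIV. C * a j)\<^sup>2"
      by (rule power_mono) simp
    also have "\<dots> \<le> real CARD('n) * (\<Sum>j\<in>UNIV. (C * a j)\<^sup>2)"
      using L2_set_mult_ineq[of "\<lambda>j. 1" "\<lambda>j. C * a j" "UNIV :: 'n set"] sum_squares_bound
      by (rule_tac order_trans[OF sum_squared_le_sum_of_squares]) (simp_all add: mult.commute)
    also have "\<dots> = (\<Sum>j\<in>UNIV. C\<^sup>2 * real CARD('n) * (a j)\<^sup>2)" by (simp add: sum_distrib_left power_mult_distrib mult_ac)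
    finally have "ennreal ((norm (\<Sum>j\<in>UNIV. cmat (A j) *v fourier (\<lambda>x. m j x *\<^sub>R v x) \<xi>))\<^sup>2) \<le> ennreal (\<Sum>j\<in>UNIV. C\<^sup>2 * real CARD('n) * (a j)\<^sup>2)"
      by (rule ennreal_leI)
    also have "\<dots> = (\<Sum>j\<in>UNIV. ennreal (C\<^sup>2 * real CARD('n)) * ennreal ((a j)\<^sup>2))"
      by (subst sum_ennreal[symmetric]) (auto simp: ennreal_mult)
    finally show "ennreal ((norm (\<Sum>j\<in>UNIV. cmat (A j) *v fourier (\<lambda>x. m j x *\<^sub>R v x) \<xi>))\<^sup>2)
       \<le> (\<Sum>j\<in>UNIV. ennreal (C\<^sup>2 * real CARD('n)) * ennreal ((norm (fourier (\<lambda>x. m j x *\<^sub>R v x) \<xi>))\<^sup>2))" by (simp add: a_def)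
  qed
  also have "\<dots> = (\<Sum>j\<in>UNIV. ennreal (C\<^sup>2 * real CARD('n)) * nsq (fourier (\<lambda>x. m j x *\<^sub>R v x)))"
    by (subst nn_integral_sum) (auto simp: nn_integral_cmult nsq_def)
  also have "\<dots> \<le> (\<Sum>j\<in>(UNIV::'n set). ennreal (C\<^sup>2 * real CARD('n)) * (ennreal ((2 * pi) ^ CARD('n)) * (ennreal (b\<^sup>2) * nsq v)))"
  proof (intro sum_mono mult_left_mono)
    fix j
    have "nsq (fourier (\<lambda>x. m j x *\<^sub>R v x)) \<le> ennreal ((2 * pi) ^ CARD('n)) * nsq (\<lambda>x. m j x *\<^sub>R v x)" by (rule fourier_bessel[OF i])
    also have "nsq (\<lambda>x. m j x *\<^sub>R v x) \<le> ennreal (b\<^sup>2) * nsq v"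
      by (rule L2_scaleR(2)[OF v smooth_measurable[OF test_function_smooth[OF m(1)]] m(2)])
    finally show "nsq (fourier (\<lambda>x. m j x *\<^sub>R v x)) \<le> ennreal ((2 * pi) ^ CARD('n)) * (ennreal (b\<^sup>2) * nsq v)"
      by (simp add: mult_left_mono)
  qed simp
  also have "\<dots> = ennreal (real CARD('n) * (C\<^sup>2 * real CARD('n) * ((2 * pi) ^ CARD('n) * (b\<^sup>2 * (L2norm v)\<^sup>2))))"
    by (simp add: nsq_eq_L2norm[OF v] ennreal_mult ennreal_of_nat_eq_real_of_nat)
  finally show ?thesis by (simp add: mult_ac)
qed

text \<open>The difference between the transformed cutoff and the flow solves the equation with a
  residual of order \<open>dil k\<close> in L2, uniformly on [0,T], and starts from an initial error
  tending to 0. Gronwall's inequality at each \<xi>, integrated over \<xi>, then gives convergence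
  at the fixed time T. In particular every weak solution has its transform prescribed by its initial
  value.\<close>

proposition fourier_cut_solution_tendsto:
  fixes u :: "real \<Rightarrow> real^'n::finite \<Rightarrow> real^'m"
  assumes cA: "cond_A A0 A L" and cs: "cauchy_solution A0 A L u0 u"
    and u0: "integrable lborel u0" "L2 u0" and T: "T \<ge> 0"
  shows "(\<lambda>k. nsq (\<lambda>\<xi>. fourier (\<lambda>x. cut_at k x *\<^sub>R u T x) \<xi> - fsol A0 A L u0 T \<xi>)) \<longlonglongrightarrow> 0"
proof -
  have pos: "pos_on (cmat A0) UNIV" using cA by (simp add: cond_A_def)
  obtain c0 where c0: "c0 > 0" "\<And>z. c0 * (norm z)\<^sup>2 \<le> (cmat A0 *v z) \<bullet> z" by (rule coercive_of_pos_on[OF pos], rule that)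
  obtain M where M: "M \<ge> 0" "\<And>z. norm (cmat A0 *v z) \<le> M * norm z" using cmat_bound1[of A0] by blast
  obtain N where N: "N \<ge> 0" "\<And>t. 0 \<le> t \<Longrightarrow> t \<le> T \<Longrightarrow> (L2norm (u t))\<^sup>2 \<le> N" using cauchy_solution_bounded[OF cs] by blast
  obtain B where B: "B > 0" "\<And>k j (x :: real^'n). \<bar>pd j (cut_at k) x\<bar> \<le> dil k * B" using pd_cut_bound by blast
  have "\<exists>C. C \<ge> 0 \<and> (\<forall>z. norm (cmat (A j) *v z) \<le> C * norm z)" for j using cmat_bound1[of "A j"] by blast
  then obtain CA where CA: "\<And>j. CA j \<ge> 0" "\<And>j z. norm (cmat (A j) *v z) \<le> CA j * norm z" by metis
  define C where "C = (\<Sum>j\<in>UNIV. CA j)"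
  have C: "C \<ge> 0" "norm (cmat (A j) *v z) \<le> C * norm z" for j z
  proof -
    show "C \<ge> 0" unfolding C_def by (intro sum_nonneg CA)
    have "CA j \<le> C" unfolding C_def by (rule member_le_sum) (use CA(1) in auto)
    then show "norm (cmat (A j) *v z) \<le> C * norm z" using CA(2)[of j z] by (meson mult_right_mono norm_ge_zero order_trans)
  qed
  define r where "r k t \<xi> = (\<Sum>j\<in>UNIV. cmat (A j) *v fourier (\<lambda>x. pd j (cut_at k) x *\<^sub>R u (max 0 t) x) \<xi>)" for k t \<xi>
  have Lu: "L2 (u (max 0 t))" for t using cauchy_solution_L2[OF cs] by simp
  have tpd: "test_function (pd j (cut_at k))" for j :: 'n and k by (rule test_function_pd[OF test_function_cut])
  have rc: "continuous_on UNIV (\<lambda>p. r k (fst p) (snd p))" for k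
    unfolding r_def by (intro continuous_on_sum continuous_on_cmat_mult continuous_on_const
        fourier_solution_jointly_continuous[OF cs test_function_L2[OF tpd]])
  have rc1: "continuous_on {0..T} (\<lambda>t. r k t \<xi>)" for k \<xi>
    by (rule continuous_on_compose2[OF rc[of k], where f = "\<lambda>t. (t, \<xi>)", simplified]) (intro continuous_intros)
  define d where "d k t \<xi> = fourier (\<lambda>x. cut_at k x *\<^sub>R u (max 0 t) x) \<xi> - fsol A0 A L u0 t \<xi>" for k t \<xi>
  have dc: "continuous_on {0..T} (\<lambda>t. d k t \<xi>)" for k \<xi>
  proof -
    have "continuous_on {0..T} (\<lambda>t. fourier (\<lambda>x. cut_at k x *\<^sub>R u (max 0 t) x) \<xi>)"
      by (rule continuous_on_compose2[OF fourier_solution_jointly_continuous[OF cs test_function_L2[OF test_function_cut[of k]]],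
            where f = "\<lambda>t. (t, \<xi>)", simplified]) (intro continuous_intros)
    moreover have "continuous_on {0..T} (\<lambda>t. fsol A0 A L u0 t \<xi>)"
      by (rule continuous_on_vector_derivative) (rule fsol_has_vector_derivative)
    ultimately show ?thesis unfolding d_def by (intro continuous_intros)
  qed
  have gron: "c0 * (norm (d k T \<xi>))\<^sup>2 \<le> exp (T / c0) * ((cmat A0 *v d k 0 \<xi>) \<bullet> d k 0 \<xi> + integral {0..T} (\<lambda>t. (norm (r k t \<xi>))\<^sup>2))" for k \<xi>
  proof -
    have "\<exists>w. ((\<lambda>t. d k t \<xi>) has_vector_derivative w) (at t) \<and>
        cmat A0 *v w + mulI (cmat (symbol A \<xi>) *v d k t \<xi>) + cmat L *v d k t \<xi> = r k t \<xi>" if t: "t > 0" for t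
    proof -
      obtain w where w: "((\<lambda>\<tau>. fourier (\<lambda>x. cut_at k x *\<^sub>R u \<tau> x) \<xi>) has_vector_derivative w) (at t)"
        "cmat A0 *v w + mulI (cmat (symbol A \<xi>) *v fourier (\<lambda>x. cut_at k x *\<^sub>R u t x) \<xi>) + cmat L *v fourier (\<lambda>x. cut_at k x *\<^sub>R u t x) \<xi>
          = (\<Sum>j\<in>UNIV. cmat (A j) *v fourier (\<lambda>x. pd j (cut_at k) x *\<^sub>R u t x) \<xi>)"
        by (rule fourier_cut_solution_ode[OF cs pos test_function_cut t])
      define g where "g = generator A0 A L \<xi> (fsol A0 A L u0 t \<xi>)"
      have "((\<lambda>\<tau>. fourier (\<lambda>x. cut_at k x *\<^sub>R u (max 0 \<tau>) x) \<xi>) has_vector_derivative w) (at t)"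
        by (rule has_vector_derivative_transform_within_open[OF w(1), of "{0<..}"]) (use t in \<open>auto simp: max_def\<close>)
      then have "((\<lambda>t. d k t \<xi>) has_vector_derivative w - g) (at t)"
        unfolding d_def g_def by (intro has_vector_derivative_diff fsol_has_vector_derivative)
      moreover have "cmat A0 *v (w - g) + mulI (cmat (symbol A \<xi>) *v d k t \<xi>) + cmat L *v d k t \<xi> = r k t \<xi>"
      proof -
        have m: "max 0 t = t" using t by simp
        show ?thesis unfolding r_def d_def g_def m w(2)[symmetric]
          by (simp add: matrix_vector_mult_diff_distrib mulI_diff A0_generator[OF pos])
      qed
      ultimately show ?thesis by blast
    qed
    then obtain d' where "\<And>t. t > 0 \<Longrightarrow> ((\<lambda>t. d k t \<xi>) has_vector_derivative d' t) (at t)"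
        "\<And>t. t > 0 \<Longrightarrow> cmat A0 *v d' t + mulI (cmat (symbol A \<xi>) *v d k t \<xi>) + cmat L *v d k t \<xi> = r k t \<xi>" by metis
    then show ?thesis by (intro gronwall_residual[OF cA c0 T dc rc1]) auto
  qed
  \<comment> \<open>Growth factor of Gronwall's inequality, times the bound for the form of
    \<open>A0\<close> at time 0, divided by its lower bound at time T.\<close>
  define K where "K = exp (T / c0) * (M + 1) / c0"
  have K: "K \<ge> 0" using M(1) c0(1) by (simp add: K_def)
  have gron': "ennreal ((norm (d k T \<xi>))\<^sup>2) \<le> ennreal K * ennreal ((norm (d k 0 \<xi>))\<^sup>2)
      + ennreal K * (\<integral>\<^sup>+t. ennreal (indicator {0..T} t * (norm (r k t \<xi>))\<^sup>2) \<partial>lborel)" for k \<xi>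
  proof -
    define J where "J = integral {0..T} (\<lambda>t. (norm (r k t \<xi>))\<^sup>2)"
    have rc2: "continuous_on {0..T} (\<lambda>t. (norm (r k t \<xi>))\<^sup>2)" by (intro continuous_intros rc1)
    have J: "J \<ge> 0" unfolding J_def by (rule integral_nonneg) (use integrable_continuous_real[OF rc2] in auto)
    have "(cmat A0 *v d k 0 \<xi>) \<bullet> d k 0 \<xi> \<le> norm (cmat A0 *v d k 0 \<xi>) * norm (d k 0 \<xi>)" by (rule norm_cauchy_schwarz)
    also have "\<dots> \<le> M * norm (d k 0 \<xi>) * norm (d k 0 \<xi>)" using M(2) by (rule mult_right_mono) simp
    finally have "(cmat A0 *v d k 0 \<xi>) \<bullet> d k 0 \<xi> + J \<le> (M + 1) * ((norm (d k 0 \<xi>))\<^sup>2 + J)"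
      using M(1) J by (simp add: power2_eq_square algebra_simps add_increasing)
    then have "exp (T / c0) * ((cmat A0 *v d k 0 \<xi>) \<bullet> d k 0 \<xi> + J) \<le> exp (T / c0) * ((M + 1) * ((norm (d k 0 \<xi>))\<^sup>2 + J))"
      by (rule mult_left_mono) simp
    then have cb: "c0 * (norm (d k T \<xi>))\<^sup>2 \<le> exp (T / c0) * ((M + 1) * ((norm (d k 0 \<xi>))\<^sup>2 + J))"
      using gron[of k \<xi>] unfolding J_def by linarith
    have "(norm (d k T \<xi>))\<^sup>2 \<le> K * (norm (d k 0 \<xi>))\<^sup>2 + K * J"
    proof -
      define Z where "Z = (norm (d k 0 \<xi>))\<^sup>2 + J"
      have "(norm (d k T \<xi>))\<^sup>2 \<le> exp (T / c0) * ((M + 1) * Z) / c0"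
        using cb unfolding Z_def[symmetric] pos_le_divide_eq[OF c0(1)] by (simp only: mult.commute[of c0])
      also have "\<dots> = K * Z" by (simp add: K_def)
      finally show ?thesis by (simp only: Z_def distrib_left)
    qed
    then have "ennreal ((norm (d k T \<xi>))\<^sup>2) \<le> ennreal (K * (norm (d k 0 \<xi>))\<^sup>2 + K * J)" by (rule ennreal_leI)
    also have "\<dots> = ennreal K * ennreal ((norm (d k 0 \<xi>))\<^sup>2) + ennreal K * ennreal J"
      using K J by (simp add: ennreal_mult)
    also have "ennreal J = (\<integral>\<^sup>+t. ennreal (indicator {0..T} t * (norm (r k t \<xi>))\<^sup>2) \<partial>lborel)"
      unfolding J_def by (rule nn_integral_Icc[OF rc2]) simp
    finally show ?thesis .
  qed
  have icut: "integrable lborel (\<lambda>x. cut_at k x *\<^sub>R u (max 0 t) x)" for k t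
    by (rule test_function_scaleR_integrable[OF test_function_cut Lu])
  have dm: "d k t \<in> borel_measurable lborel" for k t
    unfolding d_def[abs_def] using fourier_measurable[OF icut] fsol_measurable[OF u0(1)] by simp
  define R where "R = C\<^sup>2 * real CARD('n) * real CARD('n) * (2 * pi) ^ CARD('n)"
  have R: "R \<ge> 0" by (simp add: R_def)
  \<comment> \<open>Tonelli's theorem puts the frequency integral inside, where Bessel's inequality
    applies at each time.\<close>
  have rbound: "(\<integral>\<^sup>+\<xi>. (\<integral>\<^sup>+t. ennreal (indicator {0..T} t * (norm (r k t \<xi>))\<^sup>2) \<partial>lborel) \<partial>lborel) \<le> ennreal (R * (dil k * B)\<^sup>2 * N * T)" for k
  proof -
    have m: "(\<lambda>p. r k (fst p) (snd p)) \<in> borel_measurable (lborel \<Otimes>\<^sub>M lborel)"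
      using borel_measurable_continuous_onI[OF rc[of k]] by (simp add: borel_prod[symmetric])
    have m2: "(\<lambda>(t, \<xi>). ennreal (indicator {0..T} t * (norm (r k t \<xi>))\<^sup>2)) \<in> borel_measurable (lborel \<Otimes>\<^sub>M lborel)"
      unfolding case_prod_beta using m by measurable
    have "(\<integral>\<^sup>+\<xi>. (\<integral>\<^sup>+t. ennreal (indicator {0..T} t * (norm (r k t \<xi>))\<^sup>2) \<partial>lborel) \<partial>lborel)
       = (\<integral>\<^sup>+t. (\<integral>\<^sup>+\<xi>. ennreal (indicator {0..T} t * (norm (r k t \<xi>))\<^sup>2) \<partial>lborel) \<partial>lborel)"
      by (rule lborel_pair.Fubini'[OF m2])
    also have "\<dots> \<le> (\<integral>\<^sup>+t. ennreal (R * (dil k * B)\<^sup>2 * N) * indicator {0..T} t \<partial>lborel)"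
    proof (rule nn_integral_mono)
      fix t :: real
      show "(\<integral>\<^sup>+\<xi>. ennreal (indicator {0..T} t * (norm (r k t \<xi>))\<^sup>2) \<partial>lborel) \<le> ennreal (R * (dil k * B)\<^sup>2 * N) * indicator {0..T} t"
      proof (cases "t \<in> {0..T}")
        case True
        then have mt: "max 0 t = t" by simp
        have "nsq (r k t) \<le> ennreal (C\<^sup>2 * real CARD('n) * real CARD('n) * (2 * pi) ^ CARD('n) * (dil k * B)\<^sup>2 * (L2norm (u (max 0 t)))\<^sup>2)"
          unfolding r_def[abs_def] by (rule nsq_fourier_residual_le[OF C Lu tpd B(2)])
        also have "\<dots> \<le> ennreal (R * (dil k * B)\<^sup>2 * N)"
          unfolding mt R_def[symmetric] using True R by (intro ennreal_leI mult_left_mono N) auto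
        finally show ?thesis using True by (simp add: nsq_def)
      qed simp
    qed
    also have "\<dots> = ennreal (R * (dil k * B)\<^sup>2 * N) * emeasure lborel {0..T}" by (rule nn_integral_cmult_indicator) simp
    also have "\<dots> = ennreal (R * (dil k * B)\<^sup>2 * N * T)" using T R N(1) by (simp add: ennreal_mult)
    finally show ?thesis .
  qed
  have i0: "integrable lborel (\<lambda>x. cut_at k x *\<^sub>R u0 x)" for k by (rule test_function_scaleR_integrable[OF test_function_cut u0(2)])
  \<comment> \<open>At time 0 the flow is the transform of \<open>u0\<close> itself, and u(0) agrees
    with \<open>u0\<close> almost everywhere, so only the part of \<open>u0\<close> removed by the
    cutoff remains.\<close>
  have d0: "nsq (d k 0) \<le> ennreal ((2 * pi) ^ CARD('n)) * nsq (\<lambda>x. (cut_at k x - 1) *\<^sub>R u0 x)" for k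
  proof -
    have ae: "AE x in lborel. cut_at k x *\<^sub>R u 0 x = cut_at k x *\<^sub>R u0 x" using cs by (auto simp: cauchy_solution_def elim: eventually_mono)
    have eq: "d k 0 = fourier (\<lambda>x. (cut_at k x - 1) *\<^sub>R u0 x)"
    proof (rule ext)
      fix \<xi>
      have "fourier (\<lambda>x. cut_at k x *\<^sub>R u (max 0 0) x) \<xi> = fourier (\<lambda>x. cut_at k x *\<^sub>R u0 x) \<xi>"
        by (rule fourier_cong_AE) (use ae icut[of k 0] i0[of k] in auto)
      then show "d k 0 \<xi> = fourier (\<lambda>x. (cut_at k x - 1) *\<^sub>R u0 x) \<xi>"
        by (simp add: d_def fsol_def scaleR_diff_left fourier_diff[OF i0 u0(1)])
    qed
    have int: "integrable lborel (\<lambda>x. (cut_at k x - 1) *\<^sub>R u0 x)"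
      using Bochner_Integration.integrable_diff[OF i0 u0(1)] by (simp add: scaleR_diff_left)
    show ?thesis unfolding eq by (rule fourier_bessel[OF int])
  qed
  have bound: "nsq (d k T) \<le> ennreal K * (ennreal ((2 * pi) ^ CARD('n)) * nsq (\<lambda>x. (cut_at k x - 1) *\<^sub>R u0 x))
      + ennreal K * ennreal (R * (dil k * B)\<^sup>2 * N * T)" for k
  proof -
    have m: "(\<lambda>p. r k (snd p) (fst p)) \<in> borel_measurable (lborel \<Otimes>\<^sub>M lborel)"
    proof -
      have c: "continuous_on UNIV (\<lambda>p. r k (snd p) (fst p))"
        by (rule continuous_on_compose2[OF rc[of k], where f = "\<lambda>p. (snd p, fst p)", simplified]) (intro continuous_intros)
      show ?thesis using borel_measurable_continuous_onI[OF c] by (simp add: borel_prod[symmetric])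
    qed
    have m1: "(\<lambda>\<xi>. \<integral>\<^sup>+t. ennreal (indicator {0..T} t * (norm (r k t \<xi>))\<^sup>2) \<partial>lborel) \<in> borel_measurable lborel"
    proof (rule lborel.borel_measurable_nn_integral)
      show "(\<lambda>(\<xi>, t). ennreal (indicator {0..T} t * (norm (r k t \<xi>))\<^sup>2)) \<in> borel_measurable (lborel \<Otimes>\<^sub>M lborel)"
        unfolding case_prod_beta using m by measurable
    qed
    note dm[of k 0, measurable] m1[measurable]
    have "nsq (d k T) \<le> (\<integral>\<^sup>+\<xi>. ennreal K * ennreal ((norm (d k 0 \<xi>))\<^sup>2)
      + ennreal K * (\<integral>\<^sup>+t. ennreal (indicator {0..T} t * (norm (r k t \<xi>))\<^sup>2) \<partial>lborel) \<partial>lborel)"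
      unfolding nsq_def by (rule nn_integral_mono) (rule gron')
    also have "\<dots> = ennreal K * nsq (d k 0) + ennreal K * (\<integral>\<^sup>+\<xi>. (\<integral>\<^sup>+t. ennreal (indicator {0..T} t * (norm (r k t \<xi>))\<^sup>2) \<partial>lborel) \<partial>lborel)"
      unfolding nsq_def by (subst nn_integral_add) (auto simp: nn_integral_cmult)
    also have "\<dots> \<le> ennreal K * (ennreal ((2 * pi) ^ CARD('n)) * nsq (\<lambda>x. (cut_at k x - 1) *\<^sub>R u0 x))
      + ennreal K * ennreal (R * (dil k * B)\<^sup>2 * N * T)"
      by (intro add_mono mult_left_mono d0 rbound) auto
    finally show ?thesis .
  qed
  have "(\<lambda>k. nsq (\<lambda>x. (cut_at k x - 1) *\<^sub>R u0 x)) \<longlonglongrightarrow> 0"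
  proof (rule nsq_vanishing[OF u0(2)])
    show "\<bar>cut_at k x - 1\<bar> \<le> 1" for k and x :: "real^'n" using cut_bounds[of k x] by simp
    show "(\<lambda>k. cut_at k x - 1) \<longlonglongrightarrow> 0" for x :: "real^'n" using tendsto_diff[OF cut_tendsto[of x] tendsto_const[of 1]] by simp
  qed measurable
  moreover have "(\<lambda>k. R * (dil k * B)\<^sup>2 * N * T) \<longlonglongrightarrow> R * (0 * B)\<^sup>2 * N * T" by (intro tendsto_intros dil)
  then have "(\<lambda>k. ennreal (R * (dil k * B)\<^sup>2 * N * T)) \<longlonglongrightarrow> ennreal 0" by (intro tendsto_ennrealI) simp
  ultimately have "(\<lambda>k. ennreal K * (ennreal ((2 * pi) ^ CARD('n)) * nsq (\<lambda>x. (cut_at k x - 1) *\<^sub>R u0 x))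
      + ennreal K * ennreal (R * (dil k * B)\<^sup>2 * N * T)) \<longlonglongrightarrow> ennreal K * (ennreal ((2 * pi) ^ CARD('n)) * 0) + ennreal K * ennreal 0"
    by (intro tendsto_add ennreal_tendsto_cmult) auto
  then have up: "(\<lambda>k. ennreal K * (ennreal ((2 * pi) ^ CARD('n)) * nsq (\<lambda>x. (cut_at k x - 1) *\<^sub>R u0 x))
      + ennreal K * ennreal (R * (dil k * B)\<^sup>2 * N * T)) \<longlonglongrightarrow> 0" by simp
  have "(\<lambda>k. nsq (d k T)) \<longlonglongrightarrow> 0"
    by (rule tendsto_sandwich[OF _ _ tendsto_const[of 0] up]) (rule eventuallyI, simp, rule eventuallyI, rule bound)
  moreover have "max 0 T = T" using T by simp
  ultimately show ?thesis unfolding d_def[abs_def] by simp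
qed

lemma fourier_mult_tendsto:
  fixes f :: "real^'n::finite \<Rightarrow> real^'m"
  assumes f: "integrable lborel f" and [measurable]: "\<And>k. m k \<in> borel_measurable lborel"
    and b: "\<And>k x. \<bar>m k x\<bar> \<le> B" and lim: "\<And>x. (\<lambda>k. m k x) \<longlonglongrightarrow> c"
  shows "(\<lambda>k. fourier (\<lambda>x. m k x *\<^sub>R f x) \<xi>) \<longlonglongrightarrow> fourier (\<lambda>x. c *\<^sub>R f x) \<xi>"
proof (rule vec_tendstoI)
  fix i
  have fi: "integrable lborel (\<lambda>x. f x $ i)" by (rule integrable_vec_nth(1)[OF f])
  then have [measurable]: "(\<lambda>x. f x $ i) \<in> borel_measurable lborel" by simp
  show "(\<lambda>k. fourier (\<lambda>x. m k x *\<^sub>R f x) \<xi> $ i) \<longlonglongrightarrow> fourier (\<lambda>x. c *\<^sub>R f x) \<xi> $ i"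
    unfolding fourier_nth ft_def vector_scaleR_component
  proof (rule integral_dominated_convergence[where w = "\<lambda>x. B * \<bar>f x $ i\<bar>"])
    show "integrable lborel (\<lambda>x. B * \<bar>f x $ i\<bar>)" using fi by simp
    show "AE x in lborel. (\<lambda>k. cis (- 1 * (x \<bullet> \<xi>)) * complex_of_real (m k x *\<^sub>R f x $ i)) \<longlonglongrightarrow> cis (- 1 * (x \<bullet> \<xi>)) * complex_of_real (c *\<^sub>R f x $ i)"
      by (intro AE_I2 tendsto_intros lim)
    show "AE x in lborel. norm (cis (- 1 * (x \<bullet> \<xi>)) * complex_of_real (m k x *\<^sub>R f x $ i)) \<le> B * \<bar>f x $ i\<bar>" for k
      using b by (intro AE_I2) (auto simp: norm_mult abs_mult intro!: mult_right_mono)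
  qed measurable
qed

text \<open>The distributional constraint is tested with cutoffs of cosines. Because
  \<open>u0\<close> is integrable, the transforms converge at every \<xi> as the cutoff is removed,
  so the identity holds everywhere and can serve as initial condition for the flow.\<close>

lemma constraint_fourier:
  fixes u0 :: "real^'n::finite \<Rightarrow> real^'m" and Q :: "'n \<Rightarrow> real^'m^'p"
  assumes con: "constraint Q R u0" and u0: "integrable lborel u0" "L2 u0"
  shows "mulI (cmat (symbol Q \<xi>) *v fourier u0 \<xi>) + cmat R *v fourier u0 \<xi> = 0"
proof -
  have k: "mulI (cmat (symbol Q \<xi>) *v fourier (\<lambda>x. cut_at k x *\<^sub>R u0 x) \<xi>) + cmat R *v fourier (\<lambda>x. cut_at k x *\<^sub>R u0 x) \<xi>
     = (\<Sum>j\<in>UNIV. cmat (Q j) *v fourier (\<lambda>x. pd j (cut_at k) x *\<^sub>R u0 x) \<xi>)" for k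
  proof -
    define \<phi> where "\<phi> \<theta> x = cut_at k x * cos (x \<bullet> \<xi> + \<theta>)" for \<theta> x
    have tf: "test_function (\<phi> \<theta>)" for \<theta> unfolding \<phi>_def[abs_def] by (rule test_function_mult[OF test_function_cut smooth_cos])
    define Y where "Y \<theta> = (\<integral>x. \<phi> \<theta> x *\<^sub>R u0 x \<partial>lborel)" for \<theta>
    define E where "E \<theta> = (\<integral>x. (\<Sum>j\<in>UNIV. pd j (\<phi> \<theta>) x *\<^sub>R (Q j *v u0 x)) \<partial>lborel)" for \<theta>
    define F where "F = fourier (\<lambda>x. cut_at k x *\<^sub>R u0 x) \<xi>"
    have EY: "R *v Y \<theta> = E \<theta>" for \<theta>
    proof -
      have i: "integrable lborel (\<lambda>x. \<Sum>j\<in>UNIV. pd j (\<phi> \<theta>) x *\<^sub>R (Q j *v u0 x))"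
        by (intro Bochner_Integration.integrable_sum integral_matrix_vector(1) test_function_scaleR_integrable[OF test_function_pd[OF tf] u0(2)])
      have "(\<integral>x. \<phi> \<theta> x *\<^sub>R (R *v u0 x) - (\<Sum>j\<in>UNIV. pd j (\<phi> \<theta>) x *\<^sub>R (Q j *v u0 x)) \<partial>lborel) = 0"
        using con tf unfolding constraint_def by blast
      moreover have "(\<integral>x. \<phi> \<theta> x *\<^sub>R (R *v u0 x) - (\<Sum>j\<in>UNIV. pd j (\<phi> \<theta>) x *\<^sub>R (Q j *v u0 x)) \<partial>lborel) = R *v Y \<theta> - E \<theta>"
        unfolding E_def Y_def
        by (simp only: Bochner_Integration.integral_diff[OF integral_matrix_vector(1)[OF test_function_scaleR_integrable[OF tf u0(2)]] i]
            integral_matrix_vector(2)[OF test_function_scaleR_integrable[OF tf u0(2)]])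
      ultimately show ?thesis by simp
    qed
    have FY: "F = cvec (Y 0) + mulI (cvec (Y (pi / 2)))"
      unfolding F_def Y_def \<phi>_def by (rule fourier_cos_decomposition[OF test_function_scaleR_integrable[OF test_function_cut u0(2)]])
    have "cmat R *v F = cvec (E 0) + mulI (cvec (E (pi / 2)))"
      unfolding FY EY[symmetric] cvec_matrix matrix_vector_right_distrib mulI_cmat ..
    also have "\<dots> = (\<Sum>j\<in>UNIV. cmat (Q j) *v fourier (\<lambda>x. pd j (cut_at k) x *\<^sub>R u0 x) \<xi>) - mulI (cmat (symbol Q \<xi>) *v F)"
      unfolding E_def \<phi>_def[abs_def] F_def by (rule fourier_first_order_term[OF test_function_cut u0(2)])
    finally show ?thesis unfolding F_def by simp
  qed
  obtain B where B: "B > 0" "\<And>k j (x :: real^'n). \<bar>pd j (cut_at k) x\<bar> \<le> dil k * B" using pd_cut_bound by blast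
  have F: "(\<lambda>k. fourier (\<lambda>x. cut_at k x *\<^sub>R u0 x) \<xi>) \<longlonglongrightarrow> fourier (\<lambda>x. 1 *\<^sub>R u0 x) \<xi>"
    by (rule fourier_mult_tendsto[OF u0(1) _ cut_abs cut_tendsto]) measurable
  have Fj: "(\<lambda>k. fourier (\<lambda>x. pd j (cut_at k) x *\<^sub>R u0 x) \<xi>) \<longlonglongrightarrow> fourier (\<lambda>x. 0 *\<^sub>R u0 x) \<xi>" for j
  proof (rule fourier_mult_tendsto[OF u0(1)])
    show "pd j (cut_at k) \<in> borel_measurable lborel" for k
      by (rule smooth_measurable[OF test_function_smooth[OF test_function_pd[OF test_function_cut]]])
    show "\<bar>pd j (cut_at k) x\<bar> \<le> B" for k and x :: "real^'n"
    proof -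
      have "dil k * B \<le> 1 * B" using dil(2)[of k] B(1) by (intro mult_right_mono) auto
      then show ?thesis using B(2)[of j k x] by linarith
    qed
    show "(\<lambda>k. pd j (cut_at k) x) \<longlonglongrightarrow> 0" for x
    proof (rule Lim_null_comparison)
      show "\<forall>\<^sub>F k in sequentially. norm (pd j (cut_at k) x) \<le> dil k * B" using B(2)[of j] by simp
      have "(\<lambda>k. dil k * B) \<longlonglongrightarrow> 0 * B" by (intro tendsto_intros dil)
      then show "(\<lambda>k. dil k * B) \<longlonglongrightarrow> 0" by simp
    qed
  qed
  have "fourier (\<lambda>x. 0 *\<^sub>R u0 x) \<xi> = 0" by (simp add: vec_eq_iff fourier_def)
  with Fj have Fj0: "(\<lambda>k. fourier (\<lambda>x. pd j (cut_at k) x *\<^sub>R u0 x) \<xi>) \<longlonglongrightarrow> 0" for j by simp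
  have "(\<lambda>k. \<Sum>j\<in>UNIV. cmat (Q j) *v fourier (\<lambda>x. pd j (cut_at k) x *\<^sub>R u0 x) \<xi>) \<longlonglongrightarrow> (\<Sum>j\<in>UNIV. cmat (Q j) *v 0)"
    by (intro tendsto_sum bounded_linear.tendsto[OF matrix_vector_mul_bounded_linear] Fj0)
  moreover have "(\<lambda>k. mulI (cmat (symbol Q \<xi>) *v fourier (\<lambda>x. cut_at k x *\<^sub>R u0 x) \<xi>) + cmat R *v fourier (\<lambda>x. cut_at k x *\<^sub>R u0 x) \<xi>)
     \<longlonglongrightarrow> mulI (cmat (symbol Q \<xi>) *v fourier (\<lambda>x. 1 *\<^sub>R u0 x) \<xi>) + cmat R *v fourier (\<lambda>x. 1 *\<^sub>R u0 x) \<xi>"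
    by (intro tendsto_add bounded_linear.tendsto[OF bounded_linear_mulI] bounded_linear.tendsto[OF matrix_vector_mul_bounded_linear] F)
  ultimately have "mulI (cmat (symbol Q \<xi>) *v fourier (\<lambda>x. 1 *\<^sub>R u0 x) \<xi>) + cmat R *v fourier (\<lambda>x. 1 *\<^sub>R u0 x) \<xi> = (\<Sum>j\<in>UNIV. cmat (Q j) *v 0)"
    unfolding k by (intro LIMSEQ_unique)
  then show ?thesis by simp
qed

section \<open>Parseval's identity against test functions\<close>

lemma L2norm_mono:
  fixes f :: "'a::euclidean_space \<Rightarrow> 'b::euclidean_space" and g :: "'a \<Rightarrow> 'c::euclidean_space"
  assumes "L2 g" "f \<in> borel_measurable lborel" "\<And>x. norm (f x) \<le> norm (g x)"
  shows "L2norm f \<le> L2norm g"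
proof -
  have "nsq f \<le> nsq g" by (rule nsq_mono[OF assms(3)])
  also have "\<dots> = ennreal ((L2norm g)\<^sup>2)" by (rule nsq_eq_L2norm[OF assms(1)])
  finally have "(L2norm f)\<^sup>2 \<le> (L2norm g)\<^sup>2" by (intro L2norm_sq_le assms(2)) auto
  then show ?thesis by (rule power2_le_imp_le) simp
qed

abbreviation cfun :: "('a \<Rightarrow> real) \<Rightarrow> 'a \<Rightarrow> complex" where
  "cfun f \<equiv> (\<lambda>x. complex_of_real (f x))"

lemma L2_cfun: "L2 f \<Longrightarrow> L2 (cfun f)"
  unfolding L2_iff_nsq nsq_of_real by (auto intro: borel_measurable_of_real)

lemma cfun_test_function:
  assumes "test_function \<phi>"
  shows "integrable lborel (cfun \<phi>)" "L2 (cfun \<phi>)" "continuous_on UNIV (cfun \<phi>)"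
proof -
  show "integrable lborel (cfun \<phi>)" using test_function_integrable[OF assms] by (simp only: complex_of_real_integrable_eq)
  show "L2 (cfun \<phi>)" by (rule L2_cfun[OF test_function_L2[OF assms]])
  show "continuous_on UNIV (cfun \<phi>)"
    by (intro continuous_on_of_real smooth_continuous test_function_smooth assms)
qed

lemma ft_cfun_test_L2: "test_function \<phi> \<Longrightarrow> L2 (ft 1 (cfun \<phi>))"
  by (rule ft_L2[OF cfun_test_function(1,2)]) auto

lemma fourier_L2:
  fixes f :: "real^'n::finite \<Rightarrow> real^'m"
  assumes "integrable lborel f" "L2 f" shows "L2 (fourier f)"
proof -
  have "nsq (fourier f) \<le> ennreal ((2 * pi) ^ CARD('n)) * nsq f" by (rule fourier_bessel[OF assms(1)])
  also have "\<dots> < \<infinity>" using assms(2) by (simp add: L2_iff_nsq ennreal_mult_less_top)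
  finally show ?thesis using fourier_measurable[OF assms(1)] by (simp add: L2_iff_nsq)
qed

text \<open>The identity holds for the truncations of f to balls, which are integrable and square
  integrable. On the frequency side the limit is taken in L2 against the transform of \<phi>, on the
  space side by dominated convergence.\<close>

lemma parseval_L2_fourier:
  fixes f :: "real^'n::finite \<Rightarrow> real^'m"
  assumes fg: "has_L2_fourier f g" and \<phi>: "test_function \<phi>"
  shows "integrable lborel (\<lambda>\<xi>. g \<xi> $ i * ft 1 (cfun \<phi>) \<xi>)"
    "(\<integral>\<xi>. g \<xi> $ i * ft 1 (cfun \<phi>) \<xi> \<partial>lborel) = complex_of_real ((2 * pi) ^ CARD('n) * (\<integral>x. \<phi> x *\<^sub>R f x \<partial>lborel) $ i)"
proof -
  have f: "L2 f" and g: "L2 g" using fg by (auto simp: has_L2_fourier_def)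
  have gi: "L2 (\<lambda>\<xi>. g \<xi> $ i)" using g by (simp add: L2_vec_iff)
  define h where "h = ft 1 (cfun \<phi>)"
  have h: "L2 h" unfolding h_def by (rule ft_cfun_test_L2[OF \<phi>])
  show int: "integrable lborel (\<lambda>\<xi>. g \<xi> $ i * ft 1 (cfun \<phi>) \<xi>)" unfolding h_def[symmetric] by (rule integrable_mult_L2(1)[OF gi h])
  define I where "I r = (indicator (cball 0 r) :: real^'n \<Rightarrow> real)" for r
  have Im[measurable]: "I r \<in> borel_measurable lborel" for r
    unfolding I_def by (rule borel_measurable_indicator) (simp add: borel_closed)
  have IL: "L2 (I r)" for r by (rule L2_bounded_support[OF Im, of r 1 r]) (auto simp: I_def indicator_def)
  define F where "F r = (\<lambda>x. I r x *\<^sub>R f x)" for r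
  have Fi: "integrable lborel (F r)" for r unfolding F_def by (rule integrable_scaleR_L2(1)[OF IL f])
  have FL: "L2 (F r)" for r unfolding F_def by (rule L2_scaleR(1)[OF f Im, of r 1]) (simp add: I_def indicator_def)
  have D: "L2 (\<lambda>\<xi>. fourier (F r) \<xi> - g \<xi>)" for r by (rule L2_diff[OF fourier_L2[OF Fi FL] g])
  have FiL: "L2 (\<lambda>\<xi>. fourier (F r) \<xi> $ i)" for r using fourier_L2[OF Fi FL] by (simp add: L2_vec_iff)
  have N: "(\<lambda>k. L2norm (\<lambda>\<xi>. fourier (F (real k)) \<xi> - g \<xi>)) \<longlonglongrightarrow> 0"
    unfolding F_def I_def
    by (rule filterlim_compose[OF _ filterlim_real_sequentially]) (use fg in \<open>simp add: has_L2_fourier_def\<close>)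
  have lim1: "(\<lambda>k. \<integral>\<xi>. fourier (F (real k)) \<xi> $ i * h \<xi> \<partial>lborel) \<longlonglongrightarrow> (\<integral>\<xi>. g \<xi> $ i * h \<xi> \<partial>lborel)"
  proof (rule LIM_zero_cancel, rule Lim_null_comparison)
    have "norm ((\<integral>\<xi>. fourier (F (real k)) \<xi> $ i * h \<xi> \<partial>lborel) - (\<integral>\<xi>. g \<xi> $ i * h \<xi> \<partial>lborel)) \<le> L2norm (\<lambda>\<xi>. fourier (F (real k)) \<xi> - g \<xi>) * L2norm h" for k
    proof -
      have "(\<integral>\<xi>. fourier (F (real k)) \<xi> $ i * h \<xi> \<partial>lborel) - (\<integral>\<xi>. g \<xi> $ i * h \<xi> \<partial>lborel) = (\<integral>\<xi>. (fourier (F (real k)) \<xi> $ i - g \<xi> $ i) * h \<xi> \<partial>lborel)"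
        by (simp only: left_diff_distrib Bochner_Integration.integral_diff[OF integrable_mult_L2(1)[OF FiL h] integrable_mult_L2(1)[OF gi h]])
      also have "norm \<dots> \<le> L2norm (\<lambda>\<xi>. fourier (F (real k)) \<xi> $ i - g \<xi> $ i) * L2norm h"
        by (rule integrable_mult_L2(2)[OF L2_diff[OF FiL gi] h])
      also have "\<dots> \<le> L2norm (\<lambda>\<xi>. fourier (F (real k)) \<xi> - g \<xi>) * L2norm h"
      proof (rule mult_right_mono[OF L2norm_mono[OF D]])
        show "(\<lambda>\<xi>. fourier (F (real k)) \<xi> $ i - g \<xi> $ i) \<in> borel_measurable lborel" by (rule L2_measurable[OF L2_diff[OF FiL gi]])
        show "norm (fourier (F (real k)) \<xi> $ i - g \<xi> $ i) \<le> norm (fourier (F (real k)) \<xi> - g \<xi>)" for \<xi>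
          using Finite_Cartesian_Product.norm_nth_le[of "fourier (F (real k)) \<xi> - g \<xi>" i] by simp
      qed simp
      finally show ?thesis .
    qed
    then show "\<forall>\<^sub>F k in sequentially. norm ((\<integral>\<xi>. fourier (F (real k)) \<xi> $ i * h \<xi> \<partial>lborel) - (\<integral>\<xi>. g \<xi> $ i * h \<xi> \<partial>lborel)) \<le> L2norm (\<lambda>\<xi>. fourier (F (real k)) \<xi> - g \<xi>) * L2norm h"
      by (rule eventuallyI)
    have "(\<lambda>k. L2norm (\<lambda>\<xi>. fourier (F (real k)) \<xi> - g \<xi>) * L2norm h) \<longlonglongrightarrow> 0 * L2norm h" by (intro tendsto_intros N)
    then show "(\<lambda>k. L2norm (\<lambda>\<xi>. fourier (F (real k)) \<xi> - g \<xi>) * L2norm h) \<longlonglongrightarrow> 0" by simp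
  qed
  have int\<phi>: "integrable lborel (\<lambda>x. \<phi> x *\<^sub>R f x)" by (rule test_function_scaleR_integrable[OF \<phi> f])
  have int\<phi>i: "integrable lborel (\<lambda>x. \<phi> x * f x $ i)" using integrable_vec_nth(1)[OF int\<phi>, of i] by simp
  have lim2: "(\<lambda>k. \<integral>x. complex_of_real (F (real k) x $ i) * complex_of_real (\<phi> x) \<partial>lborel) \<longlonglongrightarrow> (\<integral>x. complex_of_real (\<phi> x * f x $ i) \<partial>lborel)"
  proof (rule integral_dominated_convergence[where w = "\<lambda>x. \<bar>\<phi> x * f x $ i\<bar>"])
    show "integrable lborel (\<lambda>x. \<bar>\<phi> x * f x $ i\<bar>)" using int\<phi>i by simp
    have ce: "complex_of_real (F (real k) x $ i) * complex_of_real (\<phi> x) = complex_of_real (I (real k) x) * complex_of_real (\<phi> x * f x $ i)" for k x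
      by (simp add: F_def)
    have m[measurable]: "(\<lambda>x. \<phi> x * f x $ i) \<in> borel_measurable lborel" using int\<phi>i by simp
    then show "(\<lambda>x. complex_of_real (\<phi> x * f x $ i)) \<in> borel_measurable lborel" by measurable
    show "(\<lambda>x. complex_of_real (F (real k) x $ i) * complex_of_real (\<phi> x)) \<in> borel_measurable lborel" for k
      unfolding ce by measurable
    show "AE x in lborel. norm (complex_of_real (F (real k) x $ i) * complex_of_real (\<phi> x)) \<le> \<bar>\<phi> x * f x $ i\<bar>" for k
      unfolding ce by (intro AE_I2) (simp add: norm_mult I_def indicator_def abs_mult)
    show "AE x in lborel. (\<lambda>k. complex_of_real (F (real k) x $ i) * complex_of_real (\<phi> x)) \<longlonglongrightarrow> complex_of_real (\<phi> x * f x $ i)"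
    proof (rule AE_I2)
      fix x :: "real^'n"
      have "eventually (\<lambda>k. norm x \<le> real k) sequentially"
        using filterlim_real_sequentially by (simp add: filterlim_at_top)
      then have "eventually (\<lambda>k. complex_of_real (F (real k) x $ i) * complex_of_real (\<phi> x) = complex_of_real (\<phi> x * f x $ i)) sequentially"
        unfolding ce by eventually_elim (simp add: I_def)
      then show "(\<lambda>k. complex_of_real (F (real k) x $ i) * complex_of_real (\<phi> x)) \<longlonglongrightarrow> complex_of_real (\<phi> x * f x $ i)"
        by (rule tendsto_eventually)
    qed
  qed
  obtain B where B: "\<And>x. \<bar>\<phi> x\<bar> \<le> B" using test_function_bounded[OF \<phi>] by blast
  have "(\<integral>\<xi>. fourier (F r) \<xi> $ i * h \<xi> \<partial>lborel) = complex_of_real ((2 * pi) ^ CARD('n)) * (\<integral>x. complex_of_real (F r x $ i) * complex_of_real (\<phi> x) \<partial>lborel)" for r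
  proof -
    have "L2 (\<lambda>x. F r x $ i)" using FL[of r] by (simp add: L2_vec_iff)
    then have L: "L2 (\<lambda>x. complex_of_real (F r x $ i))" by (rule L2_cfun)
    have "(\<integral>\<xi>. ft (-1) (\<lambda>x. complex_of_real (F r x $ i)) \<xi> * ft (- (-1)) (cfun \<phi>) \<xi> \<partial>lborel)
       = complex_of_real ((2 * pi) ^ DIM(real^'n)) * (\<integral>x. complex_of_real (F r x $ i) * cfun \<phi> x \<partial>lborel)"
      by (rule ft_parseval[OF integrable_vec_nth(2)[OF Fi] L cfun_test_function[OF \<phi>], of B]) (use B in auto)
    then show ?thesis by (simp add: fourier_nth h_def)
  qed
  then have "(\<lambda>k. \<integral>\<xi>. fourier (F (real k)) \<xi> $ i * h \<xi> \<partial>lborel) \<longlonglongrightarrow> complex_of_real ((2 * pi) ^ CARD('n)) * (\<integral>x. complex_of_real (\<phi> x * f x $ i) \<partial>lborel)"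
    by (simp only: tendsto_mult[OF tendsto_const lim2])
  from LIMSEQ_unique[OF lim1 this]
  have "(\<integral>\<xi>. g \<xi> $ i * h \<xi> \<partial>lborel) = complex_of_real ((2 * pi) ^ CARD('n)) * complex_of_real (\<integral>x. \<phi> x * f x $ i \<partial>lborel)"
    by (simp only: integral_complex_of_real)
  moreover have "(\<integral>x. \<phi> x *\<^sub>R f x \<partial>lborel) $ i = (\<integral>x. \<phi> x * f x $ i \<partial>lborel)"
    using integral_bounded_linear[OF bounded_linear_vec_nth int\<phi>, of i] by simp
  ultimately show "(\<integral>\<xi>. g \<xi> $ i * ft 1 (cfun \<phi>) \<xi> \<partial>lborel) = complex_of_real ((2 * pi) ^ CARD('n) * (\<integral>x. \<phi> x *\<^sub>R f x \<partial>lborel) $ i)"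
    by (simp only: h_def of_real_mult)
qed

text \<open>Integration by parts in real form: the derivative of \<phi> times a shifted cosine has
  integral 0.\<close>

lemma ft_test_pd:
  assumes \<phi>: "test_function \<phi>"
  shows "ft 1 (cfun (pd j \<phi>)) \<xi> = - \<i> * complex_of_real (\<xi> $ j) * ft 1 (cfun \<phi>) \<xi>"
proof -
  have cint: "integrable lborel (\<lambda>x. \<psi> x * cos (x \<bullet> \<xi> + \<theta>))" if "test_function \<psi>" for \<psi> \<theta>
    by (rule test_function_integrable[OF test_function_mult[OF that smooth_cos]])
  define c where "c \<psi> \<theta> = (\<integral>x. \<psi> x * cos (x \<bullet> \<xi> + \<theta>) \<partial>lborel)" for \<psi> \<theta>
  \<comment> \<open>For the kernel with positive sign the sine enters with phase -pi/2, in contrast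
    to +pi/2 for \<open>fourier\<close>.\<close>
  have ft: "ft 1 (cfun \<psi>) \<xi> = complex_of_real (c \<psi> 0) + \<i> * complex_of_real (c \<psi> (- pi / 2))" if \<psi>: "test_function \<psi>" for \<psi>
  proof -
    have ic: "integrable lborel (\<lambda>x. complex_of_real (\<psi> x * cos (x \<bullet> \<xi> + \<theta>)))" for \<theta>
      using cint[OF \<psi>] by (simp only: complex_of_real_integrable_eq)
    have "ft 1 (cfun \<psi>) \<xi> = (\<integral>x. complex_of_real (\<psi> x * cos (x \<bullet> \<xi> + 0)) + \<i> * complex_of_real (\<psi> x * cos (x \<bullet> \<xi> + (- pi / 2))) \<partial>lborel)"
      unfolding ft_def by (rule Bochner_Integration.integral_cong) (auto simp: complex_eq_iff cos_diff)
    also have "\<dots> = complex_of_real (c \<psi> 0) + \<i> * complex_of_real (c \<psi> (- pi / 2))"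
      by (simp only: Bochner_Integration.integral_add[OF ic integrable_mult_right[OF ic]] integral_mult_right_zero integral_complex_of_real c_def)
    finally show ?thesis .
  qed
  have cpd: "c (pd j \<phi>) \<theta> = - (\<xi> $ j * c \<phi> (\<theta> + pi / 2))" for \<theta>
  proof -
    have "0 = (\<integral>x. pd j (\<lambda>x. \<phi> x * cos (x \<bullet> \<xi> + \<theta>)) x \<partial>lborel)"
      by (rule integral_pd[OF test_function_mult[OF \<phi> smooth_cos], symmetric])
    also have "\<dots> = (\<integral>x. \<xi> $ j * (\<phi> x * cos (x \<bullet> \<xi> + (\<theta> + pi / 2))) + pd j \<phi> x * cos (x \<bullet> \<xi> + \<theta>) \<partial>lborel)"
      unfolding pd_mult[OF test_function_smooth[OF \<phi>] smooth_cos] pd_cos by (simp add: mult_ac)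
    also have "\<dots> = \<xi> $ j * c \<phi> (\<theta> + pi / 2) + c (pd j \<phi>) \<theta>"
      by (simp only: Bochner_Integration.integral_add[OF integrable_mult_right[OF cint[OF \<phi>]] cint[OF test_function_pd[OF \<phi>]]]
          integral_mult_right_zero c_def)
    finally show ?thesis by simp
  qed
  have "c \<phi> (0 + pi / 2) = - c \<phi> (- pi / 2)" unfolding c_def by (simp add: cos_add cos_diff)
  then show ?thesis unfolding ft[OF \<phi>] ft[OF test_function_pd[OF \<phi>]] cpd
    by (simp add: complex_eq_iff)
qed

lemma ft_test_pds:
  assumes \<phi>: "test_function \<phi>"
  shows "ft 1 (cfun (pds js \<phi>)) \<xi> = (\<Prod>j\<leftarrow>js. - \<i> * complex_of_real (\<xi> $ j)) * ft 1 (cfun \<phi>) \<xi>"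
proof (induction js)
  case (Cons j js)
  show ?case unfolding pds.simps(2) ft_test_pd[OF test_function_pds[OF \<phi>]] Cons.IH by simp
qed simp

text \<open>Each component of the weak identity, multiplied by (2 pi)^n, is by the pairing identity
  the integral of the transformed constraint against the transform of \<phi>, and therefore
  vanishes.\<close>

lemma constraint_of_fourier:
  fixes f :: "real^'n::finite \<Rightarrow> real^'m" and Q :: "'n \<Rightarrow> real^'m^'p"
  assumes fg: "has_L2_fourier f g"
    and con: "\<And>\<xi>. mulI (cmat (symbol Q \<xi>) *v g \<xi>) + cmat R *v g \<xi> = 0"
  shows "constraint Q R f"
  unfolding constraint_def
proof (intro allI impI)
  fix \<phi> :: "real^'n \<Rightarrow> real" assume \<phi>: "test_function \<phi>"
  have f: "L2 f" using fg by (simp add: has_L2_fourier_def)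
  define h where "h = ft 1 (cfun \<phi>)"
  define N where "N = (2 * pi) ^ CARD('n)"
  have N: "N \<noteq> 0" by (simp add: N_def)
  define Y where "Y = (\<integral>x. \<phi> x *\<^sub>R f x \<partial>lborel)"
  define Yj where "Yj j = (\<integral>x. pd j \<phi> x *\<^sub>R f x \<partial>lborel)" for j
  have i: "integrable lborel (\<lambda>x. \<phi> x *\<^sub>R f x)" "integrable lborel (\<lambda>x. pd j \<phi> x *\<^sub>R f x)" for j
    by (rule test_function_scaleR_integrable[OF \<phi> f], rule test_function_scaleR_integrable[OF test_function_pd[OF \<phi>] f])
  have tot: "(\<integral>x. \<phi> x *\<^sub>R (R *v f x) - (\<Sum>j\<in>UNIV. pd j \<phi> x *\<^sub>R (Q j *v f x)) \<partial>lborel) = R *v Y - (\<Sum>j\<in>UNIV. Q j *v Yj j)"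
    unfolding Y_def Yj_def
    by (simp only: Bochner_Integration.integral_diff[OF integral_matrix_vector(1)[OF i(1)] Bochner_Integration.integrable_sum[OF integral_matrix_vector(1)[OF i(2)]]]
        Bochner_Integration.integral_sum[OF integral_matrix_vector(1)[OF i(2)]] integral_matrix_vector(2)[OF i(1)] integral_matrix_vector(2)[OF i(2)])
  have gi: "integrable lborel (\<lambda>\<xi>. g \<xi> $ l * h \<xi>)" for l unfolding h_def by (rule parseval_L2_fourier(1)[OF fg \<phi>])
  have gj: "integrable lborel (\<lambda>\<xi>. g \<xi> $ l * (- \<i> * complex_of_real (\<xi> $ j) * h \<xi>))" for l j
    using parseval_L2_fourier(1)[OF fg test_function_pd[OF \<phi>], of l j] unfolding h_def ft_test_pd[OF \<phi>] .
  have P: "complex_of_real N * complex_of_real (Y $ l) = (\<integral>\<xi>. g \<xi> $ l * h \<xi> \<partial>lborel)" for l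
    using parseval_L2_fourier(2)[OF fg \<phi>, of l] by (simp add: N_def Y_def h_def)
  have Pj: "complex_of_real N * complex_of_real (Yj j $ l) = (\<integral>\<xi>. g \<xi> $ l * (- \<i> * complex_of_real (\<xi> $ j) * h \<xi>) \<partial>lborel)" for l j
    using parseval_L2_fourier(2)[OF fg test_function_pd[OF \<phi>], of l j] by (simp add: N_def Yj_def h_def ft_test_pd[OF \<phi>])
  have "complex_of_real N * complex_of_real ((R *v Y - (\<Sum>j\<in>UNIV. Q j *v Yj j)) $ k) = 0" for k
  proof -
    have "complex_of_real N * complex_of_real ((R *v Y - (\<Sum>j\<in>UNIV. Q j *v Yj j)) $ k)
       = (\<Sum>l\<in>UNIV. complex_of_real (R $ k $ l) * (complex_of_real N * complex_of_real (Y $ l)))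
         - (\<Sum>j\<in>UNIV. \<Sum>l\<in>UNIV. complex_of_real (Q j $ k $ l) * (complex_of_real N * complex_of_real (Yj j $ l)))"
      by (simp add: matrix_vector_mult_def right_diff_distrib sum_distrib_left mult_ac)
    also have "\<dots> = (\<integral>\<xi>. (\<Sum>l\<in>UNIV. complex_of_real (R $ k $ l) * (g \<xi> $ l * h \<xi>))
         - (\<Sum>j\<in>UNIV. \<Sum>l\<in>UNIV. complex_of_real (Q j $ k $ l) * (g \<xi> $ l * (- \<i> * complex_of_real (\<xi> $ j) * h \<xi>))) \<partial>lborel)"
      unfolding P Pj
      by (simp only: Bochner_Integration.integral_diff[OF Bochner_Integration.integrable_sum[OF integrable_mult_right[OF gi]]
              Bochner_Integration.integrable_sum[OF Bochner_Integration.integrable_sum[OF integrable_mult_right[OF gj]]]]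
            Bochner_Integration.integral_sum[OF integrable_mult_right[OF gi]]
            Bochner_Integration.integral_sum[OF Bochner_Integration.integrable_sum[OF integrable_mult_right[OF gj]]]
            Bochner_Integration.integral_sum[OF integrable_mult_right[OF gj]] integral_mult_right_zero)
    also have "\<dots> = (\<integral>\<xi>. (mulI (cmat (symbol Q \<xi>) *v g \<xi>) + cmat R *v g \<xi>) $ k * h \<xi> \<partial>lborel)"
    proof (rule Bochner_Integration.integral_cong[OF refl])
      fix \<xi> :: "real^'n"
      have "(cmat (symbol Q \<xi>) *v g \<xi>) $ k = (\<Sum>l\<in>UNIV. \<Sum>j\<in>UNIV. complex_of_real (\<xi> $ j * Q j $ k $ l) * g \<xi> $ l)"
        by (simp add: matrix_vector_mult_def symbol_def sum_distrib_right)
      also have "\<dots> = (\<Sum>j\<in>UNIV. \<Sum>l\<in>UNIV. complex_of_real (\<xi> $ j * Q j $ k $ l) * g \<xi> $ l)" by (rule sum.swap)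
      finally show "(\<Sum>l\<in>UNIV. complex_of_real (R $ k $ l) * (g \<xi> $ l * h \<xi>))
         - (\<Sum>j\<in>UNIV. \<Sum>l\<in>UNIV. complex_of_real (Q j $ k $ l) * (g \<xi> $ l * (- \<i> * complex_of_real (\<xi> $ j) * h \<xi>)))
         = (mulI (cmat (symbol Q \<xi>) *v g \<xi>) + cmat R *v g \<xi>) $ k * h \<xi>"
        by (simp add: mulI_def matrix_vector_mult_def distrib_right distrib_left sum_distrib_left sum_distrib_right sum_negf mult_ac)
    qed
    also have "\<dots> = 0" by (simp add: con)
    finally show ?thesis .
  qed
  then have "(R *v Y - (\<Sum>j\<in>UNIV. Q j *v Yj j)) $ k = 0" for k using N by (metis mult_eq_0_iff of_real_eq_0_iff)
  then show "(\<integral>x. \<phi> x *\<^sub>R (R *v f x) - (\<Sum>j\<in>UNIV. pd j \<phi> x *\<^sub>R (Q j *v f x)) \<partial>lborel) = 0"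
    unfolding tot vec_eq_iff zero_index by blast
qed

section \<open>Sobolev norms in Fourier variables\<close>

text \<open>The weak derivative is tested with cutoffs of cosines; as the cutoff is removed only the
  derivatives of the cosine survive. So the transforms of the cutoffs of g converge pointwise to a
  unimodular multiple of the expected monomial times the transform of \<open>u0\<close>, and Fatou's
  lemma with Bessel's inequality gives the bound.\<close>

lemma weak_pds_fourier_le:
  fixes u0 g :: "real^'n::finite \<Rightarrow> real^'m"
  assumes u0: "integrable lborel u0" and g: "L2 g" and w: "has_weak_pds js u0 g"
  shows "(\<integral>\<^sup>+\<xi>. ennreal ((\<Prod>j\<leftarrow>js. \<xi> $ j)\<^sup>2 * (norm (fourier u0 \<xi>))\<^sup>2) \<partial>lborel) \<le> ennreal ((2 * pi) ^ CARD('n)) * nsq g"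
proof -
  have ig: "integrable lborel (\<lambda>x. cut_at k x *\<^sub>R g x)" for k by (rule test_function_scaleR_integrable[OF test_function_cut g])
  have [measurable]: "fourier (\<lambda>x. cut_at k x *\<^sub>R g x) \<in> borel_measurable lborel" for k by (rule fourier_measurable[OF ig])
  have um: "u0 \<in> borel_measurable lborel" using u0 by simp
  have lim: "(\<lambda>k. (norm (fourier (\<lambda>x. cut_at k x *\<^sub>R g x) \<xi>))\<^sup>2) \<longlonglongrightarrow> (\<Prod>j\<leftarrow>js. \<xi> $ j)\<^sup>2 * (norm (fourier u0 \<xi>))\<^sup>2" for \<xi>
  proof -
    define p where "p = (\<Prod>j\<leftarrow>js. \<xi> $ j)"
    define a where "a = real (length js) * (pi / 2)"
    define \<sigma> where "\<sigma> = (-1 :: real) ^ length js"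
    define c where "c \<theta> = (\<integral>x. cos (x \<bullet> \<xi> + \<theta>) *\<^sub>R u0 x \<partial>lborel)" for \<theta>
    have ic: "integrable lborel (\<lambda>x. cos (x \<bullet> \<xi> + \<theta>) *\<^sub>R u0 x)" for \<theta>
      using cos_mult_integrable[of "\<lambda>_. 1" u0 \<xi> \<theta>] u0 by simp
    have lim\<theta>: "(\<lambda>k. \<integral>x. (cut_at k x * cos (x \<bullet> \<xi> + \<theta>)) *\<^sub>R g x \<partial>lborel) \<longlonglongrightarrow> \<sigma> *\<^sub>R (p *\<^sub>R c (\<theta> + a))" for \<theta>
    proof -
      define D where "D k = pds js (\<lambda>x. cut_at k x * cos (x \<bullet> \<xi> + \<theta>))" for k
      have tf: "test_function (\<lambda>x. cut_at k x * cos (x \<bullet> \<xi> + \<theta>))" for k by (rule test_function_mult[OF test_function_cut smooth_cos])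
      have "(\<exists>B. \<forall>k x. \<bar>D k x\<bar> \<le> B) \<and> (\<forall>x. (\<lambda>k. D k x) \<longlonglongrightarrow> cutoff (0 :: real^'n) * pds js (\<lambda>x. cos (x \<bullet> \<xi> + \<theta>)) x)"
        unfolding D_def cut_at_def
      proof (rule pds_dilation_limit[OF test_function_cutoff smooth_cos _ dil(3,2)])
        fix ks :: "'n list"
        have "\<bar>pds ks (\<lambda>x. cos (x \<bullet> \<xi> + \<theta>)) x\<bar> \<le> \<bar>\<Prod>j\<leftarrow>ks. \<xi> $ j\<bar>" for x
          unfolding pds_cos abs_mult by (simp add: mult_left_le)
        then show "\<exists>B. \<forall>x. \<bar>pds ks (\<lambda>x. cos (x \<bullet> \<xi> + \<theta>)) x\<bar> \<le> B" by blast
      qed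
      then obtain B where B: "\<And>k x. \<bar>D k x\<bar> \<le> B" and Dl: "\<And>x. (\<lambda>k. D k x) \<longlonglongrightarrow> p * cos (x \<bullet> \<xi> + (\<theta> + a))"
        unfolding pds_cos p_def a_def by (auto simp del: cutoff_0 simp: cutoff_0)
      have "(\<lambda>k. \<integral>x. D k x *\<^sub>R u0 x \<partial>lborel) \<longlonglongrightarrow> (\<integral>x. (p * cos (x \<bullet> \<xi> + (\<theta> + a))) *\<^sub>R u0 x \<partial>lborel)"
      proof (rule integral_dominated_convergence[where w = "\<lambda>x. B * norm (u0 x)"])
        have Dm: "D k \<in> borel_measurable lborel" for k unfolding D_def by (rule smooth_measurable[OF smooth_pds[OF test_function_smooth[OF tf]]])
        show "(\<lambda>x. D k x *\<^sub>R u0 x) \<in> borel_measurable lborel" for k using Dm um by measurable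
        show "(\<lambda>x. (p * cos (x \<bullet> \<xi> + (\<theta> + a))) *\<^sub>R u0 x) \<in> borel_measurable lborel" using um by measurable
        show "integrable lborel (\<lambda>x. B * norm (u0 x))" using u0 by simp
        show "AE x in lborel. (\<lambda>k. D k x *\<^sub>R u0 x) \<longlonglongrightarrow> (p * cos (x \<bullet> \<xi> + (\<theta> + a))) *\<^sub>R u0 x" by (intro AE_I2 tendsto_intros Dl)
        show "AE x in lborel. norm (D k x *\<^sub>R u0 x) \<le> B * norm (u0 x)" for k
          using B by (intro AE_I2) (auto intro!: mult_right_mono)
      qed
      moreover have "(\<integral>x. (p * cos (x \<bullet> \<xi> + (\<theta> + a))) *\<^sub>R u0 x \<partial>lborel) = p *\<^sub>R c (\<theta> + a)"
        unfolding c_def by (simp flip: scaleR_scaleR)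
      ultimately have "(\<lambda>k. \<sigma> *\<^sub>R (\<integral>x. D k x *\<^sub>R u0 x \<partial>lborel)) \<longlonglongrightarrow> \<sigma> *\<^sub>R (p *\<^sub>R c (\<theta> + a))" by (intro tendsto_intros) simp
      moreover have "\<sigma> *\<^sub>R (\<integral>x. D k x *\<^sub>R u0 x \<partial>lborel) = (\<integral>x. (cut_at k x * cos (x \<bullet> \<xi> + \<theta>)) *\<^sub>R g x \<partial>lborel)" for k
      proof -
        have "(\<integral>x. D k x *\<^sub>R u0 x \<partial>lborel) = \<sigma> *\<^sub>R (\<integral>x. (cut_at k x * cos (x \<bullet> \<xi> + \<theta>)) *\<^sub>R g x \<partial>lborel)"
          using w[unfolded has_weak_pds_def, rule_format, OF tf] unfolding D_def \<sigma>_def .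
        moreover have "\<sigma> * \<sigma> = 1" by (simp add: \<sigma>_def flip: power_mult_distrib)
        ultimately show ?thesis by simp
      qed
      ultimately show ?thesis by simp
    qed
    define U where "U = fourier u0 \<xi>"
    have U: "U = cvec (c 0) + mulI (cvec (c (pi / 2)))"
      using fourier_cos_decomposition[of "\<lambda>_. 1" u0 \<xi>] u0 by (simp add: U_def c_def)
    \<comment> \<open>The accumulated phase a = length js pi/2 acts on the transform as a rotation
      of the complex plane. It does not change the norm, so the power of \<i> never has to be
      evaluated.\<close>
    have rot: "c (\<theta> + a) = cos (\<theta> + a) *\<^sub>R c 0 + sin (\<theta> + a) *\<^sub>R c (pi / 2)" for \<theta>
    proof -
      have "cos (x \<bullet> \<xi> + (\<theta> + a)) *\<^sub>R u0 x = cos (\<theta> + a) *\<^sub>R (cos (x \<bullet> \<xi> + 0) *\<^sub>R u0 x) + sin (\<theta> + a) *\<^sub>R (cos (x \<bullet> \<xi> + pi / 2) *\<^sub>R u0 x)" for x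
        unfolding cos_add[of "x \<bullet> \<xi>" "\<theta> + a"] by (simp add: cos_add[of "x \<bullet> \<xi>" "pi / 2"] algebra_simps)
      then show ?thesis unfolding c_def
        by (simp only: Bochner_Integration.integral_add[OF integrable_scaleR_right[OF ic] integrable_scaleR_right[OF ic]] integral_scaleR_right)
    qed
    have "(\<lambda>k. fourier (\<lambda>x. cut_at k x *\<^sub>R g x) \<xi>) \<longlonglongrightarrow> cvec (\<sigma> *\<^sub>R (p *\<^sub>R c (0 + a))) + mulI (cvec (\<sigma> *\<^sub>R (p *\<^sub>R c (pi / 2 + a))))"
      unfolding fourier_cos_decomposition[OF ig]
      by (intro tendsto_add bounded_linear.tendsto[OF bounded_linear_mulI] bounded_linear.tendsto[OF bounded_linear_cvec] lim\<theta>)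
    also have "cvec (\<sigma> *\<^sub>R (p *\<^sub>R c (0 + a))) + mulI (cvec (\<sigma> *\<^sub>R (p *\<^sub>R c (pi / 2 + a)))) = (\<sigma> * p) *\<^sub>R (cos a *\<^sub>R U - sin a *\<^sub>R mulI U)"
      unfolding rot U by (simp add: cvec_linear mulI_add mulI_scaleR mulI_diff cos_add sin_add algebra_simps)
    finally have "(\<lambda>k. (norm (fourier (\<lambda>x. cut_at k x *\<^sub>R g x) \<xi>))\<^sup>2) \<longlonglongrightarrow> (norm ((\<sigma> * p) *\<^sub>R (cos a *\<^sub>R U - sin a *\<^sub>R mulI U)))\<^sup>2"
      by (intro tendsto_intros)
    also have "(norm ((\<sigma> * p) *\<^sub>R (cos a *\<^sub>R U - sin a *\<^sub>R mulI U)))\<^sup>2 = p\<^sup>2 * (norm U)\<^sup>2"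
    proof -
      have UI: "mulI U \<bullet> U = 0" "U \<bullet> mulI U = 0" using mulI_inner[of U U] by (simp_all add: inner_commute)
      have "(norm (cos a *\<^sub>R U - sin a *\<^sub>R mulI U))\<^sup>2 = (cos a)\<^sup>2 * (U \<bullet> U) + (sin a)\<^sup>2 * (mulI U \<bullet> mulI U)"
        unfolding power2_norm_eq_inner by (simp add: inner_diff_left inner_diff_right UI power2_eq_square)
      also have "mulI U \<bullet> mulI U = U \<bullet> U" by (simp add: mulI_inner)
      also have "(cos a)\<^sup>2 * (U \<bullet> U) + (sin a)\<^sup>2 * (U \<bullet> U) = U \<bullet> U" by (simp flip: distrib_right)
      finally have "(norm (cos a *\<^sub>R U - sin a *\<^sub>R mulI U))\<^sup>2 = (norm U)\<^sup>2" by (simp add: power2_norm_eq_inner)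
      moreover have "\<bar>\<sigma>\<bar> = 1" by (simp add: \<sigma>_def power_abs)
      ultimately show ?thesis by (simp add: power_mult_distrib abs_mult)
    qed
    finally show ?thesis by (simp add: p_def U_def)
  qed
  have "(\<integral>\<^sup>+\<xi>. ennreal ((\<Prod>j\<leftarrow>js. \<xi> $ j)\<^sup>2 * (norm (fourier u0 \<xi>))\<^sup>2) \<partial>lborel)
     = (\<integral>\<^sup>+\<xi>. liminf (\<lambda>k. ennreal ((norm (fourier (\<lambda>x. cut_at k x *\<^sub>R g x) \<xi>))\<^sup>2)) \<partial>lborel)"
    by (intro nn_integral_cong lim_imp_Liminf[OF trivial_limit_sequentially, symmetric] tendsto_ennrealI lim)
  also have "\<dots> \<le> liminf (\<lambda>k. nsq (fourier (\<lambda>x. cut_at k x *\<^sub>R g x)))"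
    unfolding nsq_def by (rule nn_integral_liminf) measurable
  also have "\<dots> \<le> liminf (\<lambda>k :: nat. ennreal ((2 * pi) ^ CARD('n)) * nsq g)"
  proof (intro Liminf_mono eventuallyI)
    fix k
    have "nsq (fourier (\<lambda>x. cut_at k x *\<^sub>R g x)) \<le> ennreal ((2 * pi) ^ CARD('n)) * nsq (\<lambda>x. cut_at k x *\<^sub>R g x)" by (rule fourier_bessel[OF ig])
    also have "nsq (\<lambda>x. cut_at k x *\<^sub>R g x) \<le> nsq g" by (intro nsq_mono) (simp add: mult_left_le_one_le cut_abs)
    finally show "nsq (fourier (\<lambda>x. cut_at k x *\<^sub>R g x)) \<le> ennreal ((2 * pi) ^ CARD('n)) * nsq g" by (simp add: mult_left_mono)
  qed
  also have "\<dots> = ennreal ((2 * pi) ^ CARD('n)) * nsq g" by (simp add: Liminf_const)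
  finally show ?thesis .
qed

text \<open>Completeness of L2, reduced to L1: multiplication by the square integrable Gaussian
  turns the sequence into an L1 Cauchy sequence, which has a subsequence that is Cauchy almost
  everywhere. The Gaussian is positive and can be divided out again; Fatou's lemma identifies the
  limit in L2.\<close>

lemma L2_Cauchy_limit:
  fixes s :: "nat \<Rightarrow> 'a::euclidean_space \<Rightarrow> 'b::euclidean_space"
  assumes L: "\<And>n. L2 (s n)" and C: "\<And>e. e > 0 \<Longrightarrow> \<exists>N. \<forall>i\<ge>N. \<forall>j\<ge>N. L2norm (\<lambda>x. s i x - s j x) < e"
  obtains g where "g \<in> borel_measurable lborel" "(\<lambda>n. nsq (\<lambda>x. s n x - g x)) \<longlonglongrightarrow> 0"
proof -
  have [measurable]: "s n \<in> borel_measurable lborel" for n by (rule L2_measurable[OF L])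
  have GL: "L2 (gaussian :: 'a \<Rightarrow> real)"
  proof -
    have "integrable lborel (\<lambda>x :: 'a. (norm (gaussian x))\<^sup>2)"
      by (rule Bochner_Integration.integrable_bound[OF gaussian_integral(1)]) (auto simp: power2_eq_square mult_left_le_one_le)
    then show ?thesis by (simp add: L2_def)
  qed
  define G where "G n x = gaussian x *\<^sub>R s n x" for n x
  have Gi: "integrable lborel (G n)" for n unfolding G_def[abs_def] by (rule integrable_scaleR_L2(1)[OF GL L])
  have GC: "\<exists>N. \<forall>i\<ge>N. \<forall>j\<ge>N. (\<integral>x. norm (G i x - G j x) \<partial>lborel) < e" if e: "e > 0" for e
  proof -
    define K where "K = L2norm (gaussian :: 'a \<Rightarrow> real) + 1"
    have K: "K > 0" by (simp add: K_def add_nonneg_pos)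
    obtain N where N: "\<And>i j. i \<ge> N \<Longrightarrow> j \<ge> N \<Longrightarrow> L2norm (\<lambda>x. s i x - s j x) < e / K" using C[of "e / K"] e K by auto
    have "(\<integral>x. norm (G i x - G j x) \<partial>lborel) < e" if "i \<ge> N" "j \<ge> N" for i j
    proof -
      have "(\<integral>x. norm (G i x - G j x) \<partial>lborel) = (\<integral>x. norm (gaussian x) * norm (s i x - s j x) \<partial>lborel)"
        by (simp add: G_def flip: scaleR_diff_right)
      also have "\<dots> \<le> L2norm (gaussian :: 'a \<Rightarrow> real) * L2norm (\<lambda>x. s i x - s j x)" by (rule Cauchy_Schwarz_L2(2)[OF GL L2_diff[OF L L]])
      also have "\<dots> \<le> K * L2norm (\<lambda>x. s i x - s j x)" by (rule mult_right_mono) (simp_all add: K_def)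
      also have "\<dots> < K * (e / K)" using N[OF that] K by (intro mult_strict_left_mono)
      finally show ?thesis using K by simp
    qed
    then show ?thesis by blast
  qed
  obtain r where r: "strict_mono r" "AE x in lborel. Cauchy (\<lambda>i. G (r i) x)" by (rule cauchy_L1_AE_cauchy_subseq[OF Gi GC])
  define g where "g x = lim (\<lambda>i. s (r i) x)" for x
  have gm[measurable]: "g \<in> borel_measurable lborel" unfolding g_def[abs_def] by (rule borel_measurable_lim_metric) measurable
  have ae: "AE x in lborel. (\<lambda>i. s (r i) x) \<longlonglongrightarrow> g x"
    using r(2)
  proof eventually_elim
    case (elim x)
    then obtain l where "(\<lambda>i. G (r i) x) \<longlonglongrightarrow> l" using Cauchy_convergent_iff convergent_def by blast
    then have "(\<lambda>i. (1 / gaussian x) *\<^sub>R G (r i) x) \<longlonglongrightarrow> (1 / gaussian x) *\<^sub>R l" by (intro tendsto_intros)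
    moreover have "(1 / gaussian x) *\<^sub>R G i x = s i x" for i
    proof -
      have "gaussian x \<noteq> 0" using gaussian_bounds(1)[of x] by linarith
      then show ?thesis by (simp add: G_def)
    qed
    ultimately have "convergent (\<lambda>i. s (r i) x)" by (auto simp: convergent_def)
    then show ?case by (simp add: g_def convergent_LIMSEQ_iff)
  qed
  have "(\<lambda>n. nsq (\<lambda>x. s n x - g x)) \<longlonglongrightarrow> 0"
  proof (rule order_tendstoI)
    fix e :: ennreal assume e: "0 < e"
    obtain d :: real where d: "d > 0" "ennreal (d\<^sup>2) < e"
    proof -
      obtain q where q: "0 < q" "q < e" using e dense by blast
      then obtain b where b: "q = ennreal b" "b > 0" by (cases q rule: ennreal_cases) (auto simp: top.extremum_strict)
      then show ?thesis using that[of "sqrt b"] q by simp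
    qed
    obtain N where N: "\<And>i j. i \<ge> N \<Longrightarrow> j \<ge> N \<Longrightarrow> L2norm (\<lambda>x. s i x - s j x) < d" using C[OF d(1)] by blast
    have "nsq (\<lambda>x. s n x - g x) < e" if n: "n \<ge> N" for n
    proof -
      have "nsq (\<lambda>x. s n x - g x) = (\<integral>\<^sup>+x. liminf (\<lambda>i. ennreal ((norm (s n x - s (r i) x))\<^sup>2)) \<partial>lborel)"
        unfolding nsq_def
      proof (rule nn_integral_cong_AE)
        show "AE x in lborel. ennreal ((norm (s n x - g x))\<^sup>2) = liminf (\<lambda>i. ennreal ((norm (s n x - s (r i) x))\<^sup>2))"
          using ae
        proof eventually_elim
          case (elim x)
          then have "(\<lambda>i. ennreal ((norm (s n x - s (r i) x))\<^sup>2)) \<longlonglongrightarrow> ennreal ((norm (s n x - g x))\<^sup>2)" by (intro tendsto_ennrealI tendsto_intros)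
          from lim_imp_Liminf[OF trivial_limit_sequentially this] show ?case by (rule sym)
        qed
      qed
      also have "\<dots> \<le> liminf (\<lambda>i. nsq (\<lambda>x. s n x - s (r i) x))" unfolding nsq_def by (rule nn_integral_liminf) measurable
      also have "\<dots> \<le> liminf (\<lambda>i :: nat. ennreal (d\<^sup>2))"
      proof (rule Liminf_mono, rule eventually_sequentiallyI)
        fix i assume "N \<le> i"
        then have "N \<le> r i" using seq_suble[OF r(1), of i] by simp
        then have "L2norm (\<lambda>x. s n x - s (r i) x) < d" by (rule N[OF n])
        then have "(L2norm (\<lambda>x. s n x - s (r i) x))\<^sup>2 \<le> d\<^sup>2" by (intro power_mono) auto
        then show "nsq (\<lambda>x. s n x - s (r i) x) \<le> ennreal (d\<^sup>2)" unfolding nsq_eq_L2norm[OF L2_diff[OF L L]] by (rule ennreal_leI)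
      qed
      also have "\<dots> = ennreal (d\<^sup>2)" by (simp add: Liminf_const)
      finally show ?thesis using d(2) by (rule le_less_trans)
    qed
    then show "\<forall>\<^sub>F n in sequentially. nsq (\<lambda>x. s n x - g x) < e" by (intro eventually_sequentiallyI)
  qed simp
  with gm show ?thesis by (rule that)
qed

text \<open>Real part of the inverse transform. Taking the real part gives a function of the right
  type whatever the symmetry of \<open>K\<close>, and it commutes with pairing against real test
  functions.\<close>

definition ift :: "(real^'n::finite \<Rightarrow> complex^'m) \<Rightarrow> real^'n \<Rightarrow> real^'m" where
  "ift K x = (\<chi> i. 1 / (2 * pi) ^ CARD('n) * Re (ft 1 (\<lambda>\<xi>. K \<xi> $ i) x))"

lemma integrable_cvec_nth:
  fixes K :: "'a::euclidean_space \<Rightarrow> complex^'m"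
  assumes "integrable lborel K" shows "integrable lborel (\<lambda>x. K x $ i)"
  by (rule integrable_bounded_linear[OF bounded_linear_vec_nth assms])

lemma two_pi_power_ge_1: "1 \<le> (2 * pi) ^ n"
  using pi_ge_two by (intro one_le_power) linarith

lemma ift_diff:
  fixes K H :: "real^'n::finite \<Rightarrow> complex^'m"
  assumes "integrable lborel K" "integrable lborel H"
  shows "ift (\<lambda>\<xi>. K \<xi> - H \<xi>) x = ift K x - ift H x"
  by (simp add: ift_def vec_eq_iff ft_diff integrable_cvec_nth[OF assms(1)] integrable_cvec_nth[OF assms(2)] diff_divide_distrib)

lemma ift_measurable:
  fixes K :: "real^'n::finite \<Rightarrow> complex^'m"
  assumes "integrable lborel K" shows "ift K \<in> borel_measurable lborel"
  unfolding borel_measurable_vec_iff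
proof
  fix i
  have [measurable]: "ft 1 (\<lambda>\<xi>. K \<xi> $ i) \<in> borel_measurable lborel" by (rule ft_measurable[OF integrable_cvec_nth[OF assms]])
  show "(\<lambda>x. ift K x $ i) \<in> borel_measurable lborel" unfolding ift_def vec_lambda_beta by measurable
qed

lemma ift_bessel:
  fixes K :: "real^'n::finite \<Rightarrow> complex^'m"
  assumes K: "integrable lborel K"
  shows "nsq (ift K) \<le> ennreal (1 / (2 * pi) ^ CARD('n)) * nsq K"
proof -
  define c where "c = 1 / (2 * pi) ^ CARD('n)"
  have c: "c > 0" by (simp add: c_def)
  have Km: "K \<in> borel_measurable lborel" using K by simp
  have "nsq (ift K) = (\<Sum>i\<in>UNIV. nsq (\<lambda>x. ift K x $ i))" by (rule nsq_vec[OF ift_measurable[OF K]])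
  also have "\<dots> \<le> (\<Sum>i\<in>UNIV. ennreal c * nsq (\<lambda>\<xi>. K \<xi> $ i))"
  proof (rule sum_mono)
    fix i
    have Ki: "integrable lborel (\<lambda>\<xi>. K \<xi> $ i)" by (rule integrable_cvec_nth[OF K])
    have "nsq (\<lambda>x. ift K x $ i) \<le> nsq (\<lambda>x. c *\<^sub>R ft 1 (\<lambda>\<xi>. K \<xi> $ i) x)"
      by (rule nsq_mono) (use c in \<open>simp add: ift_def c_def abs_mult abs_Re_le_cmod divide_right_mono\<close>)
    also have "\<dots> = ennreal (c\<^sup>2) * nsq (ft 1 (\<lambda>\<xi>. K \<xi> $ i))" by (rule nsq_scale[OF ft_measurable[OF Ki]])
    also have "\<dots> \<le> ennreal (c\<^sup>2) * (ennreal ((2 * pi) ^ DIM(real^'n)) * nsq (\<lambda>\<xi>. K \<xi> $ i))"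
      by (rule mult_left_mono[OF ft_bessel[OF Ki]]) auto
    also have "\<dots> = ennreal (c\<^sup>2 * (2 * pi) ^ CARD('n)) * nsq (\<lambda>\<xi>. K \<xi> $ i)"
      by (simp add: ennreal_mult mult.assoc)
    also have "c\<^sup>2 * (2 * pi) ^ CARD('n) = c" by (simp add: c_def power2_eq_square)
    finally show "nsq (\<lambda>x. ift K x $ i) \<le> ennreal c * nsq (\<lambda>\<xi>. K \<xi> $ i)" .
  qed
  also have "\<dots> = ennreal c * nsq K" unfolding nsq_vec[OF Km] sum_distrib_left ..
  finally show ?thesis by (simp add: c_def)
qed

section \<open>Weak derivatives constructed from Fourier multipliers\<close>

lemma norm_prod_list_ii: "cmod (\<Prod>j\<leftarrow>js. \<i> * complex_of_real (\<xi> $ j)) = \<bar>\<Prod>j\<leftarrow>js. \<xi> $ j\<bar>"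
  by (induction js) (simp_all add: norm_mult abs_mult)

lemma norm_vector_smult: "norm (c *s (v :: complex^'m)) = cmod c * norm v"
  by (simp add: norm_vec_def L2_set_def norm_mult power_mult_distrib sum_distrib_left[symmetric] real_sqrt_mult)

lemma borel_measurable_prod_list_nth:
  "(\<lambda>\<xi> :: real^'n::finite. \<Prod>j\<leftarrow>js. \<xi> $ j) \<in> borel_measurable lborel"
proof (induction js)
  case (Cons j js)
  have "(\<lambda>\<xi> :: real^'n. \<xi> $ j) \<in> borel_measurable borel" by (intro borel_measurable_continuous_onI continuous_intros)
  then show ?case using Cons by simp
qed simp

text \<open>The multiplied transform h is square integrable but perhaps not integrable, so it is
  truncated to balls, inverted, and the inverse transforms converge in L2 to g. Pairing with a test
  function and moving the transform onto it identifies g. The factor 2 stems from passing the bound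
  on the approximants to their limit with \<open>nsq_add_le\<close>.\<close>

proposition weak_pds_exists_of_fourier:
  fixes f :: "real^'n::finite \<Rightarrow> real^'m"
  assumes fv: "has_L2_fourier f v"
    and fin: "(\<integral>\<^sup>+\<xi>. ennreal ((\<Prod>j\<leftarrow>js. \<xi> $ j)\<^sup>2 * (norm (v \<xi>))\<^sup>2) \<partial>lborel) < \<infinity>"
  obtains g where "L2 g" "has_weak_pds js f g"
    "nsq g \<le> 2 * (\<integral>\<^sup>+\<xi>. ennreal ((\<Prod>j\<leftarrow>js. \<xi> $ j)\<^sup>2 * (norm (v \<xi>))\<^sup>2) \<partial>lborel)"
proof -
  have f: "L2 f" and v: "L2 v" using fv by (auto simp: has_L2_fourier_def)
  define p where "p \<xi> = (\<Prod>j\<leftarrow>js. \<i> * complex_of_real (\<xi> $ j))" for \<xi> :: "real^'n"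
  define h where "h \<xi> = p \<xi> *s v \<xi>" for \<xi>
  have vi: "L2 (\<lambda>\<xi>. v \<xi> $ i)" for i using v by (simp add: L2_vec_iff)
  have pm: "p \<in> borel_measurable lborel" unfolding p_def[abs_def]
  proof (induction js)
    case (Cons j js)
    have "(\<lambda>\<xi> :: real^'n. \<xi> $ j) \<in> borel_measurable borel" by (intro borel_measurable_continuous_onI continuous_intros)
    then show ?case using Cons by simp
  qed simp
  have hm: "h \<in> borel_measurable lborel"
    unfolding borel_measurable_vec_iff h_def using pm L2_measurable[OF vi] by simp
  have hn: "(norm (h \<xi>))\<^sup>2 = (\<Prod>j\<leftarrow>js. \<xi> $ j)\<^sup>2 * (norm (v \<xi>))\<^sup>2" for \<xi>
    by (simp add: h_def p_def norm_vector_smult norm_prod_list_ii power_mult_distrib)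
  define I where "I = (\<integral>\<^sup>+\<xi>. ennreal ((\<Prod>j\<leftarrow>js. \<xi> $ j)\<^sup>2 * (norm (v \<xi>))\<^sup>2) \<partial>lborel)"
  have nh: "nsq h = I" by (simp add: nsq_def hn I_def)
  have h: "L2 h" using fin hm nh by (simp add: L2_iff_nsq I_def)
  define c where "c = 1 / (2 * pi) ^ CARD('n)"
  have c: "c > 0" "c \<le> 1" using two_pi_power_ge_1[of "CARD('n)"] by (auto simp: c_def)
  define J where "J N = (indicator (cball 0 (real N)) :: real^'n \<Rightarrow> real)" for N :: nat
  have Jm[measurable]: "J N \<in> borel_measurable lborel" for N
    unfolding J_def by (rule borel_measurable_indicator) (simp add: borel_closed)
  have JL: "L2 (J N)" for N by (rule L2_bounded_support[OF Jm, of N 1 "real N"]) (auto simp: J_def indicator_def)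
  have Jlim: "(\<lambda>N. J N \<xi>) \<longlonglongrightarrow> 1" for \<xi>
  proof -
    have "eventually (\<lambda>k. norm \<xi> \<le> real k) sequentially"
      using filterlim_real_sequentially by (simp add: filterlim_at_top)
    then have "eventually (\<lambda>k. J k \<xi> = 1) sequentially" by eventually_elim (simp add: J_def)
    then show ?thesis by (rule tendsto_eventually)
  qed
  define H where "H N \<xi> = J N \<xi> *\<^sub>R h \<xi>" for N \<xi>
  have Hi: "integrable lborel (H N)" for N unfolding H_def[abs_def] by (rule integrable_scaleR_L2(1)[OF JL h])
  have HL: "L2 (H N)" and Hle: "nsq (H N) \<le> I" for N
  proof -
    have b: "\<bar>J N x\<bar> \<le> 1" for x by (simp add: J_def indicator_def)
    show "L2 (H N)" unfolding H_def[abs_def] by (rule L2_scaleR(1)[OF h Jm b])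
    show "nsq (H N) \<le> I" using L2_scaleR(2)[OF h Jm b] unfolding H_def[abs_def] nh by simp
  qed
  define q where "q N = L2norm (\<lambda>\<xi>. H N \<xi> - h \<xi>)" for N
  have qlim: "q \<longlonglongrightarrow> 0"
  proof -
    have "(\<lambda>N. nsq (\<lambda>\<xi>. (J N \<xi> - 1) *\<^sub>R h \<xi>)) \<longlonglongrightarrow> 0"
    proof (rule nsq_vanishing[OF h])
      show "\<bar>J N \<xi> - 1\<bar> \<le> 1" for N \<xi> by (simp add: J_def indicator_def)
      show "(\<lambda>N. J N \<xi> - 1) \<longlonglongrightarrow> 0" for \<xi> using tendsto_diff[OF Jlim[of \<xi>] tendsto_const[of 1]] by simp
    qed measurable
    then have "(\<lambda>N. nsq (\<lambda>\<xi>. H N \<xi> - h \<xi>)) \<longlonglongrightarrow> 0" by (simp add: H_def scaleR_diff_left)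
    then have "(\<lambda>N. sqrt (enn2real (nsq (\<lambda>\<xi>. H N \<xi> - h \<xi>)))) \<longlonglongrightarrow> sqrt (enn2real 0)"
      by (intro tendsto_real_sqrt tendsto_enn2real) simp_all
    moreover have "sqrt (enn2real (nsq (\<lambda>\<xi>. H N \<xi> - h \<xi>))) = q N" for N
      unfolding q_def L2norm_sq[OF L2_measurable[OF L2_diff[OF HL h]], symmetric] by simp
    ultimately show ?thesis by simp
  qed
  define G where "G N = ift (H N)" for N
  have Gm: "G N \<in> borel_measurable lborel" for N unfolding G_def by (rule ift_measurable[OF Hi])
  have GI: "nsq (G N) \<le> I" for N
  proof -
    have "nsq (G N) \<le> ennreal c * nsq (H N)" unfolding G_def c_def by (rule ift_bessel[OF Hi])
    also have "\<dots> \<le> 1 * I" using c by (intro mult_mono Hle) (auto simp: ennreal_le_1)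
    finally show ?thesis by simp
  qed
  have GL: "L2 (G N)" for N using Gm GI[of N] fin by (auto simp: L2_iff_nsq I_def intro: le_less_trans)
  have "\<exists>N. \<forall>i\<ge>N. \<forall>j\<ge>N. L2norm (\<lambda>x. G i x - G j x) < e" if e: "e > 0" for e
  proof -
    obtain N where N: "\<And>i. i \<ge> N \<Longrightarrow> q i < e / 4"
      using order_tendstoD(2)[OF qlim, of "e / 4"] e unfolding eventually_sequentially by auto
    have "L2norm (\<lambda>x. G i x - G j x) < e" if ij: "i \<ge> N" "j \<ge> N" for i j
    proof -
      have D: "L2 (\<lambda>\<xi>. H i \<xi> - H j \<xi>)" by (rule L2_diff[OF HL HL])
      have "(L2norm (\<lambda>\<xi>. H i \<xi> - H j \<xi>))\<^sup>2 \<le> 2 * (q i)\<^sup>2 + 2 * (q j)\<^sup>2"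
      proof -
        have "(L2norm (\<lambda>\<xi>. (H i \<xi> - h \<xi>) + (h \<xi> - H j \<xi>)))\<^sup>2 \<le> 2 * (L2norm (\<lambda>\<xi>. H i \<xi> - h \<xi>))\<^sup>2 + 2 * (L2norm (\<lambda>\<xi>. h \<xi> - H j \<xi>))\<^sup>2"
          by (rule L2norm_add_sq_le[OF L2_diff[OF HL h] L2_diff[OF h HL]])
        moreover have "L2norm (\<lambda>\<xi>. h \<xi> - H j \<xi>) = q j" by (simp add: q_def L2norm_def norm_minus_commute)
        ultimately show ?thesis by (simp add: q_def)
      qed
      also have "\<dots> \<le> 2 * (e / 4)\<^sup>2 + 2 * (e / 4)\<^sup>2"
        using N[OF ij(1)] N[OF ij(2)] by (intro add_mono mult_left_mono power_mono) (auto simp: q_def)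
      also have "\<dots> < e\<^sup>2" using e by (simp add: power_divide)
      finally have lt: "(L2norm (\<lambda>\<xi>. H i \<xi> - H j \<xi>))\<^sup>2 < e\<^sup>2" .
      have "nsq (\<lambda>x. G i x - G j x) \<le> ennreal c * nsq (\<lambda>\<xi>. H i \<xi> - H j \<xi>)"
        using ift_bessel[OF Bochner_Integration.integrable_diff[OF Hi[of i] Hi[of j]]]
        unfolding G_def c_def ift_diff[OF Hi Hi, symmetric] .
      also have "\<dots> = ennreal (c * (L2norm (\<lambda>\<xi>. H i \<xi> - H j \<xi>))\<^sup>2)" unfolding nsq_eq_L2norm[OF D] using c by (simp add: ennreal_mult)
      also have "\<dots> \<le> ennreal ((L2norm (\<lambda>\<xi>. H i \<xi> - H j \<xi>))\<^sup>2)" using c by (intro ennreal_leI mult_left_le_one_le) auto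
      finally have "(L2norm (\<lambda>x. G i x - G j x))\<^sup>2 \<le> (L2norm (\<lambda>\<xi>. H i \<xi> - H j \<xi>))\<^sup>2"
        by (intro L2norm_sq_le L2_measurable[OF L2_diff[OF GL GL]]) auto
      from this lt have "(L2norm (\<lambda>x. G i x - G j x))\<^sup>2 < e\<^sup>2" by (rule le_less_trans)
      then show ?thesis by (rule power2_less_imp_less) (use e in simp)
    qed
    then show ?thesis by blast
  qed
  from L2_Cauchy_limit[OF GL this]
  obtain g where gm: "g \<in> borel_measurable lborel" and glim: "(\<lambda>n. nsq (\<lambda>x. G n x - g x)) \<longlonglongrightarrow> 0" by blast
  have gle: "nsq g \<le> 2 * I"
  proof -
    have "nsq g \<le> 2 * I + 2 * nsq (\<lambda>x. G n x - g x)" for n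
    proof -
      have "nsq (\<lambda>x. G n x + (g x - G n x)) \<le> 2 * nsq (G n) + 2 * nsq (\<lambda>x. g x - G n x)"
        by (rule nsq_add_le) (use Gm[of n] gm in auto)
      also have "nsq (\<lambda>x. g x - G n x) = nsq (\<lambda>x. G n x - g x)" by (rule nsq_minus_commute)
      also have "2 * nsq (G n) + 2 * nsq (\<lambda>x. G n x - g x) \<le> 2 * I + 2 * nsq (\<lambda>x. G n x - g x)"
        by (intro add_mono mult_left_mono GI) auto
      finally show ?thesis by simp
    qed
    moreover have "(\<lambda>n. 2 * I + 2 * nsq (\<lambda>x. G n x - g x)) \<longlonglongrightarrow> 2 * I + 2 * 0"
      by (intro tendsto_add tendsto_const ennreal_tendsto_cmult glim) simp
    ultimately have "nsq g \<le> 2 * I + 2 * 0" by (intro LIMSEQ_le_const) auto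
    then show ?thesis by simp
  qed
  have g: "L2 g"
  proof -
    have "2 * I < \<infinity>" using fin by (simp add: I_def ennreal_mult_less_top)
    then show ?thesis using gle gm by (auto simp: L2_iff_nsq intro: le_less_trans)
  qed
  have "has_weak_pds js f g"
    unfolding has_weak_pds_def
  proof (intro allI impI)
    fix \<phi> :: "real^'n \<Rightarrow> real" assume \<phi>: "test_function \<phi>"
    define \<sigma> where "\<sigma> = (-1 :: real) ^ length js"
    have \<sigma>: "\<sigma> * \<sigma> = 1" by (simp add: \<sigma>_def flip: power_mult_distrib)
    have "(\<lambda>N. L2norm \<phi> * L2norm (\<lambda>x. G N x - g x)) \<longlonglongrightarrow> L2norm \<phi> * 0"
    proof (intro tendsto_intros)
      have "(\<lambda>N. sqrt (enn2real (nsq (\<lambda>x. G N x - g x)))) \<longlonglongrightarrow> sqrt (enn2real 0)"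
        by (intro tendsto_real_sqrt tendsto_enn2real) (simp_all add: glim)
      moreover have "sqrt (enn2real (nsq (\<lambda>x. G N x - g x))) = L2norm (\<lambda>x. G N x - g x)" for N
        unfolding L2norm_sq[OF L2_measurable[OF L2_diff[OF GL g]], symmetric] by simp
      ultimately show "(\<lambda>N. L2norm (\<lambda>x. G N x - g x)) \<longlonglongrightarrow> 0" by simp
    qed
    then have z: "(\<lambda>N. L2norm \<phi> * L2norm (\<lambda>x. G N x - g x)) \<longlonglongrightarrow> 0" by simp
    have lim1: "(\<lambda>N. \<integral>x. \<phi> x *\<^sub>R G N x \<partial>lborel) \<longlonglongrightarrow> (\<integral>x. \<phi> x *\<^sub>R g x \<partial>lborel)"
    proof (rule LIM_zero_cancel, rule Lim_null_comparison[OF eventuallyI z])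
      fix N
      have "(\<integral>x. \<phi> x *\<^sub>R G N x \<partial>lborel) - (\<integral>x. \<phi> x *\<^sub>R g x \<partial>lborel) = (\<integral>x. \<phi> x *\<^sub>R (G N x - g x) \<partial>lborel)"
        by (simp only: scaleR_diff_right Bochner_Integration.integral_diff[OF test_function_scaleR_integrable[OF \<phi> GL] test_function_scaleR_integrable[OF \<phi> g]])
      then show "norm ((\<integral>x. \<phi> x *\<^sub>R G N x \<partial>lborel) - (\<integral>x. \<phi> x *\<^sub>R g x \<partial>lborel)) \<le> L2norm \<phi> * L2norm (\<lambda>x. G N x - g x)"
        using integrable_scaleR_L2(2)[OF test_function_L2[OF \<phi>] L2_diff[OF GL g]] by simp
    qed
    have "(\<lambda>N. \<integral>x. \<phi> x *\<^sub>R G N x \<partial>lborel) \<longlonglongrightarrow> \<sigma> *\<^sub>R (\<integral>x. pds js \<phi> x *\<^sub>R f x \<partial>lborel)"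
    proof (rule vec_tendstoI)
      fix i
      have hi: "L2 (\<lambda>\<xi>. h \<xi> $ i)" using h by (simp add: L2_vec_iff)
      have Hii: "integrable lborel (\<lambda>\<xi>. H N \<xi> $ i)" for N by (rule integrable_cvec_nth[OF Hi])
      define F where "F = ft 1 (cfun \<phi>)"
      have FL: "L2 F" unfolding F_def by (rule ft_cfun_test_L2[OF \<phi>])
      have hF: "integrable lborel (\<lambda>\<xi>. h \<xi> $ i * F \<xi>)" by (rule integrable_mult_L2(1)[OF hi FL])
      \<comment> \<open>The test function is real, so the real part can be pulled out of the
        integral; Fubini's theorem then moves the transform from \<open>H N\<close> onto
        \<phi>.\<close>
      have comp: "(\<integral>x. \<phi> x *\<^sub>R G N x \<partial>lborel) $ i = c * Re (\<integral>\<xi>. H N \<xi> $ i * F \<xi> \<partial>lborel)" for N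
      proof -
        have ii: "integrable lborel (\<lambda>x. \<phi> x *\<^sub>R G N x)" by (rule test_function_scaleR_integrable[OF \<phi> GL])
        have gi: "L2 (\<lambda>x. G N x $ i)" using GL by (simp add: L2_vec_iff)
        have mf: "ft 1 (\<lambda>\<xi>. H N \<xi> $ i) \<in> borel_measurable lborel" by (rule ft_measurable[OF Hii])
        have ci: "integrable lborel (\<lambda>x. cfun \<phi> x * ft 1 (\<lambda>\<xi>. H N \<xi> $ i) x)"
        proof (rule Bochner_Integration.integrable_bound[OF integrable_mult_left[OF cfun_test_function(1)[OF \<phi>], of "complex_of_real (\<integral>\<xi>. norm (H N \<xi> $ i) \<partial>lborel)"]])
          show "(\<lambda>x. cfun \<phi> x * ft 1 (\<lambda>\<xi>. H N \<xi> $ i) x) \<in> borel_measurable lborel"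
            using mf smooth_measurable[OF test_function_smooth[OF \<phi>]] by measurable
          show "AE x in lborel. norm (cfun \<phi> x * ft 1 (\<lambda>\<xi>. H N \<xi> $ i) x) \<le> norm (cfun \<phi> x * complex_of_real (\<integral>\<xi>. norm (H N \<xi> $ i) \<partial>lborel))"
            using ft_bound[of 1 "\<lambda>\<xi>. H N \<xi> $ i"] by (intro AE_I2) (auto simp: norm_mult intro!: mult_left_mono)
        qed
        have "(\<integral>x. \<phi> x *\<^sub>R G N x \<partial>lborel) $ i = (\<integral>x. (\<phi> x *\<^sub>R G N x) $ i \<partial>lborel)"
          by (rule integral_bounded_linear[OF bounded_linear_vec_nth ii, symmetric])
        also have "\<dots> = (\<integral>x. c * Re (cfun \<phi> x * ft 1 (\<lambda>\<xi>. H N \<xi> $ i) x) \<partial>lborel)"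
          by (rule Bochner_Integration.integral_cong) (simp_all add: G_def ift_def c_def)
        also have "\<dots> = c * Re (\<integral>x. cfun \<phi> x * ft 1 (\<lambda>\<xi>. H N \<xi> $ i) x \<partial>lborel)"
          by (simp only: integral_mult_right_zero integral_bounded_linear[OF bounded_linear_Re ci])
        also have "(\<integral>x. cfun \<phi> x * ft 1 (\<lambda>\<xi>. H N \<xi> $ i) x \<partial>lborel) = (\<integral>\<xi>. H N \<xi> $ i * (\<integral>x. cis (1 * (\<xi> \<bullet> x)) * cfun \<phi> x \<partial>lborel) \<partial>lborel)"
          unfolding ft_def by (rule fubini_phase[OF Hii cfun_test_function(1)[OF \<phi>]]) measurable
        also have "\<dots> = (\<integral>\<xi>. H N \<xi> $ i * F \<xi> \<partial>lborel)" by (simp add: F_def ft_def inner_commute)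
        finally show ?thesis .
      qed
      have "(\<lambda>N. \<integral>\<xi>. H N \<xi> $ i * F \<xi> \<partial>lborel) \<longlonglongrightarrow> (\<integral>\<xi>. h \<xi> $ i * F \<xi> \<partial>lborel)"
      proof (rule integral_dominated_convergence[where w = "\<lambda>\<xi>. norm (h \<xi> $ i * F \<xi>)"])
        show "(\<lambda>\<xi>. h \<xi> $ i * F \<xi>) \<in> borel_measurable lborel" using hF by simp
        show "(\<lambda>\<xi>. H N \<xi> $ i * F \<xi>) \<in> borel_measurable lborel" for N using Hii[of N] L2_measurable[OF FL] by measurable
        show "integrable lborel (\<lambda>\<xi>. norm (h \<xi> $ i * F \<xi>))" using hF by (rule integrable_norm)
        show "AE \<xi> in lborel. (\<lambda>N. H N \<xi> $ i * F \<xi>) \<longlonglongrightarrow> h \<xi> $ i * F \<xi>"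
        proof (rule AE_I2)
          fix \<xi> :: "real^'n"
          have "(\<lambda>N. J N \<xi> *\<^sub>R (h \<xi> $ i) * F \<xi>) \<longlonglongrightarrow> 1 *\<^sub>R (h \<xi> $ i) * F \<xi>" by (intro tendsto_intros Jlim)
          then show "(\<lambda>N. H N \<xi> $ i * F \<xi>) \<longlonglongrightarrow> h \<xi> $ i * F \<xi>" by (simp add: H_def)
        qed
        show "AE \<xi> in lborel. norm (H N \<xi> $ i * F \<xi>) \<le> norm (h \<xi> $ i * F \<xi>)" for N
          by (intro AE_I2) (simp add: H_def J_def indicator_def norm_mult)
      qed
      then have "(\<lambda>N. c * Re (\<integral>\<xi>. H N \<xi> $ i * F \<xi> \<partial>lborel)) \<longlonglongrightarrow> c * Re (\<integral>\<xi>. h \<xi> $ i * F \<xi> \<partial>lborel)" by (intro tendsto_intros)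
      moreover have "c * Re (\<integral>\<xi>. h \<xi> $ i * F \<xi> \<partial>lborel) = (\<sigma> *\<^sub>R (\<integral>x. pds js \<phi> x *\<^sub>R f x \<partial>lborel)) $ i"
      proof -
        \<comment> \<open>Derivatives of the test function produce -\<i>\<xi> while the multiplier
          has \<i>\<xi>; the discrepancy is the sign in the definition of a weak derivative.\<close>
        have pneg: "(\<Prod>j\<leftarrow>js. - \<i> * complex_of_real (\<xi> $ j)) = complex_of_real \<sigma> * p \<xi>" for \<xi>
          unfolding \<sigma>_def p_def by (induction js) simp_all
        have s1: "complex_of_real \<sigma> * complex_of_real \<sigma> = 1" using \<sigma> by (metis of_real_1 of_real_mult)
        have "h \<xi> $ i * F \<xi> = complex_of_real \<sigma> * (v \<xi> $ i * ft 1 (cfun (pds js \<phi>)) \<xi>)" for \<xi>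
        proof -
          have "complex_of_real \<sigma> * (v \<xi> $ i * (complex_of_real \<sigma> * p \<xi> * F \<xi>))
              = (complex_of_real \<sigma> * complex_of_real \<sigma>) * (p \<xi> * v \<xi> $ i * F \<xi>)" by (simp only: mult_ac)
          then show ?thesis unfolding ft_test_pds[OF \<phi>] pneg F_def[symmetric] by (simp add: h_def s1)
        qed
        then have "(\<integral>\<xi>. h \<xi> $ i * F \<xi> \<partial>lborel) = complex_of_real \<sigma> * (\<integral>\<xi>. v \<xi> $ i * ft 1 (cfun (pds js \<phi>)) \<xi> \<partial>lborel)"
          by (simp only: integral_mult_right_zero)
        also have "\<dots> = complex_of_real (\<sigma> * ((2 * pi) ^ CARD('n) * (\<integral>x. pds js \<phi> x *\<^sub>R f x \<partial>lborel) $ i))"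
          unfolding parseval_L2_fourier(2)[OF fv test_function_pds[OF \<phi>]] by simp
        finally show ?thesis by (simp add: c_def)
      qed
      ultimately show "(\<lambda>N. (\<integral>x. \<phi> x *\<^sub>R G N x \<partial>lborel) $ i) \<longlonglongrightarrow> (\<sigma> *\<^sub>R (\<integral>x. pds js \<phi> x *\<^sub>R f x \<partial>lborel)) $ i"
        unfolding comp by simp
    qed
    from LIMSEQ_unique[OF lim1 this]
    have "\<sigma> *\<^sub>R (\<integral>x. \<phi> x *\<^sub>R g x \<partial>lborel) = (\<sigma> * \<sigma>) *\<^sub>R (\<integral>x. pds js \<phi> x *\<^sub>R f x \<partial>lborel)" by simp
    then show "(\<integral>x. pds js \<phi> x *\<^sub>R f x \<partial>lborel) = (-1) ^ length js *\<^sub>R (\<integral>x. \<phi> x *\<^sub>R g x \<partial>lborel)"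
      unfolding \<sigma> \<sigma>_def by simp
  qed
  with g show ?thesis using gle unfolding I_def by (rule that)
qed

section \<open>Decay\<close>

text \<open>The expansion of the k-th power of the sum of squares over ordered lists, hence without
  multinomial coefficients. It matches \<open>L2norm_deriv\<close>, which also sums over
  lists.\<close>

lemma sum_lists_prod_sq:
  fixes \<xi> :: "real^'n::finite"
  shows "(\<Sum>js | length js = k. (\<Prod>j\<leftarrow>js. \<xi> $ j)\<^sup>2) = norm \<xi> ^ (2 * k)"
proof (induction k)
  case (Suc k)
  have "bij_betw (\<lambda>(j, js). j # js) (UNIV \<times> {js :: 'n list. length js = k}) {js. length js = Suc k}"
    by (rule bij_betwI[where g = "\<lambda>js. (hd js, tl js)"]) (auto simp: length_Suc_conv)
  then have "(\<Sum>js | length js = Suc k. (\<Prod>j\<leftarrow>js. \<xi> $ j)\<^sup>2) = (\<Sum>(j, js)\<in>UNIV \<times> {js. length js = k}. (\<Prod>j\<leftarrow>j # js. \<xi> $ j)\<^sup>2)"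
    by (subst sum.reindex_bij_betw[symmetric]) (auto simp: case_prod_beta intro!: sum.cong)
  also have "\<dots> = (\<Sum>j\<in>UNIV. \<Sum>js | length js = k. (\<xi> $ j)\<^sup>2 * (\<Prod>j\<leftarrow>js. \<xi> $ j)\<^sup>2)"
    by (subst sum.cartesian_product[symmetric]) (simp add: power_mult_distrib)
  also have "\<dots> = (\<Sum>j\<in>UNIV. (\<xi> $ j)\<^sup>2) * norm \<xi> ^ (2 * k)"
    by (simp add: sum_distrib_left[symmetric] sum_distrib_right[symmetric] Suc)
  also have "(\<Sum>j\<in>UNIV. (\<xi> $ j)\<^sup>2) = (norm \<xi>)\<^sup>2"
    unfolding power2_norm_eq_inner by (simp add: inner_vec_def power2_eq_square)
  finally show ?case by (simp only: mult_Suc_right power_add)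
qed simp

lemma power_le_fact_exp: "(x :: real) \<ge> 0 \<Longrightarrow> x ^ n \<le> fact n * exp x"
proof -
  assume x: "x \<ge> 0"
  have "(\<Sum>k\<in>{n}. x ^ k /\<^sub>R fact k) \<le> (\<Sum>k. x ^ k /\<^sub>R fact k)"
    using x by (intro sum_le_suminf summable_exp_generic) auto
  then show ?thesis by (simp add: exp_def field_simps)
qed

text \<open>For \<open>|\<xi>| \<le> 1\<close> one has \<open>\<eta> \<ge> |\<xi>|\<^sup>2/4\<close> (diffusive decay), for \<open>|\<xi>| \<ge> 1\<close> only \<open>\<eta> \<ge> 1/(4|\<xi>|\<^sup>2)\<close>,
  so that decay has to be bought with derivatives.\<close>

lemma decay_split:
  fixes \<xi> :: "'a::euclidean_space"
  assumes c: "c > 0" and t: "t \<ge> 0"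
  shows "norm \<xi> ^ (2 * k) * exp (- 2 * c * eta \<xi> * t)
    \<le> exp (c / 2) * (norm \<xi> ^ (2 * k) * exp (- c * (norm \<xi>)\<^sup>2 * (1 + t) / 2))
      + exp (c / 2) * fact l * (2 / c) ^ l / (1 + t) ^ l * norm \<xi> ^ (2 * (k + l))"
proof -
  define r where "r = (norm \<xi>)\<^sup>2"
  have r: "r \<ge> 0" by (simp add: r_def)
  have eta: "eta \<xi> = r / (1 + r)\<^sup>2" by (simp add: eta_def r_def)
  have pw: "norm \<xi> ^ (2 * i) = r ^ i" for i by (simp add: r_def power_mult)
  have t1: "(1 + t) ^ l > 0" using t by simp
  have nn1: "0 \<le> exp (c / 2) * (r ^ k * exp (- c * r * (1 + t) / 2))" using r by simp
  have nn2: "0 \<le> exp (c / 2) * fact l * (2 / c) ^ l / (1 + t) ^ l * r ^ (k + l)" using r c t by simp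
  show ?thesis unfolding pw r_def[symmetric] eta
  proof (cases "r \<le> 1")
    case True
    have "(1 + r)\<^sup>2 \<le> 2\<^sup>2" using r True by (intro power_mono) auto
    then have "r / 4 \<le> r / (1 + r)\<^sup>2" using r by (intro divide_left_mono) (auto intro!: mult_pos_pos add_pos_nonneg)
    then have "2 * c * (r / 4) * t \<le> 2 * c * (r / (1 + r)\<^sup>2) * t" using c t by (intro mult_right_mono mult_left_mono) auto
    moreover have "c * r / 2 \<le> c / 2" using True c by simp
    \<comment> \<open>Replacing t by 1 + t costs at most the factor exp(c/2) because r \<le>
      1.\<close>
    moreover have "- c * r * (1 + t) / 2 = - (c * r / 2) - 2 * c * (r / 4) * t" by (simp add: field_simps)
    ultimately have "- 2 * c * (r / (1 + r)\<^sup>2) * t \<le> c / 2 + (- c * r * (1 + t) / 2)" by linarith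
    then have "exp (- 2 * c * (r / (1 + r)\<^sup>2) * t) \<le> exp (c / 2) * exp (- c * r * (1 + t) / 2)"
      unfolding mult_exp_exp by simp
    then have "r ^ k * exp (- 2 * c * (r / (1 + r)\<^sup>2) * t) \<le> r ^ k * (exp (c / 2) * exp (- c * r * (1 + t) / 2))"
      using r by (intro mult_left_mono) auto
    also have "\<dots> = exp (c / 2) * (r ^ k * exp (- c * r * (1 + t) / 2))" by (simp add: mult_ac)
    finally show "r ^ k * exp (- 2 * c * (r / (1 + r)\<^sup>2) * t) \<le> exp (c / 2) * (r ^ k * exp (- c * r * (1 + t) / 2))
      + exp (c / 2) * fact l * (2 / c) ^ l / (1 + t) ^ l * r ^ (k + l)" using nn2 by linarith
  next
    case False
    then have r1: "r > 1" by simp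
    have "(1 + r)\<^sup>2 \<le> (2 * r)\<^sup>2" using r1 by (intro power_mono) auto
    then have "r / (2 * r)\<^sup>2 \<le> r / (1 + r)\<^sup>2" using r1 by (intro divide_left_mono) (auto intro!: mult_pos_pos)
    moreover have "r / (2 * r)\<^sup>2 = 1 / (4 * r)" using r1 by (simp add: power2_eq_square)
    ultimately have "2 * c * (1 / (4 * r)) * t \<le> 2 * c * (r / (1 + r)\<^sup>2) * t" using c t by (intro mult_right_mono mult_left_mono) auto
    \<comment> \<open>The exponent at high frequency, again with t replaced by 1 + t. The bound
      exp(-x) \<le> l!/x^l trades l powers of 1 + t for l powers of r, that is, for l derivatives in
      the norm.\<close>
    moreover define x where "x = c * (1 + t) / (2 * r)"
    moreover have "2 * c * (1 / (4 * r)) * t = x - c / (2 * r)" using r1 by (simp add: x_def field_simps)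
    moreover have "c / (2 * r) \<le> c / 2" using r1 c by (simp add: field_simps)
    ultimately have "- 2 * c * (r / (1 + r)\<^sup>2) * t \<le> c / 2 + (- x)" by linarith
    then have e: "exp (- 2 * c * (r / (1 + r)\<^sup>2) * t) \<le> exp (c / 2) * exp (- x)" unfolding mult_exp_exp by simp
    have x: "x > 0" using c t r1 by (simp add: x_def)
    have "exp (- x) \<le> fact l / x ^ l" using power_le_fact_exp[of x l] x by (simp add: exp_minus field_simps)
    also have "\<dots> = fact l * (2 / c) ^ l / (1 + t) ^ l * r ^ l"
      using c t t1 r1 unfolding x_def power_divide power_mult_distrib by (simp add: field_simps)
    finally have "exp (c / 2) * exp (- x) \<le> exp (c / 2) * (fact l * (2 / c) ^ l / (1 + t) ^ l * r ^ l)" by (rule mult_left_mono) simp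
    with e have "exp (- 2 * c * (r / (1 + r)\<^sup>2) * t) \<le> exp (c / 2) * (fact l * (2 / c) ^ l / (1 + t) ^ l * r ^ l)" by linarith
    then have "r ^ k * exp (- 2 * c * (r / (1 + r)\<^sup>2) * t) \<le> r ^ k * (exp (c / 2) * (fact l * (2 / c) ^ l / (1 + t) ^ l * r ^ l))"
      using r by (intro mult_left_mono) auto
    also have "\<dots> = exp (c / 2) * fact l * (2 / c) ^ l / (1 + t) ^ l * r ^ (k + l)" by (simp add: power_add mult_ac)
    finally show "r ^ k * exp (- 2 * c * (r / (1 + r)\<^sup>2) * t) \<le> exp (c / 2) * (r ^ k * exp (- c * r * (1 + t) / 2))
      + exp (c / 2) * fact l * (2 / c) ^ l / (1 + t) ^ l * r ^ (k + l)" using nn1 by linarith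
  qed
qed

text \<open>The substitution \<xi> = z / sqrt(1 + t) extracts the whole time dependence, and
  \<open>J\<close> is the moment that remains at t = 0. It is finite because the power of |z| is
  absorbed by half of the exponent.\<close>

lemma gaussian_moment:
  assumes c: "c > 0"
  obtains J where "J \<ge> 0" "\<And>t. t \<ge> 0 \<Longrightarrow> (\<integral>\<^sup>+\<xi>. ennreal (norm (\<xi> :: 'a::euclidean_space) ^ (2 * k) * exp (- c * (norm \<xi>)\<^sup>2 * (1 + t) / 2)) \<partial>lborel)
     = ennreal ((1 + t) powr (- real DIM('a) / 2 - real k) * J)"
proof -
  define F where "F z = ennreal (norm (z :: 'a) ^ (2 * k) * exp (- c * (norm z)\<^sup>2 / 2))" for z
  have "(\<integral>\<^sup>+z. F z \<partial>lborel) \<le> (\<integral>\<^sup>+z. ennreal (fact k * (4 / c) ^ k) * ennreal (gaussian (sqrt (c / 2) *\<^sub>R (z :: 'a))) \<partial>lborel)"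
  proof (rule nn_integral_mono)
    fix z :: 'a
    define y where "y = c * (norm z)\<^sup>2 / 4"
    have y: "y \<ge> 0" using c by (simp add: y_def)
    have "norm z ^ (2 * k) = (4 / c) ^ k * y ^ k" using c by (simp add: y_def power_mult power_divide power_mult_distrib)
    also have "\<dots> \<le> (4 / c) ^ k * (fact k * exp y)" using c power_le_fact_exp[OF y] by (intro mult_left_mono) auto
    finally have "norm z ^ (2 * k) * exp (- c * (norm z)\<^sup>2 / 2) \<le> (4 / c) ^ k * (fact k * exp y) * exp (- c * (norm z)\<^sup>2 / 2)"
      by (rule mult_right_mono) simp
    also have "\<dots> = fact k * (4 / c) ^ k * (exp y * exp (- c * (norm z)\<^sup>2 / 2))" by (simp only: mult_ac)
    also have "exp y * exp (- c * (norm z)\<^sup>2 / 2) = gaussian (sqrt (c / 2) *\<^sub>R z)"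
      using c unfolding mult_exp_exp gaussian_def y_def by (simp add: power_mult_distrib field_simps)
    finally show "F z \<le> ennreal (fact k * (4 / c) ^ k) * ennreal (gaussian (sqrt (c / 2) *\<^sub>R z))"
      unfolding F_def using c by (subst ennreal_mult[symmetric]) (auto intro: ennreal_leI)
  qed
  also have "\<dots> = ennreal (fact k * (4 / c) ^ k) * (\<integral>\<^sup>+z. ennreal (gaussian (sqrt (c / 2) *\<^sub>R (z :: 'a))) \<partial>lborel)"
    by (rule nn_integral_cmult) measurable
  also have "\<dots> < \<infinity>"
  proof -
    have "integrable lborel (\<lambda>z :: 'a. gaussian (sqrt (c / 2) *\<^sub>R z))" by (rule gaussian_scale_integrable) (use c in simp)
    then have "(\<integral>\<^sup>+z. ennreal (gaussian (sqrt (c / 2) *\<^sub>R (z :: 'a))) \<partial>lborel) < \<infinity>"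
      unfolding integrable_iff_bounded by simp
    then show ?thesis by (simp add: ennreal_mult_less_top)
  qed
  finally have fin: "(\<integral>\<^sup>+z. F z \<partial>lborel) < \<infinity>" .
  define J where "J = enn2real (\<integral>\<^sup>+z. F z \<partial>lborel)"
  have J: "(\<integral>\<^sup>+z. F z \<partial>lborel) = ennreal J" using fin by (simp add: J_def)
  show ?thesis
  proof (rule that[of J])
    show "J \<ge> 0" by (simp add: J_def)
    fix t :: real assume t: "t \<ge> 0"
    define \<tau> where "\<tau> = 1 / sqrt (1 + t)"
    have \<tau>: "\<tau> > 0" "\<tau>\<^sup>2 = 1 / (1 + t)" using t by (simp_all add: \<tau>_def power_divide)
    define f where "f \<xi> = ennreal (norm (\<xi> :: 'a) ^ (2 * k) * exp (- c * (norm \<xi>)\<^sup>2 * (1 + t) / 2))" for \<xi>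
    have [measurable]: "F \<in> borel_measurable borel" "f \<in> borel_measurable borel" unfolding F_def[abs_def] f_def[abs_def] by measurable
    have sc: "f (0 + \<tau> *\<^sub>R z) = ennreal ((\<tau>\<^sup>2) ^ k) * F z" for z
    proof -
      have "norm (\<tau> *\<^sub>R z) ^ (2 * k) = (\<tau>\<^sup>2) ^ k * norm z ^ (2 * k)" using \<tau>(1) by (simp add: power_mult_distrib power_mult)
      moreover have "- c * (norm (\<tau> *\<^sub>R z))\<^sup>2 * (1 + t) / 2 = - c * (norm z)\<^sup>2 / 2"
        using \<tau>(1) t by (simp add: power_mult_distrib \<tau>(2))
      ultimately have "f (0 + \<tau> *\<^sub>R z) = ennreal ((\<tau>\<^sup>2) ^ k * (norm z ^ (2 * k) * exp (- c * (norm z)\<^sup>2 / 2)))"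
        unfolding f_def add_0 by (simp only: mult.assoc)
      then show ?thesis unfolding F_def by (subst ennreal_mult[symmetric]) simp_all
    qed
    have "(\<integral>\<^sup>+\<xi>. f \<xi> \<partial>lborel) = ennreal (\<bar>\<tau>\<bar> ^ DIM('a)) * (\<integral>\<^sup>+z. f (0 + \<tau> *\<^sub>R z) \<partial>lborel)"
      by (rule nn_integral_affine) (use \<tau> in auto)
    also have "\<dots> = ennreal (\<tau> ^ DIM('a)) * (ennreal ((\<tau>\<^sup>2) ^ k) * ennreal J)"
      unfolding sc using \<tau>(1) by (simp add: nn_integral_cmult J)
    also have "\<dots> = ennreal (\<tau> ^ DIM('a) * (\<tau>\<^sup>2) ^ k * J)" using \<tau>(1) by (simp add: ennreal_mult mult.assoc J_def)
    also have "\<tau> ^ DIM('a) * (\<tau>\<^sup>2) ^ k = (1 + t) powr (- real DIM('a) / 2 - real k)"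
    proof -
      have t1: "1 + t > 0" using t by simp
      have "\<tau> = (1 + t) powr (- 1 / 2)" using t1 by (simp add: \<tau>_def powr_half_sqrt[symmetric] powr_minus_divide)
      then have "\<tau> ^ i = (1 + t) powr (- real i / 2)" for i using t1 by (simp add: powr_power)
      then have "\<tau> ^ (DIM('a) + 2 * k) = (1 + t) powr (- real (DIM('a) + 2 * k) / 2)" .
      then show ?thesis by (simp add: power_add power_mult diff_divide_distrib add_divide_distrib)
    qed
    finally show "(\<integral>\<^sup>+\<xi>. ennreal (norm (\<xi> :: 'a) ^ (2 * k) * exp (- c * (norm \<xi>)\<^sup>2 * (1 + t) / 2)) \<partial>lborel)
     = ennreal ((1 + t) powr (- real DIM('a) / 2 - real k) * J)" by (simp add: f_def)
  qed
qed

text \<open>Low frequencies see the initial data only through this sup bound, which brings in the L1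
  norm. The factor 2 is the price for splitting real and imaginary parts.\<close>

lemma fourier_le_L1norm:
  fixes f :: "real^'n::finite \<Rightarrow> real^'m"
  assumes f: "integrable lborel f"
  shows "norm (fourier f \<xi>) \<le> 2 * L1norm f"
proof -
  have i: "integrable lborel (\<lambda>x. (1::real) *\<^sub>R f x)" using f by simp
  have b: "norm (\<integral>x. (1 * cos (x \<bullet> \<xi> + \<theta>)) *\<^sub>R f x \<partial>lborel) \<le> L1norm f" for \<theta>
  proof -
    have "norm (\<integral>x. (1 * cos (x \<bullet> \<xi> + \<theta>)) *\<^sub>R f x \<partial>lborel) \<le> (\<integral>x. norm ((1 * cos (x \<bullet> \<xi> + \<theta>)) *\<^sub>R f x) \<partial>lborel)"
      by (rule Bochner_Integration.integral_norm_bound)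
    also have "\<dots> \<le> (\<integral>x. norm (f x) \<partial>lborel)"
    proof (rule Bochner_Integration.integral_mono)
      show "integrable lborel (\<lambda>x. norm ((1 * cos (x \<bullet> \<xi> + \<theta>)) *\<^sub>R f x))" by (rule integrable_norm[OF cos_mult_integrable[OF i]])
      show "integrable lborel (\<lambda>x. norm (f x))" using f by simp
      show "norm ((1 * cos (x \<bullet> \<xi> + \<theta>)) *\<^sub>R f x) \<le> norm (f x)" for x by (simp add: mult_left_le_one_le)
    qed
    finally show ?thesis by (simp add: L1norm_def)
  qed
  have "norm (fourier (\<lambda>x. (1::real) *\<^sub>R f x) \<xi>) \<le> L1norm f + L1norm f"
    unfolding fourier_cos_decomposition[OF i]
    by (rule order_trans[OF norm_triangle_ineq]) (rule add_mono, simp only: norm_cvec b, simp only: norm_mulI norm_cvec b)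
  then show ?thesis by simp
qed

section \<open>Norms of derivatives as moments in frequency\<close>

lemma nn_integral_norm_power_eq_sum:
  fixes v :: "real^'n::finite \<Rightarrow> complex^'m"
  assumes v: "v \<in> borel_measurable lborel"
  shows "(\<integral>\<^sup>+\<xi>. ennreal (norm \<xi> ^ (2 * k) * (norm (v \<xi>))\<^sup>2) \<partial>lborel)
    = (\<Sum>js | length js = k. \<integral>\<^sup>+\<xi>. ennreal ((\<Prod>j\<leftarrow>js. \<xi> $ j)\<^sup>2 * (norm (v \<xi>))\<^sup>2) \<partial>lborel)"
proof -
  note v[measurable] borel_measurable_prod_list_nth[measurable]
  have "(\<integral>\<^sup>+\<xi>. ennreal (norm \<xi> ^ (2 * k) * (norm (v \<xi>))\<^sup>2) \<partial>lborel)
      = (\<integral>\<^sup>+\<xi>. (\<Sum>js | length js = k. ennreal ((\<Prod>j\<leftarrow>js. \<xi> $ j)\<^sup>2 * (norm (v \<xi>))\<^sup>2)) \<partial>lborel)"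
    by (subst sum_ennreal) (simp_all add: sum_lists_prod_sq flip: sum_distrib_right)
  also have "\<dots> = (\<Sum>js | length js = k. \<integral>\<^sup>+\<xi>. ennreal ((\<Prod>j\<leftarrow>js. \<xi> $ j)\<^sup>2 * (norm (v \<xi>))\<^sup>2) \<partial>lborel)"
    by (rule nn_integral_sum) measurable
  finally show ?thesis .
qed

lemma L2norm_deriv_sq:
  fixes f :: "real^'n::finite \<Rightarrow> real^'m"
  assumes "\<And>js. length js = k \<Longrightarrow> \<exists>g. L2 g \<and> has_weak_pds js f g"
  shows "ennreal ((L2norm_deriv k f)\<^sup>2) = (\<Sum>js | length js = k. nsq (weak_pds js f))"
proof -
  have L: "L2 (weak_pds js f)" if js: "length js = k" for js
    using assms[OF js] nsq_weak_pds(1)[of _ js f] by blast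
  have "(L2norm_deriv k f)\<^sup>2 = (\<Sum>js | length js = k. (L2norm (weak_pds js f))\<^sup>2)"
    unfolding L2norm_deriv_def by (rule real_sqrt_pow2) (simp add: sum_nonneg)
  then have "ennreal ((L2norm_deriv k f)\<^sup>2) = (\<Sum>js | length js = k. ennreal ((L2norm (weak_pds js f))\<^sup>2))"
    by (simp only: sum_ennreal zero_le_power2)
  also have "\<dots> = (\<Sum>js | length js = k. nsq (weak_pds js f))"
    by (intro sum.cong refl nsq_eq_L2norm[symmetric] L) simp
  finally show ?thesis .
qed

lemma L2norm_deriv_nonneg: "0 \<le> L2norm_deriv k f"
  by (simp add: L2norm_deriv_def sum_nonneg)

lemma fourier_moment_le_L2norm_deriv:
  fixes u0 :: "real^'n::finite \<Rightarrow> real^'m"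
  assumes H: "Hs s u0" and u0: "integrable lborel u0" and k: "k \<le> s"
  shows "(\<integral>\<^sup>+\<xi>. ennreal (norm \<xi> ^ (2 * k) * (norm (fourier u0 \<xi>))\<^sup>2) \<partial>lborel)
    \<le> ennreal ((2 * pi) ^ CARD('n) * (L2norm_deriv k u0)\<^sup>2)"
proof -
  have ex: "\<exists>g. L2 g \<and> has_weak_pds js u0 g" if "length js = k" for js
    using H k that by (simp add: Hs_def)
  have sq: "ennreal ((L2norm_deriv k u0)\<^sup>2) = (\<Sum>js | length js = k. nsq (weak_pds js u0))"
    by (rule L2norm_deriv_sq, rule ex)
  have "(\<integral>\<^sup>+\<xi>. ennreal (norm \<xi> ^ (2 * k) * (norm (fourier u0 \<xi>))\<^sup>2) \<partial>lborel)
      = (\<Sum>js | length js = k. \<integral>\<^sup>+\<xi>. ennreal ((\<Prod>j\<leftarrow>js. \<xi> $ j)\<^sup>2 * (norm (fourier u0 \<xi>))\<^sup>2) \<partial>lborel)"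
    by (rule nn_integral_norm_power_eq_sum[OF fourier_measurable[OF u0]])
  also have "\<dots> \<le> (\<Sum>js | length js = k. ennreal ((2 * pi) ^ CARD('n)) * nsq (weak_pds js u0))"
  proof (rule sum_mono)
    fix js :: "'n list" assume "js \<in> {js. length js = k}"
    then obtain g where "L2 g" "has_weak_pds js u0 g" using ex[of js] by auto
    from nsq_weak_pds(1,2)[OF this]
    show "(\<integral>\<^sup>+\<xi>. ennreal ((\<Prod>j\<leftarrow>js. \<xi> $ j)\<^sup>2 * (norm (fourier u0 \<xi>))\<^sup>2) \<partial>lborel) \<le> ennreal ((2 * pi) ^ CARD('n)) * nsq (weak_pds js u0)"
      by (rule weak_pds_fourier_le[OF u0])
  qed
  also have "\<dots> = ennreal ((2 * pi) ^ CARD('n)) * ennreal ((L2norm_deriv k u0)\<^sup>2)"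
    unfolding sq by (rule sum_distrib_left[symmetric])
  also have "\<dots> = ennreal ((2 * pi) ^ CARD('n) * (L2norm_deriv k u0)\<^sup>2)"
    by (rule ennreal_mult[symmetric]) simp_all
  finally show ?thesis .
qed

text \<open>The moment of order 2k dominates the integral belonging to each list of length k, so
  finiteness produces all these weak derivatives; only then does \<open>L2norm_deriv\<close> measure
  actual derivatives and not an arbitrary choice.\<close>

lemma L2norm_deriv_le_fourier_moment:
  fixes f :: "real^'n::finite \<Rightarrow> real^'m"
  assumes fv: "has_L2_fourier f v"
    and fin: "(\<integral>\<^sup>+\<xi>. ennreal (norm \<xi> ^ (2 * k) * (norm (v \<xi>))\<^sup>2) \<partial>lborel) < \<infinity>"
  shows "length js = k \<Longrightarrow> \<exists>g. L2 g \<and> has_weak_pds js f g"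
    and "ennreal ((L2norm_deriv k f)\<^sup>2) \<le> 2 * (\<integral>\<^sup>+\<xi>. ennreal (norm \<xi> ^ (2 * k) * (norm (v \<xi>))\<^sup>2) \<partial>lborel)"
proof -
  define I where "I js = (\<integral>\<^sup>+\<xi>. ennreal ((\<Prod>j\<leftarrow>js. \<xi> $ j)\<^sup>2 * (norm (v \<xi>))\<^sup>2) \<partial>lborel)" for js
  have vm: "v \<in> borel_measurable lborel" using fv L2_measurable[of v] by (simp add: has_L2_fourier_def)
  have sum: "(\<integral>\<^sup>+\<xi>. ennreal (norm \<xi> ^ (2 * k) * (norm (v \<xi>))\<^sup>2) \<partial>lborel) = (\<Sum>js | length js = k. I js)"
    unfolding I_def by (rule nn_integral_norm_power_eq_sum[OF vm])
  have finite: "finite {js :: 'n list. length js = k}"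
    using finite_lists_length_eq[of "UNIV :: 'n set" k] by simp
  have ex: "\<exists>g. L2 g \<and> has_weak_pds js f g \<and> nsq g \<le> 2 * I js" if js: "length js = k" for js
  proof -
    have "I js \<le> (\<Sum>js | length js = k. I js)" using js by (intro member_le_sum finite) auto
    also have "\<dots> < \<infinity>" using fin unfolding sum .
    finally have "(\<integral>\<^sup>+\<xi>. ennreal ((\<Prod>j\<leftarrow>js. \<xi> $ j)\<^sup>2 * (norm (v \<xi>))\<^sup>2) \<partial>lborel) < \<infinity>" unfolding I_def .
    from weak_pds_exists_of_fourier[OF fv this] obtain g where "L2 g" "has_weak_pds js f g" "nsq g \<le> 2 * I js"
      unfolding I_def .
    then show ?thesis by (intro exI[of _ g] conjI)
  qed
  show "length js = k \<Longrightarrow> \<exists>g. L2 g \<and> has_weak_pds js f g" using ex by blast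
  have sq: "ennreal ((L2norm_deriv k f)\<^sup>2) = (\<Sum>js | length js = k. nsq (weak_pds js f))"
    by (rule L2norm_deriv_sq) (use ex in blast)
  have "nsq (weak_pds js f) \<le> 2 * I js" if js: "length js = k" for js
  proof -
    from ex[OF js] obtain g where g: "L2 g" "has_weak_pds js f g" "nsq g \<le> 2 * I js" by blast
    show ?thesis unfolding nsq_weak_pds(3)[OF g(1,2)] by (rule g(3))
  qed
  then have "(\<Sum>js | length js = k. nsq (weak_pds js f)) \<le> (\<Sum>js | length js = k. 2 * I js)" by (intro sum_mono) simp
  then show "ennreal ((L2norm_deriv k f)\<^sup>2) \<le> 2 * (\<integral>\<^sup>+\<xi>. ennreal (norm \<xi> ^ (2 * k) * (norm (v \<xi>))\<^sup>2) \<partial>lborel)"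
    unfolding sq sum sum_distrib_left .
qed

text \<open>After squaring, the low-frequency part of \<open>decay_split\<close> is paired with the
  sup bound of the transform and the Gaussian moment, the other part with the moment of order k + l
  of the initial data.\<close>

lemma L2norm_deriv_decay:
  fixes u0 f :: "real^'n::finite \<Rightarrow> real^'m"
  assumes H: "Hs s u0" and u0: "integrable lborel u0" and fv: "has_L2_fourier f v"
    and c: "c > 0" and C: "C \<ge> 0" and t: "t \<ge> 0"
    and vb: "\<And>\<xi>. norm (v \<xi>) \<le> C * exp (- c * eta \<xi> * t) * norm (fourier u0 \<xi>)"
    and kl: "k + l \<le> s"
    and J: "J \<ge> 0" "(\<integral>\<^sup>+\<xi>. ennreal (norm (\<xi> :: real^'n) ^ (2 * k) * exp (- c * (norm \<xi>)\<^sup>2 * (1 + t) / 2)) \<partial>lborel)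
     = ennreal ((1 + t) powr (- real CARD('n) / 2 - real k) * J)"
  shows "L2norm_deriv k f \<le> sqrt (8 * C\<^sup>2 * exp (c / 2) * J) * (1 + t) powr (- real CARD('n) / 4 - real k / 2) * L1norm u0
    + sqrt (2 * C\<^sup>2 * exp (c / 2) * fact l * (2 / c) ^ l * (2 * pi) ^ CARD('n)) * (1 + t) powr (- real l / 2) * L2norm_deriv (k + l) u0"
proof -
  have vm[measurable]: "v \<in> borel_measurable lborel" using fv L2_measurable[of v] by (simp add: has_L2_fourier_def)
  note fourier_measurable[OF u0, measurable]
  \<comment> \<open>The square of the sup bound contributes 4; together with the 2 from the bound on
    weak derivatives this explains the 8 in the final constant.\<close>
  define K1 where "K1 = C\<^sup>2 * exp (c / 2) * (2 * L1norm u0)\<^sup>2"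
  define K2 where "K2 = C\<^sup>2 * (exp (c / 2) * fact l * (2 / c) ^ l / (1 + t) ^ l)"
  define p where "p = (1 + t) powr (- real CARD('n) / 2 - real k) * J"
  define q where "q = (2 * pi) ^ CARD('n) * (L2norm_deriv (k + l) u0)\<^sup>2"
  have K: "K1 \<ge> 0" "K2 \<ge> 0" using c t by (simp_all add: K1_def K2_def)
  have pq: "p \<ge> 0" "q \<ge> 0" using J(1) by (simp_all add: p_def q_def)
  have L1: "L1norm u0 \<ge> 0" by (simp add: L1norm_def)
  have "(\<integral>\<^sup>+\<xi>. ennreal (norm \<xi> ^ (2 * k) * (norm (v \<xi>))\<^sup>2) \<partial>lborel)
     \<le> (\<integral>\<^sup>+\<xi>. ennreal K1 * ennreal (norm (\<xi> :: real^'n) ^ (2 * k) * exp (- c * (norm \<xi>)\<^sup>2 * (1 + t) / 2))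
        + ennreal K2 * ennreal (norm \<xi> ^ (2 * (k + l)) * (norm (fourier u0 \<xi>))\<^sup>2) \<partial>lborel)"
  proof (rule nn_integral_mono)
    fix \<xi> :: "real^'n"
    define F where "F = (norm (fourier u0 \<xi>))\<^sup>2"
    define a where "a = norm \<xi> ^ (2 * k) * exp (- c * (norm \<xi>)\<^sup>2 * (1 + t) / 2)"
    define b where "b = norm \<xi> ^ (2 * (k + l))"
    define d where "d = exp (c / 2) * fact l * (2 / c) ^ l / (1 + t) ^ l"
    have K2d: "K2 = C\<^sup>2 * d" by (simp only: K2_def d_def)
    have nn: "F \<ge> 0" "a \<ge> 0" "b \<ge> 0" "d \<ge> 0" using c t by (simp_all add: F_def a_def b_def d_def)
    have F: "F \<le> (2 * L1norm u0)\<^sup>2" unfolding F_def by (intro power_mono fourier_le_L1norm[OF u0]) simp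
    have "(norm (v \<xi>))\<^sup>2 \<le> (C * exp (- c * eta \<xi> * t) * norm (fourier u0 \<xi>))\<^sup>2" by (intro power_mono vb) simp
    also have "\<dots> = C\<^sup>2 * F * exp (- 2 * c * eta \<xi> * t)"
      by (simp add: F_def power_mult_distrib exp_double[symmetric] algebra_simps)
    finally have "norm \<xi> ^ (2 * k) * (norm (v \<xi>))\<^sup>2 \<le> norm \<xi> ^ (2 * k) * (C\<^sup>2 * F * exp (- 2 * c * eta \<xi> * t))"
      by (rule mult_left_mono) simp
    also have "\<dots> = C\<^sup>2 * F * (norm \<xi> ^ (2 * k) * exp (- 2 * c * eta \<xi> * t))" by (simp only: mult_ac)
    also have "\<dots> \<le> C\<^sup>2 * F * (exp (c / 2) * a + d * b)"
      unfolding a_def b_def d_def by (intro mult_left_mono decay_split c t) (use nn in simp)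
    also have "\<dots> = C\<^sup>2 * exp (c / 2) * a * F + K2 * (b * F)" unfolding K2d by (simp add: algebra_simps)
    also have "\<dots> \<le> C\<^sup>2 * exp (c / 2) * a * (2 * L1norm u0)\<^sup>2 + K2 * (b * F)"
      using nn F by (intro add_right_mono mult_left_mono) auto
    also have "\<dots> = K1 * a + K2 * (b * F)" by (simp add: K1_def mult_ac)
    finally have "ennreal (norm \<xi> ^ (2 * k) * (norm (v \<xi>))\<^sup>2) \<le> ennreal (K1 * a + K2 * (b * F))" by (rule ennreal_leI)
    also have "\<dots> = ennreal K1 * ennreal a + ennreal K2 * ennreal (b * F)"
      using K nn by (simp add: ennreal_plus ennreal_mult)
    finally show "ennreal (norm \<xi> ^ (2 * k) * (norm (v \<xi>))\<^sup>2) \<le> ennreal K1 * ennreal (norm \<xi> ^ (2 * k) * exp (- c * (norm \<xi>)\<^sup>2 * (1 + t) / 2))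
        + ennreal K2 * ennreal (norm \<xi> ^ (2 * (k + l)) * (norm (fourier u0 \<xi>))\<^sup>2)" unfolding a_def b_def F_def .
  qed
  also have "\<dots> = ennreal K1 * ennreal p + ennreal K2 * (\<integral>\<^sup>+\<xi>. ennreal (norm \<xi> ^ (2 * (k + l)) * (norm (fourier u0 \<xi>))\<^sup>2) \<partial>lborel)"
    unfolding p_def J(2)[symmetric] by (subst nn_integral_add; (subst nn_integral_cmult)?) (measurable, simp add: nn_integral_cmult)
  also have "\<dots> \<le> ennreal K1 * ennreal p + ennreal K2 * ennreal q"
    unfolding q_def by (intro add_left_mono mult_left_mono fourier_moment_le_L2norm_deriv[OF H u0 kl]) simp_all
  also have "\<dots> = ennreal (K1 * p + K2 * q)" using K pq by (simp add: ennreal_plus ennreal_mult)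
  finally have le: "(\<integral>\<^sup>+\<xi>. ennreal (norm \<xi> ^ (2 * k) * (norm (v \<xi>))\<^sup>2) \<partial>lborel) \<le> ennreal (K1 * p + K2 * q)" .
  then have "(\<integral>\<^sup>+\<xi>. ennreal (norm \<xi> ^ (2 * k) * (norm (v \<xi>))\<^sup>2) \<partial>lborel) < \<infinity>" by (rule le_less_trans) simp
  from L2norm_deriv_le_fourier_moment(2)[OF fv this]
  have "ennreal ((L2norm_deriv k f)\<^sup>2) \<le> 2 * (\<integral>\<^sup>+\<xi>. ennreal (norm \<xi> ^ (2 * k) * (norm (v \<xi>))\<^sup>2) \<partial>lborel)" .
  also have "\<dots> \<le> 2 * ennreal (K1 * p + K2 * q)" by (intro mult_left_mono le) simp
  also have "\<dots> = ennreal (2 * (K1 * p + K2 * q))" by (subst ennreal_mult) (use K pq in auto)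
  finally have sq: "(L2norm_deriv k f)\<^sup>2 \<le> 2 * (K1 * p + K2 * q)" using K pq by (subst (asm) ennreal_le_iff) auto
  define P where "P = (1 + t) powr (- real CARD('n) / 4 - real k / 2)"
  define R where "R = (1 + t) powr (- real l / 2)"
  define \<alpha> where "\<alpha> = sqrt (8 * C\<^sup>2 * exp (c / 2) * J)"
  define \<beta> where "\<beta> = sqrt (2 * C\<^sup>2 * exp (c / 2) * fact l * (2 / c) ^ l * (2 * pi) ^ CARD('n))"
  have t1: "1 + t > 0" using t by simp
  have P2: "P\<^sup>2 = (1 + t) powr (- real CARD('n) / 2 - real k)"
    unfolding P_def power2_eq_square powr_add[symmetric] by (rule arg_cong[where f = "(powr) (1 + t)"]) simp
  have R2: "R\<^sup>2 = 1 / (1 + t) ^ l"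
    unfolding R_def power2_eq_square powr_add[symmetric] using t1 by (simp add: powr_minus_divide powr_realpow)
  have \<alpha>2: "\<alpha>\<^sup>2 = 8 * C\<^sup>2 * exp (c / 2) * J" unfolding \<alpha>_def by (rule real_sqrt_pow2) (use J(1) in simp)
  have \<beta>2: "\<beta>\<^sup>2 = 2 * C\<^sup>2 * exp (c / 2) * fact l * (2 / c) ^ l * (2 * pi) ^ CARD('n)" unfolding \<beta>_def by (rule real_sqrt_pow2) (use c in simp)
  define X where "X = \<alpha> * P * L1norm u0"
  define Y where "Y = \<beta> * R * L2norm_deriv (k + l) u0"
  have XY: "X \<ge> 0" "Y \<ge> 0"
    using L1 J(1) c L2norm_deriv_nonneg[of "k + l" u0] by (auto simp: X_def Y_def \<alpha>_def \<beta>_def P_def R_def)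
  have "2 * (K1 * p) = X\<^sup>2" unfolding X_def power_mult_distrib \<alpha>2 P2 K1_def p_def by (simp add: power_mult_distrib)
  moreover have "2 * (K2 * q) = Y\<^sup>2" unfolding Y_def power_mult_distrib \<beta>2 R2 K2_def q_def by simp
  \<comment> \<open>Separates the two contributions after taking the root.\<close>
  moreover have "X\<^sup>2 + Y\<^sup>2 \<le> (X + Y)\<^sup>2" using XY by (simp add: power2_sum)
  ultimately have "(L2norm_deriv k f)\<^sup>2 \<le> (X + Y)\<^sup>2" using sq[unfolded distrib_left] by linarith
  then have "L2norm_deriv k f \<le> X + Y" by (rule power2_le_imp_le) (use XY in simp)
  then show ?thesis unfolding X_def Y_def \<alpha>_def \<beta>_def P_def R_def .
qed

text \<open>A bounded frequency factor preserves Sobolev regularity. It guarantees that the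
  derivative norms of the solution in the decay estimate refer to existing derivatives.\<close>

lemma Hs_of_fourier_le:
  fixes u0 f :: "real^'n::finite \<Rightarrow> real^'m"
  assumes H: "Hs s u0" and u0: "integrable lborel u0" and fv: "has_L2_fourier f v"
    and vb: "\<And>\<xi>. norm (v \<xi>) \<le> C * norm (fourier u0 \<xi>)"
  shows "Hs s f"
  unfolding Hs_def
proof (intro conjI allI impI)
  show "L2 f" using fv by (simp add: has_L2_fourier_def)
  fix js :: "'n list" assume js: "length js \<le> s"
  define k where "k = length js"
  note fourier_measurable[OF u0, measurable]
  have "(\<integral>\<^sup>+\<xi>. ennreal (norm \<xi> ^ (2 * k) * (norm (v \<xi>))\<^sup>2) \<partial>lborel)
      \<le> (\<integral>\<^sup>+\<xi>. ennreal (C\<^sup>2) * ennreal (norm \<xi> ^ (2 * k) * (norm (fourier u0 \<xi>))\<^sup>2) \<partial>lborel)"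
  proof (rule nn_integral_mono)
    fix \<xi> :: "real^'n"
    have "(norm (v \<xi>))\<^sup>2 \<le> (C * norm (fourier u0 \<xi>))\<^sup>2" by (intro power_mono vb) simp
    then have "norm \<xi> ^ (2 * k) * (norm (v \<xi>))\<^sup>2 \<le> norm \<xi> ^ (2 * k) * (C * norm (fourier u0 \<xi>))\<^sup>2" by (rule mult_left_mono) simp
    also have "\<dots> = C\<^sup>2 * (norm \<xi> ^ (2 * k) * (norm (fourier u0 \<xi>))\<^sup>2)" by (simp only: power_mult_distrib mult_ac)
    finally show "ennreal (norm \<xi> ^ (2 * k) * (norm (v \<xi>))\<^sup>2) \<le> ennreal (C\<^sup>2) * ennreal (norm \<xi> ^ (2 * k) * (norm (fourier u0 \<xi>))\<^sup>2)"
      by (subst ennreal_mult[symmetric]) (auto intro: ennreal_leI)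
  qed
  also have "\<dots> = ennreal (C\<^sup>2) * (\<integral>\<^sup>+\<xi>. ennreal (norm \<xi> ^ (2 * k) * (norm (fourier u0 \<xi>))\<^sup>2) \<partial>lborel)"
    by (rule nn_integral_cmult) measurable
  also have "\<dots> \<le> ennreal (C\<^sup>2) * ennreal ((2 * pi) ^ CARD('n) * (L2norm_deriv k u0)\<^sup>2)"
    by (intro mult_left_mono fourier_moment_le_L2norm_deriv[OF H u0]) (use js in \<open>simp_all add: k_def\<close>)
  also have "\<dots> < \<infinity>" by (simp add: ennreal_mult_less_top)
  finally show "\<exists>g. L2 g \<and> has_weak_pds js f g"
    by (rule L2norm_deriv_le_fourier_moment(1)[OF fv]) (simp add: k_def)
qed

section \<open>The flow as transform of the solution, and the choice of uniform constants\<close>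

lemma imult_smult_eq_mulI: "(\<i> * complex_of_real r) *s z = r *\<^sub>R mulI z"
  unfolding mulI_def vec_eq_iff vector_scaleR_component vector_smult_component
  by (simp add: scaleR_conv_of_real mult_ac)

lemma fourier_solution_fsol:
  fixes A :: "'n::finite \<Rightarrow> real^'m^'m"
  assumes cA: "cond_A A0 A L" and cs: "cauchy_solution A0 A L u0 u" and u0: "integrable lborel u0" "L2 u0"
  shows "fourier_solution A0 A L u0 u (fsol A0 A L u0)"
  unfolding fourier_solution_def
proof (intro conjI allI impI)
  fix t :: real and \<xi> :: "real^'n" assume t: "t \<ge> 0"
  show "has_L2_fourier (u t) (fsol A0 A L u0 t)"
    by (rule has_L2_fourier_cutI[OF cauchy_solution_L2[OF cs t] fsol_measurable[OF u0(1)] fourier_cut_solution_tendsto[OF cA cs u0 t]])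
  have pos: "pos_on (cmat A0) UNIV" using cA by (simp add: cond_A_def)
  show "\<exists>w. ((\<lambda>\<tau>. fsol A0 A L u0 \<tau> \<xi>) has_vector_derivative w) (at t within {0..}) \<and>
        cmat A0 *v w + (\<i> * complex_of_real (norm \<xi>)) *s (cmat (symbol A (sgn \<xi>)) *v fsol A0 A L u0 t \<xi>)
          + cmat L *v fsol A0 A L u0 t \<xi> = 0"
    by (intro exI conjI, rule fsol_has_vector_derivative)
      (simp add: A0_generator[OF pos] imult_smult_eq_mulI scaleR_mulI_symbol)
qed (simp add: fsol_def)

lemma fsol_constraint:
  fixes Q :: "'n::finite \<Rightarrow> real^'m^'p"
  assumes "cond_C A0 A L Q R" "constraint Q R u0" "integrable lborel u0" "L2 u0"
  shows "mulI (cmat (symbol Q \<xi>) *v fsol A0 A L u0 t \<xi>) + cmat R *v fsol A0 A L u0 t \<xi> = 0"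
  unfolding fsol_def by (rule flow_constraint[OF assms(1) constraint_fourier[OF assms(2-4)]])

text \<open>The curve is the flow through the transform of \<open>u0\<close>, and the constraint at
  time 0 persists for each \<xi>. The constants are fixed before \<open>u0\<close> and \<xi>
  enter.\<close>

lemma fsol_decay:
  fixes A0 L S :: "real^'m^'m" and A :: "'n::finite \<Rightarrow> real^'m^'m"
    and Q :: "'n \<Rightarrow> real^'m^'p" and R :: "real^'m^'p"
  assumes cA: "cond_A A0 A L" and cC: "cond_C A0 A L Q R" and cS: "cond_S A0 L S"
    and cS1: "cond_Sstar1 A L Q R S" and cK: "cond_Kstar A0 A L Q R"
  obtains C c where "C > 0" "c > 0"
    "\<And>u0 t \<xi>. constraint Q R u0 \<Longrightarrow> integrable lborel u0 \<Longrightarrow> L2 u0 \<Longrightarrow> t \<ge> 0 \<Longrightarrow>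
      norm (fsol A0 A L u0 t \<xi>) \<le> C * exp (- c * eta \<xi> * t) * norm (fourier u0 \<xi>)"
proof -
  have pos: "pos_on (cmat A0) UNIV" using cA by (simp add: cond_A_def)
  show ?thesis
  proof (rule pointwise_decay[OF cA cS cS1 cK])
    fix C c :: real assume Cc: "C > 0" "c > 0" and dec:
    "\<And>(\<xi> :: real^'n) z z' t. (\<And>t. t \<ge> 0 \<Longrightarrow> (z has_vector_derivative z' t) (at t within {0..})) \<Longrightarrow>
      (\<And>t. t \<ge> 0 \<Longrightarrow> cmat A0 *v z' t + norm \<xi> *\<^sub>R mulI (cmat (symbol A (sgn \<xi>)) *v z t) + cmat L *v z t = 0) \<Longrightarrow>
      (\<And>t. t \<ge> 0 \<Longrightarrow> norm \<xi> *\<^sub>R mulI (cmat (symbol Q (sgn \<xi>)) *v z t) + cmat R *v z t = 0) \<Longrightarrow>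
      t \<ge> 0 \<Longrightarrow> norm (z t) \<le> C * exp (- c * eta \<xi> * t) * norm (z 0)"
  show ?thesis
  proof (rule that[OF Cc])
    fix u0 :: "real^'n \<Rightarrow> real^'m" and t :: real and \<xi> :: "real^'n"
    assume u0: "constraint Q R u0" "integrable lborel u0" "L2 u0" and t: "t \<ge> 0"
    have "norm (fsol A0 A L u0 t \<xi>) \<le> C * exp (- c * eta \<xi> * t) * norm (fsol A0 A L u0 0 \<xi>)"
    proof (rule dec[of "\<lambda>t. fsol A0 A L u0 t \<xi>" "\<lambda>t. generator A0 A L \<xi> (fsol A0 A L u0 t \<xi>)"])
      fix t :: real
      show "((\<lambda>t. fsol A0 A L u0 t \<xi>) has_vector_derivative generator A0 A L \<xi> (fsol A0 A L u0 t \<xi>)) (at t within {0..})"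
        by (rule fsol_has_vector_derivative)
      show "cmat A0 *v generator A0 A L \<xi> (fsol A0 A L u0 t \<xi>) + norm \<xi> *\<^sub>R mulI (cmat (symbol A (sgn \<xi>)) *v fsol A0 A L u0 t \<xi>)
        + cmat L *v fsol A0 A L u0 t \<xi> = 0" by (simp add: A0_generator[OF pos] scaleR_mulI_symbol)
      show "norm \<xi> *\<^sub>R mulI (cmat (symbol Q (sgn \<xi>)) *v fsol A0 A L u0 t \<xi>) + cmat R *v fsol A0 A L u0 t \<xi> = 0"
        unfolding scaleR_mulI_symbol by (rule fsol_constraint[OF cC u0])
    qed (rule t)
    then show "norm (fsol A0 A L u0 t \<xi>) \<le> C * exp (- c * eta \<xi> * t) * norm (fourier u0 \<xi>)" by (simp add: fsol_def)
  qed
  qed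
qed

lemma eta_nonneg: "eta \<xi> \<ge> 0"
  by (simp add: eta_def)

theorem theorem5p1:
  fixes A0 L S :: "real^'m^'m"
    and A :: "'n::finite \<Rightarrow> real^'m^'m"
    and Q :: "'n \<Rightarrow> real^'m^'p"
    and R :: "real^'m^'p"
    and s :: nat
  assumes "CARD('p) < CARD('m)"
    and "cond_A A0 A L"
    and "cond_C A0 A L Q R"
    and "cond_S A0 L S"
    and "cond_Sstar1 A L Q R S"
    and "cond_Kstar A0 A L Q R"
  shows "\<exists>C>0. \<exists>c>0. \<forall>u0 u.
    Hs s u0 \<and> integrable lborel u0 \<and> constraint Q R u0 \<and> cauchy_solution A0 A L u0 u \<longrightarrow>
      (\<forall>t>0. constraint Q R (u t)) \<and>
      (\<exists>uh. fourier_solution A0 A L u0 u uh \<and>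
         (\<forall>t\<ge>0. \<forall>\<xi>. norm (uh t \<xi>) \<le> C * exp (- c * eta \<xi> * t) * norm (fourier u0 \<xi>))) \<and>
      (\<forall>t\<ge>0. Hs s (u t)) \<and>
      (\<forall>t\<ge>0. \<forall>k l. k + l \<le> s \<longrightarrow>
         L2norm_deriv k (u t)
           \<le> C * (1 + t) powr (- real CARD('n) / 4 - real k / 2) * L1norm u0
             + C * (1 + t) powr (- real l / 2) * L2norm_deriv (k + l) u0)"
  proof (rule fsol_decay[OF assms(2-6)])
  fix C1 c :: real assume C1: "C1 > 0" and c: "c > 0" and dec:
    "\<And>u0 t (\<xi> :: real^'n). constraint Q R u0 \<Longrightarrow> integrable lborel u0 \<Longrightarrow> L2 u0 \<Longrightarrow> t \<ge> 0 \<Longrightarrow>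
      norm (fsol A0 A L u0 t \<xi>) \<le> C1 * exp (- c * eta \<xi> * t) * norm (fourier u0 \<xi>)"
  define M where "M k t = (\<integral>\<^sup>+\<xi>. ennreal (norm (\<xi> :: real^'n) ^ (2 * k) * exp (- c * (norm \<xi>)\<^sup>2 * (1 + t) / 2)) \<partial>lborel)" for k t
  \<comment> \<open>The moment constants are chosen for each k before any solution is considered, so
    they cannot depend on t or \<open>u0\<close>.\<close>
  have "\<forall>k. \<exists>J. J \<ge> 0 \<and> (\<forall>t\<ge>0. M k t = ennreal ((1 + t) powr (- real CARD('n) / 2 - real k) * J))"
  proof
    fix k
    obtain J where "J \<ge> 0" "\<And>t. t \<ge> 0 \<Longrightarrow> M k t = ennreal ((1 + t) powr (- real DIM(real^'n) / 2 - real k) * J)"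
      by (rule gaussian_moment[OF c, where 'a = "real^'n" and k = k, folded M_def], rule that)
    then show "\<exists>J. J \<ge> 0 \<and> (\<forall>t\<ge>0. M k t = ennreal ((1 + t) powr (- real CARD('n) / 2 - real k) * J))"
      by (intro exI[of _ J]) simp
  qed
  then obtain J where J': "\<forall>k. J k \<ge> 0 \<and> (\<forall>t\<ge>0. M k t = ennreal ((1 + t) powr (- real CARD('n) / 2 - real k) * J k))"
    by (rule exE[OF choice])
  have J: "J k \<ge> 0" "t \<ge> 0 \<Longrightarrow> M k t = ennreal ((1 + t) powr (- real CARD('n) / 2 - real k) * J k)" for k t
    using J' by simp_all
  define \<alpha> where "\<alpha> k = sqrt (8 * C1\<^sup>2 * exp (c / 2) * J k)" for k
  define \<beta> where "\<beta> l = sqrt (2 * C1\<^sup>2 * exp (c / 2) * fact l * (2 / c) ^ l * (2 * pi) ^ CARD('n))" for l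
  have \<alpha>0: "\<alpha> k \<ge> 0" and \<beta>0: "\<beta> k \<ge> 0" for k using J(1)[of k] c by (simp_all add: \<alpha>_def \<beta>_def)
  \<comment> \<open>Only orders up to \<open>s\<close> occur, so a finite sum of the individual
    constants serves for all k and l at once and for the pointwise estimate too.\<close>
  define C where "C = C1 + (\<Sum>k\<le>s. \<alpha> k) + (\<Sum>l\<le>s. \<beta> l)"
  have sums: "0 \<le> (\<Sum>k\<le>s. \<alpha> k)" "0 \<le> (\<Sum>l\<le>s. \<beta> l)" by (simp_all add: sum_nonneg \<alpha>0 \<beta>0)
  have CC1: "C1 \<le> C" using sums by (simp add: C_def)
  have C\<alpha>: "\<alpha> k \<le> C" and C\<beta>: "\<beta> k \<le> C" if "k \<le> s" for k
  proof -
    have "\<alpha> k \<le> (\<Sum>k\<le>s. \<alpha> k)" "\<beta> k \<le> (\<Sum>k\<le>s. \<beta> k)"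
      using \<alpha>0 \<beta>0 that by (auto intro!: member_le_sum)
    then show "\<alpha> k \<le> C" "\<beta> k \<le> C" using sums C1 by (simp_all add: C_def)
  qed
  show ?thesis
  proof (rule exI[of _ C], rule conjI, use CC1 C1 in linarith, rule exI[of _ c], rule conjI[OF c], intro allI impI, elim conjE)
    fix u0 :: "real^'n \<Rightarrow> real^'m" and u
    assume H: "Hs s u0" and u0: "integrable lborel u0" and con: "constraint Q R u0" and cs: "cauchy_solution A0 A L u0 u"
    have L2: "L2 u0" using H by (simp add: Hs_def)
    define v where "v = fsol A0 A L u0"
    have fs: "fourier_solution A0 A L u0 u v" unfolding v_def by (rule fourier_solution_fsol[OF assms(2) cs u0 L2])
    have fv: "has_L2_fourier (u t) (v t)" if t: "t \<ge> 0" for t using fs t by (simp add: fourier_solution_def)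
    have vb: "norm (v t \<xi>) \<le> C1 * exp (- c * eta \<xi> * t) * norm (fourier u0 \<xi>)" if t: "t \<ge> 0" for t \<xi>
      unfolding v_def by (rule dec[OF con u0 L2 t])
    have "\<forall>t>0. constraint Q R (u t)"
    proof (intro allI impI)
      fix t :: real assume "t > 0"
      then show "constraint Q R (u t)"
        by (intro constraint_of_fourier[OF fv]) (simp_all only: v_def fsol_constraint[OF assms(3) con u0 L2] less_imp_le)
    qed
    moreover have "norm (v t \<xi>) \<le> C * exp (- c * eta \<xi> * t) * norm (fourier u0 \<xi>)" if t: "t \<ge> 0" for t \<xi>
      by (rule order_trans[OF vb[OF t]]) (intro mult_right_mono CC1; simp)
    with fs have "\<exists>uh. fourier_solution A0 A L u0 u uh \<and>
         (\<forall>t\<ge>0. \<forall>\<xi>. norm (uh t \<xi>) \<le> C * exp (- c * eta \<xi> * t) * norm (fourier u0 \<xi>))"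
      by (intro exI[of _ v]) simp
    moreover have "\<forall>t\<ge>0. Hs s (u t)"
    proof (intro allI impI)
      fix t :: real assume t: "t \<ge> 0"
      show "Hs s (u t)"
      proof (rule Hs_of_fourier_le[OF H u0 fv[OF t]])
        fix \<xi> :: "real^'n"
        have "C1 * exp (- c * eta \<xi> * t) * norm (fourier u0 \<xi>) \<le> C1 * 1 * norm (fourier u0 \<xi>)"
          using C1 c t eta_nonneg[of \<xi>] by (intro mult_right_mono mult_left_mono) auto
        then show "norm (v t \<xi>) \<le> C1 * norm (fourier u0 \<xi>)" using vb[OF t, of \<xi>] by simp
      qed
    qed
    moreover have "\<forall>t\<ge>0. \<forall>k l. k + l \<le> s \<longrightarrow>
         L2norm_deriv k (u t)
           \<le> C * (1 + t) powr (- real CARD('n) / 4 - real k / 2) * L1norm u0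
             + C * (1 + t) powr (- real l / 2) * L2norm_deriv (k + l) u0"
    proof (intro allI impI)
      fix t :: real and k l assume t: "t \<ge> 0" and kl: "k + l \<le> s"
      have "L2norm_deriv k (u t) \<le> \<alpha> k * (1 + t) powr (- real CARD('n) / 4 - real k / 2) * L1norm u0
             + \<beta> l * (1 + t) powr (- real l / 2) * L2norm_deriv (k + l) u0"
        unfolding \<alpha>_def \<beta>_def
        by (rule L2norm_deriv_decay[OF H u0 fv[OF t] c less_imp_le[OF C1] t vb[OF t] kl J(1) J(2)[OF t, unfolded M_def]])
      also have "\<dots> \<le> C * (1 + t) powr (- real CARD('n) / 4 - real k / 2) * L1norm u0
             + C * (1 + t) powr (- real l / 2) * L2norm_deriv (k + l) u0"
        using kl by (intro add_mono mult_right_mono C\<alpha> C\<beta>) (simp_all add: L1norm_def L2norm_deriv_nonneg)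
      finally show "L2norm_deriv k (u t)
           \<le> C * (1 + t) powr (- real CARD('n) / 4 - real k / 2) * L1norm u0
             + C * (1 + t) powr (- real l / 2) * L2norm_deriv (k + l) u0" .
    qed
    ultimately show "(\<forall>t>0. constraint Q R (u t)) \<and>
      (\<exists>uh. fourier_solution A0 A L u0 u uh \<and>
         (\<forall>t\<ge>0. \<forall>\<xi>. norm (uh t \<xi>) \<le> C * exp (- c * eta \<xi> * t) * norm (fourier u0 \<xi>))) \<and>
      (\<forall>t\<ge>0. Hs s (u t)) \<and>
      (\<forall>t\<ge>0. \<forall>k l. k + l \<le> s \<longrightarrow>
         L2norm_deriv k (u t)
           \<le> C * (1 + t) powr (- real CARD('n) / 4 - real k / 2) * L1norm u0
             + C * (1 + t) powr (- real l / 2) * L2norm_deriv (k + l) u0)"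
      by (intro conjI)
  qed
qed

end
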